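(* Let $X$ be a compact connected Riemann surface and let $p_1,\dots,p_m,q_1,\dots,q_m$ be points of $X$. For each $j$ fix a path in $X$ from $p_j$ to $q_j$, and let $\int_{p_j}^{q_j}$ denote integration along it. Then the following two conditions are equivalent: (i) There exists a (nonzero) meromorphic function $f$ on $X$ such that $(f)=\sum_{j=1}^m q_j-\sum_{j=1}^m p_j$. (ii) There exists a closed path $\gamma$ in $X$ such that for every holomorphic differential $\omega\in\Omega^1(X)$, $$\sum_{j=1}^m\int_{p_j}^{q_j}\omega=\int_\gamma\omega.$$
   Context: $\Omega^1(X)$ is the space of holomorphic differential $1$-forms on $X$. For a nonzero meromorphic function $f$, $(f)=\sum_{p\in X}\mathrm{ord}_p(f)\,p$ is its divisor (zeros counted positively, poles negatively, with multiplicity). *)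

theory Defs
  imports "HOL-Complex_Analysis.Complex_Analysis" "HOL-Library.Poly_Mapping"
begin

section \<open>Riemann surfaces\<close>

(* A chart is a pair (U, phi) of a domain and a coordinate map; the values of phi outside U
   are irrelevant. *)
type_synonym 'a chart = "'a set \<times> ('a \<Rightarrow> complex)"

abbreviation chart_inv :: "'a chart \<Rightarrow> complex \<Rightarrow> 'a" where
  "chart_inv c \<equiv> inv_into (fst c) (snd c)"

abbreviation transition :: "'a chart \<Rightarrow> 'a chart \<Rightarrow> complex \<Rightarrow> complex" where
  "transition c d \<equiv> snd d \<circ> chart_inv c"

definition complex_chart :: "'a topology \<Rightarrow> 'a chart \<Rightarrow> bool" where
  "complex_chart X c \<longleftrightarrow>
     openin X (fst c) \<and> open (snd c ` fst c) \<and>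
     homeomorphic_map (subtopology X (fst c)) (top_of_set (snd c ` fst c)) (snd c)"

(* Neither connectedness nor a countable base is demanded here. *)
definition riemann_surface :: "'a topology \<Rightarrow> 'a chart set \<Rightarrow> bool" where
  "riemann_surface X A \<longleftrightarrow>
     Hausdorff_space X \<and>
     (\<forall>c\<in>A. complex_chart X c) \<and>
     \<Union>(fst ` A) = topspace X \<and>
     (\<forall>c\<in>A. \<forall>d\<in>A. transition c d holomorphic_on snd c ` (fst c \<inter> fst d))"


section \<open>Meromorphic functions and divisors\<close>

(* A meromorphic function is represented by its unique complex-valued representative that takes
   the value 0 at the poles and has no removable singularities (nicely_meromorphic_on).
   In particular, on a connected surface it is the zero element of the function field iff it
   vanishes at every point. *)
definition meromorphic_function :: "'a topology \<Rightarrow> 'a chart set \<Rightarrow> ('a \<Rightarrow> complex) \<Rightarrow> bool" where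
  "meromorphic_function X A f \<longleftrightarrow>
     (\<forall>c\<in>A. (f \<circ> chart_inv c) nicely_meromorphic_on snd c ` fst c)"

(* The order does not depend on the chart around p. *)
definition ord_at :: "'a chart set \<Rightarrow> ('a \<Rightarrow> complex) \<Rightarrow> 'a \<Rightarrow> int" where
  "ord_at A f p = (let c = (SOME c. c \<in> A \<and> p \<in> fst c) in zorder (f \<circ> chart_inv c) (snd c p))"

(* Divisors are elements of the free abelian group on the points.  On a compact connected surface
   a nonzero meromorphic function has finitely many zeros and poles, so the sum is finite. *)
definition divisor :: "'a topology \<Rightarrow> 'a chart set \<Rightarrow> ('a \<Rightarrow> complex) \<Rightarrow> ('a \<Rightarrow>\<^sub>0 int)" where
  "divisor X A f =
     (\<Sum>p\<in>{p \<in> topspace X. ord_at A f p \<noteq> 0}. frag_cmul (ord_at A f p) (frag_of p))"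


section \<open>Holomorphic differentials and their integrals\<close>

(* A differential is given by its coefficients: in the chart c it reads (omega c z) dz.
   Values of omega at non-charts, and of (omega c) outside the image of c, are irrelevant. *)
definition holomorphic_differential ::
    "'a chart set \<Rightarrow> ('a chart \<Rightarrow> complex \<Rightarrow> complex) \<Rightarrow> bool" where
  "holomorphic_differential A \<omega> \<longleftrightarrow>
     (\<forall>c\<in>A. \<omega> c holomorphic_on snd c ` fst c) \<and>
     (\<forall>c\<in>A. \<forall>d\<in>A. \<forall>z\<in>snd c ` (fst c \<inter> fst d).
        \<omega> c z = \<omega> d (transition c d z) * deriv (transition c d) z)"

(* F is a primitive of omega on W: dF = omega there. *)
definition primitive_on ::
    "'a chart set \<Rightarrow> ('a chart \<Rightarrow> complex \<Rightarrow> complex) \<Rightarrow> 'a set \<Rightarrow> ('a \<Rightarrow> complex) \<Rightarrow> bool" where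
  "primitive_on A \<omega> W F \<longleftrightarrow>
     (\<forall>c\<in>A. \<forall>x\<in>W \<inter> fst c.
        ((F \<circ> chart_inv c) has_field_derivative \<omega> c (snd c x)) (at (snd c x)))"

(* A primitive of omega along g: locally on [0,1] it is F o g with F a primitive of omega on a
   neighbourhood of g t. *)
definition primitive_along ::
    "'a topology \<Rightarrow> 'a chart set \<Rightarrow> ('a chart \<Rightarrow> complex \<Rightarrow> complex) \<Rightarrow> (real \<Rightarrow> 'a) \<Rightarrow>
     (real \<Rightarrow> complex) \<Rightarrow> bool" where
  "primitive_along X A \<omega> g \<Phi> \<longleftrightarrow>
     (\<forall>t\<in>{0..1}. \<exists>T W F. open T \<and> t \<in> T \<and> openin X W \<and> primitive_on A \<omega> W F \<and>
        (\<forall>s\<in>T \<inter> {0..1}. g s \<in> W \<and> \<Phi> s = F (g s)))"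

(* Paths are continuous, so the integral of a (closed) holomorphic differential is taken through
   primitives along the path.  primitive_along_unique below says that the value does not depend
   on the primitive, and primitive_along_has_integral that for piecewise differentiable paths it
   is the integral over [0,1] of the pulled back differential. *)
definition path_integral ::
    "'a topology \<Rightarrow> 'a chart set \<Rightarrow> (real \<Rightarrow> 'a) \<Rightarrow> ('a chart \<Rightarrow> complex \<Rightarrow> complex) \<Rightarrow> complex" where
  "path_integral X A g \<omega> = (THE I. \<exists>\<Phi>. primitive_along X A \<omega> g \<Phi> \<and> I = \<Phi> 1 - \<Phi> 0)"

lemma chart_inv_snd:
  assumes "complex_chart X c" "x \<in> fst c"
  shows "chart_inv c (snd c x) = x"
proof -
  have "fst c \<subseteq> topspace X"
    using assms(1) by (auto simp: complex_chart_def dest: openin_subset)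
  moreover have "inj_on (snd c) (topspace (subtopology X (fst c)))"
    using assms(1) unfolding complex_chart_def by (blast dest: homeomorphic_imp_injective_map)
  ultimately have "inj_on (snd c) (fst c)" by (simp add: Int_absorb1)
  thus ?thesis using assms(2) by simp
qed

lemma open_chart_image:
  assumes "complex_chart X c" "openin X W"
  shows "open (snd c ` (W \<inter> fst c))"
proof -
  have "openin (subtopology X (fst c)) (W \<inter> fst c)"
    using assms(2) by (auto simp: openin_subtopology)
  hence "openin (top_of_set (snd c ` fst c)) (snd c ` (W \<inter> fst c))"
    using assms(1) by (meson complex_chart_def homeomorphic_imp_open_map open_map_def)
  thus ?thesis
    using assms(1) by (meson complex_chart_def openin_open_trans)
qed

lemma chart_continuous:
  assumes "complex_chart X c" "pathin X g" "t \<in> {0..1}" "g t \<in> fst c"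
  obtains T where "open T" "t \<in> T" "\<And>s. s \<in> T \<inter> {0..1} \<Longrightarrow> g s \<in> fst c"
    "continuous_on (T \<inter> {0..1}) (snd c \<circ> g)"
proof -
  have "openin X (fst c)" using assms(1) by (simp add: complex_chart_def)
  with assms(2) have "openin (top_of_set {0..1::real})
      {s \<in> topspace (top_of_set {0..1}). g s \<in> fst c}"
    unfolding pathin_def by (rule openin_continuous_map_preimage)
  hence "openin (top_of_set {0..1::real}) {s \<in> {0..1}. g s \<in> fst c}"
    by (simp only: topspace_euclidean_subtopology)
  then obtain T where T: "open T" "{s \<in> {0..1}. g s \<in> fst c} = {0..1} \<inter> T"
    unfolding openin_open by blast
  have gT: "g s \<in> fst c" if "s \<in> T \<inter> {0..1}" for s
    using T(2) that by blast
  have tT: "t \<in> T" using T(2) assms(3,4) by blast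
  have "continuous_map (top_of_set (T \<inter> {0..1})) (subtopology X (fst c)) g"
    unfolding continuous_map_in_subtopology
  proof
    show "continuous_map (top_of_set (T \<inter> {0..1})) X g"
      using assms(2) unfolding pathin_def by (rule continuous_map_from_subtopology_mono) blast
    show "g \<in> topspace (top_of_set (T \<inter> {0..1})) \<rightarrow> fst c"
      unfolding topspace_euclidean_subtopology by (rule Pi_I) (rule gT)
  qed
  moreover have "continuous_map (subtopology X (fst c)) (top_of_set (snd c ` fst c)) (snd c)"
    using assms(1) unfolding complex_chart_def by (blast dest: homeomorphic_imp_continuous_map)
  ultimately have "continuous_map (top_of_set (T \<inter> {0..1})) (top_of_set (snd c ` fst c)) (snd c \<circ> g)"
    by (rule continuous_map_compose)
  hence "continuous_on (T \<inter> {0..1}) (snd c \<circ> g)"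
    unfolding continuous_map_in_subtopology continuous_map_iff_continuous ..
  thus ?thesis using that[OF T(1) tT gT] by blast
qed

lemma primitive_along_unique:
  assumes X: "riemann_surface X A" and g: "pathin X g"
    and \<Phi>: "primitive_along X A \<omega> g \<Phi>" and \<Psi>: "primitive_along X A \<omega> g \<Psi>"
  shows "\<Phi> 1 - \<Phi> 0 = \<Psi> 1 - \<Psi> 0"
proof -
  have "(\<lambda>t. \<Phi> t - \<Psi> t) constant_on {0..1}"
  proof (rule locally_constant_imp_constant)
    show "connected {0..1::real}" by simp
  next
    fix t :: real assume t: "t \<in> {0..1}"
    obtain T W F where 1: "open T" "t \<in> T" "openin X W" "primitive_on A \<omega> W F"
        "\<And>s. s\<in>T \<inter> {0..1} \<Longrightarrow> g s \<in> W \<and> \<Phi> s = F (g s)"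
      using \<Phi> t unfolding primitive_along_def by meson
    obtain T' W' F' where 2: "open T'" "t \<in> T'" "openin X W'" "primitive_on A \<omega> W' F'"
        "\<And>s. s\<in>T' \<inter> {0..1} \<Longrightarrow> g s \<in> W' \<and> \<Psi> s = F' (g s)"
      using \<Psi> t unfolding primitive_along_def by meson
    have gt: "g t \<in> W" "g t \<in> W'" using 1 2 t by auto
    have "g t \<in> topspace X" using gt(1) 1(3) openin_subset by auto
    then obtain c where c: "c \<in> A" "g t \<in> fst c"
      using X unfolding riemann_surface_def by blast
    have cc: "complex_chart X c" using X c(1) by (auto simp: riemann_surface_def)
    obtain R where R: "open R" "t \<in> R" "\<And>s. s \<in> R \<inter> {0..1} \<Longrightarrow> g s \<in> fst c"
        "continuous_on (R \<inter> {0..1}) (snd c \<circ> g)"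
      using chart_continuous[OF cc g t c(2)] by metis
    have "open (snd c ` (W \<inter> W' \<inter> fst c))"
      using open_chart_image[OF cc] 1(3) 2(3) by blast
    moreover have "snd c (g t) \<in> snd c ` (W \<inter> W' \<inter> fst c)" using gt c by blast
    ultimately obtain e where e: "e > 0" "ball (snd c (g t)) e \<subseteq> snd c ` (W \<inter> W' \<inter> fst c)"
      by (meson openE)
    define H where "H = (\<lambda>z. (F \<circ> chart_inv c) z - (F' \<circ> chart_inv c) z)"
    have "(H has_field_derivative 0) (at z)" if z: "z \<in> ball (snd c (g t)) e" for z
    proof -
      obtain x where x: "x \<in> W" "x \<in> W'" "x \<in> fst c" "z = snd c x" using z e by blast
      have "((F \<circ> chart_inv c) has_field_derivative \<omega> c z) (at z)"
        "((F' \<circ> chart_inv c) has_field_derivative \<omega> c z) (at z)"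
        using 1(4) 2(4) c(1) x unfolding primitive_on_def by blast+
      from DERIV_diff[OF this] show ?thesis unfolding H_def by simp
    qed
    hence "(H has_field_derivative 0) (at z within ball (snd c (g t)) e)"
      if "z \<in> ball (snd c (g t)) e" for z
      using that has_field_derivative_at_within by blast
    from has_field_derivative_zero_constant[OF convex_ball this]
    obtain k where k: "\<And>z. z \<in> ball (snd c (g t)) e \<Longrightarrow> H z = k" by metis
    have "openin (top_of_set (R \<inter> {0..1}))
            (R \<inter> {0..1} \<inter> (snd c \<circ> g) -` ball (snd c (g t)) e)"
      by (rule continuous_openin_preimage_gen[OF R(4)]) simp
    then obtain Q where Q: "open Q"
        "R \<inter> {0..1} \<inter> (snd c \<circ> g) -` ball (snd c (g t)) e = R \<inter> {0..1} \<inter> Q"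
      unfolding openin_open by auto
    define S where "S = {0..1} \<inter> (T \<inter> T' \<inter> R \<inter> Q)"
    have tS: "t \<in> S"
      using t 1 2 R Q e(1) unfolding S_def by auto
    have val: "\<Phi> s - \<Psi> s = k" if "s \<in> S" for s
    proof -
      have s: "s \<in> {0..1}" "s \<in> T" "s \<in> T'" "s \<in> R" "snd c (g s) \<in> ball (snd c (g t)) e"
        using that Q(2) unfolding S_def by auto
      have "\<Phi> s - \<Psi> s = H (snd c (g s))"
        using 1(5)[of s] 2(5)[of s] R(3)[of s] s chart_inv_snd[OF cc]
        unfolding H_def by simp
      thus ?thesis using k s by simp
    qed
    have "openin (top_of_set {0..1}) S"
      unfolding S_def using 1(1) 2(1) R(1) Q(1) by (intro openin_open_Int open_Int)
    thus "\<exists>S. openin (top_of_set {0..1}) S \<and> t \<in> S \<and> (\<forall>x\<in>S. \<Phi> x - \<Psi> x = \<Phi> t - \<Psi> t)"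
      using tS val by metis
  qed
  hence "\<Phi> 1 - \<Psi> 1 = \<Phi> 0 - \<Psi> 0"
    unfolding constant_on_def by force
  thus ?thesis by (simp add: algebra_simps)
qed

corollary path_integral_eqI:
  assumes "riemann_surface X A" "pathin X g" "primitive_along X A \<omega> g \<Phi>"
  shows "path_integral X A g \<omega> = \<Phi> 1 - \<Phi> 0"
  unfolding path_integral_def
proof (rule the_equality)
  show "\<exists>\<Psi>. primitive_along X A \<omega> g \<Psi> \<and> \<Phi> 1 - \<Phi> 0 = \<Psi> 1 - \<Psi> 0"
    using assms(3) by blast
next
  fix I assume "\<exists>\<Psi>. primitive_along X A \<omega> g \<Psi> \<and> I = \<Psi> 1 - \<Psi> 0"
  thus "I = \<Phi> 1 - \<Phi> 0"
    using primitive_along_unique[OF assms(1,2) _ assms(3)] by blast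
qed

lemma primitive_along_continuous:
  assumes X: "riemann_surface X A" and g: "pathin X g" and \<Phi>: "primitive_along X A \<omega> g \<Phi>"
  shows "continuous_on {0..1} \<Phi>"
  unfolding continuous_on_eq_continuous_within
proof
  fix t :: real assume t: "t \<in> {0..1}"
  obtain T W F where 1: "open T" "t \<in> T" "openin X W" "primitive_on A \<omega> W F"
      "\<And>s. s\<in>T \<inter> {0..1} \<Longrightarrow> g s \<in> W \<and> \<Phi> s = F (g s)"
    using \<Phi> t unfolding primitive_along_def by meson
  have gt: "g t \<in> W" using 1 t by auto
  have "g t \<in> topspace X" using gt 1(3) openin_subset by auto
  then obtain c where c: "c \<in> A" "g t \<in> fst c"
    using X unfolding riemann_surface_def by blast
  have cc: "complex_chart X c" using X c(1) by (auto simp: riemann_surface_def)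
  obtain R where R: "open R" "t \<in> R" "\<And>s. s \<in> R \<inter> {0..1} \<Longrightarrow> g s \<in> fst c"
      "continuous_on (R \<inter> {0..1}) (snd c \<circ> g)"
    using chart_continuous[OF cc g t c(2)] by metis
  have "((F \<circ> chart_inv c) has_field_derivative \<omega> c (snd c (g t))) (at (snd c (g t)))"
    using 1(4) c gt unfolding primitive_on_def by blast
  hence "isCont (F \<circ> chart_inv c) (snd c (g t))" by (rule DERIV_isCont)
  moreover have "continuous (at t within R \<inter> {0..1}) (snd c \<circ> g)"
    using R t unfolding continuous_on_eq_continuous_within by blast
  ultimately have "continuous (at t within R \<inter> {0..1}) (\<lambda>s. (F \<circ> chart_inv c) ((snd c \<circ> g) s))"
    using continuous_within_compose3[of "(snd c \<circ> g)" t "F \<circ> chart_inv c" "R \<inter> {0..1}"] by simp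
  moreover have "at t within R \<inter> {0..1} = at t within {0..1}"
    by (rule at_within_nhd[OF R(2,1)]) blast
  ultimately have *: "continuous (at t within {0..1}) (\<lambda>s. (F \<circ> chart_inv c) ((snd c \<circ> g) s))"
    by (simp only:)
  obtain d where d: "d > 0" "ball t d \<subseteq> T \<inter> R"
    using 1(1,2) R(1,2) by (meson IntI open_Int openE)
  show "continuous (at t within {0..1}) \<Phi>"
  proof (rule continuous_transform_within[OF * d(1) t])
    fix s :: real assume s: "s \<in> {0..1}" "dist s t < d"
    hence "s \<in> T" "s \<in> R" using d(2) by (auto simp: dist_commute)
    thus "(F \<circ> chart_inv c) ((snd c \<circ> g) s) = \<Phi> s"
      using 1(5)[of s] R(3)[of s] s chart_inv_snd[OF cc] by simp
  qed
qed

(* The hypothesis on h says that h(t) dt is the pullback of omega under g outside of a finite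
   set of parameters. *)
lemma primitive_along_has_integral:
  assumes X: "riemann_surface X A" and g: "pathin X g" and \<Phi>: "primitive_along X A \<omega> g \<Phi>"
    and S: "finite S"
    and h: "\<And>t. t \<in> {0<..<1} - S \<Longrightarrow> \<exists>c\<in>A. \<exists>D. g t \<in> fst c \<and>
              ((snd c \<circ> g) has_vector_derivative D) (at t) \<and> h t = \<omega> c (snd c (g t)) * D"
  shows "(h has_integral path_integral X A g \<omega>) {0..1}"
proof -
  have "(\<Phi> has_vector_derivative h t) (at t)" if tS: "t \<in> {0<..<1} - S" for t
  proof -
    have t: "t \<in> {0..1}" using tS by auto
    obtain c D where c: "c \<in> A" "g t \<in> fst c"
        and D: "((snd c \<circ> g) has_vector_derivative D) (at t)" "h t = \<omega> c (snd c (g t)) * D"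
      using h[OF tS] by blast
    have cc: "complex_chart X c" using X c(1) by (auto simp: riemann_surface_def)
    obtain T W F where 1: "open T" "t \<in> T" "openin X W" "primitive_on A \<omega> W F"
        "\<And>s. s\<in>T \<inter> {0..1} \<Longrightarrow> g s \<in> W \<and> \<Phi> s = F (g s)"
      using \<Phi> t unfolding primitive_along_def by meson
    obtain R where R: "open R" "t \<in> R" "\<And>s. s \<in> R \<inter> {0..1} \<Longrightarrow> g s \<in> fst c"
      using chart_continuous[OF cc g t c(2)] by metis
    have "((F \<circ> chart_inv c) has_field_derivative \<omega> c ((snd c \<circ> g) t)) (at ((snd c \<circ> g) t))"
      using 1 t c unfolding primitive_on_def by auto
    from field_vector_diff_chain_at[OF D(1) this]
    have *: "(((F \<circ> chart_inv c) \<circ> (snd c \<circ> g)) has_vector_derivative h t) (at t)"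
      unfolding D(2) by (simp only: mult.commute o_apply[of "snd c" g t])
    show ?thesis
    proof (rule has_vector_derivative_transform_within_open[OF *])
      show "open (T \<inter> R \<inter> {0<..<1})" using 1 R by auto
      show "t \<in> T \<inter> R \<inter> {0<..<1}" using 1 R tS by auto
      fix s assume "s \<in> T \<inter> R \<inter> {0<..<1}"
      thus "((F \<circ> chart_inv c) \<circ> (snd c \<circ> g)) s = \<Phi> s"
        using 1(5)[of s] R(3)[of s] chart_inv_snd[OF cc] by auto
    qed
  qed
  from fundamental_theorem_of_calculus_interior_strong[OF S _ this primitive_along_continuous[OF X g \<Phi>]]
  show ?thesis using path_integral_eqI[OF X g \<Phi>] by simp
qed

end

(* Sufficiency.  The paths, followed by the reverse of the closed path, are cut into segments lying
   in coordinate discs.  In such a disc the ratio (u - q) / (u - p) of the endpoints of a segment has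
   a logarithm away from a smaller disc; multiplied by a cutoff function it yields a smooth function
   on X with the required divisor, which is holomorphic up to a (0,1)-form b.  If b is the
   dbar-derivative of g, then multiplication by exp (-g) makes the function meromorphic.  To solve
   this equation, the Cauchy transforms in the discs are glued to a parametrix of dbar; its error is
   approximated by operators of finite rank, so a form that is not exact is separated from the exact
   forms by a bounded functional.  Evaluated on the errors of Cauchy kernels such a functional gives a
   holomorphic differential, and its value on b is, up to sign, the sum of the integrals of this
   differential along the segments, which vanishes by hypothesis.

   Necessity.  For nonconstant f, sum local primitives of a holomorphic differential over the fibre
   f = s, with multiplicities.  By the argument principle this is a holomorphic function of s.  Its
   derivative, the trace of the differential, does not depend on the primitives; it is entire, and
   the same argument for 1/f shows that it tends to 0 at infinity.  By Liouville's theorem it vanishes,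
   so the integrals from a base point to the fibres over 0 and over infinity differ by an integral
   over a closed path that is the same for all differentials. *)

theory Submission
  imports Defs
begin


section \<open>The Cauchy-Riemann operator on the plane\<close>

text \<open>All analysis is done in the sup norm for functions of one plane variable: the coordinate
  discs get far-apart centres \<open>ctr i\<close>, so that one Cauchy transform and one cutoff
  serve all of them. The parametrix \<open>\<Psi> * transf b\<close> leaves the error
  \<open>\<Psi>' * transf b\<close> on the annuli of radii 3/2 to 2, whereas sources live in the
  unit discs. As the unit discs already cover the surface, a partition of unity rewrites the error
  as a source there; this is the operator \<open>Q\<close>. The gap between annuli and unit discs
  does two things. The kernel \<open>1 / (u - w)\<close> is smooth across it, so Riemann sums
  approximate the error by finite rank up to a contraction. And \<open>Q\<close> does not see the
  unit discs, so Cauchy kernels and logarithms with singularities inside them are legitimate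
  arguments. That the functional comes from a differential is Serre duality made concrete:
  \<open>Q\<close> of a Cauchy kernel is the obstruction to a function with one simple pole. In the
  converse the difficulty is that one loop has to serve all differentials at once; therefore paths
  are chosen before any differential, and the argument runs on functionals of the differential
  (\<open>period\<close>).\<close>

definition has_dbar :: "(complex \<Rightarrow> complex) \<Rightarrow> complex \<Rightarrow> complex \<Rightarrow> bool" where
  "has_dbar f b z \<longleftrightarrow> (\<exists>a. (f has_derivative (\<lambda>h. a * h + b * cnj h)) (at z))"

text \<open>Every real-linear map of the plane is the sum of a complex-linear and a conjugate-linear
  one. The coefficient \<open>b\<close> is thus the Wirtinger derivative in the conjugate variable,
  and \<open>has_dbar\<close> merely names one part of the real derivative.\<close>

lemma differentiable_iff_has_dbar:
  "f differentiable (at z) \<longleftrightarrow> (\<exists>b. has_dbar f b z)" for f :: "complex \<Rightarrow> complex"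
proof
  assume "f differentiable (at z)"
  then obtain D where D: "(f has_derivative D) (at z)"
    unfolding differentiable_def by blast
  interpret D: bounded_linear D using D by (rule has_derivative_bounded_linear)
  have "D h = (D 1 - \<i> * D \<i>) / 2 * h + (D 1 + \<i> * D \<i>) / 2 * cnj h" for h
  proof -
    have "D h = D (Re h *\<^sub>R 1 + Im h *\<^sub>R \<i>)"
      by (rule arg_cong[of _ _ D]) (simp add: complex_eq_iff)
    also have "\<dots> = of_real (Re h) * D 1 + of_real (Im h) * D \<i>"
      by (simp only: D.add D.scaleR) (simp only: scaleR_conv_of_real)
    finally have 1: "D h = of_real (Re h) * D 1 + of_real (Im h) * D \<i>" .
    have 2: "of_real (Re h) = (h + cnj h) / 2" "of_real (Im h) = - \<i> * (h - cnj h) / 2"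
      by (simp_all add: complex_eq_iff)
    show ?thesis unfolding 1 2 by (simp add: field_simps)
  qed
  hence "D = (\<lambda>h. (D 1 - \<i> * D \<i>) / 2 * h + (D 1 + \<i> * D \<i>) / 2 * cnj h)" by (rule ext)
  from has_derivative_eq_rhs[OF D this] show "\<exists>b. has_dbar f b z" unfolding has_dbar_def by blast
next
  assume "\<exists>b. has_dbar f b z"
  then obtain a b where "(f has_derivative (\<lambda>h. a * h + b * cnj h)) (at z)"
    unfolding has_dbar_def by blast
  thus "f differentiable (at z)" by (rule differentiableI)
qed

lemma has_dbar_imp_continuous: "has_dbar f b z \<Longrightarrow> isCont f z"
  unfolding has_dbar_def by (blast dest: has_derivative_continuous)

lemma has_dbar_imp_differentiable: "has_dbar f b z \<Longrightarrow> f differentiable (at z)"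
  using differentiable_iff_has_dbar by blast

lemma has_field_derivative_imp_has_dbar:
  "(f has_field_derivative f') (at z) \<Longrightarrow> has_dbar f 0 z"
  unfolding has_dbar_def has_field_derivative_def by (auto intro!: exI[of _ f'])

lemma has_dbar_0_iff: "has_dbar f 0 z \<longleftrightarrow> f field_differentiable (at z)"
proof
  assume "has_dbar f 0 z"
  then obtain a where "(f has_derivative (\<lambda>h. a * h)) (at z)" unfolding has_dbar_def by auto
  thus "f field_differentiable (at z)"
    unfolding field_differentiable_def has_field_derivative_def by blast
qed (auto simp: field_differentiable_def intro: has_field_derivative_imp_has_dbar)

lemma has_dbar_0_imp_holomorphic:
  assumes "open S" "\<And>z. z \<in> S \<Longrightarrow> has_dbar f 0 z"
  shows "f holomorphic_on S"
  using assms by (auto simp: holomorphic_on_open has_dbar_0_iff field_differentiable_def)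

lemma holomorphic_imp_has_dbar_0:
  "f holomorphic_on S \<Longrightarrow> open S \<Longrightarrow> z \<in> S \<Longrightarrow> has_dbar f 0 z"
  by (auto simp: has_dbar_0_iff holomorphic_on_imp_differentiable_at)

lemma has_dbar_const [simp]: "has_dbar (\<lambda>_. c) 0 z"
  by (simp add: has_dbar_0_iff)

lemma has_dbar_add:
  assumes "has_dbar f b z" "has_dbar g c z"
  shows "has_dbar (\<lambda>w. f w + g w) (b + c) z"
proof -
  obtain a a' where "(f has_derivative (\<lambda>h. a * h + b * cnj h)) (at z)"
    "(g has_derivative (\<lambda>h. a' * h + c * cnj h)) (at z)"
    using assms unfolding has_dbar_def by blast
  hence "((\<lambda>w. f w + g w) has_derivative (\<lambda>h. (a * h + b * cnj h) + (a' * h + c * cnj h))) (at z)"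
    by (rule has_derivative_add)
  hence "((\<lambda>w. f w + g w) has_derivative (\<lambda>h. (a + a') * h + (b + c) * cnj h)) (at z)"
    by (rule has_derivative_eq_rhs) (auto simp: algebra_simps)
  thus ?thesis unfolding has_dbar_def by blast
qed

lemma has_dbar_mult:
  assumes "has_dbar f b z" "has_dbar g c z"
  shows "has_dbar (\<lambda>w. f w * g w) (b * g z + f z * c) z"
proof -
  obtain a a' where "(f has_derivative (\<lambda>h. a * h + b * cnj h)) (at z)"
    "(g has_derivative (\<lambda>h. a' * h + c * cnj h)) (at z)"
    using assms unfolding has_dbar_def by blast
  hence "((\<lambda>w. f w * g w) has_derivative
     (\<lambda>h. f z * (a' * h + c * cnj h) + (a * h + b * cnj h) * g z)) (at z)"
    by (rule has_derivative_mult)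
  hence "((\<lambda>w. f w * g w) has_derivative
     (\<lambda>h. (f z * a' + a * g z) * h + (b * g z + f z * c) * cnj h)) (at z)"
    by (rule has_derivative_eq_rhs) (auto simp: algebra_simps)
  thus ?thesis unfolding has_dbar_def by blast
qed

lemma has_dbar_cmult: "has_dbar f b z \<Longrightarrow> has_dbar (\<lambda>w. c * f w) (c * b) z"
  using has_dbar_mult[of "\<lambda>_. c" 0 z f b] by simp

lemma has_dbar_diff:
  assumes "has_dbar f b z" "has_dbar g c z"
  shows "has_dbar (\<lambda>w. f w - g w) (b - c) z"
  using has_dbar_add[OF assms(1) has_dbar_cmult[OF assms(2), of "-1"]] by simp

lemma has_dbar_sum:
  assumes "\<And>i. i \<in> I \<Longrightarrow> has_dbar (f i) (b i) z"
  shows "has_dbar (\<lambda>w. \<Sum>i\<in>I. f i w) (\<Sum>i\<in>I. b i) z"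
proof (cases "finite I")
  case True
  thus ?thesis using assms by (induction I) (auto intro: has_dbar_add)
qed auto

lemma product_rule_rearrangement: "a * e * p + a * (p * s) = (a * p) * (e + s)" for a e p s :: complex
  by (simp add: algebra_simps)

text \<open>The hypothesis is in logarithmic form, so that the terms \<open>e i\<close> add up; no
  factor is divided by, hence factors may vanish at \<open>z\<close>.\<close>

lemma has_dbar_prod:
  assumes "finite I" "\<And>i. i \<in> I \<Longrightarrow> has_dbar (f i) (f i z * e i) z"
  shows "has_dbar (\<lambda>w. \<Prod>i\<in>I. f i w) ((\<Prod>i\<in>I. f i z) * (\<Sum>i\<in>I. e i)) z"
  using assms
proof (induction I)
  case (insert i I)
  let ?P = "\<Prod>i\<in>I. f i z" and ?S = "\<Sum>i\<in>I. e i"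
  have IH: "has_dbar (\<lambda>w. \<Prod>i\<in>I. f i w) (?P * ?S) z" using insert.IH insert.prems by blast
  have "has_dbar (f i) (f i z * e i) z" using insert.prems by blast
  from has_dbar_mult[OF this IH]
  have *: "has_dbar (\<lambda>w. f i w * (\<Prod>i\<in>I. f i w)) (f i z * e i * ?P + f i z * (?P * ?S)) z" .
  have **: "f i z * e i * ?P + f i z * (?P * ?S) = (f i z * ?P) * (e i + ?S)"
    by (rule product_rule_rearrangement)
  show ?case
    using * by (simp only: ** prod.insert[OF insert.hyps] sum.insert[OF insert.hyps])
next
  case empty
  show ?case by simp
qed

lemma has_dbar_transform_open:
  assumes "has_dbar f b z" "open S" "z \<in> S" "\<And>w. w \<in> S \<Longrightarrow> f w = g w"
  shows "has_dbar g b z"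
proof -
  obtain a where "(f has_derivative (\<lambda>h. a * h + b * cnj h)) (at z)"
    using assms(1) unfolding has_dbar_def by blast
  from has_derivative_transform_within_open[OF this assms(2,3)] assms(4)
  have "(g has_derivative (\<lambda>h. a * h + b * cnj h)) (at z)" by simp
  thus ?thesis unfolding has_dbar_def by blast
qed

lemma has_dbar_eventually:
  assumes "has_dbar f b z" "eventually (\<lambda>w. f w = g w) (nhds z)"
  shows "has_dbar g b z"
proof -
  obtain S where "open S" "z \<in> S" "\<And>w. w \<in> S \<Longrightarrow> f w = g w"
    using assms(2) unfolding eventually_nhds by auto
  thus ?thesis by (rule has_dbar_transform_open[OF assms(1)])
qed

text \<open>The factor \<open>cnj \<tau>'\<close> is the transformation law of (0,1)-forms, on which
  the definition of \<open>form\<close> rests.\<close>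

lemma has_dbar_comp_holomorphic:
  assumes "has_dbar f b (\<tau> z)" "(\<tau> has_field_derivative \<tau>') (at z)"
  shows "has_dbar (\<lambda>w. f (\<tau> w)) (b * cnj \<tau>') z"
proof -
  obtain a where "(f has_derivative (\<lambda>h. a * h + b * cnj h)) (at (\<tau> z))"
    using assms unfolding has_dbar_def by blast
  from has_derivative_compose[OF assms(2)[unfolded has_field_derivative_def] this]
  have "((\<lambda>w. f (\<tau> w)) has_derivative (\<lambda>h. a * (\<tau>' * h) + b * cnj (\<tau>' * h))) (at z)" .
  hence "((\<lambda>w. f (\<tau> w)) has_derivative (\<lambda>h. (a * \<tau>') * h + (b * cnj \<tau>') * cnj h)) (at z)"
    by (rule has_derivative_eq_rhs) (auto simp: algebra_simps)
  thus ?thesis unfolding has_dbar_def by blast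
qed

lemma has_dbar_holomorphic_comp:
  assumes "has_dbar f b z" "(F has_field_derivative F') (at (f z))"
  shows "has_dbar (\<lambda>w. F (f w)) (F' * b) z"
proof -
  obtain a where "(f has_derivative (\<lambda>h. a * h + b * cnj h)) (at z)"
    using assms unfolding has_dbar_def by blast
  from has_derivative_compose[OF this assms(2)[unfolded has_field_derivative_def]]
  have "((\<lambda>w. F (f w)) has_derivative (\<lambda>h. F' * (a * h + b * cnj h))) (at z)" .
  hence "((\<lambda>w. F (f w)) has_derivative (\<lambda>h. (F' * a) * h + (F' * b) * cnj h)) (at z)"
    by (rule has_derivative_eq_rhs) (auto simp: algebra_simps)
  thus ?thesis unfolding has_dbar_def by blast
qed

lemma has_dbar_exp: "has_dbar f b z \<Longrightarrow> has_dbar (\<lambda>w. exp (f w)) (exp (f z) * b) z"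
  by (rule has_dbar_holomorphic_comp[OF _ DERIV_exp])

lemma has_dbar_cnj: "has_dbar cnj 1 z"
  unfolding has_dbar_def
  by (rule exI[of _ 0]) (simp add: bounded_linear.has_derivative[OF bounded_linear_cnj has_derivative_ident])

subsection \<open>The Cauchy transform\<close>

lemma emeasure_lborel_cball_le:
  fixes z :: complex
  assumes "0 \<le> r"
  shows "emeasure lborel (cball z r) \<le> ennreal (4 * r^2)"
proof -
  have "pi * r^2 \<le> 4 * r^2" using pi_less_4 by (intro mult_right_mono) auto
  thus ?thesis using assms by (simp add: emeasure_cball eval_unit_ball_vol ennreal_leI)
qed

text \<open>Convolution with \<open>1 / (pi * z)\<close>, the fundamental solution of the
  Cauchy-Riemann operator. At \<open>w = z\<close> the integrand is 0 by the convention for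
  division, which concerns a null set.\<close>

definition cauchy_transform :: "(complex \<Rightarrow> complex) \<Rightarrow> complex \<Rightarrow> complex" where
  "cauchy_transform f z = (LINT w|lborel. f w / (z - w)) / of_real pi"

text \<open>Dyadic shells take the place of polar coordinates. Where \<open>norm (z - w)\<close>
  lies between \<open>r / 2 ^ Suc k\<close> and \<open>r / 2 ^ k\<close>, the kernel is at most
  \<open>2 ^ Suc k / r\<close>, on a disc of area at most \<open>4 * (r / 2 ^ k)^2\<close>; the
  products \<open>8 * r / 2 ^ k\<close> sum to \<open>16 * r\<close>.\<close>

lemma nn_integral_inverse_norm_cball:
  fixes z :: complex
  assumes "0 < r"
  shows "(\<integral>\<^sup>+w. ennreal (indicator (cball z r) w / norm (z - w)) \<partial>lborel) \<le> ennreal (16 * r)"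
proof -
  have pw: "ennreal (indicator (cball z r) w / norm (z - w)) \<le>
      (suminf (\<lambda>k. ennreal (2 ^ Suc k / r) * indicator (cball z (r / 2 ^ k)) w))" for w
  proof (cases "w \<in> cball z r \<and> w \<noteq> z")
    case True
    define d where "d = norm (z - w)"
    have d: "0 < d" "d \<le> r" using True by (auto simp: d_def dist_norm)
    have "\<exists>k. r / 2 ^ k < d"
    proof -
      obtain k where "r / d < 2 ^ k" using real_arch_pow[of 2 "r / d"] by auto
      thus ?thesis using d by (intro exI[of _ k]) (simp add: field_simps)
    qed
    define k where "k = (LEAST k. r / 2 ^ k < d)"
    have k: "r / 2 ^ k < d" using LeastI_ex[OF \<open>\<exists>k. r / 2 ^ k < d\<close>] unfolding k_def .
    have "k \<noteq> 0" using k d by (cases k) auto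
    then obtain m where m: "k = Suc m" by (cases k) auto
    have "\<not> r / 2 ^ m < d" using not_less_Least[of m "\<lambda>k. r / 2 ^ k < d"] m unfolding k_def by simp
    hence wm: "w \<in> cball z (r / 2 ^ m)" by (simp add: d_def dist_norm)
    have "1 / d \<le> 2 ^ Suc m / r" using k d assms unfolding m by (simp add: field_simps)
    hence "ennreal (indicator (cball z r) w / norm (z - w)) \<le>
         ennreal (2 ^ Suc m / r) * indicator (cball z (r / 2 ^ m)) w"
      using True wm by (simp add: d_def ennreal_leI)
    also have "\<dots> \<le> (suminf (\<lambda>k. ennreal (2 ^ Suc k / r) * indicator (cball z (r / 2 ^ k)) w))"
    proof -
      define F where "F = (\<lambda>k. ennreal (2 ^ Suc k / r) * indicator (cball z (r / 2 ^ k)) w)"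
      have "sum F {m} \<le> suminf F" by (rule sum_le_suminf) auto
      hence "F m \<le> suminf F" by simp
      thus ?thesis unfolding F_def .
    qed
    finally show ?thesis .
  qed (auto simp: indicator_def)
  have "(\<integral>\<^sup>+w. ennreal (indicator (cball z r) w / norm (z - w)) \<partial>lborel) \<le>
      (\<integral>\<^sup>+w. (suminf (\<lambda>k. ennreal (2 ^ Suc k / r) * indicator (cball z (r / 2 ^ k)) w)) \<partial>lborel)"
    by (rule nn_integral_mono) (rule pw)
  also have "\<dots> = (suminf (\<lambda>k. \<integral>\<^sup>+w. ennreal (2 ^ Suc k / r) * indicator (cball z (r / 2 ^ k)) w \<partial>lborel))"
    by (rule nn_integral_suminf) (auto intro!: borel_measurable_times_ennreal borel_measurable_indicator)
  also have "\<dots> = (suminf (\<lambda>k. ennreal (2 ^ Suc k / r) * emeasure lborel (cball z (r / 2 ^ k))))"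
    by (subst nn_integral_cmult_indicator) auto
  also have "\<dots> \<le> (suminf (\<lambda>k. ennreal (8 * r * (1/2) ^ k)))"
  proof (rule suminf_le)
    fix k
    have "ennreal (2 ^ Suc k / r) * emeasure lborel (cball z (r / 2 ^ k)) \<le>
        ennreal (2 ^ Suc k / r) * ennreal (4 * (r / 2 ^ k)^2)"
      using assms by (intro mult_left_mono emeasure_lborel_cball_le) auto
    also have "\<dots> = ennreal (2 ^ Suc k / r * (4 * (r / 2 ^ k)^2))"
      using assms by (subst ennreal_mult) auto
    also have "2 ^ Suc k / r * (4 * (r / 2 ^ k)^2) = 8 * r * (1/2) ^ k"
      using assms by (simp add: field_simps power2_eq_square)
    finally show "ennreal (2 ^ Suc k / r) * emeasure lborel (cball z (r / 2 ^ k)) \<le>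
        ennreal (8 * r * (1/2) ^ k)" .
  qed auto
  also have "\<dots> = ennreal (suminf (\<lambda>k. 8 * r * (1/2) ^ k))"
    using assms by (intro suminf_ennreal2) (auto intro!: summable_mult)
  also have "suminf (\<lambda>k. 8 * r * (1/2::real) ^ k) = 16 * r"
    by (subst suminf_mult) (auto simp: suminf_geometric)
  finally show ?thesis .
qed


text \<open>Measurable rather than continuous, because the indicator of a disc is the test case from
  which the general differentiation formula is deduced.\<close>

definition cc_measurable :: "(complex \<Rightarrow> complex) \<Rightarrow> bool" where
  "cc_measurable f \<longleftrightarrow> f \<in> borel_measurable borel \<and> bounded (range f) \<and> bounded {w. f w \<noteq> 0}"

lemma cc_measurableE:
  assumes "cc_measurable f"
  obtains M R where "0 < M" "0 < R" "\<And>w. norm (f w) \<le> M" "\<And>w. R < norm (w - z) \<Longrightarrow> f w = 0"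
    "f \<in> borel_measurable borel"
proof -
  from assms obtain M where M: "0 < M" "\<And>w. norm (f w) \<le> M"
    unfolding cc_measurable_def bounded_pos by auto
  from assms obtain R where R: "\<And>w. f w \<noteq> 0 \<Longrightarrow> dist z w \<le> R"
    unfolding cc_measurable_def bounded_any_center[of _ z] by blast
  have "f w = 0" if "max 1 R < norm (w - z)" for w
    using R that by (force simp: dist_norm norm_minus_commute)
  with M show ?thesis using assms that[of M "max 1 R"] by (auto simp: cc_measurable_def)
qed

lemma cc_measurable_add:
  assumes "cc_measurable f" "cc_measurable g"
  shows "cc_measurable (\<lambda>w. f w + g w)"
proof -
  have "bounded ({w. f w \<noteq> 0} \<union> {w. g w \<noteq> 0})"
    using assms by (simp add: cc_measurable_def)
  hence 1: "bounded {w. f w + g w \<noteq> 0}" by (rule bounded_subset) force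
  obtain M where "\<And>w. norm (f w) \<le> M"
    using assms(1) unfolding cc_measurable_def by (auto simp: bounded_pos)
  moreover obtain N where "\<And>w. norm (g w) \<le> N"
    using assms(2) unfolding cc_measurable_def by (auto simp: bounded_pos)
  ultimately have "norm (f w + g w) \<le> M + N" for w by (meson norm_triangle_mono)
  hence 2: "bounded (range (\<lambda>w. f w + g w))" unfolding bounded_iff by auto
  have "(\<lambda>w. f w + g w) \<in> borel_measurable borel"
    using assms unfolding cc_measurable_def by (intro borel_measurable_add) blast+
  with 1 2 show ?thesis unfolding cc_measurable_def by (intro conjI)
qed

lemma cc_measurable_mult:
  assumes "cc_measurable f" "g \<in> borel_measurable borel" "bounded (range g)"
  shows "cc_measurable (\<lambda>w. g w * f w)"
proof -
  have "bounded {w. f w \<noteq> 0}" using assms(1) unfolding cc_measurable_def by blast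
  hence "bounded {w. g w * f w \<noteq> 0}" by (rule bounded_subset) auto
  moreover obtain M where M: "\<And>w. norm (f w) \<le> M"
    using assms(1) unfolding cc_measurable_def by (auto simp: bounded_pos)
  obtain N where N: "\<And>w. norm (g w) \<le> N"
    using assms(3) by (auto simp: bounded_pos)
  have "norm (g w * f w) \<le> N * M" for w
    unfolding norm_mult using M N order.trans[OF norm_ge_zero N] by (intro mult_mono) auto
  hence "bounded (range (\<lambda>w. g w * f w))" unfolding bounded_iff by auto
  moreover have "(\<lambda>w. g w * f w) \<in> borel_measurable borel"
    using assms(1) unfolding cc_measurable_def by (intro borel_measurable_times assms(2)) blast
  ultimately show ?thesis unfolding cc_measurable_def by (intro conjI)
qed

lemma cc_measurable_cmult: "cc_measurable f \<Longrightarrow> cc_measurable (\<lambda>w. c * f w)"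
  by (rule cc_measurable_mult) auto

lemma cc_measurable_indicator_ball: "cc_measurable (indicator (ball z r))"
proof -
  have "{w. indicator (ball z r) w \<noteq> (0::complex)} = ball z r" by (auto simp: indicator_def)
  moreover have "norm (indicator (ball z r) w :: complex) \<le> 1" for w by (simp add: indicator_def)
  hence "bounded (range (indicator (ball z r) :: complex \<Rightarrow> complex))" unfolding bounded_iff by auto
  moreover have "(indicator (ball z r) :: complex \<Rightarrow> complex) \<in> borel_measurable borel"
    by (rule borel_measurable_indicator) simp
  ultimately show ?thesis by (simp add: cc_measurable_def)
qed

text \<open>The radius of the support is measured from the singularity \<open>z\<close>. A bound
  proportional to it is what makes the truncation error of the kernel small in the proof of
  continuity.\<close>

lemma cauchy_kernel_bound:
  fixes f :: "complex \<Rightarrow> complex"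
  assumes f: "f \<in> borel_measurable borel" and M: "0 \<le> M" "\<And>w. norm (f w) \<le> M"
    and r: "0 < r" "\<And>w. r < norm (w - z) \<Longrightarrow> f w = 0"
  shows "integrable lborel (\<lambda>w. f w / (z - w))"
    and "norm (LINT w|lborel. f w / (z - w)) \<le> 16 * r * M"
proof -
  have [measurable]: "f \<in> borel_measurable borel" by fact
  have *: "(\<integral>\<^sup>+w. ennreal (norm (f w / (z - w))) \<partial>lborel) \<le> ennreal (16 * r * M)"
  proof -
    have "ennreal (norm (f w / (z - w))) \<le> ennreal M * ennreal (indicator (cball z r) w / norm (z - w))" for w
    proof (cases "w \<in> cball z r")
      case True
      have "norm (f w / (z - w)) \<le> M * (1 / norm (z - w))"
        using divide_right_mono[OF M(2)[of w], of "norm (z - w)"] by (simp add: norm_divide)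
      thus ?thesis using True M by (simp add: ennreal_mult'[symmetric] ennreal_leI)
    next
      case False
      hence "f w = 0" using r by (simp add: dist_norm norm_minus_commute)
      thus ?thesis by simp
    qed
    hence "(\<integral>\<^sup>+w. ennreal (norm (f w / (z - w))) \<partial>lborel) \<le>
        (\<integral>\<^sup>+w. ennreal M * ennreal (indicator (cball z r) w / norm (z - w)) \<partial>lborel)"
      by (intro nn_integral_mono)
    also have "\<dots> = ennreal M * (\<integral>\<^sup>+w. ennreal (indicator (cball z r) w / norm (z - w)) \<partial>lborel)"
      by (rule nn_integral_cmult)
         (intro measurable_compose[OF _ measurable_ennreal] borel_measurable_divide
            borel_measurable_indicator borel_measurable_norm borel_measurable_diff, auto)
    also have "\<dots> \<le> ennreal M * ennreal (16 * r)"
      by (intro mult_left_mono nn_integral_inverse_norm_cball r) auto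
    also have "\<dots> = ennreal (16 * r * M)" using M r by (simp add: ennreal_mult'[symmetric] mult_ac)
    finally show ?thesis .
  qed
  show I: "integrable lborel (\<lambda>w. f w / (z - w))"
  proof (rule integrableI_bounded)
    show "(\<integral>\<^sup>+w. ennreal (norm (f w / (z - w))) \<partial>lborel) < \<infinity>"
      using * by (rule order.strict_trans1) simp
  qed measurable
  have "ennreal (norm (LINT w|lborel. f w / (z - w))) \<le> (\<integral>\<^sup>+w. ennreal (norm (f w / (z - w))) \<partial>lborel)"
    using I by (rule integral_norm_bound_ennreal)
  also note *
  finally show "norm (LINT w|lborel. f w / (z - w)) \<le> 16 * r * M"
    using M r by (subst (asm) ennreal_le_iff) auto
qed

lemma cauchy_kernel_integrable:
  assumes "cc_measurable f"
  shows "integrable lborel (\<lambda>w. f w / (z - w))"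
proof -
  obtain M R where "0 < M" "0 < R" "\<And>w. norm (f w) \<le> M" "\<And>w. R < norm (w - z) \<Longrightarrow> f w = 0"
    "f \<in> borel_measurable borel" using cc_measurableE[OF assms, where z = z] by metis
  thus ?thesis by (intro cauchy_kernel_bound(1)[of f M R]) auto
qed

lemma cauchy_transform_add:
  assumes "cc_measurable f" "cc_measurable g"
  shows "cauchy_transform (\<lambda>w. f w + g w) z = cauchy_transform f z + cauchy_transform g z"
  unfolding cauchy_transform_def
  using cauchy_kernel_integrable[OF assms(1)] cauchy_kernel_integrable[OF assms(2)]
  by (simp add: add_divide_distrib)

lemma cauchy_transform_cmult:
  "cauchy_transform (\<lambda>w. c * f w) z = c * cauchy_transform f z"
  unfolding cauchy_transform_def
  using integral_mult_right_zero[of lborel c "\<lambda>w. f w / (z - w)"] by simp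

text \<open>Equal to \<open>1 / u\<close> for \<open>r \<le> norm u\<close> and to
  \<open>cnj u / r^2\<close> inside: a bounded continuous substitute for the Cauchy kernel.\<close>

definition truncated_kernel :: "real \<Rightarrow> complex \<Rightarrow> complex" where
  "truncated_kernel r u = cnj u / of_real ((max r (norm u))\<^sup>2)"

lemma truncated_kernel_outside: "0 < r \<Longrightarrow> r \<le> norm u \<Longrightarrow> truncated_kernel r u = 1 / u"
proof -
  assume "0 < r" "r \<le> norm u"
  hence "u \<noteq> 0" by auto
  moreover have "of_real ((norm u)\<^sup>2) = u * cnj u" by (rule complex_norm_square)
  ultimately show ?thesis using \<open>r \<le> norm u\<close>
    by (simp add: truncated_kernel_def max_absorb2)
qed

lemma truncated_kernel_le:
  assumes "0 < r"
  shows "norm (truncated_kernel r u) \<le> 1 / r" "norm (truncated_kernel r u) \<le> 1 / norm u"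
proof -
  define m where "m = max r (norm u)"
  have m: "0 < m" "norm u \<le> m" "r \<le> m" using assms by (auto simp: m_def)
  have n: "norm (truncated_kernel r u) = norm u / m\<^sup>2"
    by (simp add: truncated_kernel_def norm_divide m_def norm_power)
  have "norm u / m\<^sup>2 \<le> m / m\<^sup>2" using m by (intro divide_right_mono) auto
  also have "\<dots> = 1 / m" using m by (simp add: power2_eq_square)
  also have "\<dots> \<le> 1 / r" using m assms by (intro divide_left_mono) auto
  finally show "norm (truncated_kernel r u) \<le> 1 / r" using n by simp
  show "norm (truncated_kernel r u) \<le> 1 / norm u"
  proof (cases "u = 0")
    case False
    have "norm u * norm u \<le> m * m" using m by (intro mult_mono) auto
    thus ?thesis unfolding n using False m by (simp add: field_simps power2_eq_square)
  qed (simp add: truncated_kernel_def)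
qed

lemma continuous_truncated_kernel: "0 < r \<Longrightarrow> continuous_on UNIV (truncated_kernel r)"
  unfolding truncated_kernel_def
  by (intro continuous_intros) (auto simp: max_def)

text \<open>The transform is the uniform limit, as the truncation radius shrinks, of convolutions
  with truncated kernels. Those are continuous by dominated convergence.\<close>

lemma continuous_cauchy_transform:
  assumes f: "cc_measurable f"
  shows "continuous_on UNIV (cauchy_transform f)"
proof -
  obtain M R where M: "0 < M" "0 < R" "\<And>w. norm (f w) \<le> M" "\<And>w. R < norm (w - 0) \<Longrightarrow> f w = 0"
    and [measurable]: "f \<in> borel_measurable borel" using cc_measurableE[OF assms, where z = 0] by metis
  define C where "C = (\<lambda>z. LINT w|lborel. f w / (z - w))"
  define Cr where "Cr = (\<lambda>r z. LINT w|lborel. f w * truncated_kernel r (z - w))"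
  have km: "(\<lambda>w. truncated_kernel r (z - w)) \<in> borel_measurable borel" if "0 < r" for r z
    by (rule borel_measurable_continuous_onI)
       (intro continuous_on_compose2[OF continuous_truncated_kernel[OF that]] continuous_intros, auto)
  have bd: "norm (f w * truncated_kernel r (z - w)) \<le> M / r * indicator (cball 0 R) w"
    if "0 < r" for r z w
  proof (cases "w \<in> cball 0 R")
    case True
    have "norm (f w) * norm (truncated_kernel r (z - w)) \<le> M * (1 / r)"
      using M truncated_kernel_le[OF that] by (intro mult_mono) auto
    thus ?thesis using True by (simp add: norm_mult)
  next
    case False
    thus ?thesis using M(4)[of w] by simp
  qed
  have ibd: "integrable lborel (\<lambda>w. M / r * indicator (cball 0 R) w :: real)" for r
    by (intro integrable_mult_right integrable_real_indicator)
       (auto simp: emeasure_cball M less_imp_le)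
  have Ir: "integrable lborel (\<lambda>w. f w * truncated_kernel r (z - w))" if "0 < r" for r z
    by (rule Bochner_Integration.integrable_bound[OF ibd[of r]])
       (use km[OF that] order.trans[OF bd[OF that] abs_ge_self] in \<open>auto intro!: AE_I2 borel_measurable_times\<close>)
  have contr: "continuous_on UNIV (Cr r)" if r: "0 < r" for r
  proof (rule continuous_on_sequentiallyI)
    fix x :: "nat \<Rightarrow> complex" and a assume x: "x \<longlonglongrightarrow> a"
    show "(\<lambda>n. Cr r (x n)) \<longlonglongrightarrow> Cr r a" unfolding Cr_def
    proof (rule integral_dominated_convergence[where w = "\<lambda>w. M / r * indicator (cball 0 R) w"])
      show "AE w in lborel. (\<lambda>n. f w * truncated_kernel r (x n - w)) \<longlonglongrightarrow> f w * truncated_kernel r (a - w)"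
      proof (intro AE_I2 tendsto_intros)
        fix w
        have "isCont (truncated_kernel r) (a - w)"
          using continuous_truncated_kernel[OF r] by (simp add: continuous_on_eq_continuous_at)
        thus "(\<lambda>n. truncated_kernel r (x n - w)) \<longlonglongrightarrow> truncated_kernel r (a - w)"
          by (rule isCont_tendsto_compose) (intro tendsto_intros x)
      qed
    qed (use km[OF r] bd[OF r] ibd in auto)
  qed
  have near: "norm (C z - Cr r z) \<le> 32 * M * r" if r: "0 < r" for r z
  proof -
    \<comment> \<open>The truncation error has to be written with the singular kernel again:
      \<open>g\<close> is bounded by \<open>2 * M\<close> and supported within \<open>r\<close> of
      \<open>z\<close>, so \<open>cauchy_kernel_bound\<close> applies to
      \<open>g w / (z - w)\<close>.\<close>
    define g where "g = (\<lambda>w. f w * (1 - (z - w) * truncated_kernel r (z - w)))"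
    have gm: "g \<in> borel_measurable borel" unfolding g_def using km[OF r] by measurable
    have gb: "norm (g w) \<le> 2 * M" for w
    proof -
      have "norm ((z - w) * truncated_kernel r (z - w)) \<le> norm (z - w) * (1 / norm (z - w))"
        using truncated_kernel_le(2)[OF r] unfolding norm_mult by (intro mult_left_mono) auto
      also have "\<dots> \<le> 1" by simp
      finally have "norm (1 - (z - w) * truncated_kernel r (z - w)) \<le> 2"
        by (intro order.trans[OF norm_triangle_ineq4]) simp
      hence "norm (f w) * norm (1 - (z - w) * truncated_kernel r (z - w)) \<le> M * 2"
        using M by (intro mult_mono) auto
      thus ?thesis by (simp add: g_def norm_mult)
    qed
    have g0: "g w = 0" if w: "r < norm (w - z)" for w
      using truncated_kernel_outside[OF r, of "z - w"] w r
      by (auto simp: g_def norm_minus_commute)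
    have "C z - Cr r z = (LINT w|lborel. f w / (z - w) - f w * truncated_kernel r (z - w))"
      unfolding C_def Cr_def
      by (rule Bochner_Integration.integral_diff[symmetric])
         (use cauchy_kernel_integrable[OF f] Ir[OF r] in auto)
    also have "\<dots> = (LINT w|lborel. g w / (z - w))"
      by (rule Bochner_Integration.integral_cong)
         (auto simp: g_def truncated_kernel_def divide_simps algebra_simps)
    also have "norm \<dots> \<le> 16 * r * (2 * M)"
      by (rule cauchy_kernel_bound(2)[OF gm]) (use gb g0 M r in auto)
    finally show ?thesis by (simp add: mult_ac)
  qed
  have "continuous_on UNIV C"
  proof (rule uniform_limit_theorem)
    show "uniform_limit UNIV (\<lambda>n. Cr (1 / real (Suc n))) C sequentially"
    proof (rule uniform_limitI)
      fix e :: real assume e: "0 < e"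
      have "(\<lambda>n. 32 * M * (1 / real (Suc n))) \<longlonglongrightarrow> 32 * M * 0"
        by (intro tendsto_mult tendsto_const LIMSEQ_Suc lim_1_over_n)
      hence "\<forall>\<^sub>F n in sequentially. 32 * M * (1 / real (Suc n)) < e"
        using e by (intro order_tendstoD(2)) auto
      thus "\<forall>\<^sub>F n in sequentially. \<forall>x\<in>UNIV. dist (Cr (1 / real (Suc n)) x) (C x) < e"
      proof eventually_elim
        case (elim n)
        show ?case
        proof
          fix x
          have "dist (Cr (1 / real (Suc n)) x) (C x) \<le> 32 * M * (1 / real (Suc n))"
            using near[of "1 / real (Suc n)" x] by (simp add: dist_norm norm_minus_commute)
          with elim show "dist (Cr (1 / real (Suc n)) x) (C x) < e" by linarith
        qed
      qed
    qed
  qed (auto intro!: contr always_eventually)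
  thus ?thesis unfolding cauchy_transform_def C_def by (intro continuous_intros) auto
qed

text \<open>If \<open>f\<close> vanishes to first order at \<open>z0\<close>, then
  \<open>f w / (z0 - w)\<close> is still bounded. The difference quotient of the transform of
  \<open>f\<close> at \<open>z0\<close> is minus the transform of this function, which is
  continuous.\<close>

lemma cauchy_transform_differentiable:
  assumes f: "cc_measurable f" and L: "\<And>w. norm (f w) \<le> L * norm (w - z0)"
  shows "has_dbar (cauchy_transform f) 0 z0"
proof -
  obtain M R where M: "0 < M" "0 < R" "\<And>w. norm (f w) \<le> M" "\<And>w. R < norm (w - 0) \<Longrightarrow> f w = 0"
    and [measurable]: "f \<in> borel_measurable borel" using cc_measurableE[OF assms(1), where z = 0] by metis
  define f1 where "f1 = (\<lambda>w. f w / (z0 - w))"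
  have f1: "cc_measurable f1"
    unfolding cc_measurable_def
  proof (intro conjI)
    show "f1 \<in> borel_measurable borel" unfolding f1_def by measurable
    have "norm (f1 w) \<le> \<bar>L\<bar>" for w
    proof (cases "w = z0")
      case False
      have "norm (f w) \<le> \<bar>L\<bar> * norm (w - z0)"
        using L[of w] by (rule order.trans) (simp add: mult_right_mono)
      thus ?thesis using False by (simp add: f1_def norm_divide field_simps norm_minus_commute)
    qed (simp add: f1_def)
    thus "bounded (range f1)" unfolding bounded_iff by auto
    show "bounded {w. f1 w \<noteq> 0}"
      by (rule bounded_subset[of "{w. f w \<noteq> 0}"]) (use f in \<open>auto simp: f1_def cc_measurable_def\<close>)
  qed
  have q: "(cauchy_transform f z - cauchy_transform f z0) / (z - z0) = - cauchy_transform f1 z"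
    if "z \<noteq> z0" for z
  proof -
    have "(LINT w|lborel. f w / (z - w)) - (LINT w|lborel. f w / (z0 - w)) =
        (LINT w|lborel. f w / (z - w) - f w / (z0 - w))"
      by (intro Bochner_Integration.integral_diff[symmetric] cauchy_kernel_integrable f)
    also have "\<dots> = (LINT w|lborel. (z0 - z) * (f1 w / (z - w)))"
    proof (rule integral_cong_AE)
      \<comment> \<open>At \<open>w = z\<close> the identity may fail, since a division by zero
        yields 0.\<close>
      have "AE w in lborel. w \<noteq> z" by (rule AE_lborel_singleton)
      thus "AE w in lborel. f w / (z - w) - f w / (z0 - w) = (z0 - z) * (f1 w / (z - w))"
      proof eventually_elim
        case (elim w)
        show ?case
        proof (cases "w = z0")
          case True
          thus ?thesis using L[of z0] by (simp add: f1_def)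
        next
          case False
          thus ?thesis using elim unfolding f1_def by (simp add: field_simps)
        qed
      qed
    qed (unfold f1_def, measurable)
    also have "\<dots> = (z0 - z) * (LINT w|lborel. f1 w / (z - w))" by (rule integral_mult_right_zero)
    finally have *: "(LINT w|lborel. f w / (z - w)) - (LINT w|lborel. f w / (z0 - w)) =
        (z0 - z) * (LINT w|lborel. f1 w / (z - w))" .
    have "(cauchy_transform f z - cauchy_transform f z0) / (z - z0) =
        ((LINT w|lborel. f w / (z - w)) - (LINT w|lborel. f w / (z0 - w))) / (of_real pi * (z - z0))"
      unfolding cauchy_transform_def by (simp add: diff_divide_distrib)
    also have "\<dots> = - cauchy_transform f1 z"
      using that unfolding * cauchy_transform_def by (simp add: field_simps)
    finally show ?thesis .
  qed
  have "isCont (\<lambda>z. - cauchy_transform f1 z) z0"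
    using continuous_cauchy_transform[OF f1]
    by (intro continuous_minus) (simp add: continuous_on_eq_continuous_at)
  hence "((\<lambda>z. - cauchy_transform f1 z) \<longlongrightarrow> - cauchy_transform f1 z0) (at z0)"
    by (simp add: isCont_def)
  hence "((\<lambda>z. (cauchy_transform f z - cauchy_transform f z0) / (z - z0)) \<longlongrightarrow> - cauchy_transform f1 z0) (at z0)"
    by (rule Lim_transform_eventually) (auto simp: eventually_at_filter q)
  hence "(cauchy_transform f has_field_derivative - cauchy_transform f1 z0) (at z0)"
    by (simp add: has_field_derivative_iff)
  thus ?thesis by (rule has_field_derivative_imp_has_dbar)
qed

lemma has_dbarI_quadratic:
  assumes "0 < r" "\<And>h. norm h < r \<Longrightarrow> norm (f (z + h) - f z - (a * h + b * cnj h)) \<le> K * (norm h)\<^sup>2"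
  shows "has_dbar f b z"
proof -
  have "bounded_linear (\<lambda>h. a * h + b * cnj h)"
    by (intro bounded_linear_add bounded_linear_mult_right
        bounded_linear_compose[OF bounded_linear_mult_right bounded_linear_cnj])
  moreover have "((\<lambda>h. norm (f (z + h) - f z - (a * h + b * cnj h)) / norm h) \<longlongrightarrow> 0) (at 0)"
  proof (rule Lim_null_comparison)
    have "eventually (\<lambda>h::complex. norm h < r) (at 0)"
      using assms(1) unfolding eventually_at by (intro exI[of _ r]) (auto simp: dist_norm)
    thus "\<forall>\<^sub>F h in at 0. norm (norm (f (z + h) - f z - (a * h + b * cnj h)) / norm h) \<le> \<bar>K\<bar> * norm h"
    proof eventually_elim
      case (elim h)
      show ?case
      proof (cases "h = 0")
        case False
        have "norm (f (z + h) - f z - (a * h + b * cnj h)) \<le> \<bar>K\<bar> * (norm h)\<^sup>2"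
          using assms(2)[OF elim] by (rule order.trans) (simp add: mult_right_mono)
        thus ?thesis using False by (simp add: field_simps power2_eq_square)
      qed simp
    qed
    show "((\<lambda>h. \<bar>K\<bar> * norm h) \<longlongrightarrow> 0) (at (0::complex))"
      by (rule tendsto_eq_intros refl tendsto_norm tendsto_ident_at | simp)+
  qed
  ultimately have "(f has_derivative (\<lambda>h. a * h + b * cnj h)) (at z)"
    unfolding has_derivative_at by blast
  thus ?thesis unfolding has_dbar_def by blast
qed


lemma lborel_integral_affine:
  fixes g :: "complex \<Rightarrow> complex"
  assumes "g \<in> borel_measurable borel" "\<bar>c\<bar> = 1"
  shows "(LINT w|lborel. g (t + c *\<^sub>R w)) = (LINT w|lborel. g w)"
proof -
  have "c \<noteq> 0" using assms(2) by auto
  have "(lborel :: complex measure) = density (distr lborel borel (\<lambda>x. t + c *\<^sub>R x)) (\<lambda>_. ennreal (\<bar>c\<bar> ^ DIM(complex)))"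
    using lborel_affine[OF \<open>c \<noteq> 0\<close>, of t] by simp
  also have "\<dots> = distr lborel borel (\<lambda>x. t + c *\<^sub>R x)" using assms(2) by (simp add: density_1)
  finally have eq: "(lborel :: complex measure) = distr lborel borel (\<lambda>x. t + c *\<^sub>R x)" .
  have "(LINT w|lborel. g w) = (LINT w|distr lborel borel (\<lambda>x. t + c *\<^sub>R x). g w)"
    using eq by simp
  also have "\<dots> = (LINT w|lborel. g (t + c *\<^sub>R w))"
    using assms(1) by (intro integral_distr) auto
  finally show ?thesis ..
qed

lemma integrable_ball_times:
  fixes g :: "complex \<Rightarrow> complex"
  assumes [measurable]: "g \<in> borel_measurable borel" "S \<in> sets borel"
    and S: "S \<subseteq> cball z r" and b: "\<And>w. w \<in> S \<Longrightarrow> norm (g w) \<le> B"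
  shows "integrable lborel (\<lambda>w. indicator S w * g w)"
    and "norm (LINT w|lborel. indicator S w * g w) \<le> \<bar>B\<bar> * measure lborel S"
proof -
  have fin: "emeasure lborel S < \<infinity>"
    by (rule order.strict_trans1[OF emeasure_mono[OF S] emeasure_lborel_cball_finite]) simp
  have *: "norm (indicator S w * g w) \<le> \<bar>B\<bar> * indicator S w" for w
    using b[of w] by (auto simp: indicator_def)
  have I: "integrable lborel (\<lambda>w. \<bar>B\<bar> * indicator S w :: real)"
    using fin by (intro integrable_mult_right integrable_real_indicator) auto
  show "integrable lborel (\<lambda>w. indicator S w * g w)"
  proof (rule Bochner_Integration.integrable_bound[OF I])
    show "(\<lambda>w. indicator S w * g w) \<in> borel_measurable lborel" by measurable
    show "AE w in lborel. norm (indicator S w * g w) \<le> norm (\<bar>B\<bar> * indicator S w :: real)"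
      by (rule AE_I2, rule order.trans[OF *]) simp
  qed
  have "norm (LINT w|lborel. indicator S w * g w) \<le> (LINT w|lborel. \<bar>B\<bar> * indicator S w)"
    by (rule Bochner_Integration.integral_norm_bound_integral[OF _ I])
       (use * in \<open>auto intro!: \<open>integrable lborel (\<lambda>w. indicator S w * g w)\<close>\<close>)
  also have "\<dots> = \<bar>B\<bar> * measure lborel S" using fin by simp
  finally show "norm (LINT w|lborel. indicator S w * g w) \<le> \<bar>B\<bar> * measure lborel S" .
qed

(* On the symmetric difference of two close unit discs 1/u and cnj u are close to each other. *)
lemma cauchy_transform_unit_disc:
  "has_dbar (cauchy_transform (indicator (ball z0 1))) 1 z0"
proof (rule has_dbarI_quadratic[where r = "1/2" and a = 0 and K = 20])
  fix h :: complex assume h: "norm h < 1/2"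
  \<comment> \<open>On the unit circle \<open>1 / u = cnj u\<close>, so \<open>rho\<close> vanishes
    there. The kernel is split into \<open>rho\<close> and \<open>cnj u\<close>.\<close>
  define rho where "rho = (\<lambda>u::complex. 1 / u - cnj u)"
  define J where "J = (\<lambda>d. LINT u|lborel. indicator (ball d 1) u * rho u :: complex)"
  have mc [measurable]: "cnj \<in> borel_measurable borel"
    by (rule borel_measurable_continuous_onI[OF linear_continuous_on[OF bounded_linear_cnj]])
  have m [measurable]: "rho \<in> borel_measurable borel" unfolding rho_def by measurable
  have Iinv: "integrable lborel (\<lambda>u. indicator (ball d 1) u / u :: complex)" for d
  proof -
    have "integrable lborel (\<lambda>u. indicator (ball d 1) u / (0 - u) :: complex)"
      by (rule cauchy_kernel_integrable[OF cc_measurable_indicator_ball])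
    hence "integrable lborel (\<lambda>u. - (indicator (ball d 1) u / (0 - u)) :: complex)" by simp
    thus ?thesis by simp
  qed
  have Icnj: "integrable lborel (\<lambda>u. indicator (ball d 1) u * cnj u :: complex)" for d
  proof (rule integrable_ball_times(1)[where z = d and r = 1 and B = "norm d + 1"])
    fix w assume "w \<in> ball d 1"
    thus "norm (cnj w) \<le> norm d + 1"
      using norm_triangle_sub[of w d] by (simp add: dist_norm norm_minus_commute)
  qed auto
  have T: "cauchy_transform (indicator (ball z0 1)) (z0 + d) * of_real pi =
      J d + (LINT u|lborel. indicator (ball d 1) u * cnj u)" for d
  proof -
    have "(LINT w|lborel. indicator (ball z0 1) w / (z0 + d - w)) =
        (LINT w|lborel. (\<lambda>u. indicator (ball d 1) u / u) ((z0 + d) + (-1) *\<^sub>R w) :: complex)"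
      by (rule Bochner_Integration.integral_cong) (auto simp: indicator_def dist_norm norm_minus_commute)
    also have "\<dots> = (LINT u|lborel. indicator (ball d 1) u / u)"
      by (rule lborel_integral_affine) (auto intro!: borel_measurable_divide borel_measurable_indicator)
    also have "\<dots> = (LINT u|lborel. indicator (ball d 1) u * rho u + indicator (ball d 1) u * cnj u)"
      by (rule Bochner_Integration.integral_cong) (auto simp: rho_def algebra_simps)
    also have "\<dots> = J d + (LINT u|lborel. indicator (ball d 1) u * cnj u)"
      unfolding J_def
    proof (rule Bochner_Integration.integral_add[OF _ Icnj])
      have "integrable lborel (\<lambda>u. indicator (ball d 1) u / u - indicator (ball d 1) u * cnj u :: complex)"
        by (intro Bochner_Integration.integrable_diff Iinv Icnj)
      thus "integrable lborel (\<lambda>u. indicator (ball d 1) u * rho u)"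
        by (simp add: rho_def algebra_simps)
    qed
    finally show ?thesis by (simp add: cauchy_transform_def)
  qed
  \<comment> \<open>The linear term of the expansion comes from here, exactly: moving the disc by
    \<open>h\<close> adds \<open>cnj h\<close> to the integrand \<open>cnj u\<close> on a disc of
    area \<open>pi\<close>.\<close>
  have C: "(LINT u|lborel. indicator (ball h 1) u * cnj u) =
      (LINT u|lborel. indicator (ball 0 1) u * cnj u) + of_real pi * cnj h"
  proof -
    have "(LINT u|lborel. indicator (ball h 1) u * cnj u) =
        (LINT u|lborel. (\<lambda>u. indicator (ball h 1) u * cnj u) (h + 1 *\<^sub>R u))"
      by (rule lborel_integral_affine[symmetric]) (auto intro!: borel_measurable_times borel_measurable_indicator mc)
    also have "\<dots> = (LINT u|lborel. indicator (ball 0 1) u * cnj u + indicator (ball 0 1) u * cnj h)"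
      by (rule Bochner_Integration.integral_cong) (auto simp: indicator_def dist_norm algebra_simps)
    also have "\<dots> = (LINT u|lborel. indicator (ball 0 1) u * cnj u) + (LINT u|lborel. indicator (ball (0::complex) 1) u * cnj h)"
      by (rule Bochner_Integration.integral_add[OF Icnj])
         (rule integrable_ball_times(1)[where z = 0 and r = 1 and B = "norm h"], auto)
    also have "(LINT u|lborel. indicator (ball (0::complex) 1) u * cnj h) =
        (LINT u|lborel. (indicator (ball (0::complex) 1) u :: real) *\<^sub>R cnj h)"
      by (rule Bochner_Integration.integral_cong) (auto simp: indicator_def)
    also have "\<dots> = measure lborel (ball (0::complex) 1) *\<^sub>R cnj h"
      by (subst integral_scaleR_left) (auto simp: emeasure_ball)
    also have "measure lborel (ball (0::complex) 1) = pi"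
      by (simp add: content_ball eval_unit_ball_vol)
    finally show ?thesis by (simp add: scaleR_conv_of_real)
  qed
  have J: "norm (J h - J 0) \<le> 20 * pi * (norm h)\<^sup>2"
  proof -
    \<comment> \<open>The two discs differ only inside this annulus of area
      \<open>4 * pi * norm h\<close>, on which \<open>norm (rho u)\<close> is at most
      \<open>5 * norm h\<close>. The product gives the constant 20, once \<open>pi\<close> is
      divided out.\<close>
    define A where "A = cball 0 (1 + norm h) - ball (0::complex) (1 - norm h)"
    define g where "g = (\<lambda>u. (indicator (ball h 1) u - indicator (ball 0 1) u) * rho u)"
    have Irho: "integrable lborel (\<lambda>u. indicator (ball d 1) u * rho u)" for d
    proof -
      have "integrable lborel (\<lambda>u. indicator (ball d 1) u / u - indicator (ball d 1) u * cnj u :: complex)"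
        by (intro Bochner_Integration.integrable_diff Iinv Icnj)
      thus ?thesis by (simp add: rho_def algebra_simps)
    qed
    have gA: "g u = indicator A u * g u" for u
    proof (cases "u \<in> A")
      case False
      hence "norm u > 1 + norm h \<or> norm u < 1 - norm h" by (auto simp: A_def)
      hence "(u \<in> ball h 1) = (u \<in> ball 0 1)"
        using norm_triangle_ineq4[of u h] norm_triangle_sub[of u h] norm_ge_zero[of h]
        by (auto simp: dist_norm norm_minus_commute)
      thus ?thesis by (simp add: g_def indicator_def)
    qed simp
    have "J h - J 0 = (LINT u|lborel. indicator (ball h 1) u * rho u - indicator (ball 0 1) u * rho u)"
      unfolding J_def by (rule Bochner_Integration.integral_diff[symmetric, OF Irho Irho])
    also have "\<dots> = (LINT u|lborel. g u)"
      by (rule Bochner_Integration.integral_cong) (auto simp: g_def algebra_simps)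
    also have "\<dots> = (LINT u|lborel. indicator A u * g u)"
      by (rule Bochner_Integration.integral_cong[OF refl gA])
    also have "norm \<dots> \<le> \<bar>5 * norm h\<bar> * measure lborel A"
    proof (rule integrable_ball_times(2)[where z = 0 and r = "1 + norm h"])
      show "g \<in> borel_measurable borel" unfolding g_def
        by (intro borel_measurable_times borel_measurable_diff borel_measurable_indicator m) auto
      fix u assume u: "u \<in> A"
      hence n: "1 - norm h \<le> norm u" "norm u \<le> 1 + norm h" by (auto simp: A_def)
      hence n0: "norm u > 1/2" "u \<noteq> 0" using h by auto
      have "u * cnj u = of_real ((norm u)\<^sup>2)" by (rule complex_norm_square[symmetric])
      moreover have "rho u * u = 1 - u * cnj u"
        using n0 by (simp add: rho_def field_simps)
      ultimately have "rho u * u = of_real (1 - (norm u)\<^sup>2)" by simp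
      hence "rho u = of_real (1 - (norm u)\<^sup>2) / u"
        using n0 by (simp only: eq_divide_eq) simp
      hence r: "norm (rho u) = \<bar>1 - (norm u)\<^sup>2\<bar> / norm u"
        by (simp only: norm_divide norm_of_real)
      have "1 - (norm u)\<^sup>2 = (1 - norm u) * (1 + norm u)"
        by (simp add: power2_eq_square algebra_simps)
      hence "\<bar>1 - (norm u)\<^sup>2\<bar> = \<bar>1 - norm u\<bar> * (1 + norm u)"
        by (simp only: abs_mult) simp
      also have "\<dots> \<le> norm h * (5/2)" using n h by (intro mult_mono) auto
      finally have "\<bar>1 - (norm u)\<^sup>2\<bar> / norm u \<le> (norm h * (5/2)) / (1/2)"
        using n0 by (intro frac_le) auto
      hence "norm (rho u) \<le> 5 * norm h" unfolding r by simp
      moreover have "norm (g u) \<le> norm (rho u)" by (auto simp: g_def indicator_def)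
      ultimately show "norm (g u) \<le> 5 * norm h" by linarith
    qed (auto simp: A_def)
    also have "measure lborel A = pi * (1 + norm h)\<^sup>2 - pi * (1 - norm h)\<^sup>2"
    proof -
      have "measure lborel A = measure lborel (cball (0::complex) (1 + norm h)) - measure lborel (ball (0::complex) (1 - norm h))"
        unfolding A_def
        using emeasure_lborel_cball_finite[of "0::complex" "1 + norm h"] norm_ge_zero[of h]
        by (intro measure_Diff) (auto simp del: norm_ge_zero)
      thus ?thesis using h by (simp add: content_ball content_cball eval_unit_ball_vol)
    qed
    also have "pi * (1 + norm h)\<^sup>2 - pi * (1 - norm h)\<^sup>2 = 4 * pi * norm h"
      by (simp add: power2_eq_square algebra_simps)
    also have "\<bar>5 * norm h\<bar> * (4 * pi * norm h) = 20 * pi * (norm h)\<^sup>2"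
      by (simp add: power2_eq_square)
    finally show ?thesis .
  qed
  define H where "H = cauchy_transform (indicator (ball z0 1))"
  have "of_real pi * (H (z0 + h) - H z0 - cnj h) = J h - J 0"
    using T[of h] T[of 0] C by (simp add: H_def algebra_simps)
  from arg_cong[OF this, of norm] J
  have "pi * norm (H (z0 + h) - H z0 - cnj h) \<le> pi * (20 * (norm h)\<^sup>2)"
    by (simp add: norm_mult)
  hence "norm (H (z0 + h) - H z0 - cnj h) \<le> 20 * (norm h)\<^sup>2"
    by (rule mult_left_le_imp_le) simp
  thus "norm (cauchy_transform (indicator (ball z0 1)) (z0 + h) - cauchy_transform (indicator (ball z0 1)) z0 -
      (0 * h + 1 * cnj h)) \<le> 20 * (norm h)\<^sup>2" by (simp add: H_def)
qed auto

text \<open>Differentiability at the single point \<open>z0\<close> suffices: after subtracting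
  \<open>f z0\<close> times the indicator of the unit disc about \<open>z0\<close>, whose transform
  is known at its centre, the rest vanishes to first order at \<open>z0\<close>.\<close>

lemma cauchy_transform_has_dbar:
  assumes f: "cc_measurable f" and d: "f differentiable (at z0)"
  shows "has_dbar (cauchy_transform f) (f z0) z0"
proof -
  define u where "u = (indicator (ball z0 1) :: complex \<Rightarrow> complex)"
  define g where "g = (\<lambda>w. f w + - f z0 * u w)"
  have u: "cc_measurable u" unfolding u_def by (rule cc_measurable_indicator_ball)
  have cu: "cc_measurable (\<lambda>w. c * u w)" for c using u by (rule cc_measurable_cmult)
  have g: "cc_measurable g" unfolding g_def by (rule cc_measurable_add[OF f cu])
  obtain L where L: "\<And>w. norm (g w) \<le> L * norm (w - z0)"
  proof -
    obtain D where "(f has_derivative D) (at z0)" using d unfolding differentiable_def by blast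
    then obtain r where bl: "bounded_linear D" and r: "0 < r"
        "\<And>w. norm (w - z0) < r \<Longrightarrow> norm (f w - f z0 - D (w - z0)) \<le> 1 * norm (w - z0)"
      unfolding has_derivative_at_alt by (meson zero_less_one)
    obtain B where B: "\<And>w. norm (D w) \<le> norm w * B" using bounded_linear.bounded[OF bl] by blast
    obtain M where M: "\<And>w. norm (g w) \<le> M" using g unfolding cc_measurable_def bounded_iff by auto
    \<comment> \<open>Within \<open>r\<close> the derivative estimate holds, within 1 the indicator
      is 1; farther out the bound \<open>M\<close> on \<open>g\<close> is absorbed by the slope
      \<open>M / s\<close>.\<close>
    define s where "s = min r 1"
    have s: "0 < s" "s \<le> r" "s \<le> 1" using r by (auto simp: s_def)
    have "norm (g w) \<le> (\<bar>B\<bar> + 1 + \<bar>M\<bar> / s) * norm (w - z0)" for w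
    proof (cases "norm (w - z0) < s")
      case True
      hence "w \<in> ball z0 1" using s by (simp add: dist_norm norm_minus_commute)
      hence "g w = (f w - f z0 - D (w - z0)) + D (w - z0)" by (simp add: g_def u_def)
      also have "norm \<dots> \<le> 1 * norm (w - z0) + norm (w - z0) * B"
        using True s B r by (intro norm_triangle_mono) auto
      also have "\<dots> \<le> 1 * norm (w - z0) + norm (w - z0) * \<bar>B\<bar> + \<bar>M\<bar> / s * norm (w - z0)"
        using s by (intro order.trans[OF _ le_add_same_cancel1[THEN iffD2]] add_left_mono mult_left_mono) auto
      finally show ?thesis by (simp add: algebra_simps)
    next
      case False
      have "norm (g w) \<le> \<bar>M\<bar> / s * s" using M[of w] s by simp
      also have "\<dots> \<le> \<bar>M\<bar> / s * norm (w - z0)" using False s by (intro mult_left_mono) auto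
      also have "\<dots> \<le> (\<bar>B\<bar> + 1 + \<bar>M\<bar> / s) * norm (w - z0)" by (intro mult_right_mono) auto
      finally show ?thesis .
    qed
    thus ?thesis by (rule that)
  qed
  have "cauchy_transform f = (\<lambda>z. cauchy_transform g z + f z0 * cauchy_transform u z)"
  proof
    fix z
    have "cauchy_transform f z = cauchy_transform (\<lambda>w. g w + f z0 * u w) z"
      by (simp add: g_def)
    thus "cauchy_transform f z = cauchy_transform g z + f z0 * cauchy_transform u z"
      by (simp only: cauchy_transform_add[OF g cu] cauchy_transform_cmult)
  qed
  moreover have "has_dbar (\<lambda>z. cauchy_transform g z + f z0 * cauchy_transform u z) (0 + f z0 * 1) z0"
    using cauchy_transform_unit_disc[of z0] unfolding u_def[symmetric]
    by (intro has_dbar_add has_dbar_cmult cauchy_transform_differentiable[OF g L])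
  ultimately show ?thesis by simp
qed


section \<open>Charts\<close>

lemma complex_chartD:
  assumes "complex_chart X c"
  shows "openin X (fst c)" "fst c \<subseteq> topspace X" "inj_on (snd c) (fst c)" "open (snd c ` fst c)"
    and "\<And>V. open V \<Longrightarrow> openin X {x \<in> fst c. snd c x \<in> V}"
    and "\<And>W. openin X W \<Longrightarrow> W \<subseteq> fst c \<Longrightarrow> open (snd c ` W)"
proof -
  show o: "openin X (fst c)" and "open (snd c ` fst c)"
    using assms by (simp_all add: complex_chart_def)
  thus sub: "fst c \<subseteq> topspace X" by (blast dest: openin_subset)
  have h: "homeomorphic_map (subtopology X (fst c)) (top_of_set (snd c ` fst c)) (snd c)"
    using assms by (simp add: complex_chart_def)
  have "inj_on (snd c) (topspace (subtopology X (fst c)))"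
    using h by (blast dest: homeomorphic_imp_injective_map)
  thus "inj_on (snd c) (fst c)" using sub by (simp add: Int_absorb1)
  show "openin X {x \<in> fst c. snd c x \<in> V}" if "open V" for V
  proof -
    have "openin (top_of_set (snd c ` fst c)) (snd c ` fst c \<inter> V)"
      using that by (rule openin_open_Int)
    with homeomorphic_imp_continuous_map[OF h]
    have "openin (subtopology X (fst c))
        {x \<in> topspace (subtopology X (fst c)). snd c x \<in> snd c ` fst c \<inter> V}"
      by (rule openin_continuous_map_preimage)
    moreover have "{x \<in> topspace (subtopology X (fst c)). snd c x \<in> snd c ` fst c \<inter> V} =
        {x \<in> fst c. snd c x \<in> V}" using sub by auto
    ultimately show ?thesis using openin_trans_full[OF _ o] by simp
  qed
  show "open (snd c ` W)" if "openin X W" "W \<subseteq> fst c" for W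
    using open_chart_image[OF assms that(1)] that(2) by (simp add: Int_absorb2)
qed

lemma complex_chartI:
  assumes o: "openin X (fst c)" and inj: "inj_on (snd c) (fst c)"
    and cont: "\<And>V. open V \<Longrightarrow> openin X {x \<in> fst c. snd c x \<in> V}"
    and opn: "\<And>W. openin X W \<Longrightarrow> W \<subseteq> fst c \<Longrightarrow> open (snd c ` W)"
  shows "complex_chart X c"
proof -
  have sub: "fst c \<subseteq> topspace X" using o by (rule openin_subset)
  have "homeomorphic_map (subtopology X (fst c)) (top_of_set (snd c ` fst c)) (snd c)"
  proof (rule bijective_open_imp_homeomorphic_map)
    show "continuous_map (subtopology X (fst c)) (top_of_set (snd c ` fst c)) (snd c)"
      unfolding continuous_map_in_subtopology
    proof
      show "continuous_map (subtopology X (fst c)) euclidean (snd c)"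
        unfolding continuous_map_def
      proof (intro conjI allI impI)
        fix V :: "complex set" assume "openin euclidean V"
        hence "openin X {x \<in> fst c. snd c x \<in> V}" using cont by simp
        hence "openin (subtopology X (fst c)) (fst c \<inter> {x \<in> fst c. snd c x \<in> V})"
          by (rule openin_subtopology_Int2)
        moreover have "fst c \<inter> {x \<in> fst c. snd c x \<in> V} =
          {x \<in> topspace (subtopology X (fst c)). snd c x \<in> V}" using sub by auto
        ultimately show "openin (subtopology X (fst c))
            {x \<in> topspace (subtopology X (fst c)). snd c x \<in> V}" by simp
      qed auto
      show "snd c \<in> topspace (subtopology X (fst c)) \<rightarrow> snd c ` fst c" by auto
    qed
    show "open_map (subtopology X (fst c)) (top_of_set (snd c ` fst c)) (snd c)"
      unfolding open_map_def
    proof (intro allI impI)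
      fix U assume "openin (subtopology X (fst c)) U"
      hence U: "openin X U" "U \<subseteq> fst c" using o by (simp_all add: openin_open_subtopology)
      hence "open (snd c ` U)" by (rule opn)
      thus "openin (top_of_set (snd c ` fst c)) (snd c ` U)" using U by (auto intro: open_subset)
    qed
    show "snd c ` topspace (subtopology X (fst c)) = topspace (top_of_set (snd c ` fst c))"
      using sub by (simp add: Int_absorb1)
    show "inj_on (snd c) (topspace (subtopology X (fst c)))"
      using inj sub by (simp add: Int_absorb1)
  qed
  thus ?thesis using o opn[OF o] by (simp add: complex_chart_def)
qed

lemma compactin_chart_inv:
  assumes "complex_chart X c" "compact K" "K \<subseteq> snd c ` fst c"
  shows "compactin X {x \<in> fst c. snd c x \<in> K}"
  unfolding compactin_def
proof (intro conjI allI impI)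
  show "{x \<in> fst c. snd c x \<in> K} \<subseteq> topspace X" using complex_chartD(2)[OF assms(1)] by auto
  fix \<U> assume U: "Ball \<U> (openin X) \<and> {x \<in> fst c. snd c x \<in> K} \<subseteq> \<Union>\<U>"
  let ?G = "\<lambda>U. snd c ` (U \<inter> fst c)"
  have cov: "K \<subseteq> \<Union> (?G ` \<U>)"
  proof
    fix z assume z: "z \<in> K"
    with assms(3) obtain x where x: "x \<in> fst c" "z = snd c x" by auto
    with z U obtain W where "W \<in> \<U>" "x \<in> W" by blast
    with x show "z \<in> \<Union> (?G ` \<U>)" by auto
  qed
  have opn: "open B" if B: "B \<in> ?G ` \<U>" for B
  proof -
    obtain W where "W \<in> \<U>" "B = ?G W" using B by blast
    with U open_chart_image[OF assms(1), of W] show ?thesis by simp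
  qed
  obtain C' where C': "C' \<subseteq> ?G ` \<U>" "finite C'" "K \<subseteq> \<Union>C'"
    using compactE[OF assms(2) cov opn] by metis
  from finite_subset_image[OF C'(2,1)] obtain F where "F \<subseteq> \<U>" "finite F" "C' = ?G ` F"
    by blast
  with C' have F: "F \<subseteq> \<U>" "finite F" "K \<subseteq> \<Union>(?G ` F)" by simp_all
  have "{x \<in> fst c. snd c x \<in> K} \<subseteq> \<Union>F"
  proof
    fix x assume x: "x \<in> {x \<in> fst c. snd c x \<in> K}"
    then obtain U y where "U \<in> F" "y \<in> U" "y \<in> fst c" "snd c x = snd c y" using F(3) by blast
    moreover from this have "x = y" using x by (intro inj_onD[OF complex_chartD(3)[OF assms(1)]]) auto
    ultimately show "x \<in> \<Union>F" by blast
  qed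
  with F show "\<exists>\<F>. finite \<F> \<and> \<F> \<subseteq> \<U> \<and> {x \<in> fst c. snd c x \<in> K} \<subseteq> \<Union>\<F>" by blast
qed

locale rsurface =
  fixes X :: "'a topology" and A :: "'a chart set"
  assumes riemann: "riemann_surface X A"
begin

definition maximal_atlas :: "'a chart set" where
  "maximal_atlas = {d. complex_chart X d \<and> (\<forall>c\<in>A. \<forall>x\<in>fst c \<inter> fst d.
      transition c d field_differentiable at (snd c x) \<and>
      transition d c field_differentiable at (snd d x))}"

lemma Hausdorff: "Hausdorff_space X"
  using riemann by (simp add: riemann_surface_def)

lemma atlas_chart: "c \<in> A \<Longrightarrow> complex_chart X c"
  using riemann by (simp add: riemann_surface_def)

lemma atlas_covers: "x \<in> topspace X \<Longrightarrow> \<exists>c\<in>A. x \<in> fst c"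
  using riemann unfolding riemann_surface_def by blast

lemma maximal_chart: "d \<in> maximal_atlas \<Longrightarrow> complex_chart X d"
  by (simp add: maximal_atlas_def)

lemmas chartD = complex_chartD[OF maximal_chart]

lemma chart_inv [simp]: "d \<in> maximal_atlas \<Longrightarrow> x \<in> fst d \<Longrightarrow> chart_inv d (snd d x) = x"
  by (rule chart_inv_snd[OF maximal_chart])

lemma chart_inv_image:
  assumes "z \<in> snd d ` fst d"
  shows "chart_inv d z \<in> fst d" "snd d (chart_inv d z) = z"
  using assms by (simp_all add: inv_into_into f_inv_into_f)

lemma atlas_subset: "A \<subseteq> maximal_atlas"
proof
  fix d assume d: "d \<in> A"
  have "transition c e field_differentiable at (snd c x)"
    if "c \<in> A" "e \<in> A" "x \<in> fst c" "x \<in> fst e" for c e x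
  proof (rule holomorphic_on_imp_differentiable_at)
    show "transition c e holomorphic_on snd c ` (fst c \<inter> fst e)"
      using riemann that by (simp add: riemann_surface_def)
    have "openin X (fst e)" using atlas_chart[OF that(2)] by (rule complex_chartD(1))
    thus "open (snd c ` (fst c \<inter> fst e))"
      using open_chart_image[OF atlas_chart[OF that(1)], of "fst e"] by (simp add: Int_commute)
  qed (use that in auto)
  thus "d \<in> maximal_atlas" using d atlas_chart by (auto simp: maximal_atlas_def)
qed

lemma open_chart_overlap:
  assumes "c \<in> maximal_atlas" "d \<in> maximal_atlas"
  shows "open (snd c ` (fst c \<inter> fst d))"
  using open_chart_image[OF maximal_chart[OF assms(1)] chartD(1)[OF assms(2)]]
  by (simp add: Int_commute)

text \<open>Near \<open>x\<close> the transition factors through a chart of \<open>A\<close>, with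
  which both charts are compatible by definition.\<close>

lemma transition_differentiable:
  assumes c: "c \<in> maximal_atlas" and d: "d \<in> maximal_atlas" and x: "x \<in> fst c" "x \<in> fst d"
  shows "transition c d field_differentiable at (snd c x)"
proof -
  have "x \<in> topspace X" using chartD(2)[OF c] x by auto
  then obtain a where a: "a \<in> A" "x \<in> fst a" using atlas_covers by blast
  have aM: "a \<in> maximal_atlas" using a atlas_subset by blast
  have "transition c a field_differentiable at (snd c x)"
    "transition a d field_differentiable at (snd a x)"
    using c d a x by (auto simp: maximal_atlas_def)
  then obtain s t where "(transition c a has_field_derivative s) (at (snd c x))"
    "(transition a d has_field_derivative t) (at (transition c a (snd c x)))"
    unfolding field_differentiable_def using c x by auto
  hence "(transition a d \<circ> transition c a has_field_derivative t * s) (at (snd c x))"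
    by (intro DERIV_chain) auto
  hence "(transition c d has_field_derivative t * s) (at (snd c x))"
  proof (rule has_field_derivative_transform_within_open)
    show "open (snd c ` (fst a \<inter> fst d \<inter> fst c))"
      using open_chart_image[OF maximal_chart[OF c], of "fst a \<inter> fst d"] chartD(1)[OF d] chartD(1)[OF aM]
      by auto
    show "snd c x \<in> snd c ` (fst a \<inter> fst d \<inter> fst c)" using x a by auto
    show "(transition a d \<circ> transition c a) w = transition c d w"
      if "w \<in> snd c ` (fst a \<inter> fst d \<inter> fst c)" for w using that c aM by auto
  qed
  thus ?thesis unfolding field_differentiable_def by blast
qed

definition jac :: "'a chart \<Rightarrow> 'a chart \<Rightarrow> 'a \<Rightarrow> complex" where
  "jac c d x = deriv (transition c d) (snd c x)"

lemma has_derivative_transition: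
  assumes "c \<in> maximal_atlas" "d \<in> maximal_atlas" "x \<in> fst c" "x \<in> fst d"
  shows "(transition c d has_field_derivative jac c d x) (at (snd c x))"
  unfolding jac_def using transition_differentiable[OF assms]
  by (simp add: DERIV_deriv_iff_field_differentiable)

lemma jac_chain:
  assumes c: "c \<in> maximal_atlas" and d: "d \<in> maximal_atlas" and e: "e \<in> maximal_atlas"
    and x: "x \<in> fst c" "x \<in> fst d" "x \<in> fst e"
  shows "jac c e x = jac d e x * jac c d x"
proof -
  have "(transition d e \<circ> transition c d has_field_derivative jac d e x * jac c d x) (at (snd c x))"
    using has_derivative_transition[OF c d] has_derivative_transition[OF d e] x c
    by (intro DERIV_chain) auto
  hence "(transition c e has_field_derivative jac d e x * jac c d x) (at (snd c x))"
  proof (rule has_field_derivative_transform_within_open)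
    show "open (snd c ` (fst d \<inter> fst e \<inter> fst c))"
      using open_chart_image[OF maximal_chart[OF c], of "fst d \<inter> fst e"] chartD(1)[OF d] chartD(1)[OF e]
      by auto
    show "snd c x \<in> snd c ` (fst d \<inter> fst e \<inter> fst c)" using x by auto
    show "(transition d e \<circ> transition c d) w = transition c e w"
      if "w \<in> snd c ` (fst d \<inter> fst e \<inter> fst c)" for w using that c d by auto
  qed
  with has_derivative_transition[OF c e x(1,3)] show ?thesis by (rule DERIV_unique)
qed

lemma jac_self:
  assumes "c \<in> maximal_atlas" "x \<in> fst c"
  shows "jac c c x = 1"
proof -
  have "(transition c c has_field_derivative 1) (at (snd c x))"
    by (rule has_field_derivative_transform_within_open[OF DERIV_ident, of "snd c ` fst c"])
       (use assms chartD(4)[OF assms(1)] in auto)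
  with has_derivative_transition[OF assms(1,1,2,2)] show ?thesis by (rule DERIV_unique)
qed

lemma jac_nonzero:
  assumes "c \<in> maximal_atlas" "d \<in> maximal_atlas" "x \<in> fst c" "x \<in> fst d"
  shows "jac c d x \<noteq> 0"
  using jac_chain[OF assms(1,2,1,3,4,3)] jac_self[OF assms(1,3)] by auto

lemma holomorphic_transition:
  assumes "c \<in> maximal_atlas" "d \<in> maximal_atlas"
  shows "transition c d holomorphic_on snd c ` (fst c \<inter> fst d)"
  using transition_differentiable[OF assms]
  by (auto simp: holomorphic_on_def intro: field_differentiable_at_within)

lemma eventually_chart:
  assumes "c \<in> maximal_atlas" "openin X W" "x \<in> W" "x \<in> fst c"
  shows "eventually (\<lambda>z. z \<in> snd c ` fst c \<and> chart_inv c z \<in> fst c \<and> chart_inv c z \<in> W \<and> snd c (chart_inv c z) = z) (nhds (snd c x))"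
proof -
  have "open (snd c ` (W \<inter> fst c))" by (rule open_chart_image[OF maximal_chart[OF assms(1)] assms(2)])
  moreover have "snd c x \<in> snd c ` (W \<inter> fst c)" using assms by auto
  moreover have "\<forall>z\<in>snd c ` (W \<inter> fst c). z \<in> snd c ` fst c \<and> chart_inv c z \<in> fst c \<and>
      chart_inv c z \<in> W \<and> snd c (chart_inv c z) = z"
    using assms(1) by auto
  ultimately show ?thesis unfolding eventually_nhds by blast
qed

text \<open>By the Hausdorff property a compact piece of a chart is closed in the whole surface;
  therefore functions supported in it can be extended by zero.\<close>

lemma closedin_chart_compact:
  assumes "c \<in> maximal_atlas" "compact K" "K \<subseteq> snd c ` fst c"
  shows "closedin X {x \<in> fst c. snd c x \<in> K}"
  using compactin_chart_inv[OF maximal_chart[OF assms(1)] assms(2,3)] Hausdorff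
  by (rule compactin_imp_closedin[rotated])

lemma affine_chart:
  assumes c: "c \<in> maximal_atlas" and U: "openin X U" "U \<subseteq> fst c" and s: "s \<noteq> 0"
  shows "(U, \<lambda>x. s * (snd c x - a) + b) \<in> maximal_atlas" (is "?d \<in> _")
proof -
  define \<alpha> where "\<alpha> = (\<lambda>z. s * (z - a) + b)"
  define \<alpha>i where "\<alpha>i = (\<lambda>w. (w - b) / s + a)"
  have inv: "\<alpha>i (\<alpha> z) = z" "\<alpha> (\<alpha>i z) = z" for z using s by (simp_all add: \<alpha>_def \<alpha>i_def)
  have ac: "continuous_on UNIV \<alpha>" "continuous_on UNIV \<alpha>i"
    using s by (auto simp: \<alpha>_def \<alpha>i_def intro!: continuous_intros)
  have d: "?d = (U, \<lambda>x. \<alpha> (snd c x))" by (simp add: \<alpha>_def)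
  have cd: "complex_chart X ?d" unfolding d
  proof (rule complex_chartI; simp only: fst_conv snd_conv)
    show "openin X U" by fact
    show "inj_on (\<lambda>x. \<alpha> (snd c x)) U"
    proof (rule inj_onI)
      fix x y assume xy: "x \<in> U" "y \<in> U" "\<alpha> (snd c x) = \<alpha> (snd c y)"
      hence "\<alpha>i (\<alpha> (snd c x)) = \<alpha>i (\<alpha> (snd c y))" by simp
      hence "snd c x = snd c y" by (simp only: inv)
      thus "x = y" using xy U(2) by (intro inj_onD[OF chartD(3)[OF c]]) auto
    qed
    show "openin X {x \<in> U. \<alpha> (snd c x) \<in> V}" if "open V" for V
    proof -
      have "open (\<alpha> -` V)" using ac(1) that by (simp add: open_vimage)
      hence "openin X (U \<inter> {x \<in> fst c. snd c x \<in> \<alpha> -` V})"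
        by (intro openin_Int U(1) chartD(5)[OF c])
      moreover have "U \<inter> {x \<in> fst c. snd c x \<in> \<alpha> -` V} = {x \<in> U. \<alpha> (snd c x) \<in> V}" using U(2) by auto
      ultimately show ?thesis by simp
    qed
    show "open ((\<lambda>x. \<alpha> (snd c x)) ` W)" if "openin X W" "W \<subseteq> U" for W
    proof -
      have "open (\<alpha>i -` (snd c ` W))"
        using ac(2) chartD(6)[OF c that(1)] that(2) U(2) by (intro open_vimage) auto
      moreover have "\<alpha>i -` (snd c ` W) = (\<lambda>x. \<alpha> (snd c x)) ` W"
      proof (intro equalityI subsetI)
        fix w assume "w \<in> \<alpha>i -` (snd c ` W)"
        then obtain x where "x \<in> W" "\<alpha>i w = snd c x" by auto
        moreover from this have "w = \<alpha> (snd c x)" using inv(2)[of w] by simp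
        ultimately show "w \<in> (\<lambda>x. \<alpha> (snd c x)) ` W" by blast
      qed (auto simp: inv)
      ultimately show ?thesis by simp
    qed
  qed
  have "transition e ?d field_differentiable at (snd e x) \<and>
      transition ?d e field_differentiable at (snd ?d x)"
    if e: "e \<in> A" and x: "x \<in> fst e \<inter> fst ?d" for e x
  proof
    have eM: "e \<in> maximal_atlas" using e atlas_subset by blast
    have xs: "x \<in> fst e" "x \<in> fst c" "x \<in> U" using x U by auto
    have "(transition e c has_field_derivative jac e c x) (at (snd e x))"
      by (rule has_derivative_transition[OF eM c xs(1,2)])
    hence "((\<lambda>w. s * (transition e c w - a) + b) has_field_derivative s * jac e c x) (at (snd e x))"
      by (intro DERIV_add[where E = 0, simplified] DERIV_cmult DERIV_diff[where E = 0, simplified] DERIV_const)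
    thus "transition e ?d field_differentiable at (snd e x)"
      unfolding field_differentiable_def comp_def by auto
    have "(transition c e has_field_derivative jac c e x) (at (\<alpha>i (\<alpha> (snd c x))))"
      unfolding inv by (rule has_derivative_transition[OF c eM xs(2,1)])
    moreover have "(\<alpha>i has_field_derivative 1 / s) (at (\<alpha> (snd c x)))"
      unfolding \<alpha>i_def using s by (auto intro!: derivative_eq_intros)
    ultimately have "(transition c e \<circ> \<alpha>i has_field_derivative jac c e x * (1 / s)) (at (\<alpha> (snd c x)))"
      by (rule DERIV_chain)
    hence "(transition ?d e has_field_derivative jac c e x * (1 / s)) (at (\<alpha> (snd c x)))"
    proof (rule has_field_derivative_transform_within_open)
      show "open ((\<lambda>x. \<alpha> (snd c x)) ` U)" using complex_chartD(4)[OF cd] by (simp add: d)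
      show "\<alpha> (snd c x) \<in> (\<lambda>x. \<alpha> (snd c x)) ` U" using xs by auto
      fix w assume "w \<in> (\<lambda>x. \<alpha> (snd c x)) ` U"
      then obtain y where y: "y \<in> U" "w = \<alpha> (snd c y)" by auto
      have "chart_inv ?d w = y" using chart_inv_snd[OF cd, of y] y unfolding d by simp
      thus "(transition c e \<circ> \<alpha>i) w = transition ?d e w"
        using y U c by (auto simp: inv)
    qed
    thus "transition ?d e field_differentiable at (snd ?d x)"
      unfolding field_differentiable_def by (auto simp: \<alpha>_def)
  qed
  with cd show ?thesis unfolding maximal_atlas_def by (intro CollectI conjI ballI) blast+
qed

end


section \<open>Cutoff functions for a row of discs in the plane\<close>

lemma has_dbar_norm_square:
  "has_dbar (\<lambda>w. complex_of_real ((norm (w - a))\<^sup>2)) (z - a) z"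
proof -
  have "has_dbar (\<lambda>w. (w - a) * (cnj w + - cnj a)) (0 * (cnj z + - cnj a) + (z - a) * (1 + 0)) z"
    by (intro has_dbar_mult has_dbar_add has_dbar_cnj has_dbar_const)
       (auto simp: has_dbar_0_iff intro!: derivative_intros)
  moreover have "(\<lambda>w. (w - a) * (cnj w + - cnj a)) = (\<lambda>w. complex_of_real ((norm (w - a))\<^sup>2))"
    by (rule ext) (subst complex_norm_square, simp)
  ultimately show ?thesis by simp
qed

text \<open>The outer function is only real differentiable, so the holomorphic chain rule does not
  apply. But the derivative of the real-valued inner function takes real values, and passing to its
  real part loses nothing.\<close>

lemma has_dbar_real_comp:
  assumes "has_dbar (\<lambda>w. complex_of_real (q w)) b z" "(h has_real_derivative h') (at (q z))"
  shows "has_dbar (\<lambda>w. complex_of_real (h (q w))) (of_real h' * b) z"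
proof -
  obtain a where D: "((\<lambda>w. complex_of_real (q w)) has_derivative (\<lambda>k. a * k + b * cnj k)) (at z)"
    using assms(1) unfolding has_dbar_def by blast
  have "((\<lambda>w. Re (complex_of_real (q w))) has_derivative (\<lambda>k. Re (a * k + b * cnj k))) (at z)"
    by (rule bounded_linear.has_derivative[OF bounded_linear_Re D])
  hence "(q has_derivative (\<lambda>k. Re (a * k + b * cnj k))) (at z)" by simp
  from has_derivative_compose[OF this assms(2)[unfolded has_field_derivative_def]]
  have "((\<lambda>w. h (q w)) has_derivative (\<lambda>k. h' * Re (a * k + b * cnj k))) (at z)" .
  hence "((\<lambda>w. complex_of_real (h (q w))) has_derivative (\<lambda>k. complex_of_real (h' * Re (a * k + b * cnj k)))) (at z)"
    by (rule bounded_linear.has_derivative[OF bounded_linear_of_real])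
  moreover have re: "complex_of_real (Re (a * k + b * cnj k)) = a * k + b * cnj k" for k
  proof -
    have "((\<lambda>w. Im (complex_of_real (q w))) has_derivative (\<lambda>k. Im (a * k + b * cnj k))) (at z)"
      by (rule bounded_linear.has_derivative[OF bounded_linear_Im D])
    moreover have "((\<lambda>w. Im (complex_of_real (q w))) has_derivative (\<lambda>k. 0)) (at z)" by simp
    ultimately have "(\<lambda>k. Im (a * k + b * cnj k)) = (\<lambda>k. 0)" by (rule has_derivative_unique)
    from fun_cong[OF this, of k] show ?thesis by (simp add: complex_eq_iff)
  qed
  moreover have "(\<lambda>k. complex_of_real (h' * Re (a * k + b * cnj k))) =
      (\<lambda>k. (of_real h' * a) * k + (of_real h' * b) * cnj k)"
    by (rule ext) (simp only: of_real_mult re ring_distribs mult.assoc)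
  ultimately have "((\<lambda>w. complex_of_real (h (q w))) has_derivative
      (\<lambda>k. (of_real h' * a) * k + (of_real h' * b) * cnj k)) (at z)"
    by (simp only:)
  thus ?thesis unfolding has_dbar_def by blast
qed

lemma DERIV_max_power:
  "((\<lambda>t::real. (max 0 t) ^ Suc (Suc k)) has_real_derivative real (Suc (Suc k)) * (max 0 t) ^ Suc k) (at t)"
proof -
  consider "t < 0" | "t > 0" | "t = 0" by linarith
  thus ?thesis
  proof cases
    case 1
    show ?thesis
      by (rule has_field_derivative_transform_within_open[of "\<lambda>_. 0" _ _ "{..<0}"])
         (use 1 in auto)
  next
    case 2
    have "((\<lambda>t::real. t ^ Suc (Suc k)) has_real_derivative real (Suc (Suc k)) * t ^ Suc k) (at t)"
      using DERIV_pow[of "Suc (Suc k)" t] by simp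
    hence "((\<lambda>t::real. (max 0 t) ^ Suc (Suc k)) has_real_derivative real (Suc (Suc k)) * t ^ Suc k) (at t)"
      by (rule has_field_derivative_transform_within_open[of _ _ _ "{0<..}"]) (use 2 in auto)
    thus ?thesis using 2 by simp
  next
    case 3
    have "((\<lambda>h::real. (max 0 h) ^ Suc (Suc k) / h) \<longlongrightarrow> 0) (at 0)"
    proof (rule Lim_null_comparison)
      show "\<forall>\<^sub>F h::real in at 0. norm ((max 0 h) ^ Suc (Suc k) / h) \<le> \<bar>h\<bar> ^ Suc k"
      proof (rule always_eventually, rule allI)
        fix h :: real
        show "norm ((max 0 h) ^ Suc (Suc k) / h) \<le> \<bar>h\<bar> ^ Suc k"
        proof (cases "0 < h")
          case False
          hence "(max 0 h) ^ Suc (Suc k) / h = 0" by simp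
          moreover have "0 \<le> \<bar>h\<bar> ^ Suc k" by (rule zero_le_power) simp
          ultimately show ?thesis by (simp only: norm_zero)
        qed simp
      qed
      show "((\<lambda>h::real. \<bar>h\<bar> ^ Suc k) \<longlongrightarrow> 0) (at 0)"
        by (rule tendsto_eq_intros refl | simp)+
    qed
    thus ?thesis using 3 by (simp add: has_field_derivative_iff)
  qed
qed

text \<open>To be applied to squared radii, hence 9/4 and 4 for the radii 3/2 and 2. With
  \<open>p\<close> the positive part of a cube, \<open>h = p (1 - p s)\<close> where
  \<open>s\<close> rescales the interval from 9/4 to 4 to the unit interval; cubes leave room for
  the second derivative.\<close>

lemma real_cutoff_exists:
  obtains h h' h'' :: "real \<Rightarrow> real" where
    "\<And>t. t \<le> 9/4 \<Longrightarrow> h t = 1" "\<And>t. 4 \<le> t \<Longrightarrow> h t = 0"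
    "\<And>t. t \<le> 9/4 \<Longrightarrow> h' t = 0" "\<And>t. 4 \<le> t \<Longrightarrow> h' t = 0"
    "\<And>t. (h has_real_derivative h' t) (at t)" "\<And>t. (h' has_real_derivative h'' t) (at t)"
proof -
  define s where "s = (\<lambda>t::real. (t - 9/4) / (7/4))"
  have ds: "(s has_real_derivative 4/7) (at t)" for t
    unfolding s_def by (auto intro!: derivative_eq_intros)
  define p where "p = (\<lambda>k t. (max 0 t :: real) ^ k)"
  have dp3: "(p 3 has_real_derivative 3 * p 2 t) (at t)" for t
    using DERIV_max_power[of 1 t] by (simp add: p_def numeral_3_eq_3 numeral_2_eq_2)
  have dp2: "(p 2 has_real_derivative 2 * p 1 t) (at t)" for t
    using DERIV_max_power[of 0 t] by (simp add: p_def numeral_2_eq_2)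
  define u where "u = (\<lambda>t. 1 - p 3 (s t))"
  have du: "(u has_real_derivative - (3 * p 2 (s t) * (4/7))) (at t)" for t
    unfolding u_def using DERIV_diff[OF DERIV_const DERIV_chain2[OF dp3 ds]] by simp
  define h where "h = (\<lambda>t. p 3 (u t))"
  define h' where "h' = (\<lambda>t. (3 * p 2 (u t)) * - (3 * p 2 (s t) * (4/7)))"
  have dh: "(h has_real_derivative h' t) (at t)" for t
    unfolding h_def h'_def by (rule DERIV_chain2[OF dp3 du])
  have "\<exists>D. (h' has_real_derivative D) (at t)" for t
  proof -
    have 1: "((\<lambda>t. p 2 (u t)) has_real_derivative 2 * p 1 (u t) * - (3 * p 2 (s t) * (4/7))) (at t)"
      by (rule DERIV_chain2[OF dp2 du])
    have 2: "((\<lambda>t. p 2 (s t)) has_real_derivative 2 * p 1 (s t) * (4/7)) (at t)"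
      by (rule DERIV_chain2[OF dp2 ds])
    show ?thesis unfolding h'_def
      by (rule exI, rule DERIV_mult[OF DERIV_cmult[OF 1] DERIV_minus[OF DERIV_cmult_right[OF DERIV_cmult[OF 2]]]])
  qed
  then obtain h'' where "\<And>t. (h' has_real_derivative h'' t) (at t)" by metis
  moreover have "h t = 1" "h' t = 0" if "t \<le> 9/4" for t
    using that by (simp_all add: h_def h'_def u_def s_def p_def max_def)
  moreover have "h t = 0" "h' t = 0" if "4 \<le> t" for t
  proof -
    have "1 \<le> s t" using that by (simp add: s_def)
    hence "1 \<le> p 3 (s t)" by (simp add: p_def one_le_power)
    thus "h t = 0" "h' t = 0" by (simp_all add: h_def h'_def u_def p_def max_def)
  qed
  ultimately show ?thesis using that[of h h' h''] dh by blast
qed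

text \<open>All coordinate discs of radius 3 are laid out disjointly in a single plane. A family of
  functions on the discs is then one function of a plane variable.\<close>

definition ctr :: "nat \<Rightarrow> complex" where "ctr i = of_nat (10 * i)"

lemma ctr_dist: "i \<noteq> j \<Longrightarrow> 10 \<le> norm (ctr i - ctr j)"
proof -
  assume "i \<noteq> j"
  have "ctr i - ctr j = of_int (10 * (int i - int j))" by (simp add: ctr_def)
  hence "norm (ctr i - ctr j) = \<bar>of_int (10 * (int i - int j))\<bar>" by (simp only: norm_of_int)
  moreover have "10 \<le> \<bar>10 * (int i - int j)\<bar>" using \<open>i \<noteq> j\<close> by auto
  ultimately show ?thesis by linarith
qed

lemma ctr_far:
  assumes "i \<noteq> j" "norm (w - ctr i) \<le> r" shows "10 - r \<le> norm (w - ctr j)"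
  using ctr_dist[OF assms(1)] norm_triangle_ineq[of "ctr i - w" "w - ctr j"] assms(2)
  by (simp add: norm_minus_commute)

lemma plane_cutoff_exists:
  obtains \<Psi> \<Psi>' :: "complex \<Rightarrow> complex" where
    "\<And>i w. i < n \<Longrightarrow> norm (w - ctr i) \<le> 3/2 \<Longrightarrow> \<Psi> w = 1"
    "\<And>w. (\<And>i. i < n \<Longrightarrow> 2 \<le> norm (w - ctr i)) \<Longrightarrow> \<Psi> w = 0"
    "\<And>w. \<Psi>' w \<noteq> 0 \<Longrightarrow> \<exists>i<n. 3/2 < norm (w - ctr i) \<and> norm (w - ctr i) < 2"
    "\<And>w. has_dbar \<Psi> (\<Psi>' w) w" "\<And>w. \<Psi>' differentiable (at w)"
proof -
  obtain h h' h'' :: "real \<Rightarrow> real" where h: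
    "\<And>t. t \<le> 9/4 \<Longrightarrow> h t = 1" "\<And>t. 4 \<le> t \<Longrightarrow> h t = 0"
    "\<And>t. t \<le> 9/4 \<Longrightarrow> h' t = 0" "\<And>t. 4 \<le> t \<Longrightarrow> h' t = 0"
    "\<And>t. (h has_real_derivative h' t) (at t)" "\<And>t. (h' has_real_derivative h'' t) (at t)"
    using real_cutoff_exists by metis
  define q where "q = (\<lambda>i w. (norm (w - ctr i))\<^sup>2)"
  define \<Psi> where "\<Psi> = (\<lambda>w. \<Sum>i<n. complex_of_real (h (q i w)))"
  define \<Psi>' where "\<Psi>' = (\<lambda>w. \<Sum>i<n. complex_of_real (h' (q i w)) * (w - ctr i))"
  have q4: "4 \<le> q i w" if "2 \<le> norm (w - ctr i)" for i w
    using power_mono[OF that, of 2] by (simp add: q_def)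
  have q2: "q i w \<le> 9/4" if "norm (w - ctr i) \<le> 3/2" for i w
    using power_mono[OF that, of 2] by (simp add: q_def power2_eq_square)
  show ?thesis
  proof (rule that[of \<Psi> \<Psi>'])
    fix i w assume i: "i < n" "norm (w - ctr i) \<le> 3/2"
    have "h (q j w) = (if j = i then 1 else 0)" for j
      using ctr_far[of i j w "3/2"] i h(1)[OF q2[OF i(2)]] h(2)[OF q4[of w j]] by auto
    hence "\<Psi> w = (\<Sum>j<n. if j = i then 1 else 0)"
      unfolding \<Psi>_def by (intro sum.cong refl) simp
    thus "\<Psi> w = 1" using i by simp
  next
    fix w assume "\<And>i. i < n \<Longrightarrow> 2 \<le> norm (w - ctr i)"
    thus "\<Psi> w = 0" using h(2)[OF q4] by (simp add: \<Psi>_def)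
  next
    fix w assume "\<Psi>' w \<noteq> 0"
    then obtain i where "i < n" "h' (q i w) \<noteq> 0"
      unfolding \<Psi>'_def by (metis (no_types, lifting) lessThan_iff mult_zero_left of_real_0 sum.neutral)
    thus "\<exists>i<n. 3/2 < norm (w - ctr i) \<and> norm (w - ctr i) < 2"
      using h(3)[OF q2] h(4)[OF q4] by (meson not_le)
  next
    fix w
    show "has_dbar \<Psi> (\<Psi>' w) w" unfolding \<Psi>_def \<Psi>'_def q_def
      by (intro has_dbar_sum has_dbar_real_comp has_dbar_norm_square h)
    have "has_dbar (\<lambda>w. complex_of_real (h' (q i w)) * (w - ctr i))
       (complex_of_real (h'' (q i w)) * (w - ctr i) * (w - ctr i) + complex_of_real (h' (q i w)) * 0) w" for i
      unfolding q_def
      by (intro has_dbar_mult has_dbar_real_comp has_dbar_norm_square h)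
         (auto simp: has_dbar_0_iff intro!: derivative_intros)
    from has_dbar_sum[of "{..<n}", OF this]
    show "\<Psi>' differentiable (at w)" unfolding \<Psi>'_def by (rule has_dbar_imp_differentiable)
  qed
qed

lemma plane_bump_exists:
  obtains \<rho> :: "complex \<Rightarrow> real" where
    "\<And>w. 0 \<le> \<rho> w" "\<And>i w. i < n \<Longrightarrow> norm (w - ctr i) < 1 \<Longrightarrow> 0 < \<rho> w"
    "\<And>w. (\<And>i. i < n \<Longrightarrow> 1 \<le> norm (w - ctr i)) \<Longrightarrow> \<rho> w = 0"
    "\<And>w. (\<lambda>w. complex_of_real (\<rho> w)) differentiable (at w)"
proof
  define r where "r = (\<lambda>i w. (max 0 (1 - (norm (w - ctr i))\<^sup>2)) ^ Suc (Suc 0))"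
  define \<rho> where "\<rho> = (\<lambda>w. \<Sum>i<n. r i w)"
  have r0: "0 \<le> r i w" for i w by (simp add: r_def)
  show "0 \<le> \<rho> w" for w unfolding \<rho>_def by (intro sum_nonneg r0)
  show "0 < \<rho> w" if i: "i < n" "norm (w - ctr i) < 1" for i w
  proof -
    have "(norm (w - ctr i))\<^sup>2 < 1" using i(2) by (simp add: abs_square_less_1)
    hence "0 < r i w" by (simp add: r_def)
    also have "r i w \<le> \<rho> w" unfolding \<rho>_def using i r0 by (intro member_le_sum) auto
    finally show ?thesis .
  qed
  show "\<rho> w = 0" if "\<And>i. i < n \<Longrightarrow> 1 \<le> norm (w - ctr i)" for w
    unfolding \<rho>_def
  proof (intro sum.neutral ballI)
    fix i assume "i \<in> {..<n}"
    hence "1 \<le> (norm (w - ctr i))\<^sup>2" using that by (intro one_le_power) auto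
    thus "r i w = 0" by (simp add: r_def)
  qed
  show "(\<lambda>w. complex_of_real (\<rho> w)) differentiable (at w)" for w
  proof -
    have "has_dbar (\<lambda>w. complex_of_real (1 - (norm (w - ctr i))\<^sup>2)) (0 - (w - ctr i)) w" for i
      using has_dbar_diff[OF has_dbar_const has_dbar_norm_square[of "ctr i" w]]
      by (simp add: of_real_diff)
    from has_dbar_sum[of "{..<n}", OF has_dbar_real_comp[OF this DERIV_max_power[of 0]]]
    show ?thesis unfolding \<rho>_def r_def of_real_sum by (rule has_dbar_imp_differentiable)
  qed
qed


section \<open>The Cauchy-Riemann operator on a compact Riemann surface\<close>

lemma norm_affine: "0 < k \<Longrightarrow> norm (of_real k * z + c - c) = k * norm z" for z c :: complex
  by (simp add: norm_mult)

text \<open>Compactness is applied to the concentric thirds of discs in charts; scaling by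
  \<open>3 / r\<close> turns a disc of radius \<open>r\<close> into one of radius 3 and its third
  into a unit disc.\<close>

lemma (in rsurface) disc_cover_exists:
  assumes "compact_space X"
  shows "\<exists>n d. (\<forall>i<n. d i \<in> maximal_atlas \<and> snd (d i) ` fst (d i) = ball (ctr i) 3) \<and>
    (\<forall>x\<in>topspace X. \<exists>i<n. x \<in> fst (d i) \<and> snd (d i) x \<in> ball (ctr i) 1)"
proof -
  have "\<exists>c r. c \<in> A \<and> x \<in> fst c \<and> 0 < r \<and> ball (snd c x) r \<subseteq> snd c ` fst c" if xX: "x \<in> topspace X" for x
  proof -
    obtain c where c: "c \<in> A" "x \<in> fst c" using atlas_covers[OF xX] by blast
    have "open (snd c ` fst c)" "snd c x \<in> snd c ` fst c"
      using complex_chartD(4)[OF atlas_chart[OF c(1)]] c(2) by auto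
    then obtain r where "0 < r" "ball (snd c x) r \<subseteq> snd c ` fst c" by (rule openE)
    with c show ?thesis by blast
  qed
  then obtain c r where c: "\<And>x. x \<in> topspace X \<Longrightarrow> c x \<in> A \<and> x \<in> fst (c x) \<and> 0 < r x \<and>
      ball (snd (c x) x) (r x) \<subseteq> snd (c x) ` fst (c x)" by metis
  define N where "N = (\<lambda>x. {y \<in> fst (c x). snd (c x) y \<in> ball (snd (c x) x) (r x / 3)})"
  have cM: "c x \<in> maximal_atlas" if "x \<in> topspace X" for x using c[OF that] atlas_subset by blast
  have "openin X (N x)" if "x \<in> topspace X" for x
    unfolding N_def by (rule chartD(5)[OF cM[OF that]]) simp
  moreover have "x \<in> N x" if "x \<in> topspace X" for x using c[OF that] by (simp add: N_def)
  ultimately obtain F where F: "finite F" "F \<subseteq> topspace X" "topspace X \<subseteq> (\<Union>x\<in>F. N x)"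
  proof -
    assume o: "\<And>x. x \<in> topspace X \<Longrightarrow> openin X (N x)" and i: "\<And>x. x \<in> topspace X \<Longrightarrow> x \<in> N x"
    have *: "\<forall>\<U>. Ball \<U> (openin X) \<and> topspace X \<subseteq> \<Union>\<U> \<longrightarrow> (\<exists>\<F>. finite \<F> \<and> \<F> \<subseteq> \<U> \<and> topspace X \<subseteq> \<Union>\<F>)"
      using assms unfolding compact_space_def compactin_def by blast
    have "Ball (N ` topspace X) (openin X) \<and> topspace X \<subseteq> \<Union>(N ` topspace X)" using o i by blast
    with * obtain G where G: "finite G" "G \<subseteq> N ` topspace X" "topspace X \<subseteq> \<Union>G" by meson
    from finite_subset_image[OF G(1,2)] obtain F where "F \<subseteq> topspace X" "finite F" "G = N ` F" by blast
    with G(3) show ?thesis using that by blast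
  qed
  obtain e where e: "bij_betw e {..<card F} F"
    using ex_bij_betw_nat_finite[OF F(1)] by (auto simp: atLeast0LessThan)
  define d where "d = (\<lambda>i. ({y \<in> fst (c (e i)). snd (c (e i)) y \<in> ball (snd (c (e i)) (e i)) (r (e i))},
      \<lambda>y. of_real (3 / r (e i)) * (snd (c (e i)) y - snd (c (e i)) (e i)) + ctr i))"
  have ei: "e i \<in> topspace X" if "i < card F" for i
    using e F(2) that by (auto simp: bij_betw_def)
  show ?thesis
  proof (rule exI[of _ "card F"], rule exI[of _ d], intro conjI allI impI ballI)
    fix i assume i: "i < card F"
    note ci = c[OF ei[OF i]]
    have "openin X {y \<in> fst (c (e i)). snd (c (e i)) y \<in> ball (snd (c (e i)) (e i)) (r (e i))}"
      by (rule chartD(5)[OF cM[OF ei[OF i]] open_ball])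
    thus "d i \<in> maximal_atlas" unfolding d_def
      by (rule affine_chart[OF cM[OF ei[OF i]]]) (use ci in auto)
    show "snd (d i) ` fst (d i) = ball (ctr i) 3"
    proof (intro equalityI subsetI)
      fix w assume "w \<in> snd (d i) ` fst (d i)"
      then obtain y where y: "norm (snd (c (e i)) y - snd (c (e i)) (e i)) < r (e i)"
        "w = of_real (3 / r (e i)) * (snd (c (e i)) y - snd (c (e i)) (e i)) + ctr i"
        by (auto simp: d_def dist_norm norm_minus_commute)
      have "norm (w - ctr i) = 3 / r (e i) * norm (snd (c (e i)) y - snd (c (e i)) (e i))"
        unfolding y(2) by (rule norm_affine) (use ci in simp)
      also have "\<dots> < 3 / r (e i) * r (e i)" using y(1) ci by (intro mult_strict_left_mono) auto
      finally show "w \<in> ball (ctr i) 3" using ci by (simp add: dist_norm norm_minus_commute)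
    next
      fix w assume w: "w \<in> ball (ctr i) 3"
      define z where "z = of_real (r (e i) / 3) * (w - ctr i) + snd (c (e i)) (e i)"
      have "norm (z - snd (c (e i)) (e i)) = r (e i) / 3 * norm (w - ctr i)"
        unfolding z_def by (rule norm_affine) (use ci in simp)
      also have "\<dots> < r (e i) / 3 * 3"
        using w ci by (intro mult_strict_left_mono) (auto simp: dist_norm norm_minus_commute)
      finally have z: "z \<in> ball (snd (c (e i)) (e i)) (r (e i))" by (simp add: dist_norm norm_minus_commute)
      then obtain y where y: "y \<in> fst (c (e i))" "z = snd (c (e i)) y" using ci by blast
      have "w = of_real (3 / r (e i)) * (z - snd (c (e i)) (e i)) + ctr i"
        using ci by (simp add: z_def field_simps)
      hence "w = snd (d i) y" by (simp add: d_def y)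
      moreover have "y \<in> fst (d i)" using y z by (simp add: d_def)
      ultimately show "w \<in> snd (d i) ` fst (d i)" by blast
    qed
  next
    fix x assume "x \<in> topspace X"
    then obtain p where p: "p \<in> F" "x \<in> N p" using F by blast
    hence "p \<in> e ` {..<card F}" using e by (simp add: bij_betw_def)
    then obtain i where i: "i < card F" "e i = p" by auto
    note ci = c[OF ei[OF i(1)]]
    have x: "x \<in> fst (c (e i))" "norm (snd (c (e i)) x - snd (c (e i)) (e i)) < r (e i) / 3"
      using p i by (auto simp: N_def dist_norm norm_minus_commute)
    have "norm (snd (d i) x - ctr i) = 3 / r (e i) * norm (snd (c (e i)) x - snd (c (e i)) (e i))"
      unfolding d_def snd_conv by (rule norm_affine) (use ci in simp)
    also have "\<dots> < 3 / r (e i) * (r (e i) / 3)" using x ci by (intro mult_strict_left_mono) auto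
    finally have "snd (d i) x \<in> ball (ctr i) 1" using ci by (simp add: dist_norm norm_minus_commute)
    moreover have "x \<in> fst (d i)" using x ci by (simp add: d_def dist_norm norm_minus_commute)
    ultimately show "\<exists>i<card F. x \<in> fst (d i) \<and> snd (d i) x \<in> ball (ctr i) 1" using i(1) by blast
  qed
qed

locale disc_cover = rsurface X A for X :: "'a topology" and A +
  fixes n :: nat and d :: "nat \<Rightarrow> 'a chart"
  assumes disc_chart: "\<And>i. i < n \<Longrightarrow> d i \<in> maximal_atlas"
    and disc_image: "\<And>i. i < n \<Longrightarrow> snd (d i) ` fst (d i) = ball (ctr i) 3"
    and disc_covers: "\<And>x. x \<in> topspace X \<Longrightarrow> \<exists>i<n. x \<in> fst (d i) \<and> snd (d i) x \<in> ball (ctr i) 1"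
begin

lemma disc_range: "i < n \<Longrightarrow> x \<in> fst (d i) \<Longrightarrow> norm (snd (d i) x - ctr i) < 3"
proof -
  assume "i < n" "x \<in> fst (d i)"
  hence "snd (d i) x \<in> ball (ctr i) 3" using disc_image by blast
  thus ?thesis by (simp add: dist_norm norm_minus_commute)
qed

lemma disc_inv:
  assumes "i < n" "norm (w - ctr i) < 3"
  shows "chart_inv (d i) w \<in> fst (d i)" "snd (d i) (chart_inv (d i) w) = w"
proof -
  have "w \<in> snd (d i) ` fst (d i)"
    using assms by (simp add: disc_image dist_norm norm_minus_commute)
  thus "chart_inv (d i) w \<in> fst (d i)" "snd (d i) (chart_inv (d i) w) = w"
    by (rule chart_inv_image)+
qed

(* push v is the sum of v over the coordinates of a point in the discs; a function b with compact
   support in the discs likewise stands for the sum of the forms b dz-bar, whose coefficient at x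
   in the chart c is form b c x. *)
definition push :: "(complex \<Rightarrow> complex) \<Rightarrow> 'a \<Rightarrow> complex" where
  "push v x = (\<Sum>i<n. if x \<in> fst (d i) then v (snd (d i) x) else 0)"

definition form :: "(complex \<Rightarrow> complex) \<Rightarrow> 'a chart \<Rightarrow> 'a \<Rightarrow> complex" where
  "form b c x = (\<Sum>i<n. if x \<in> fst (d i) then b (snd (d i) x) * cnj (jac c (d i) x) else 0)"

text \<open>Exactness in the sense of Dolbeault: one global \<open>g\<close> solves the
  inhomogeneous Cauchy-Riemann equation in every compatible chart.\<close>

definition exact :: "(complex \<Rightarrow> complex) \<Rightarrow> bool" where
  "exact b \<longleftrightarrow> (\<exists>g. \<forall>c\<in>maximal_atlas. \<forall>x\<in>fst c. has_dbar (g \<circ> chart_inv c) (form b c x) (snd c x))"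

lemma form_add: "form (\<lambda>w. b w + b' w) c x = form b c x + form b' c x"
  unfolding form_def sum.distrib[symmetric] by (rule sum.cong) (auto simp: ring_distribs)

lemma form_cmult: "form (\<lambda>w. k * b w) c x = k * form b c x"
  unfolding form_def sum_distrib_left by (rule sum.cong) (auto simp: mult.assoc)

lemma form_transition:
  assumes "c \<in> maximal_atlas" "e \<in> maximal_atlas" "x \<in> fst c" "x \<in> fst e"
  shows "form b c x = form b e x * cnj (jac c e x)"
  unfolding form_def sum_distrib_right
proof (rule sum.cong[OF refl])
  fix i assume "i \<in> {..<n}"
  hence "d i \<in> maximal_atlas" using disc_chart by simp
  from jac_chain[OF assms(1,2) this assms(3,4)]
  show "(if x \<in> fst (d i) then b (snd (d i) x) * cnj (jac c (d i) x) else 0) =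
      (if x \<in> fst (d i) then b (snd (d i) x) * cnj (jac e (d i) x) else 0) * cnj (jac c e x)" by simp
qed

lemma exact_add: "exact b \<Longrightarrow> exact b' \<Longrightarrow> exact (\<lambda>w. b w + b' w)"
proof -
  assume "exact b" "exact b'"
  then obtain g g' where
    "\<forall>c\<in>maximal_atlas. \<forall>x\<in>fst c. has_dbar (g \<circ> chart_inv c) (form b c x) (snd c x)"
    "\<forall>c\<in>maximal_atlas. \<forall>x\<in>fst c. has_dbar (g' \<circ> chart_inv c) (form b' c x) (snd c x)"
    unfolding exact_def by blast
  hence "\<forall>c\<in>maximal_atlas. \<forall>x\<in>fst c.
      has_dbar ((\<lambda>x. g x + g' x) \<circ> chart_inv c) (form (\<lambda>w. b w + b' w) c x) (snd c x)"
    unfolding form_add comp_def by (intro ballI has_dbar_add) auto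
  thus ?thesis unfolding exact_def by blast
qed

lemma exact_cmult: "exact b \<Longrightarrow> exact (\<lambda>w. k * b w)"
proof -
  assume "exact b"
  then obtain g where
    "\<forall>c\<in>maximal_atlas. \<forall>x\<in>fst c. has_dbar (g \<circ> chart_inv c) (form b c x) (snd c x)"
    unfolding exact_def by blast
  hence "\<forall>c\<in>maximal_atlas. \<forall>x\<in>fst c.
      has_dbar ((\<lambda>x. k * g x) \<circ> chart_inv c) (form (\<lambda>w. k * b w) c x) (snd c x)"
    unfolding form_cmult comp_def by (intro ballI has_dbar_cmult) auto
  thus ?thesis unfolding exact_def by blast
qed

lemma exact_form_cong:
  assumes "exact b" "\<And>c x. c \<in> maximal_atlas \<Longrightarrow> x \<in> fst c \<Longrightarrow> form b c x = form b' c x"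
  shows "exact b'"
  using assms unfolding exact_def by auto

lemma exact_0: "exact (\<lambda>_. 0)"
  unfolding exact_def form_def by (auto intro!: exI[of _ "\<lambda>_. 0"] simp: comp_def cong: if_cong)

text \<open>Inside a disc this is the chain rule for its chart. At a point outside, the summand of
  that disc is locally zero: \<open>v\<close> lives within radius 2, and the corresponding compact
  set is closed in the surface.\<close>

lemma push_has_dbar:
  assumes c: "c \<in> maximal_atlas" and x: "x \<in> fst c"
    and supp: "\<And>w. (\<And>i. i < n \<Longrightarrow> 2 < norm (w - ctr i)) \<Longrightarrow> v w = 0"
    and v: "\<And>i. i < n \<Longrightarrow> x \<in> fst (d i) \<Longrightarrow> has_dbar v (v' (snd (d i) x)) (snd (d i) x)"
  shows "has_dbar (push v \<circ> chart_inv c) (form v' c x) (snd c x)"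
  unfolding push_def form_def comp_def
proof (rule has_dbar_sum)
  fix i assume "i \<in> {..<n}"
  hence i: "i < n" and di: "d i \<in> maximal_atlas" using disc_chart by auto
  show "has_dbar (\<lambda>z. if chart_inv c z \<in> fst (d i) then v (snd (d i) (chart_inv c z)) else 0)
      (if x \<in> fst (d i) then v' (snd (d i) x) * cnj (jac c (d i) x) else 0) (snd c x)"
  proof (cases "x \<in> fst (d i)")
    case True
    have "has_dbar (\<lambda>z. v (transition c (d i) z)) (v' (snd (d i) x) * cnj (jac c (d i) x)) (snd c x)"
      by (rule has_dbar_comp_holomorphic[OF _ has_derivative_transition[OF c di x True]])
         (use v[OF i True] c x in simp)
    hence "has_dbar (\<lambda>z. if chart_inv c z \<in> fst (d i) then v (snd (d i) (chart_inv c z)) else 0)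
        (v' (snd (d i) x) * cnj (jac c (d i) x)) (snd c x)"
      by (rule has_dbar_eventually)
         (use eventually_chart[OF c chartD(1)[OF di] True x] in \<open>auto elim: eventually_mono\<close>)
    thus ?thesis using True by simp
  next
    case False
    define K where "K = {y \<in> fst (d i). snd (d i) y \<in> cball (ctr i) 2}"
    have "closedin X K" unfolding K_def
      by (rule closedin_chart_compact[OF di]) (auto simp: disc_image[OF i])
    hence "openin X (topspace X - K)" by blast
    moreover have "x \<in> topspace X - K" using False chartD(2)[OF c] x by (auto simp: K_def)
    ultimately have ev: "eventually (\<lambda>z. chart_inv c z \<in> topspace X - K) (nhds (snd c x))"
      by (intro eventually_mono[OF eventually_chart[OF c _ _ x]]) auto
    have "has_dbar (\<lambda>z. if chart_inv c z \<in> fst (d i) then v (snd (d i) (chart_inv c z)) else 0) 0 (snd c x)"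
    proof (rule has_dbar_eventually[OF has_dbar_const], rule eventually_mono[OF ev])
      fix z assume z: "chart_inv c z \<in> topspace X - K"
      show "0 = (if chart_inv c z \<in> fst (d i) then v (snd (d i) (chart_inv c z)) else 0)"
      proof (cases "chart_inv c z \<in> fst (d i)")
        case True
        let ?w = "snd (d i) (chart_inv c z)"
        have 1: "2 < norm (?w - ctr i)" using True z by (auto simp: K_def dist_norm norm_minus_commute)
        have 2: "norm (?w - ctr i) \<le> 3" using disc_range[OF i True] by simp
        have "2 < norm (?w - ctr j)" for j using ctr_far[of i j ?w 3] 1 2 by (cases "j = i") auto
        thus ?thesis using supp by simp
      qed simp
    qed
    thus ?thesis using False by simp
  qed
qed

lemma exact_dbar:
  assumes "\<And>w. (\<And>i. i < n \<Longrightarrow> 2 < norm (w - ctr i)) \<Longrightarrow> v w = 0"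
    and "\<And>w i. i < n \<Longrightarrow> norm (w - ctr i) < 3 \<Longrightarrow> has_dbar v (v' w) w"
  shows "exact v'"
  unfolding exact_def
proof (rule exI[of _ "push v"], intro ballI)
  fix c x assume "c \<in> maximal_atlas" "x \<in> fst c"
  thus "has_dbar (push v \<circ> chart_inv c) (form v' c x) (snd c x)"
    by (rule push_has_dbar[OF _ _ assms(1)]) (use assms(2) disc_range in auto)
qed

end


text \<open>The radii: the unit discs cover the surface and carry the bump \<rho> and all sources;
  \<Psi> is 1 up to 3/2 and 0 from 2 on; the charts reach to 3, so that closed discs of radius 2 are
  compact in them.\<close>

locale cutoff_cover = disc_cover X A n d for X :: "'a topology" and A n d +
  fixes \<rho> :: "complex \<Rightarrow> real" and \<Psi> \<Psi>' :: "complex \<Rightarrow> complex"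
  assumes bump_nonneg: "\<And>w. 0 \<le> \<rho> w"
    and bump_pos: "\<And>i w. i < n \<Longrightarrow> norm (w - ctr i) < 1 \<Longrightarrow> 0 < \<rho> w"
    and bump_zero: "\<And>w. (\<And>i. i < n \<Longrightarrow> 1 \<le> norm (w - ctr i)) \<Longrightarrow> \<rho> w = 0"
    and bump_diff: "\<And>w. (\<lambda>w. complex_of_real (\<rho> w)) differentiable (at w)"
    and cut_one: "\<And>i w. i < n \<Longrightarrow> norm (w - ctr i) \<le> 3/2 \<Longrightarrow> \<Psi> w = 1"
    and cut_zero: "\<And>w. (\<And>i. i < n \<Longrightarrow> 2 \<le> norm (w - ctr i)) \<Longrightarrow> \<Psi> w = 0"
    and cut'_support: "\<And>w. \<Psi>' w \<noteq> 0 \<Longrightarrow> \<exists>i<n. 3/2 < norm (w - ctr i) \<and> norm (w - ctr i) < 2"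
    and cut_dbar: "\<And>w. has_dbar \<Psi> (\<Psi>' w) w"
    and cut'_diff: "\<And>w. \<Psi>' differentiable (at w)"
begin

section \<open>The partition of unity and the operator \<open>Q\<close>\<close>

definition weight :: "'a \<Rightarrow> real" where
  "weight x = (\<Sum>i<n. if x \<in> fst (d i) then \<rho> (snd (d i) x) else 0)"

lemma weight_push: "complex_of_real (weight x) = push (\<lambda>w. complex_of_real (\<rho> w)) x"
  unfolding weight_def push_def by (simp add: if_distrib cong: if_cong)

lemma bump_le_weight: "i < n \<Longrightarrow> x \<in> fst (d i) \<Longrightarrow> \<rho> (snd (d i) x) \<le> weight x"
proof -
  assume i: "i < n" "x \<in> fst (d i)"
  have "(if x \<in> fst (d i) then \<rho> (snd (d i) x) else 0) \<le> weight x"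
    unfolding weight_def by (rule member_le_sum) (use i bump_nonneg in auto)
  thus ?thesis using i by simp
qed

lemma weight_pos: "x \<in> topspace X \<Longrightarrow> 0 < weight x"
proof -
  assume "x \<in> topspace X"
  then obtain i where i: "i < n" "x \<in> fst (d i)" "snd (d i) x \<in> ball (ctr i) 1"
    using disc_covers by blast
  hence "0 < \<rho> (snd (d i) x)" by (intro bump_pos[of i]) (auto simp: dist_norm norm_minus_commute)
  with bump_le_weight[OF i(1,2)] show ?thesis by linarith
qed

lemma disc_topspace: "i < n \<Longrightarrow> x \<in> fst (d i) \<Longrightarrow> x \<in> topspace X"
  using chartD(2)[OF disc_chart] by blast

text \<open>The passage from the surface to the plane, opposite to \<open>push\<close>. The discs of
  radius 3 are disjoint, so at most one summand is active at \<open>w\<close>.\<close>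

definition planar :: "(nat \<Rightarrow> 'a \<Rightarrow> complex) \<Rightarrow> complex \<Rightarrow> complex" where
  "planar s w = (\<Sum>i<n. if norm (w - ctr i) < 3 then s i (chart_inv (d i) w) else 0)"

lemma planar_disc:
  assumes "i < n" "norm (w - ctr i) < 3"
  shows "planar s w = s i (chart_inv (d i) w)"
proof -
  have "\<not> norm (w - ctr j) < 3" if "j \<noteq> i" for j using ctr_far[of i j w 3] assms that by auto
  hence "planar s w = (\<Sum>j<n. if j = i then s i (chart_inv (d i) w) else 0)"
    unfolding planar_def using assms by (intro sum.cong) auto
  thus ?thesis using assms by simp
qed

lemma planar_apply: "i < n \<Longrightarrow> x \<in> fst (d i) \<Longrightarrow> planar s (snd (d i) x) = s i x"
  by (subst planar_disc[of i]) (auto simp: disc_range disc_chart)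

definition pou :: "complex \<Rightarrow> complex" where
  "pou w = planar (\<lambda>_ x. of_real (\<rho> w) / of_real (weight x)) w"

lemma pou_apply: "i < n \<Longrightarrow> x \<in> fst (d i) \<Longrightarrow> pou (snd (d i) x) = of_real (\<rho> (snd (d i) x)) / of_real (weight x)"
  unfolding pou_def by (rule planar_apply)

lemma pou_partition:
  assumes "x \<in> topspace X"
  shows "(\<Sum>i<n. if x \<in> fst (d i) then pou (snd (d i) x) else 0) = 1"
proof -
  have "(\<Sum>i<n. if x \<in> fst (d i) then pou (snd (d i) x) else 0) =
      (\<Sum>i<n. complex_of_real (if x \<in> fst (d i) then \<rho> (snd (d i) x) else 0) / of_real (weight x))"
    by (rule sum.cong) (auto simp: pou_apply)
  also have "\<dots> = of_real (weight x) / of_real (weight x)"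
    by (simp only: sum_divide_distrib[symmetric] of_real_sum[symmetric] weight_def[symmetric])
  finally show ?thesis using weight_pos[OF assms] by simp
qed

lemma pou_zero: "(\<And>i. i < n \<Longrightarrow> 1 \<le> norm (w - ctr i)) \<Longrightarrow> pou w = 0"
proof -
  assume "\<And>i. i < n \<Longrightarrow> 1 \<le> norm (w - ctr i)"
  hence "\<rho> w = 0" by (rule bump_zero)
  thus ?thesis unfolding pou_def planar_def by (intro sum.neutral) simp
qed

lemma pou_norm: "norm (pou w) \<le> 1"
proof (cases "\<exists>i<n. norm (w - ctr i) < 1")
  case True
  then obtain i where i: "i < n" "norm (w - ctr i) < 1" by blast
  hence x: "chart_inv (d i) w \<in> fst (d i)" "snd (d i) (chart_inv (d i) w) = w"
    using disc_inv[of i w] by auto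
  have "norm (pou w) = \<rho> w / weight (chart_inv (d i) w)"
    using pou_apply[OF i(1) x(1)] bump_nonneg[of w] weight_pos[OF disc_topspace[OF i(1) x(1)]]
    by (simp add: x(2) norm_divide)
  also have "\<dots> \<le> 1"
    using bump_le_weight[OF i(1) x(1)] weight_pos[OF disc_topspace[OF i(1) x(1)]]
    by (simp add: x(2))
  finally show ?thesis .
next
  case False
  hence "pou w = 0" by (intro pou_zero) (meson not_less)
  thus ?thesis by simp
qed

lemma not_in_any_disc:
  assumes "\<not> (\<exists>i<n. norm (w - ctr i) < 3)"
  obtains S where "open S" "w \<in> S" "\<And>u i. u \<in> S \<Longrightarrow> i < n \<Longrightarrow> 2 < norm (u - ctr i)"
proof (rule that[of "\<Inter>i\<in>{..<n}. - cball (ctr i) 2"])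
  show "open (\<Inter>i\<in>{..<n}. - cball (ctr i) 2)" by (intro open_INT) auto
  show "w \<in> (\<Inter>i\<in>{..<n}. - cball (ctr i) 2)"
    using assms by (auto simp: dist_norm norm_minus_commute)
  show "2 < norm (u - ctr i)" if "u \<in> (\<Inter>i\<in>{..<n}. - cball (ctr i) 2)" "i < n" for u i
  proof -
    have "u \<in> - cball (ctr i) 2" using that by blast
    thus ?thesis by (simp add: dist_norm norm_minus_commute)
  qed
qed

lemma planar_differentiable:
  assumes "i < n" "norm (w - ctr i) < 3" "(s i \<circ> chart_inv (d i)) differentiable (at w)"
  shows "planar s differentiable (at w)"
proof -
  obtain b where "has_dbar (s i \<circ> chart_inv (d i)) b w" using assms(3) differentiable_iff_has_dbar by blast
  hence "has_dbar (planar s) b w"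
    by (rule has_dbar_transform_open[of _ _ _ "ball (ctr i) 3"])
       (use assms planar_disc[OF assms(1)] in \<open>auto simp: dist_norm norm_minus_commute\<close>)
  thus ?thesis using differentiable_iff_has_dbar by blast
qed

lemma push_differentiable:
  assumes c: "c \<in> maximal_atlas" "x \<in> fst c"
    and "\<And>w. (\<And>i. i < n \<Longrightarrow> 2 < norm (w - ctr i)) \<Longrightarrow> v w = 0"
    and "\<And>i. i < n \<Longrightarrow> x \<in> fst (d i) \<Longrightarrow> v differentiable (at (snd (d i) x))"
  shows "(push v \<circ> chart_inv c) differentiable (at (snd c x))"
proof -
  have "\<forall>w. \<exists>b. v differentiable (at w) \<longrightarrow> has_dbar v b w" using differentiable_iff_has_dbar by blast
  then obtain v' where v': "\<And>w. v differentiable (at w) \<Longrightarrow> has_dbar v (v' w) w" by metis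
  have "has_dbar (push v \<circ> chart_inv c) (form v' c x) (snd c x)"
    by (rule push_has_dbar[OF c assms(3)]) (auto intro: v' assms(4))
  thus ?thesis by (rule has_dbar_imp_differentiable)
qed

lemma pou_differentiable: "pou differentiable (at w)"
proof (cases "\<exists>i<n. norm (w - ctr i) < 3")
  case True
  then obtain i where i: "i < n" "norm (w - ctr i) < 3" by blast
  define x where "x = chart_inv (d i) w"
  have x: "x \<in> fst (d i)" "snd (d i) x = w" using disc_inv[OF i] by (auto simp: x_def)
  have "(push (\<lambda>w. complex_of_real (\<rho> w)) \<circ> chart_inv (d i)) differentiable (at (snd (d i) x))"
    by (rule push_differentiable[OF disc_chart[OF i(1)] x(1)])
       (use bump_zero bump_diff in \<open>auto simp: less_imp_le order_less_trans[of 1 2]\<close>)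
  moreover have "push (\<lambda>w. complex_of_real (\<rho> w)) \<circ> chart_inv (d i) = (\<lambda>u. of_real (weight (chart_inv (d i) u)))"
    by (auto simp: weight_push)
  ultimately have "(\<lambda>u. of_real (weight (chart_inv (d i) u)) :: complex) differentiable (at w)"
    by (simp add: x)
  hence "(\<lambda>u. of_real (\<rho> u) / of_real (weight (chart_inv (d i) u)) :: complex) differentiable (at w)"
    using bump_diff[of w] weight_pos[OF disc_topspace[OF i(1) x(1)]]
    by (intro differentiable_divide) (auto simp: x_def)
  then obtain b where "has_dbar (\<lambda>u. of_real (\<rho> u) / of_real (weight (chart_inv (d i) u))) b w"
    using differentiable_iff_has_dbar by blast
  hence "has_dbar pou b w"
    by (rule has_dbar_transform_open[of _ _ _ "ball (ctr i) 3"])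
       (use i in \<open>auto simp: dist_norm norm_minus_commute pou_def planar_disc[OF i(1)]\<close>)
  thus ?thesis by (rule has_dbar_imp_differentiable)
next
  case False
  then obtain S where S: "open S" "w \<in> S" "\<And>u i. u \<in> S \<Longrightarrow> i < n \<Longrightarrow> 2 < norm (u - ctr i)"
    by (rule not_in_any_disc) blast
  have "has_dbar pou 0 w"
    by (rule has_dbar_transform_open[OF has_dbar_const S(1,2)])
       (rule pou_zero[symmetric], use S(3) in fastforce)
  thus ?thesis by (rule has_dbar_imp_differentiable)
qed

text \<open>The error \<open>\<Psi>' u * q u\<close> of the parametrix lives on the annuli.
  \<open>Q q\<close> takes the coefficient of its form in each disc and multiplies it by the
  partition of unity: the same form on the surface, now represented by a function supported in the
  unit discs, to which the Cauchy transform can be applied again.\<close>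

definition Q :: "(complex \<Rightarrow> complex) \<Rightarrow> complex \<Rightarrow> complex" where
  "Q q w = pou w * planar (\<lambda>i. form (\<lambda>u. \<Psi>' u * q u) (d i)) w"

lemma Q_add: "Q (\<lambda>w. q w + q' w) w = Q q w + Q q' w"
proof -
  have "planar (\<lambda>i. form (\<lambda>u. \<Psi>' u * (q u + q' u)) (d i)) w =
      planar (\<lambda>i. form (\<lambda>u. \<Psi>' u * q u) (d i)) w + planar (\<lambda>i. form (\<lambda>u. \<Psi>' u * q' u) (d i)) w"
    unfolding planar_def ring_distribs form_add sum.distrib[symmetric] by (rule sum.cong) auto
  thus ?thesis by (simp add: Q_def ring_distribs)
qed

lemma Q_cmult: "Q (\<lambda>w. k * q w) w = k * Q q w"
proof -
  have "planar (\<lambda>i. form (\<lambda>u. \<Psi>' u * (k * q u)) (d i)) w =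
      k * planar (\<lambda>i. form (\<lambda>u. \<Psi>' u * q u) (d i)) w"
    unfolding planar_def mult.left_commute[of _ k] form_cmult sum_distrib_left by (rule sum.cong) auto
  thus ?thesis by (simp add: Q_def)
qed

lemma Q_sum: "finite I \<Longrightarrow> Q (\<lambda>w. \<Sum>k\<in>I. q k w) w = (\<Sum>k\<in>I. Q (q k) w)"
proof (induction I rule: finite_induct)
  case empty
  show ?case using Q_cmult[of 0 "\<lambda>_. 0" w] by simp
qed (simp add: Q_add)

lemma Q_cong:
  assumes "\<And>u i. i < n \<Longrightarrow> 3/2 < norm (u - ctr i) \<Longrightarrow> norm (u - ctr i) < 2 \<Longrightarrow> q u = q' u"
  shows "Q q w = Q q' w"
proof -
  have "\<Psi>' u * q u = \<Psi>' u * q' u" for u using cut'_support[of u] assms by fastforce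
  hence "(\<lambda>u. \<Psi>' u * q u) = (\<lambda>u. \<Psi>' u * q' u)" by (rule ext)
  thus ?thesis unfolding Q_def by (simp only:)
qed

lemma Q_zero: "(\<And>i. i < n \<Longrightarrow> 1 \<le> norm (w - ctr i)) \<Longrightarrow> Q q w = 0"
  by (simp add: Q_def pou_zero)

text \<open>The coefficients of a form in two charts differ by the factor
  \<open>cnj (jac c (d i) x)\<close> that \<open>form\<close> supplies, so what remains is the sum
  of the partition of unity at \<open>x\<close>.\<close>

lemma form_Q:
  assumes c: "c \<in> maximal_atlas" "x \<in> fst c"
  shows "form (Q q) c x = form (\<lambda>u. \<Psi>' u * q u) c x"
proof -
  have "form (Q q) c x = (\<Sum>i<n. (if x \<in> fst (d i) then pou (snd (d i) x) else 0) * form (\<lambda>u. \<Psi>' u * q u) c x)"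
    unfolding form_def[of "Q q"]
  proof (rule sum.cong[OF refl])
    fix i assume "i \<in> {..<n}"
    hence i: "i < n" by simp
    show "(if x \<in> fst (d i) then Q q (snd (d i) x) * cnj (jac c (d i) x) else 0) =
        (if x \<in> fst (d i) then pou (snd (d i) x) else 0) * form (\<lambda>u. \<Psi>' u * q u) c x"
      using form_transition[OF c(1) disc_chart[OF i] c(2)] by (simp add: Q_def planar_apply[OF i])
  qed
  also have "\<dots> = form (\<lambda>u. \<Psi>' u * q u) c x"
    unfolding sum_distrib_right[symmetric] using pou_partition chartD(2)[OF c(1)] c(2) by auto
  finally show ?thesis .
qed

lemma exact_Q_iff: "exact (Q q) \<longleftrightarrow> exact (\<lambda>u. \<Psi>' u * q u)"
proof
  assume "exact (Q q)"
  thus "exact (\<lambda>u. \<Psi>' u * q u)" by (rule exact_form_cong) (rule form_Q)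
next
  assume "exact (\<lambda>u. \<Psi>' u * q u)"
  thus "exact (Q q)" by (rule exact_form_cong) (rule form_Q[symmetric])
qed

end


section \<open>Regularity and sup norm bounds for \<open>Q\<close>\<close>

context cutoff_cover
begin

lemma eventually_outside_disc:
  assumes c: "c \<in> maximal_atlas" and x: "x \<in> fst c" and i: "i < n" "x \<notin> fst (d i)"
  shows "eventually (\<lambda>z. chart_inv c z \<in> fst (d i) \<longrightarrow> (\<forall>j. 2 < norm (snd (d i) (chart_inv c z) - ctr j)))
      (nhds (snd c x))"
proof -
  define K where "K = {y \<in> fst (d i). snd (d i) y \<in> cball (ctr i) 2}"
  have "closedin X K" unfolding K_def
    by (rule closedin_chart_compact[OF disc_chart[OF i(1)]]) (auto simp: disc_image[OF i(1)])
  hence "openin X (topspace X - K)" by blast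
  moreover have "x \<in> topspace X - K" using i chartD(2)[OF c] x by (auto simp: K_def)
  ultimately have "eventually (\<lambda>z. chart_inv c z \<in> topspace X - K) (nhds (snd c x))"
    by (intro eventually_mono[OF eventually_chart[OF c _ _ x]]) auto
  thus ?thesis
  proof eventually_elim
    case (elim z)
    show ?case
    proof (intro impI allI)
      fix j assume *: "chart_inv c z \<in> fst (d i)"
      let ?w = "snd (d i) (chart_inv c z)"
      have 1: "2 < norm (?w - ctr i)" using elim * by (auto simp: K_def dist_norm norm_minus_commute)
      have 2: "norm (?w - ctr i) \<le> 3" using disc_range[OF i(1) *] by simp
      show "2 < norm (?w - ctr j)" using ctr_far[of i j ?w 3] 1 2 by (cases "j = i") auto
    qed
  qed
qed

lemma differentiable_sum_planar:
  assumes "finite I" "\<And>i. i \<in> I \<Longrightarrow> f i differentiable (at (w::complex))"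
  shows "(\<lambda>u. \<Sum>i\<in>I. f i u :: complex) differentiable (at w)"
  using assms by (induction I rule: finite_induct) auto

lemma form_differentiable:
  assumes c: "c \<in> maximal_atlas" and x: "x \<in> fst c"
    and supp: "\<And>w. (\<And>i. i < n \<Longrightarrow> 2 < norm (w - ctr i)) \<Longrightarrow> b w = 0"
    and b: "\<And>i. i < n \<Longrightarrow> x \<in> fst (d i) \<Longrightarrow> b differentiable (at (snd (d i) x))"
  shows "(form b c \<circ> chart_inv c) differentiable (at (snd c x))"
  unfolding form_def comp_def
proof (rule differentiable_sum_planar)
  fix i assume "i \<in> {..<n}"
  hence i: "i < n" and di: "d i \<in> maximal_atlas" using disc_chart by auto
  let ?f = "\<lambda>z. if chart_inv c z \<in> fst (d i) then b (snd (d i) (chart_inv c z)) *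
      cnj (jac c (d i) (chart_inv c z)) else 0"
  show "?f differentiable (at (snd c x))"
  proof (cases "x \<in> fst (d i)")
    case True
    let ?t = "transition c (d i)"
    obtain b' where "has_dbar b b' (?t (snd c x))" using b[OF i True] differentiable_iff_has_dbar c x by auto
    hence 1: "has_dbar (\<lambda>z. b (?t z)) (b' * cnj (jac c (d i) x)) (snd c x)"
      by (rule has_dbar_comp_holomorphic[OF _ has_derivative_transition[OF c di x True]])
    have op: "open (snd c ` (fst c \<inter> fst (d i)))" by (rule open_chart_overlap[OF c di])
    have "deriv ?t holomorphic_on snd c ` (fst c \<inter> fst (d i))"
      by (rule holomorphic_deriv[OF holomorphic_transition[OF c di] op])
    hence "deriv ?t field_differentiable at (snd c x)"
      by (rule holomorphic_on_imp_differentiable_at[OF _ op]) (use x True in auto)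
    then obtain D where "(deriv ?t has_field_derivative D) (at (snd c x))"
      unfolding field_differentiable_def by blast
    hence "has_dbar (\<lambda>z. cnj (deriv ?t z)) (1 * cnj D) (snd c x)"
      by (rule has_dbar_comp_holomorphic[OF has_dbar_cnj])
    from has_dbar_mult[OF 1 this]
    obtain e where e: "has_dbar (\<lambda>z. b (?t z) * cnj (deriv ?t z)) e (snd c x)" by blast
    have "has_dbar ?f e (snd c x)"
      by (rule has_dbar_eventually[OF e])
         (use eventually_chart[OF c chartD(1)[OF di] True x] in \<open>auto elim!: eventually_mono simp: jac_def\<close>)
    thus ?thesis by (rule has_dbar_imp_differentiable)
  next
    case False
    have "has_dbar ?f 0 (snd c x)"
      by (rule has_dbar_eventually[OF has_dbar_const],
          rule eventually_mono[OF eventually_outside_disc[OF c x i False]])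
         (use supp in auto)
    thus ?thesis by (rule has_dbar_imp_differentiable)
  qed
qed simp

text \<open>\<open>\<Psi>'\<close> vanishes up to radius 3/2, so singularities of \<open>q\<close>
  in the closed unit discs do no harm. Cauchy kernels and logarithms are later inserted for
  \<open>q\<close>.\<close>

lemma Q_differentiable:
  assumes q: "\<And>u i. i < n \<Longrightarrow> 1 < norm (u - ctr i) \<Longrightarrow> norm (u - ctr i) < 3 \<Longrightarrow> q differentiable (at u)"
  shows "Q q differentiable (at w)"
proof (cases "\<exists>i<n. norm (w - ctr i) < 3")
  case True
  then obtain j where j: "j < n" "norm (w - ctr j) < 3" by blast
  define x where "x = chart_inv (d j) w"
  have x: "x \<in> fst (d j)" "snd (d j) x = w" using disc_inv[OF j] by (auto simp: x_def)
  let ?b = "\<lambda>u. \<Psi>' u * q u"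
  have b: "?b differentiable (at u)" if "i < n" "norm (u - ctr i) < 3" for i u
  proof (cases "1 < norm (u - ctr i)")
    case True
    thus ?thesis by (intro differentiable_mult cut'_diff q[OF that(1) True that(2)])
  next
    case False
    have z: "0 = ?b v" if v: "v \<in> ball (ctr i) (3/2)" for v
    proof -
      have iv: "norm (v - ctr i) < 3/2" using v by (simp add: dist_norm norm_minus_commute)
      have "\<Psi>' v = 0"
      proof (rule ccontr)
        assume "\<Psi>' v \<noteq> 0"
        then obtain k where k: "k < n" "3/2 < norm (v - ctr k)" "norm (v - ctr k) < 2"
          using cut'_support by blast
        thus False using iv ctr_far[of i k v "3/2"] by (cases "k = i") auto
      qed
      thus ?thesis by simp
    qed
    have "has_dbar ?b 0 u"
      by (rule has_dbar_transform_open[OF has_dbar_const open_ball[of "ctr i" "3/2"] _ z])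
         (use False in \<open>auto simp: dist_norm norm_minus_commute\<close>)
    thus ?thesis by (rule has_dbar_imp_differentiable)
  qed
  have "(form ?b (d j) \<circ> chart_inv (d j)) differentiable (at (snd (d j) x))"
  proof (rule form_differentiable[OF disc_chart[OF j(1)] x(1)])
    show "?b u = 0" if "\<And>i. i < n \<Longrightarrow> 2 < norm (u - ctr i)" for u
      using cut'_support[of u] that by force
    show "?b differentiable (at (snd (d i) x))" if "i < n" "x \<in> fst (d i)" for i
      by (rule b[OF that(1) disc_range[OF that]])
  qed
  hence "planar (\<lambda>i. form ?b (d i)) differentiable (at w)"
    unfolding x by (rule planar_differentiable[OF j])
  thus ?thesis unfolding Q_def by (intro differentiable_mult pou_differentiable) simp
next
  case False
  then obtain S where S: "open S" "w \<in> S" "\<And>u i. u \<in> S \<Longrightarrow> i < n \<Longrightarrow> 2 < norm (u - ctr i)"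
    by (rule not_in_any_disc) blast
  have "has_dbar (Q q) 0 w"
    by (rule has_dbar_transform_open[OF has_dbar_const S(1,2)])
       (rule Q_zero[symmetric], use S(3) in fastforce)
  thus ?thesis by (rule has_dbar_imp_differentiable)
qed

lemma compact_discs: "compact {w. \<exists>i<n. norm (w - ctr i) \<le> r}"
proof -
  have "{w. \<exists>i<n. norm (w - ctr i) \<le> r} = (\<Union>i\<in>{..<n}. cball (ctr i) r)"
    by (auto simp: dist_norm norm_minus_commute)
  thus ?thesis by (simp add: compact_UN)
qed

lemma chart_continuous_map:
  assumes "c \<in> maximal_atlas"
  shows "continuous_map (subtopology X (fst c)) euclidean (snd c)"
proof -
  have "homeomorphic_map (subtopology X (fst c)) (top_of_set (snd c ` fst c)) (snd c)"
    using maximal_chart[OF assms] by (simp add: complex_chart_def)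
  from homeomorphic_imp_continuous_map[OF this] show ?thesis
    by (simp add: continuous_map_in_subtopology)
qed

text \<open>The points whose coordinates lie in the two closed discs form a compact set inside the
  overlap of the charts, on which the derivative of the transition is continuous.\<close>

lemma jac_bounded:
  assumes i: "i < n" and j: "j < n"
  shows "\<exists>C. \<forall>x \<in> fst (d i) \<inter> fst (d j). norm (snd (d j) x - ctr j) \<le> 1 \<longrightarrow>
    norm (snd (d i) x - ctr i) \<le> 2 \<longrightarrow> norm (jac (d j) (d i) x) \<le> C"
proof -
  define Ki where "Ki = {x \<in> fst (d i). snd (d i) x \<in> cball (ctr i) 2}"
  define Kj where "Kj = {x \<in> fst (d j). snd (d j) x \<in> cball (ctr j) 1}"
  note dM = disc_chart[OF i] disc_chart[OF j]
  have "compactin X Kj" unfolding Kj_def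
    by (rule compactin_chart_inv[OF maximal_chart[OF dM(2)]]) (auto simp: disc_image[OF j])
  moreover have "closedin X Ki" unfolding Ki_def
    by (rule closedin_chart_compact[OF dM(1)]) (auto simp: disc_image[OF i])
  ultimately have "compactin X (Ki \<inter> Kj)" by (simp add: closed_Int_compactin)
  hence "compactin (subtopology X (fst (d j))) (Ki \<inter> Kj)"
    by (auto simp: compactin_subtopology Kj_def)
  from image_compactin[OF this chart_continuous_map[OF dM(2)]]
  have cpt: "compact (snd (d j) ` (Ki \<inter> Kj))" by simp
  have sub: "snd (d j) ` (Ki \<inter> Kj) \<subseteq> snd (d j) ` (fst (d j) \<inter> fst (d i))"
    by (auto simp: Ki_def Kj_def)
  have "deriv (transition (d j) (d i)) holomorphic_on snd (d j) ` (fst (d j) \<inter> fst (d i))"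
    by (rule holomorphic_deriv[OF holomorphic_transition[OF dM(2,1)] open_chart_overlap[OF dM(2,1)]])
  hence "continuous_on (snd (d j) ` (Ki \<inter> Kj)) (deriv (transition (d j) (d i)))"
    using sub by (blast intro: holomorphic_on_imp_continuous_on holomorphic_on_subset)
  from compact_imp_bounded[OF compact_continuous_image[OF this cpt]]
  obtain C where C: "\<And>z. z \<in> snd (d j) ` (Ki \<inter> Kj) \<Longrightarrow> norm (deriv (transition (d j) (d i)) z) \<le> C"
    unfolding bounded_iff by auto
  show ?thesis
    by (rule exI[of _ C]) (auto simp: jac_def Ki_def Kj_def dist_norm norm_minus_commute intro!: C)
qed

lemma cut'_bounded: "\<exists>C. \<forall>w. norm (\<Psi>' w) \<le> C"
proof -
  let ?K = "{w. \<exists>i<n. norm (w - ctr i) \<le> 2}"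
  have "continuous_on ?K \<Psi>'"
    using cut'_diff differentiable_imp_continuous_within by (intro continuous_at_imp_continuous_on) blast
  from compact_imp_bounded[OF compact_continuous_image[OF this compact_discs]]
  obtain C where C: "\<And>w. w \<in> ?K \<Longrightarrow> norm (\<Psi>' w) \<le> C" unfolding bounded_iff by auto
  have "norm (\<Psi>' w) \<le> max C 0" for w
  proof (cases "\<Psi>' w = 0")
    case False
    from cut'_support[OF this] have "w \<in> ?K" by force
    thus ?thesis using C by fastforce
  qed simp
  thus ?thesis by blast
qed

text \<open>Only the values of \<open>q\<close> on the annuli enter, and at a point of a unit disc
  only the finitely many transition derivatives bounded in \<open>jac_bounded\<close>.\<close>

lemma Q_bound:
  obtains C where "0 < C"
    "\<And>q B w. 0 \<le> B \<Longrightarrow> (\<And>u i. i < n \<Longrightarrow> 3/2 < norm (u - ctr i) \<Longrightarrow> norm (u - ctr i) < 2 \<Longrightarrow> norm (q u) \<le> B) \<Longrightarrow>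
      norm (Q q w) \<le> C * B"
proof -
  obtain P where P: "\<And>w. norm (\<Psi>' w) \<le> P" using cut'_bounded by blast
  have P0: "0 \<le> P" using order.trans[OF norm_ge_zero P] .
  have "\<forall>i j. \<exists>C. i < n \<and> j < n \<longrightarrow> (\<forall>x \<in> fst (d i) \<inter> fst (d j). norm (snd (d j) x - ctr j) \<le> 1 \<longrightarrow>
    norm (snd (d i) x - ctr i) \<le> 2 \<longrightarrow> norm (jac (d j) (d i) x) \<le> C)"
    using jac_bounded by metis
  then obtain J where J: "\<And>i j x. i < n \<Longrightarrow> j < n \<Longrightarrow> x \<in> fst (d i) \<Longrightarrow> x \<in> fst (d j) \<Longrightarrow>
     norm (snd (d j) x - ctr j) \<le> 1 \<Longrightarrow> norm (snd (d i) x - ctr i) \<le> 2 \<Longrightarrow> norm (jac (d j) (d i) x) \<le> J i j"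
    by (metis IntI)
  define C where "C = (\<Sum>j<n. \<Sum>i<n. P * \<bar>J i j\<bar>) + 1"
  have nn: "0 \<le> (\<Sum>i<n. P * \<bar>J i j\<bar>)" for j using P0 by (intro sum_nonneg) auto
  have "0 \<le> (\<Sum>j<n. \<Sum>i<n. P * \<bar>J i j\<bar>)" by (rule sum_nonneg) (rule nn)
  hence C0: "0 < C" by (simp add: C_def)
  show ?thesis
  proof (rule that[OF C0])
    fix q :: "complex \<Rightarrow> complex" and B :: real and w
    assume B: "0 \<le> B" and
      q: "\<And>u i. i < n \<Longrightarrow> 3/2 < norm (u - ctr i) \<Longrightarrow> norm (u - ctr i) < 2 \<Longrightarrow> norm (q u) \<le> B"
    show "norm (Q q w) \<le> C * B"
    proof (cases "\<exists>j<n. norm (w - ctr j) < 1")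
      case False
      hence "Q q w = 0" by (intro Q_zero) (meson not_less)
      thus ?thesis using C0 B by simp
    next
      case True
      then obtain j where j: "j < n" "norm (w - ctr j) < 1" by blast
      define x where "x = chart_inv (d j) w"
      have j3: "norm (w - ctr j) < 3" using j by simp
      have x: "x \<in> fst (d j)" "snd (d j) x = w" using disc_inv[OF j(1) j3] by (auto simp: x_def)
      have "norm (Q q w) \<le> 1 * norm (planar (\<lambda>i. form (\<lambda>u. \<Psi>' u * q u) (d i)) w)"
        unfolding Q_def norm_mult by (intro mult_right_mono pou_norm) auto
      also have "planar (\<lambda>i. form (\<lambda>u. \<Psi>' u * q u) (d i)) w = form (\<lambda>u. \<Psi>' u * q u) (d j) x"
        by (simp add: planar_disc[OF j(1) j3] x_def)
      also have "norm \<dots> \<le> (\<Sum>i<n. P * \<bar>J i j\<bar> * B)"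
        unfolding form_def
      proof (rule sum_norm_le)
        fix i assume "i \<in> {..<n}"
        hence i: "i < n" by simp
        have *: "0 \<le> P * \<bar>J i j\<bar> * B" using P0 B by simp
        show "norm (if x \<in> fst (d i) then \<Psi>' (snd (d i) x) * q (snd (d i) x) * cnj (jac (d j) (d i) x) else 0)
            \<le> P * \<bar>J i j\<bar> * B"
        proof (cases "x \<in> fst (d i) \<and> \<Psi>' (snd (d i) x) \<noteq> 0")
          case False
          thus ?thesis using * by auto
        next
          case True
          let ?u = "snd (d i) x"
          obtain k where k: "k < n" "3/2 < norm (?u - ctr k)" "norm (?u - ctr k) < 2"
            using cut'_support True by blast
          have "k = i" using ctr_far[of i k ?u 3] disc_range[OF i, of x] True k by force
          hence "norm (jac (d j) (d i) x) \<le> J i j"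
            using J[OF i j(1), of x] True x j k by auto
          moreover have "norm (q ?u) \<le> B" using q[OF k] .
          ultimately have "norm (\<Psi>' ?u) * norm (q ?u) * norm (jac (d j) (d i) x) \<le> P * B * \<bar>J i j\<bar>"
            using P P0 B by (intro mult_mono) auto
          thus ?thesis using True by (simp add: norm_mult mult_ac)
        qed
      qed
      also have "\<dots> = (\<Sum>i<n. P * \<bar>J i j\<bar>) * B" by (simp add: sum_distrib_right)
      also have "\<dots> \<le> C * B"
      proof (rule mult_right_mono[OF _ B])
        have "(\<Sum>i<n. P * \<bar>J i j\<bar>) \<le> (\<Sum>j<n. \<Sum>i<n. P * \<bar>J i j\<bar>)"
          using j nn by (intro member_le_sum) auto
        thus "(\<Sum>i<n. P * \<bar>J i j\<bar>) \<le> C" by (simp add: C_def)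
      qed
      finally show ?thesis by simp
    qed
  qed
qed

end


section \<open>Separation by linear functionals, and the Neumann equation\<close>

lemma separating_functional_aux:
  fixes V :: "(nat \<Rightarrow> complex) set"
  assumes "\<And>c c'. c \<in> V \<Longrightarrow> c' \<in> V \<Longrightarrow> (\<lambda>k. c k + c' k) \<in> V"
    and "\<And>t c. c \<in> V \<Longrightarrow> (\<lambda>k. t * c k) \<in> V" and "(\<lambda>_. 0) \<in> V" and "v \<notin> V"
  shows "\<exists>W. V \<subseteq> W \<and> (\<forall>c c'. c \<in> W \<longrightarrow> c' \<in> W \<longrightarrow> (\<lambda>k. c k + c' k) \<in> W) \<and>
    (\<forall>t c. c \<in> W \<longrightarrow> (\<lambda>k. t * c k) \<in> W) \<and> v \<notin> W \<and>
    (\<forall>j<N. \<exists>\<mu>. (\<lambda>k. (if k = j then 1 else 0) - \<mu> * v k) \<in> W)"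
proof (induction N)
  case 0
  show ?case by (rule exI[of _ V]) (use assms in auto)
next
  case (Suc N)
  then obtain W where W: "V \<subseteq> W" "\<And>c c'. c \<in> W \<Longrightarrow> c' \<in> W \<Longrightarrow> (\<lambda>k. c k + c' k) \<in> W"
    "\<And>t c. c \<in> W \<Longrightarrow> (\<lambda>k. t * c k) \<in> W" "v \<notin> W"
    "\<And>j. j < N \<Longrightarrow> \<exists>\<mu>. (\<lambda>k. (if k = j then 1 else 0) - \<mu> * v k) \<in> W"
    by blast
  define e :: "nat \<Rightarrow> complex" where "e = (\<lambda>k. if k = N then 1 else 0)"
  define W' where "W' = {\<lambda>k. c k + t * e k | c t. c \<in> W}"
  have W'I: "f \<in> W'" if "c \<in> W" "f = (\<lambda>k. c k + t * e k)" for f c t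
    using that unfolding W'_def by blast
  \<comment> \<open>If adjoining the unit vector \<open>e\<close> would swallow \<open>v\<close>,
    then \<open>e\<close> is already a multiple of \<open>v\<close> modulo \<open>W\<close>, and
    \<open>W\<close> is kept. Otherwise \<open>e\<close> is adjoined and its multiple is 0.\<close>
  show ?case
  proof (cases "v \<in> W'")
    case True
    then obtain c t where c: "c \<in> W" "v = (\<lambda>k. c k + t * e k)" by (auto simp: W'_def)
    have t: "t \<noteq> 0" using c W(4) by auto
    have "(\<lambda>k. (- 1 / t) * c k) \<in> W" using c W(3) by blast
    moreover have "(\<lambda>k. (- 1 / t) * c k) = (\<lambda>k. e k - (1 / t) * v k)"
      using t by (auto simp: c(2) fun_eq_iff field_simps)
    ultimately have "(\<lambda>k. (if k = N then 1 else 0) - (1 / t) * v k) \<in> W" by (simp add: e_def)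
    hence "\<exists>\<mu>. (\<lambda>k. (if k = j then 1 else 0) - \<mu> * v k) \<in> W" if "j < Suc N" for j
    proof (cases "j = N")
      case False
      hence "j < N" using that by simp
      from W(5)[OF this] show ?thesis .
    qed blast
    with W(1-4) show ?thesis by (intro exI[of _ W] conjI allI impI)
  next
    case False
    have WW': "W \<subseteq> W'"
    proof
      fix c assume "c \<in> W"
      moreover have "c = (\<lambda>k. c k + 0 * e k)" by simp
      ultimately show "c \<in> W'" unfolding W'_def by blast
    qed
    have "(\<lambda>k. c k + c' k) \<in> W'" if cc: "c \<in> W'" "c' \<in> W'" for c c'
    proof -
      obtain b t b' t' where b: "b \<in> W" "b' \<in> W" "c = (\<lambda>k. b k + t * e k)" "c' = (\<lambda>k. b' k + t' * e k)"
        using cc unfolding W'_def by blast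
      have "(\<lambda>k. c k + c' k) = (\<lambda>k. (b k + b' k) + (t + t') * e k)" by (auto simp: b algebra_simps)
      thus ?thesis by (rule W'I[OF W(2)[OF b(1,2)]])
    qed
    moreover have "(\<lambda>k. s * c k) \<in> W'" if cc: "c \<in> W'" for c s
    proof -
      obtain b t where b: "b \<in> W" "c = (\<lambda>k. b k + t * e k)" using cc unfolding W'_def by blast
      have "(\<lambda>k. s * c k) = (\<lambda>k. s * b k + (s * t) * e k)" by (auto simp: b algebra_simps)
      thus ?thesis by (rule W'I[OF W(3)[OF b(1)]])
    qed
    moreover have "\<exists>\<mu>. (\<lambda>k. (if k = j then 1 else 0) - \<mu> * v k) \<in> W'" if j: "j < Suc N" for j
    proof (cases "j = N")
      case True
      have "(\<lambda>_. 0) \<in> W" using W(1) assms(3) by blast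
      have "(\<lambda>k. (if k = j then 1 else 0) - 0 * v k) = (\<lambda>k. 0 + 1 * e k)"
        by (auto simp: e_def True)
      from this W'I[OF \<open>(\<lambda>_. 0) \<in> W\<close> this] show ?thesis by blast
    next
      case False
      thus ?thesis using W(5)[of j] WW' j by auto
    qed
    ultimately show ?thesis using False WW' W(1) by (intro exI[of _ W']) blast
  qed
qed

text \<open>Modulo a suitable \<open>W\<close> that contains \<open>V\<close> but not
  \<open>v\<close>, every vector is a multiple of \<open>v\<close>; \<open>\<mu> j\<close> is that
  multiple for the j-th unit vector. Sequences stand for N-tuples: by \<open>fin\<close> the entries
  from \<open>N\<close> on do not affect membership in \<open>V\<close>.\<close>

lemma separating_functional:
  fixes V :: "(nat \<Rightarrow> complex) set"
  assumes add: "\<And>c c'. c \<in> V \<Longrightarrow> c' \<in> V \<Longrightarrow> (\<lambda>k. c k + c' k) \<in> V"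
    and mul: "\<And>t c. c \<in> V \<Longrightarrow> (\<lambda>k. t * c k) \<in> V"
    and fin: "\<And>c. (\<And>k. k < N \<Longrightarrow> c k = 0) \<Longrightarrow> c \<in> V" and v: "v \<notin> V"
  shows "\<exists>\<mu>. (\<forall>c\<in>V. (\<Sum>k<N. \<mu> k * c k) = 0) \<and> (\<Sum>k<N. \<mu> k * v k) \<noteq> 0"
proof -
  have "(\<lambda>_. 0) \<in> V" by (rule fin) simp
  from separating_functional_aux[OF add mul this v, of N]
  obtain W where W: "V \<subseteq> W" "\<And>c c'. c \<in> W \<Longrightarrow> c' \<in> W \<Longrightarrow> (\<lambda>k. c k + c' k) \<in> W"
    "\<And>t c. c \<in> W \<Longrightarrow> (\<lambda>k. t * c k) \<in> W" "v \<notin> W"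
    "\<And>j. j < N \<Longrightarrow> \<exists>\<mu>. (\<lambda>k. (if k = j then 1 else 0) - \<mu> * v k) \<in> W"
    by blast
  from W(5) obtain \<mu> where mu: "\<And>j. j < N \<Longrightarrow> (\<lambda>k. (if k = j then 1 else 0) - \<mu> j * v k) \<in> W" by metis
  have step: "(\<lambda>k. (if k < M then c k else 0) - (\<Sum>j<M. \<mu> j * c j) * v k) \<in> W" if "M \<le> N" for M c
    using that
  proof (induction M)
    case 0
    have "(\<lambda>_. 0) \<in> W" using W(1) \<open>(\<lambda>_. 0) \<in> V\<close> by blast
    thus ?case by simp
  next
    case (Suc M)
    have "(\<lambda>k. c M * ((if k = M then 1 else 0) - \<mu> M * v k)) \<in> W"
      by (rule W(3)[OF mu]) (use Suc in simp)
    from W(2)[OF Suc.IH this] have "(\<lambda>k. ((if k < M then c k else 0) - (\<Sum>j<M. \<mu> j * c j) * v k) +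
        c M * ((if k = M then 1 else 0) - \<mu> M * v k)) \<in> W" using Suc by simp
    moreover have "(\<lambda>k. ((if k < M then c k else 0) - (\<Sum>j<M. \<mu> j * c j) * v k) +
        c M * ((if k = M then 1 else 0) - \<mu> M * v k)) =
        (\<lambda>k. (if k < Suc M then c k else 0) - (\<Sum>j<Suc M. \<mu> j * c j) * v k)"
      by (auto simp: fun_eq_iff algebra_simps less_Suc_eq)
    ultimately show ?case by simp
  qed
  have all: "(\<lambda>k. c k - (\<Sum>j<N. \<mu> j * c j) * v k) \<in> W" for c
  proof -
    have "(\<lambda>k. if k < N then 0 else c k) \<in> W" using W(1) fin[of "\<lambda>k. if k < N then 0 else c k"] by auto
    from W(2)[OF this step[OF order.refl, of c]]
    have "(\<lambda>k. (if k < N then 0 else c k) + ((if k < N then c k else 0) - (\<Sum>j<N. \<mu> j * c j) * v k)) \<in> W" .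
    moreover have "(\<lambda>k. (if k < N then 0 else c k) + ((if k < N then c k else 0) - (\<Sum>j<N. \<mu> j * c j) * v k)) =
        (\<lambda>k. c k - (\<Sum>j<N. \<mu> j * c j) * v k)" by auto
    ultimately show ?thesis by simp
  qed
  show ?thesis
  proof (rule exI[of _ \<mu>], intro conjI ballI)
    fix c assume "c \<in> V"
    hence c: "(\<lambda>k. (-1) * c k) \<in> W" using W(1,3) by blast
    let ?s = "\<Sum>j<N. \<mu> j * c j"
    from W(2)[OF all[of c] c] have "(\<lambda>k. - ?s * v k) \<in> W" by simp
    show "?s = 0"
    proof (rule ccontr)
      assume s: "?s \<noteq> 0"
      have "(\<lambda>k. (- 1 / ?s) * (- ?s * v k)) \<in> W" by (rule W(3)) fact
      thus False using W(4) s by simp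
    qed
  next
    show "(\<Sum>k<N. \<mu> k * v k) \<noteq> 0" using all[of v] W(4) by auto
  qed
qed

definition bcont :: "(complex \<Rightarrow> complex) \<Rightarrow> bool" where
  "bcont f \<longleftrightarrow> continuous_on UNIV f \<and> bounded (range f)"

text \<open>The supremum \<open>B\<close> of \<open>norm (b w)\<close> satisfies
  \<open>B \<le> M + B / 2\<close>. This yields a bound on \<open>B\<close> because \<open>B\<close>
  is known to be finite beforehand.\<close>

lemma contraction_bound:
  assumes b: "bounded (range b)" and s: "\<And>w. norm (s w) \<le> M"
    and eq: "\<And>w. b w = s w - T w" and T: "\<And>B. (\<And>w. norm (b w) \<le> B) \<Longrightarrow> (\<And>w. norm (T w) \<le> B / 2)"
  shows "norm (b w :: complex) \<le> 2 * M"
proof -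
  define B where "B = (SUP w. norm (b w))"
  have bdd: "bdd_above (range (\<lambda>w. norm (b w)))"
    using b by (auto simp: bounded_iff bdd_above_def)
  have bB: "norm (b w) \<le> B" for w unfolding B_def by (rule cSUP_upper[OF _ bdd]) simp
  have "norm (b w) \<le> M + B / 2" for w
    unfolding eq[of w] using s[of w] T[OF bB, of w] by (intro order.trans[OF norm_triangle_ineq4]) simp
  hence "B \<le> M + B / 2" unfolding B_def[symmetric] by (subst B_def, intro cSUP_least) auto
  with bB[of w] show ?thesis by linarith
qed

text \<open>Banach's fixed point theorem in the complete space of bounded continuous functions, for
  the map that sends \<open>b\<close> to \<open>s - T b\<close>; by linearity the bound on
  \<open>T\<close> is a Lipschitz constant 1/2.\<close>

lemma neumann_exists:
  assumes T: "\<And>b. bcont b \<Longrightarrow> continuous_on UNIV (T b)"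
    and lin: "\<And>b b' w. bcont b \<Longrightarrow> bcont b' \<Longrightarrow> T (\<lambda>w. b w - b' w) w = T b w - T b' w"
    and bd: "\<And>b B w. bcont b \<Longrightarrow> (\<And>w. norm (b w) \<le> B) \<Longrightarrow> norm (T b w) \<le> B / 2"
    and s: "bcont s"
  shows "\<exists>b. bcont b \<and> (\<forall>w. b w = s w - T b w)"
proof -
  have bc: "bcont (apply_bcontfun f)" for f :: "complex \<Rightarrow>\<^sub>C complex"
    using apply_bcontfun[of f] by (simp add: bcont_def bcontfun_def)
  define \<Phi> :: "(complex \<Rightarrow>\<^sub>C complex) \<Rightarrow> (complex \<Rightarrow>\<^sub>C complex)" where
    "\<Phi> = (\<lambda>f. Bcontfun (\<lambda>w. s w - T (apply_bcontfun f) w))"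
  have app: "apply_bcontfun (\<Phi> f) w = s w - T (apply_bcontfun f) w" for f w
  proof -
    obtain M where M: "\<And>w. norm (s w) \<le> M" using s by (auto simp: bcont_def bounded_iff)
    obtain B where B: "\<And>w. norm (apply_bcontfun f w) \<le> B"
      using bc[of f] by (auto simp: bcont_def bounded_iff)
    have "norm (s w - T (apply_bcontfun f) w) \<le> M + B / 2" for w
      using M[of w] bd[OF bc B, of w] by (intro order.trans[OF norm_triangle_ineq4]) simp
    hence "bounded (range (\<lambda>w. s w - T (apply_bcontfun f) w))" by (auto simp: bounded_iff)
    moreover have "continuous_on UNIV (\<lambda>w. s w - T (apply_bcontfun f) w)"
      using s T[OF bc] by (intro continuous_on_diff) (auto simp: bcont_def)
    ultimately have "(\<lambda>w. s w - T (apply_bcontfun f) w) \<in> bcontfun" by (simp add: bcontfun_def)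
    thus ?thesis unfolding \<Phi>_def by (simp add: Bcontfun_inverse)
  qed
  have "\<exists>!f. \<Phi> f = f"
  proof (rule banach_fix_type[where c = "1/2"])
    show "\<forall>f g. dist (\<Phi> f) (\<Phi> g) \<le> 1/2 * dist f g"
    proof (intro allI)
      fix f g :: "complex \<Rightarrow>\<^sub>C complex"
      have fg: "bcont (\<lambda>w. apply_bcontfun f w - apply_bcontfun g w)"
        using bc[of "f - g"] by (simp add: minus_bcontfun.rep_eq)
      show "dist (\<Phi> f) (\<Phi> g) \<le> 1/2 * dist f g"
      proof (rule dist_bound)
        fix w
        have "dist (apply_bcontfun (\<Phi> f) w) (apply_bcontfun (\<Phi> g) w) =
            norm (T (\<lambda>w. apply_bcontfun f w - apply_bcontfun g w) w)"
          by (simp add: app dist_norm lin[OF bc bc] norm_minus_commute)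
        also have "\<dots> \<le> dist f g / 2"
          by (rule bd[OF fg]) (simp add: dist_norm[symmetric] dist_bounded)
        finally show "dist (apply_bcontfun (\<Phi> f) w) (apply_bcontfun (\<Phi> g) w) \<le> 1/2 * dist f g" by simp
      qed
    qed
  qed auto
  then obtain f where "\<Phi> f = f" by blast
  hence "apply_bcontfun f w = s w - T (apply_bcontfun f) w" for w using app[of f w] by simp
  with bc[of f] show ?thesis by blast
qed


section \<open>A parametrix whose error is of finite rank up to a contraction\<close>

context cutoff_cover
begin

definition D1 :: "complex set" where "D1 = {w. \<exists>i<n. norm (w - ctr i) \<le> 1}"

definition annuli :: "complex set" where
  "annuli = {w. \<exists>i<n. 3/2 < norm (w - ctr i) \<and> norm (w - ctr i) < 2}"

definition admissible :: "(complex \<Rightarrow> complex) \<Rightarrow> bool" where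
  "admissible b \<longleftrightarrow> continuous_on UNIV b \<and> (\<forall>w. w \<notin> D1 \<longrightarrow> b w = 0)"

text \<open>The Neumann equation is solved among all bounded continuous functions, which need not be
  integrable; the indicator makes the transform meaningful for them and changes nothing for
  admissible \<open>b\<close>.\<close>

definition transf :: "(complex \<Rightarrow> complex) \<Rightarrow> complex \<Rightarrow> complex" where
  "transf b = cauchy_transform (\<lambda>w. indicator D1 w * b w)"

lemma compact_D1: "compact D1" unfolding D1_def by (rule compact_discs)

lemma admissible_bcont: "admissible b \<Longrightarrow> bcont b"
proof -
  assume b: "admissible b"
  have "bounded (b ` D1)"
    using b compact_D1 unfolding admissible_def
    by (blast intro: compact_imp_bounded compact_continuous_image continuous_on_subset)
  hence "bounded (insert 0 (b ` D1))" by simp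
  hence "bounded (range b)" by (rule bounded_subset) (use b in \<open>auto simp: admissible_def\<close>)
  thus ?thesis using b by (simp add: bcont_def admissible_def)
qed

lemma Q_admissible:
  assumes "\<And>u i. i < n \<Longrightarrow> 1 < norm (u - ctr i) \<Longrightarrow> norm (u - ctr i) < 3 \<Longrightarrow> q differentiable (at u)"
  shows "admissible (Q q)"
  unfolding admissible_def
proof (intro conjI allI impI)
  show "continuous_on UNIV (Q q)"
  proof (intro continuous_at_imp_continuous_on ballI)
    fix w
    have "Q q differentiable (at w)" by (rule Q_differentiable) (use assms in blast)
    thus "isCont (Q q) w" by (rule differentiable_imp_continuous_within)
  qed
  show "Q q w = 0" if "w \<notin> D1" for w
    by (rule Q_zero) (use that in \<open>force simp: D1_def\<close>)
qed

text \<open>In the same disc the distance exceeds 3/2 - 1, and different discs are much farther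
  apart. This gap keeps the Cauchy kernel harmless on the annuli.\<close>

lemma annuli_far: "u \<in> annuli \<Longrightarrow> w \<in> D1 \<Longrightarrow> 1/2 < norm (u - w)"
proof -
  assume "u \<in> annuli" "w \<in> D1"
  then obtain i j where i: "i < n" "3/2 < norm (u - ctr i)" "norm (u - ctr i) < 2"
    and j: "norm (w - ctr j) \<le> 1" by (auto simp: annuli_def D1_def)
  have "3/2 < norm (u - ctr j)" using ctr_far[of i j u 2] i by (cases "i = j") auto
  thus ?thesis using norm_triangle_ineq[of "u - w" "w - ctr j"] j by simp
qed

lemma Q_bound_annuli:
  obtains C where "0 < C"
    "\<And>q B w. 0 \<le> B \<Longrightarrow> (\<And>u. u \<in> annuli \<Longrightarrow> norm (q u) \<le> B) \<Longrightarrow> norm (Q q w) \<le> C * B"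
proof -
  obtain C where C: "0 < C"
    "\<And>q B w. 0 \<le> B \<Longrightarrow> (\<And>u i. i < n \<Longrightarrow> 3/2 < norm (u - ctr i) \<Longrightarrow> norm (u - ctr i) < 2 \<Longrightarrow> norm (q u) \<le> B) \<Longrightarrow>
      norm (Q q w) \<le> C * B" using Q_bound by metis
  show ?thesis
  proof (rule that[OF C(1)])
    fix q :: "complex \<Rightarrow> complex" and B w
    assume "0 \<le> (B::real)" "\<And>u. u \<in> annuli \<Longrightarrow> norm (q u) \<le> B"
    thus "norm (Q q w) \<le> C * B" by (intro C(2)) (auto simp: annuli_def)
  qed
qed

lemma Q_cong_annuli: "(\<And>u. u \<in> annuli \<Longrightarrow> q u = q' u) \<Longrightarrow> Q q w = Q q' w"
  by (rule Q_cong) (auto simp: annuli_def)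

lemma cc_measurable_D1:
  assumes "bcont b"
  shows "cc_measurable (\<lambda>w. indicator D1 w * b w)"
proof -
  obtain M where M: "\<And>w. norm (b w) \<le> M" using assms by (auto simp: bcont_def bounded_iff)
  have "norm (indicator D1 w * b w) \<le> \<bar>M\<bar>" for w
    using M[of w] by (auto simp: indicator_def)
  hence "bounded (range (\<lambda>w. indicator D1 w * b w))" by (auto simp: bounded_iff)
  moreover have "bounded {w. indicator D1 w * b w \<noteq> 0}"
    by (rule bounded_subset[OF compact_imp_bounded[OF compact_D1]]) (auto simp: indicator_def)
  moreover have "(\<lambda>w. indicator D1 w * b w) \<in> borel_measurable borel"
    using assms compact_imp_closed[OF compact_D1]
    by (intro borel_measurable_times borel_measurable_indicator borel_measurable_continuous_onI)
       (auto simp: bcont_def)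
  ultimately show ?thesis unfolding cc_measurable_def by (intro conjI)
qed

lemma transf_add:
  "bcont b \<Longrightarrow> bcont b' \<Longrightarrow> transf (\<lambda>w. b w + b' w) z = transf b z + transf b' z"
  unfolding transf_def using cauchy_transform_add[OF cc_measurable_D1 cc_measurable_D1, of b b' z]
  by (simp add: ring_distribs)

lemma transf_cmult: "transf (\<lambda>w. k * b w) z = k * transf b z"
  unfolding transf_def using cauchy_transform_cmult[of k "\<lambda>w. indicator D1 w * b w" z]
  by (simp add: mult.left_commute)

lemma transf_dbar_outside:
  assumes "bcont b" "u \<notin> D1"
  shows "has_dbar (transf b) 0 u"
proof -
  have "open (- D1)" using compact_imp_closed[OF compact_D1] by (simp add: open_Compl)
  hence "has_dbar (\<lambda>w. indicator D1 w * b w) 0 u"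
    by (rule has_dbar_transform_open[OF has_dbar_const]) (use assms in auto)
  from cauchy_transform_has_dbar[OF cc_measurable_D1[OF assms(1)] has_dbar_imp_differentiable[OF this]]
  show ?thesis unfolding transf_def using assms(2) by simp
qed

lemma transf_dbar_admissible:
  assumes "admissible b" "b differentiable (at u)"
  shows "has_dbar (transf b) (b u) u"
proof -
  have *: "(\<lambda>w. indicator D1 w * b w) = b" using assms(1) by (auto simp: admissible_def indicator_def fun_eq_iff)
  have "cc_measurable b" using cc_measurable_D1[OF admissible_bcont[OF assms(1)]] unfolding * .
  from cauchy_transform_has_dbar[OF this assms(2)] show ?thesis unfolding transf_def * .
qed

(* psi times the transform of b is a primitive of b plus an error term in the annuli. *)
lemma exact_parametrix:
  assumes b: "admissible b" "\<And>w. b differentiable (at w)"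
  shows "exact (\<lambda>w. b w + Q (transf b) w)"
proof -
  have "exact (\<lambda>w. b w + \<Psi>' w * transf b w)"
  proof (rule exact_dbar[of "\<lambda>w. \<Psi> w * transf b w"])
    show "\<Psi> w * transf b w = 0" if "\<And>i. i < n \<Longrightarrow> 2 < norm (w - ctr i)" for w
      using cut_zero[of w] that by (simp add: less_imp_le)
    fix w i assume "i < n" "norm (w - ctr i) < 3"
    \<comment> \<open>The cutoff is 1 wherever \<open>b\<close> lives, so in the product rule one
      term is \<open>b\<close> itself and the other is the error.\<close>
    have *: "\<Psi> w * b w = b w"
    proof (cases "w \<in> D1")
      case True
      then obtain j where "j < n" "norm (w - ctr j) \<le> 1" by (auto simp: D1_def)
      hence "\<Psi> w = 1" by (intro cut_one[of j]) auto
      thus ?thesis by simp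
    next
      case False
      thus ?thesis using b(1) by (simp add: admissible_def)
    qed
    thus "has_dbar (\<lambda>w. \<Psi> w * transf b w) (b w + \<Psi>' w * transf b w) w"
      using has_dbar_mult[OF cut_dbar transf_dbar_admissible[OF b], of w] unfolding *
      by (simp only: add.commute)
  qed
  thus ?thesis
    by (rule exact_form_cong) (simp add: form_add form_Q)
qed

lemma D1_partition:
  assumes "0 < \<delta>"
  obtains N :: nat and \<zeta> :: "nat \<Rightarrow> complex" and P :: "nat \<Rightarrow> complex set" where "\<And>k. k < N \<Longrightarrow> P k \<in> sets borel" "\<And>k. k < N \<Longrightarrow> P k \<subseteq> ball (\<zeta> k) \<delta>"
    "\<And>k. k < N \<Longrightarrow> \<zeta> k \<in> D1" "\<And>w. w \<in> D1 \<Longrightarrow> \<exists>!k. k < N \<and> w \<in> P k" "\<And>k. k < N \<Longrightarrow> P k \<subseteq> D1"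
proof -
  obtain F where F: "finite F" "F \<subseteq> D1" "D1 \<subseteq> (\<Union>z\<in>F. ball z \<delta>)"
  proof -
    have "D1 \<subseteq> (\<Union>z\<in>D1. ball z \<delta>)" using assms by auto
    then obtain F where "F \<subseteq> D1" "finite F" "D1 \<subseteq> (\<Union>z\<in>F. ball z \<delta>)"
      by (rule compactE_image[OF compact_D1 open_ball])
    thus ?thesis by (intro that)
  qed
  obtain e where e: "bij_betw e {..<card F} F"
    using ex_bij_betw_nat_finite[OF F(1)] by (auto simp: atLeast0LessThan)
  define P where "P = (\<lambda>k. D1 \<inter> (ball (e k) \<delta> - (\<Union>l\<in>{..<k}. ball (e l) \<delta>)))"
  show ?thesis
  proof (rule that[of "card F" P e])
    show "P k \<in> sets borel" for k
      unfolding P_def using compact_imp_closed[OF compact_D1]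
      by (intro sets.Int sets.Diff sets.finite_UN) auto
    show "P k \<subseteq> ball (e k) \<delta>" "P k \<subseteq> D1" for k by (auto simp: P_def)
    show "e k \<in> D1" if "k < card F" for k using e F(2) that by (auto simp: bij_betw_def)
    fix w assume w: "w \<in> D1"
    obtain z where z: "z \<in> F" "w \<in> ball z \<delta>" using F(3) w by blast
    have "z \<in> e ` {..<card F}" using e z(1) by (simp add: bij_betw_def)
    hence "\<exists>k<card F. w \<in> ball (e k) \<delta>" using z(2) by blast
    define k where "k = (LEAST k. w \<in> ball (e k) \<delta>)"
    have k: "w \<in> ball (e k) \<delta>" "k < card F"
    proof -
      show "w \<in> ball (e k) \<delta>" unfolding k_def by (rule LeastI_ex) (use \<open>\<exists>k<card F. w \<in> ball (e k) \<delta>\<close> in blast)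
      show "k < card F" using \<open>\<exists>k<card F. w \<in> ball (e k) \<delta>\<close> unfolding k_def
        by (meson Least_le le_less_trans)
    qed
    have nk: "w \<notin> ball (e l) \<delta>" if "l < k" for l using not_less_Least that unfolding k_def by blast
    show "\<exists>!k. k < card F \<and> w \<in> P k"
    proof (rule ex1I[of _ k])
      show "k < card F \<and> w \<in> P k" using k nk w by (auto simp: P_def)
      fix l assume l: "l < card F \<and> w \<in> P l"
      hence "\<not> l < k" using nk by (auto simp: P_def)
      moreover have "\<not> k < l" using l k by (auto simp: P_def)
      ultimately show "l = k" by simp
    qed
  qed
qed

definition cellint :: "complex set \<Rightarrow> (complex \<Rightarrow> complex) \<Rightarrow> complex" where
  "cellint P b = (LINT w|lborel. indicator P w * b w) / of_real pi"

lemma cell_integrable: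
  assumes "bcont b" "P \<in> sets borel" "P \<subseteq> D1"
  shows "integrable lborel (\<lambda>w. indicator P w * b w)"
proof -
  obtain M where M: "\<And>w. norm (b w) \<le> M" using assms by (auto simp: bcont_def bounded_iff)
  obtain a r where "D1 \<subseteq> cball a r" using compact_imp_bounded[OF compact_D1] bounded_subset_cball by blast
  thus ?thesis using assms M
    by (intro integrable_ball_times(1)[where z = a and r = r and B = M])
       (auto simp: bcont_def intro!: borel_measurable_continuous_onI)
qed

lemma cellint_add:
  "bcont b \<Longrightarrow> bcont b' \<Longrightarrow> P \<in> sets borel \<Longrightarrow> P \<subseteq> D1 \<Longrightarrow>
    cellint P (\<lambda>w. b w + b' w) = cellint P b + cellint P b'"
  unfolding cellint_def using cell_integrable[of b P] cell_integrable[of b' P]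
  by (simp add: ring_distribs add_divide_distrib)

lemma cellint_cmult: "cellint P (\<lambda>w. k * b w) = k * cellint P b"
  unfolding cellint_def mult.left_commute[of _ k] integral_mult_right_zero by simp

lemma cellint_bound:
  "\<exists>V\<ge>0. \<forall>b B P. bcont b \<longrightarrow> (\<forall>w. norm (b w) \<le> B) \<longrightarrow> P \<in> sets borel \<longrightarrow> P \<subseteq> D1 \<longrightarrow>
    norm (cellint P b) \<le> V * B"
proof -
  obtain a r where D: "D1 \<subseteq> cball a r" using compact_imp_bounded[OF compact_D1] bounded_subset_cball by blast
  define V where "V = measure lborel (cball a r) / pi"
  show ?thesis
  proof (rule exI[of _ V], intro conjI allI impI)
    show "0 \<le> V" by (simp add: V_def)
    fix b :: "complex \<Rightarrow> complex" and B P
    assume b: "bcont b" "\<forall>w. norm (b w) \<le> B" and P: "P \<in> sets borel" "P \<subseteq> D1"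
    have B: "0 \<le> B" using order.trans[OF norm_ge_zero b(2)[rule_format]] .
    have "norm (LINT w|lborel. indicator P w * b w) \<le> \<bar>B\<bar> * measure lborel P"
      by (rule integrable_ball_times(2)[where z = a and r = r])
         (use b P D in \<open>auto simp: bcont_def intro!: borel_measurable_continuous_onI\<close>)
    also have "\<dots> \<le> \<bar>B\<bar> * measure lborel (cball a r)"
      using P D emeasure_lborel_cball_finite[of a r]
      by (intro mult_left_mono measure_mono_fmeasurable) (auto simp: fmeasurable_def)
    finally show "norm (cellint P b) \<le> V * B"
      using B by (simp add: cellint_def V_def norm_divide field_simps)
  qed
qed

end


context cutoff_cover
begin

text \<open>A Riemann sum: on each cell the pole \<open>w\<close> of the kernel is moved to the
  nearby point \<open>\<zeta> k\<close>. Both keep distance 1/2 from the annuli, so the kernel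
  changes by at most \<open>4 * \<delta>\<close>, uniformly in \<open>u\<close>.\<close>

lemma transf_approx:
  assumes \<epsilon>: "0 < \<epsilon>"
  obtains N :: nat and \<zeta> :: "nat \<Rightarrow> complex" and P :: "nat \<Rightarrow> complex set" where
    "\<And>k. k < N \<Longrightarrow> P k \<in> sets borel" "\<And>k. k < N \<Longrightarrow> P k \<subseteq> D1" "\<And>k. k < N \<Longrightarrow> \<zeta> k \<in> D1"
    "\<And>b B u. bcont b \<Longrightarrow> (\<And>w. norm (b w) \<le> B) \<Longrightarrow> u \<in> annuli \<Longrightarrow>
      norm (transf b u - (\<Sum>k<N. cellint (P k) b * (1 / (u - \<zeta> k)))) \<le> \<epsilon> * B"
proof -
  obtain a r where D: "D1 \<subseteq> cball a r" using compact_imp_bounded[OF compact_D1] bounded_subset_cball by blast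
  define V where "V = measure lborel D1"
  \<comment> \<open>Chosen so that the total error \<open>4 * \<delta> * V / pi\<close> stays below
    \<epsilon>; \<open>V + 1\<close> avoids dividing by a zero area.\<close>
  define \<delta> where "\<delta> = \<epsilon> * pi / (4 * (V + 1))"
  have V0: "0 \<le> V" by (simp add: V_def)
  hence \<delta>0: "0 < \<delta>" using \<epsilon> by (simp add: \<delta>_def)
  obtain N :: nat and \<zeta> P where P: "\<And>k. k < N \<Longrightarrow> P k \<in> sets borel" "\<And>k. k < N \<Longrightarrow> P k \<subseteq> ball (\<zeta> k) \<delta>"
    "\<And>k. k < N \<Longrightarrow> \<zeta> k \<in> D1" "\<And>w. w \<in> D1 \<Longrightarrow> \<exists>!k. k < N \<and> w \<in> P k" "\<And>k. k < N \<Longrightarrow> P k \<subseteq> D1"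
    by (rule D1_partition[OF \<delta>0]) blast
  show ?thesis
  proof (rule that[OF P(1,5,3)])
    fix b :: "complex \<Rightarrow> complex" and B u assume b: "bcont b" "\<And>w. norm (b w) \<le> B" and u: "u \<in> annuli"
    have B0: "0 \<le> B" using order.trans[OF norm_ge_zero b(2)] .
    define g where "g = (\<lambda>w. b w / (u - w) - (\<Sum>k<N. indicator (P k) w * b w * (1 / (u - \<zeta> k))))"
    have bm: "b \<in> borel_measurable borel" using b(1) by (auto simp: bcont_def intro!: borel_measurable_continuous_onI)
    have gm: "g \<in> borel_measurable borel" unfolding g_def
      using bm P(1) by (intro borel_measurable_diff borel_measurable_divide borel_measurable_sum
          borel_measurable_times borel_measurable_indicator) auto
    have "norm (g w) \<le> 4 * \<delta> * B" if w: "w \<in> D1" for w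
    proof -
      obtain k where k: "k < N" "w \<in> P k" "\<And>l. l < N \<Longrightarrow> w \<in> P l \<Longrightarrow> l = k" using P(4)[OF w] by blast
      have "(\<Sum>l<N. indicator (P l) w * b w * (1 / (u - \<zeta> l))) = (\<Sum>l<N. if l = k then b w * (1 / (u - \<zeta> k)) else 0)"
      proof (rule sum.cong[OF refl])
        fix l assume "l \<in> {..<N}"
        hence l: "l < N" by simp
        show "indicator (P l) w * b w * (1 / (u - \<zeta> l)) = (if l = k then b w * (1 / (u - \<zeta> k)) else 0)"
        proof (cases "l = k")
          case True
          thus ?thesis using k(2) by simp
        next
          case False
          hence "w \<notin> P l" using k(3)[OF l] by blast
          thus ?thesis using False by simp
        qed
      qed
      also have "\<dots> = b w * (1 / (u - \<zeta> k))" using k(1) by (subst sum.delta) simp_all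
      finally have "g w = b w * (1 / (u - w) - 1 / (u - \<zeta> k))"
        unfolding g_def by (simp add: right_diff_distrib)
      also have "1 / (u - w) - 1 / (u - \<zeta> k) = (w - \<zeta> k) / ((u - w) * (u - \<zeta> k))"
        using annuli_far[OF u w] annuli_far[OF u P(3)[OF k(1)]] by (subst diff_frac_eq) auto
      also have "norm (b w * \<dots>) \<le> B * (\<delta> / ((1/2) * (1/2)))"
        unfolding norm_mult norm_divide
      proof (intro mult_mono frac_le)
        show "norm (w - \<zeta> k) \<le> \<delta>" using P(2)[OF k(1)] k(2) by (force simp: dist_norm norm_minus_commute)
      qed (use annuli_far[OF u w] annuli_far[OF u P(3)[OF k(1)]] b(2) B0 \<delta>0 in auto)
      finally show ?thesis by (simp add: mult_ac)
    qed
    hence "norm (LINT w|lborel. indicator D1 w * g w) \<le> \<bar>4 * \<delta> * B\<bar> * measure lborel D1"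
      using compact_imp_closed[OF compact_D1] by (intro integrable_ball_times(2)[OF gm _ D]) auto
    hence gi: "norm (LINT w|lborel. indicator D1 w * g w) \<le> 4 * \<delta> * B * V"
      using B0 \<delta>0 by (simp add: V_def)
    have i1: "integrable lborel (\<lambda>w. indicator D1 w * b w / (u - w))"
      by (rule cauchy_kernel_integrable[OF cc_measurable_D1[OF b(1)]])
    have i2: "integrable lborel (\<lambda>w. indicator (P k) w * b w * (1 / (u - \<zeta> k)))" if "k < N" for k
      by (intro integrable_mult_left cell_integrable[OF b(1) P(1)[OF that] P(5)[OF that]])
    have "(LINT w|lborel. indicator D1 w * g w) =
        (LINT w|lborel. indicator D1 w * b w / (u - w) - (\<Sum>k<N. indicator (P k) w * b w * (1 / (u - \<zeta> k))))"
    proof (rule Bochner_Integration.integral_cong[OF refl])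
      fix w
      have "w \<notin> P k" if "w \<notin> D1" "k < N" for k using that P(5) by blast
      thus "indicator D1 w * g w = indicator D1 w * b w / (u - w) - (\<Sum>k<N. indicator (P k) w * b w * (1 / (u - \<zeta> k)))"
        by (cases "w \<in> D1") (auto simp: g_def)
    qed
    also have "\<dots> = (LINT w|lborel. indicator D1 w * b w / (u - w)) -
        (LINT w|lborel. (\<Sum>k<N. indicator (P k) w * b w * (1 / (u - \<zeta> k))))"
      using i2 by (intro Bochner_Integration.integral_diff i1 Bochner_Integration.integrable_sum) auto
    also have "(LINT w|lborel. (\<Sum>k<N. indicator (P k) w * b w * (1 / (u - \<zeta> k)))) =
        (\<Sum>k<N. (LINT w|lborel. indicator (P k) w * b w) * (1 / (u - \<zeta> k)))"
      using i2 by (subst Bochner_Integration.integral_sum) (auto simp: integral_mult_left_zero)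
    finally have fin: "(LINT w|lborel. indicator D1 w * g w) = (LINT w|lborel. indicator D1 w * b w / (u - w)) -
        (\<Sum>k<N. (LINT w|lborel. indicator (P k) w * b w) * (1 / (u - \<zeta> k)))" .
    have pc: "of_real pi * (cellint (P k) b * x) = (LINT w|lborel. indicator (P k) w * b w) * x" for k x
      by (simp add: cellint_def)
    have pt: "of_real pi * transf b u = (LINT w|lborel. indicator D1 w * b w / (u - w))"
      by (simp add: transf_def cauchy_transform_def)
    have "(LINT w|lborel. indicator D1 w * g w) = of_real pi *
        (transf b u - (\<Sum>k<N. cellint (P k) b * (1 / (u - \<zeta> k))))"
      unfolding right_diff_distrib sum_distrib_left pc pt by (rule fin)
    hence "pi * norm (transf b u - (\<Sum>k<N. cellint (P k) b * (1 / (u - \<zeta> k)))) \<le> 4 * \<delta> * B * V"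
      using gi by (simp add: norm_mult)
    also have "\<dots> = pi * (\<epsilon> * B * (V / (V + 1)))" using V0 by (simp add: \<delta>_def field_simps)
    also have "\<dots> \<le> pi * (\<epsilon> * B * 1)"
      using V0 \<epsilon> B0 by (intro mult_left_mono) auto
    finally show "norm (transf b u - (\<Sum>k<N. cellint (P k) b * (1 / (u - \<zeta> k)))) \<le> \<epsilon> * B"
      by (simp add: mult_le_cancel_left_pos)
  qed
qed

(* The approximation of the transform by operators of finite rank makes the cokernel of the
   Cauchy-Riemann operator finite-dimensional, with bounded coordinate functionals. *)
lemma separating_form_functional:
  assumes \<sigma>: "admissible \<sigma>" "\<And>w. \<sigma> differentiable (at w)" "\<not> exact \<sigma>"
  obtains \<Lambda> :: "(complex \<Rightarrow> complex) \<Rightarrow> complex" and C where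
    "\<And>b b'. admissible b \<Longrightarrow> admissible b' \<Longrightarrow> \<Lambda> (\<lambda>w. b w + b' w) = \<Lambda> b + \<Lambda> b'"
    "\<And>k b. admissible b \<Longrightarrow> \<Lambda> (\<lambda>w. k * b w) = k * \<Lambda> b"
    "\<And>b B. admissible b \<Longrightarrow> (\<And>w. norm (b w) \<le> B) \<Longrightarrow> norm (\<Lambda> b) \<le> C * B"
    "\<And>b. admissible b \<Longrightarrow> (\<And>w. b differentiable (at w)) \<Longrightarrow> exact b \<Longrightarrow> \<Lambda> b = 0"
    "\<Lambda> \<sigma> \<noteq> 0"
proof -
  obtain CQ where CQ: "0 < CQ"
    "\<And>q B w. 0 \<le> B \<Longrightarrow> (\<And>u. u \<in> annuli \<Longrightarrow> norm (q u) \<le> B) \<Longrightarrow> norm (Q q w) \<le> CQ * B"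
    by (rule Q_bound_annuli) blast
  \<comment> \<open>With this accuracy the part \<open>S\<close> of the error that remains after
    removing the finite-rank part has norm at most 1/2, the loss \<open>CQ\<close> through
    \<open>Q\<close> included.\<close>
  have e0: "0 < 1 / (2 * CQ)" using CQ by simp
  obtain N :: nat and \<zeta> P where P: "\<And>k. k < N \<Longrightarrow> P k \<in> sets borel" "\<And>k. k < N \<Longrightarrow> P k \<subseteq> D1" "\<And>k. k < N \<Longrightarrow> \<zeta> k \<in> D1"
    "\<And>b B u. bcont b \<Longrightarrow> (\<And>w. norm (b w) \<le> B) \<Longrightarrow> u \<in> annuli \<Longrightarrow>
      norm (transf b u - (\<Sum>k<N. cellint (P k) b * (1 / (u - \<zeta> k)))) \<le> 1 / (2 * CQ) * B"
    by (rule transf_approx[OF e0]) blast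
  define F where "F = (\<lambda>b u. \<Sum>k<N. cellint (P k) b * (1 / (u - \<zeta> k)))"
  define S where "S = (\<lambda>b. Q (\<lambda>u. transf b u + (-1) * F b u))"
  \<comment> \<open>These finitely many forms span the range of the finite-rank part.\<close>
  define \<tau> where "\<tau> = (\<lambda>k. Q (\<lambda>u. 1 / (u - \<zeta> k)))"
  have offD: "u \<notin> D1" if "i < n" "1 < norm (u - ctr i)" "norm (u - ctr i) < 3" for u i
  proof
    assume "u \<in> D1"
    then obtain j where "j < n" "norm (u - ctr j) \<le> 1" by (auto simp: D1_def)
    thus False using that ctr_far[of j i u 1] by (cases "j = i") auto
  qed
  have kdiff: "(\<lambda>u. 1 / (u - \<zeta> k)) differentiable (at u)" if "u \<notin> D1" "k < N" for u k
  proof -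
    have "u \<noteq> \<zeta> k" using that P(3) by auto
    hence "((\<lambda>u. 1 / (u - \<zeta> k)) has_field_derivative - 1 / (u - \<zeta> k)\<^sup>2) (at u)"
      by (auto intro!: derivative_eq_intros simp: power2_eq_square)
    thus ?thesis by (intro has_dbar_imp_differentiable[OF has_field_derivative_imp_has_dbar])
  qed
  have tdiff: "transf b differentiable (at u)" if "bcont b" "u \<notin> D1" for b u
    by (rule has_dbar_imp_differentiable[OF transf_dbar_outside[OF that]])
  have Fdiff: "F b differentiable (at u)" if "u \<notin> D1" for b u
    unfolding F_def 
    by (rule differentiable_sum_planar, simp, rule differentiable_mult[OF differentiable_const kdiff[OF that]], simp)
  have Sdiff: "S b differentiable (at w)" and Sadm: "admissible (S b)" if "bcont b" for b w
  proof -
    have "(\<lambda>u. transf b u + (-1) * F b u) differentiable (at u)" if "u \<notin> D1" for u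
      using tdiff[OF \<open>bcont b\<close> that] Fdiff[OF that] by (intro differentiable_add differentiable_mult) auto
    thus "S b differentiable (at w)" "admissible (S b)" unfolding S_def
      using offD by (auto intro!: Q_differentiable Q_admissible)
  qed
  have Fadd: "F (\<lambda>w. b w + b' w) u = F b u + F b' u" if "bcont b" "bcont b'" for b b' u
    unfolding F_def sum.distrib[symmetric]
    using cellint_add[OF that P(1,2)] by (intro sum.cong) (auto simp: ring_distribs add_divide_distrib)
  have Fmul: "F (\<lambda>w. k * b w) u = k * F b u" for k b u
    unfolding F_def sum_distrib_left cellint_cmult by (intro sum.cong) auto
  have Sadd: "S (\<lambda>w. b w + b' w) w = S b w + S b' w" if "bcont b" "bcont b'" for b b' w
    unfolding S_def Q_add[symmetric] transf_add[OF that] Fadd[OF that] by (simp add: algebra_simps)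
  have Smul: "S (\<lambda>w. k * b w) w = k * S b w" for k b w
    unfolding S_def Q_cmult[symmetric] transf_cmult Fmul by (simp add: algebra_simps)
  have bcmul: "bcont (\<lambda>w. k * b w)" if bc: "bcont b" for k b
  proof -
    obtain M where M: "\<And>w. norm (b w) \<le> M" using bc by (auto simp: bcont_def bounded_iff)
    have "norm (k * b w) \<le> norm k * M" for w unfolding norm_mult by (intro mult_left_mono M) auto
    thus ?thesis using bc unfolding bcont_def bounded_iff by (auto intro!: continuous_intros)
  qed
  have bcadd: "bcont (\<lambda>w. b w + b' w)" if "bcont b" "bcont b'" for b b'
    using that unfolding bcont_def by (auto intro!: continuous_intros bounded_plus_comp)
  have Sbd: "norm (S b w) \<le> B / 2" if "bcont b" "\<And>w. norm (b w) \<le> B" for b B w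
  proof -
    have "0 \<le> B" using order.trans[OF norm_ge_zero that(2)] .
    have "norm (S b w) \<le> CQ * (1 / (2 * CQ) * B)" unfolding S_def
      by (rule CQ(2)) (use P(4)[OF that] CQ \<open>0 \<le> B\<close> in \<open>auto simp: F_def\<close>)
    thus ?thesis using CQ by simp
  qed
  have ex: "\<exists>b. bcont b \<and> (\<forall>w. b w = s w - S b w)" if "bcont s" for s
  proof (rule neumann_exists)
    show "continuous_on UNIV (S b)" if "bcont b" for b using Sadm[OF that] by (simp add: admissible_def)
    show "S (\<lambda>w. b w - b' w) w = S b w - S b' w" if "bcont b" "bcont b'" for b b' w
      using Sadd[OF that(1) bcmul[OF that(2)], of "-1" w] Smul[of "-1" b' w] by simp
  qed (use Sbd that in auto)
  have bnd: "norm (b w) \<le> 2 * M" if "bcont b" "\<And>w. b w = s w - S b w" "\<And>w. norm (s w) \<le> M" for b s w M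
    by (rule contraction_bound[of b s M "S b"]) (use that Sbd[OF that(1)] in \<open>auto simp: bcont_def\<close>)
  have uniq: "b = b'" if "bcont b" "\<And>w. b w = s w - S b w" "bcont b'" "\<And>w. b' w = s w - S b' w" for b b' s
  proof
    fix w
    have c: "bcont (\<lambda>w. b w + (-1) * b' w)" by (intro bcadd bcmul that)
    have "norm (b w + (-1) * b' w) \<le> 2 * 0"
    proof (rule bnd[OF c, of "\<lambda>_. 0"])
      fix w show "b w + (-1) * b' w = 0 - S (\<lambda>w. b w + (-1) * b' w) w"
        unfolding Sadd[OF that(1) bcmul[OF that(3)]] Smul using that(2)[of w] that(4)[of w] by simp
    qed simp
    thus "b w = b' w" by simp
  qed
  \<comment> \<open>\<open>R\<close> is the inverse of the identity plus \<open>S\<close>.\<close>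
  define R where "R = (\<lambda>s. THE b. bcont b \<and> (\<forall>w. b w = s w - S b w))"
  have R: "bcont (R s)" "R s w = s w - S (R s) w" if s: "bcont s" for s w
  proof -
    obtain b where b: "bcont b \<and> (\<forall>w. b w = s w - S b w)" using ex[OF s] by blast
    hence "\<exists>!b. bcont b \<and> (\<forall>w. b w = s w - S b w)" using uniq by blast
    from theI'[OF this] have "bcont (R s) \<and> (\<forall>w. R s w = s w - S (R s) w)" unfolding R_def .
    thus "bcont (R s)" "R s w = s w - S (R s) w" by blast+
  qed
  have Req: "R s = b" if "bcont s" "bcont b" "\<And>w. b w = s w - S b w" for s b
    using uniq[OF R[OF that(1)] that(2,3)] .
  have Radd: "R (\<lambda>w. s w + s' w) = (\<lambda>w. R s w + R s' w)" if "bcont s" "bcont s'" for s s'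
  proof (rule Req[OF bcadd[OF that] bcadd[OF R(1)[OF that(1)] R(1)[OF that(2)]]])
    fix w
    show "R s w + R s' w = s w + s' w - S (\<lambda>w. R s w + R s' w) w"
      unfolding Sadd[OF R(1)[OF that(1)] R(1)[OF that(2)]]
      using R(2)[OF that(1), of w] R(2)[OF that(2), of w] by (simp only: algebra_simps)
  qed
  have Rmul: "R (\<lambda>w. k * s w) = (\<lambda>w. k * R s w)" if "bcont s" for s k
  proof (rule Req[OF bcmul[OF that] bcmul[OF R(1)[OF that]]])
    fix w
    show "k * R s w = k * s w - S (\<lambda>w. k * R s w) w"
      unfolding Smul right_diff_distrib[symmetric] using R(2)[OF that, of w] by (rule arg_cong)
  qed
  \<comment> \<open>\<open>m s\<close> lists the coefficients of the finite-rank part of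
    \<open>R s\<close>; \<open>V\<close> consists of the coefficient vectors whose combination of
    the \<open>\<tau> k\<close> is exact.\<close>
  define m where "m = (\<lambda>s k. if k < N then cellint (P k) (R s) else 0)"
  define V where "V = {c. exact (\<lambda>w. \<Sum>k<N. c k * \<tau> k w)}"
  \<comment> \<open>With \<open>b = R s\<close> the Neumann equation reads
    \<open>s = (b + Q (transf b)) - Q (F b)\<close>. The bracket is exact by the parametrix, so
    \<open>s\<close> is exact together with \<open>Q (F b)\<close>, which is the combination of the
    \<open>\<tau> k\<close> with coefficients \<open>m s\<close>.\<close>
  have key: "exact s \<longleftrightarrow> m s \<in> V" if s: "admissible s" "\<And>w. s differentiable (at w)" for s
  proof -
    have bs: "bcont s" by (rule admissible_bcont[OF s(1)])
    define b where "b = R s"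
    note b = R[OF bs, folded b_def]
    \<comment> \<open>A priori \<open>b\<close> is only bounded and continuous; its support and its
      differentiability are read off from the equation \<open>b = s - S b\<close>.\<close>
    have badm: "admissible b" using b(1) s(1) Sadm[OF b(1)] b(2) unfolding admissible_def bcont_def by simp
    have "(\<lambda>w. s w - S b w) differentiable (at w)" for w
      by (intro differentiable_diff s Sdiff b)
    moreover have "(\<lambda>w. s w - S b w) = b" by (rule ext) (rule b(2)[symmetric])
    ultimately have bdiff: "b differentiable (at w)" for w by (simp only:)
    have QF: "Q (F b) w = (\<Sum>k<N. m s k * \<tau> k w)" for w
    proof -
      have "Q (F b) w = (\<Sum>k<N. Q (\<lambda>u. cellint (P k) b * (1 / (u - \<zeta> k))) w)"
        unfolding F_def by (rule Q_sum[OF finite_lessThan])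
      also have "\<dots> = (\<Sum>k<N. m s k * \<tau> k w)"
      proof (rule sum.cong[OF refl])
        fix k assume "k \<in> {..<N}"
        hence "m s k = cellint (P k) b" by (simp add: m_def b_def)
        thus "Q (\<lambda>u. cellint (P k) b * (1 / (u - \<zeta> k))) w = m s k * \<tau> k w"
          unfolding \<tau>_def by (simp only: Q_cmult)
      qed
      finally show ?thesis .
    qed
    have eq: "s w = (b w + Q (transf b) w) + (-1) * (\<Sum>k<N. m s k * \<tau> k w)" for w
      using b(2)[of w] unfolding S_def Q_add Q_cmult QF by (simp add: algebra_simps)
    note E = exact_parametrix[OF badm bdiff]
    show ?thesis
    proof
      assume "exact s"
      from exact_add[OF E exact_cmult[OF this, of "-1"]]
      have "exact (\<lambda>w. \<Sum>k<N. m s k * \<tau> k w)" by (simp add: eq)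
      thus "m s \<in> V" by (simp add: V_def)
    next
      assume "m s \<in> V"
      hence "exact (\<lambda>w. \<Sum>k<N. m s k * \<tau> k w)" by (simp add: V_def)
      from exact_add[OF E exact_cmult[OF this, of "-1"]]
      have "exact (\<lambda>w. (b w + Q (transf b) w) + (-1) * (\<Sum>k<N. m s k * \<tau> k w))" .
      thus "exact s" by (subst eq[abs_def]) 
    qed
  qed
  have "\<exists>\<mu>. (\<forall>c\<in>V. (\<Sum>k<N. \<mu> k * c k) = 0) \<and> (\<Sum>k<N. \<mu> k * m \<sigma> k) \<noteq> 0"
  proof (rule separating_functional)
    show "(\<lambda>k. c k + c' k) \<in> V" if "c \<in> V" "c' \<in> V" for c c'
      using exact_add[of "\<lambda>w. \<Sum>k<N. c k * \<tau> k w" "\<lambda>w. \<Sum>k<N. c' k * \<tau> k w"] that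
      by (simp add: V_def sum.distrib ring_distribs)
    show "(\<lambda>k. t * c k) \<in> V" if "c \<in> V" for t c
      using exact_cmult[of "\<lambda>w. \<Sum>k<N. c k * \<tau> k w" t] that
      by (simp add: V_def sum_distrib_left mult.assoc)
    show "c \<in> V" if "\<And>k. k < N \<Longrightarrow> c k = 0" for c
      using that exact_0 by (simp add: V_def)
    show "m \<sigma> \<notin> V" using key[OF \<sigma>(1,2)] \<sigma>(3) by simp
  qed
  then obtain \<mu> where mu: "\<And>c. c \<in> V \<Longrightarrow> (\<Sum>k<N. \<mu> k * c k) = 0" "(\<Sum>k<N. \<mu> k * m \<sigma> k) \<noteq> 0" by blast
  obtain W where W: "0 \<le> W" "\<forall>b B P. bcont b \<longrightarrow> (\<forall>w. norm (b w) \<le> B) \<longrightarrow> P \<in> sets borel \<longrightarrow> P \<subseteq> D1 \<longrightarrow>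
    norm (cellint P b) \<le> W * B"
    using cellint_bound by blast
  define \<Lambda> where "\<Lambda> = (\<lambda>s. \<Sum>k<N. \<mu> k * m s k)"
  show ?thesis
  proof (rule that[of \<Lambda> "\<Sum>k<N. norm (\<mu> k) * (W * 2)"])
    fix b b' assume bb: "admissible b" "admissible b'"
    note bc = bb[THEN admissible_bcont]
    show "\<Lambda> (\<lambda>w. b w + b' w) = \<Lambda> b + \<Lambda> b'"
      unfolding \<Lambda>_def m_def Radd[OF bc] sum.distrib[symmetric]
      using cellint_add[OF R(1)[OF bc(1)] R(1)[OF bc(2)] P(1,2)] by (intro sum.cong) (auto simp: ring_distribs)
  next
    fix k b assume "admissible b"
    note bc = this[THEN admissible_bcont]
    show "\<Lambda> (\<lambda>w. k * b w) = k * \<Lambda> b"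
      unfolding \<Lambda>_def m_def Rmul[OF bc] sum_distrib_left by (intro sum.cong) (auto simp: cellint_cmult)
  next
    fix b B assume b: "admissible b" "\<And>w. norm (b w) \<le> B"
    note bc = b(1)[THEN admissible_bcont]
    have "norm (\<Lambda> b) \<le> (\<Sum>k<N. norm (\<mu> k) * (W * 2) * B)"
      unfolding \<Lambda>_def
    proof (rule sum_norm_le)
      fix k assume "k \<in> {..<N}"
      hence k: "k < N" by simp
      have "norm (m b k) \<le> W * (2 * B)"
        using W(2)[rule_format, OF R(1)[OF bc] bnd[OF R[OF bc] b(2)] P(1,2)[OF k]] k by (simp add: m_def)
      hence "norm (\<mu> k) * norm (m b k) \<le> norm (\<mu> k) * (W * (2 * B))" by (rule mult_left_mono) simp
      thus "norm (\<mu> k * m b k) \<le> norm (\<mu> k) * (W * 2) * B" by (simp add: norm_mult mult_ac)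
    qed
    thus "norm (\<Lambda> b) \<le> (\<Sum>k<N. norm (\<mu> k) * (W * 2)) * B" by (simp add: sum_distrib_right)
  next
    fix b assume "admissible b" "\<And>w. b differentiable (at w)" "exact b"
    thus "\<Lambda> b = 0" using key mu(1) by (simp add: \<Lambda>_def)
  next
    show "\<Lambda> \<sigma> \<noteq> 0" using mu(2) by (simp add: \<Lambda>_def)
  qed
qed

end


section \<open>From a functional on forms to a holomorphic differential\<close>

lemma quadratic_imp_has_field_derivative:
  fixes f :: "complex \<Rightarrow> complex"
  assumes "0 < r" "\<And>w. norm (w - w0) < r \<Longrightarrow> norm (f w - f w0 - (w - w0) * D) \<le> K * (norm (w - w0))\<^sup>2"
  shows "(f has_field_derivative D) (at w0)"
proof -
  have "((\<lambda>w. (f w - f w0) / (w - w0) - D) \<longlongrightarrow> 0) (at w0)"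
  proof (rule Lim_null_comparison)
    have "eventually (\<lambda>w. norm (w - w0) < r) (at w0)"
      using assms(1) unfolding eventually_at by (intro exI[of _ r]) (auto simp: dist_norm)
    moreover have "eventually (\<lambda>w. w \<noteq> w0) (at w0)" by (simp add: eventually_at_filter)
    ultimately show "\<forall>\<^sub>F w in at w0. norm ((f w - f w0) / (w - w0) - D) \<le> K * norm (w - w0)"
    proof eventually_elim
      case (elim w)
      have "(f w - f w0) / (w - w0) - D = (f w - f w0 - (w - w0) * D) / (w - w0)"
        using elim by (simp add: field_simps)
      hence "norm ((f w - f w0) / (w - w0) - D) \<le> K * (norm (w - w0))\<^sup>2 / norm (w - w0)"
        using assms(2)[OF elim(1)] by (simp add: norm_divide divide_right_mono)
      thus ?case using elim by (simp add: power2_eq_square)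
    qed
    show "((\<lambda>w. K * norm (w - w0)) \<longlongrightarrow> 0) (at w0)"
      by (rule tendsto_eq_intros refl | simp)+
  qed
  thus ?thesis by (simp add: has_field_derivative_iff LIM_zero_iff)
qed

text \<open>The ratio of the vectors from \<open>t\<close> and from \<open>a\<close> to
  \<open>u\<close> is negative or zero only when \<open>u\<close> lies between \<open>a\<close> and
  \<open>t\<close>. Hence the principal logarithm of the ratio is holomorphic off the
  segment.\<close>

lemma quotient_not_nonpos:
  fixes u a t :: complex
  assumes "u \<notin> closed_segment a t"
  shows "(u - t) / (u - a) \<notin> \<real>\<^sub>\<le>\<^sub>0"
proof
  assume "(u - t) / (u - a) \<in> \<real>\<^sub>\<le>\<^sub>0"
  then obtain r where r: "(u - t) / (u - a) = of_real r" "r \<le> 0" by (auto elim: nonpos_Reals_cases)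
  have ua: "u \<noteq> a" using assms by auto
  hence "u - t = of_real r * (u - a)" using r by (simp add: field_simps)
  hence e: "of_real (1 - r) * u = t - of_real r * a" by (simp add: algebra_simps)
  define s where "s = 1 / (1 - r)"
  have s: "0 \<le> s" "s \<le> 1" "s * (1 - r) = 1" "1 - s = s * (- r)" using r(2) by (auto simp: s_def field_simps)
  have "u = of_real (s * (1 - r)) * u" using s(3) by simp
  also have "\<dots> = of_real s * (of_real (1 - r) * u)" by simp
  also have "\<dots> = of_real (s * (- r)) * a + of_real s * t" unfolding e by (simp add: algebra_simps)
  also have "\<dots> = of_real (1 - s) * a + of_real s * t" by (simp only: s(4))
  finally have "u = (1 - s) *\<^sub>R a + s *\<^sub>R t" by (simp add: scaleR_conv_of_real)
  hence "u \<in> closed_segment a t" using s(1,2) unfolding closed_segment_def by blast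
  with assms show False by blast
qed

lemma Ln_quotient_derivatives:
  assumes "u \<notin> closed_segment a t"
  shows "((\<lambda>t. Ln ((u - t) / (u - a))) has_field_derivative - 1 / (u - t)) (at t)"
    and "(\<lambda>u. Ln ((u - t) / (u - a))) field_differentiable (at u)"
proof -
  note np = quotient_not_nonpos[OF assms]
  have ne: "u \<noteq> a" "u \<noteq> t" using assms by auto
  have "((\<lambda>t. (u - t) / (u - a)) has_field_derivative - 1 / (u - a)) (at t)"
    using DERIV_cdivide[OF DERIV_diff[OF DERIV_const[of u] DERIV_ident], of "u - a"] by simp
  from DERIV_chain2[OF has_field_derivative_Ln[OF np] this]
  show "((\<lambda>t. Ln ((u - t) / (u - a))) has_field_derivative - 1 / (u - t)) (at t)"
    using ne by (simp add: field_simps)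
  have "(\<lambda>u. (u - t) / (u - a)) field_differentiable (at u)"
    using ne by (intro derivative_intros) auto
  then obtain D where "((\<lambda>u. (u - t) / (u - a)) has_field_derivative D) (at u)"
    unfolding field_differentiable_def by blast
  from DERIV_chain2[OF has_field_derivative_Ln[OF np] this]
  show "(\<lambda>u. Ln ((u - t) / (u - a))) field_differentiable (at u)"
    unfolding field_differentiable_def by blast
qed

context disc_cover
begin

text \<open>The coefficients of \<open>form b\<close> and the derivatives of \<open>g\<close> change
  by the same factor under a transition, so one chart around each point decides.\<close>

lemma exactI:
  assumes "\<And>x. x \<in> topspace X \<Longrightarrow>
    \<exists>c\<in>maximal_atlas. x \<in> fst c \<and> has_dbar (g \<circ> chart_inv c) (form b c x) (snd c x)"
  shows "exact b"
  unfolding exact_def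
proof (rule exI[of _ g], intro ballI)
  fix e x assume e: "e \<in> maximal_atlas" "x \<in> fst e"
  then obtain c where c: "c \<in> maximal_atlas" "x \<in> fst c"
    and h: "has_dbar (g \<circ> chart_inv c) (form b c x) (snd c x)"
    using assms chartD(2)[OF e(1)] by blast
  have "has_dbar (\<lambda>z. (g \<circ> chart_inv c) (transition e c z)) (form b c x * cnj (jac e c x)) (snd e x)"
    by (rule has_dbar_comp_holomorphic[OF _ has_derivative_transition[OF e(1) c(1) e(2) c(2)]])
       (use h e in \<open>simp add: comp_def\<close>)
  hence "has_dbar (g \<circ> chart_inv e) (form b c x * cnj (jac e c x)) (snd e x)"
    by (rule has_dbar_eventually)
       (use eventually_chart[OF e(1) chartD(1)[OF c(1)] c(2) e(2)] c(1) in \<open>auto elim!: eventually_mono\<close>)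
  thus "has_dbar (g \<circ> chart_inv e) (form b e x) (snd e x)"
    using form_transition[OF e(1) c(1) e(2) c(2)] by simp
qed

end

text \<open>A bounded functional on (0,1)-forms that kills the exact ones. By Serre duality it
  should be integration against a holomorphic differential; here the differential is recovered
  directly from the values on Cauchy kernels.\<close>

locale form_functional = cutoff_cover X A n d \<rho> \<Psi> \<Psi>'
  for X :: "'a topology" and A n d \<rho> \<Psi> \<Psi>' +
  fixes \<Lambda> :: "(complex \<Rightarrow> complex) \<Rightarrow> complex" and C :: real
  assumes \<Lambda>_add: "\<And>b b'. admissible b \<Longrightarrow> admissible b' \<Longrightarrow> \<Lambda> (\<lambda>w. b w + b' w) = \<Lambda> b + \<Lambda> b'"
    and \<Lambda>_cmult: "\<And>k b. admissible b \<Longrightarrow> \<Lambda> (\<lambda>w. k * b w) = k * \<Lambda> b"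
    and \<Lambda>_bound: "\<And>b B. admissible b \<Longrightarrow> (\<And>w. norm (b w) \<le> B) \<Longrightarrow> norm (\<Lambda> b) \<le> C * B"
    and \<Lambda>_exact: "\<And>b. admissible b \<Longrightarrow> (\<And>w. b differentiable (at w)) \<Longrightarrow> exact b \<Longrightarrow> \<Lambda> b = 0"

context cutoff_cover
begin

text \<open>Nothing is asked inside the closed unit discs, where the kernels have their
  singularities.\<close>

definition regular :: "(complex \<Rightarrow> complex) \<Rightarrow> bool" where
  "regular q \<longleftrightarrow> (\<forall>u i. i < n \<longrightarrow> 1 < norm (u - ctr i) \<longrightarrow> norm (u - ctr i) < 3 \<longrightarrow> q differentiable (at u))"

lemma regular_admissible: "regular q \<Longrightarrow> admissible (Q q)"
  by (rule Q_admissible) (auto simp: regular_def)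

lemma regular_differentiable: "regular q \<Longrightarrow> Q q differentiable (at w)"
  by (rule Q_differentiable) (auto simp: regular_def)

lemma regular_add: "regular q \<Longrightarrow> regular q' \<Longrightarrow> regular (\<lambda>u. q u + q' u)"
  by (auto simp: regular_def)

lemma regular_cmult: "regular q \<Longrightarrow> regular (\<lambda>u. k * q u)"
  by (auto simp: regular_def)

lemma regular_sum: "finite I \<Longrightarrow> (\<And>k. k \<in> I \<Longrightarrow> regular (q k)) \<Longrightarrow> regular (\<lambda>u. \<Sum>k\<in>I. q k u)"
  by (induction I rule: finite_induct) (auto simp: regular_add, auto simp: regular_def)

definition on_disc :: "nat \<Rightarrow> (complex \<Rightarrow> complex) \<Rightarrow> complex \<Rightarrow> complex" where
  "on_disc i f u = (if norm (u - ctr i) < 3 then f u else 0)"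

lemma on_disc_has_dbar:
  assumes "norm (u - ctr i) < 3" "has_dbar f b u"
  shows "has_dbar (on_disc i f) b u"
  by (rule has_dbar_transform_open[OF assms(2) open_ball[of "ctr i" 3]])
     (use assms in \<open>auto simp: on_disc_def dist_norm norm_minus_commute\<close>)

lemma on_disc_has_dbar_0:
  assumes "norm (u - ctr j) < 3" "j \<noteq> i"
  shows "has_dbar (on_disc i f) 0 u"
proof (rule has_dbar_transform_open[OF has_dbar_const open_ball[of "ctr j" 3]])
  fix v assume "v \<in> ball (ctr j) 3"
  thus "0 = on_disc i f v" using ctr_far[OF assms(2), of v 3]
    by (auto simp: on_disc_def dist_norm norm_minus_commute)
qed (use assms in \<open>auto simp: dist_norm norm_minus_commute\<close>)

lemma regular_on_disc:
  assumes "\<And>u. 1 < norm (u - ctr i) \<Longrightarrow> norm (u - ctr i) < 3 \<Longrightarrow> f field_differentiable (at u)"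
  shows "regular (on_disc i f)"
  unfolding regular_def
proof (intro allI impI)
  fix u j assume u: "j < n" "1 < norm (u - ctr j)" "norm (u - ctr j) < 3"
  show "on_disc i f differentiable (at u)"
  proof (cases "j = i")
    case True
    have "has_dbar f 0 u" using assms[of u] u True by (simp add: has_dbar_0_iff)
    thus ?thesis using on_disc_has_dbar u True has_dbar_imp_differentiable by blast
  next
    case False
    thus ?thesis using on_disc_has_dbar_0[OF u(3) False] has_dbar_imp_differentiable by blast
  qed
qed

text \<open>A simple pole at \<open>w\<close> in the i-th disc. The class of
  \<open>Q (cauchy_part i w)\<close> modulo exact forms is the obstruction to a global function with
  this principal part.\<close>

definition cauchy_part :: "nat \<Rightarrow> complex \<Rightarrow> complex \<Rightarrow> complex" where
  "cauchy_part i w = on_disc i (\<lambda>u. 1 / (u - w))"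

text \<open>The logarithm of a local function with zero \<open>t\<close> and pole \<open>a\<close>;
  its derivative in \<open>t\<close> is minus the Cauchy kernel at \<open>t\<close>.\<close>

definition log_part :: "nat \<Rightarrow> complex \<Rightarrow> complex \<Rightarrow> complex \<Rightarrow> complex" where
  "log_part i a t = on_disc i (\<lambda>u. Ln ((u - t) / (u - a)))"

lemma segment_in_unit:
  assumes "a \<in> ball (ctr i) 1" "t \<in> ball (ctr i) 1" "1 < norm (u - ctr i)"
  shows "u \<notin> closed_segment a t"
proof
  assume "u \<in> closed_segment a t"
  hence "u \<in> ball (ctr i) 1" using closed_segment_subset[OF assms(1,2) convex_ball] by blast
  thus False using assms(3) by (simp add: dist_norm norm_minus_commute)
qed

lemma regular_cauchy_part: "w \<in> ball (ctr i) 1 \<Longrightarrow> regular (cauchy_part i w)"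
  unfolding cauchy_part_def
  by (rule regular_on_disc) (auto intro!: derivative_intros simp: dist_norm norm_minus_commute)

lemma regular_log_part: "a \<in> ball (ctr i) 1 \<Longrightarrow> t \<in> ball (ctr i) 1 \<Longrightarrow> regular (log_part i a t)"
  unfolding log_part_def
  by (rule regular_on_disc, rule Ln_quotient_derivatives(2), rule segment_in_unit)

end

context form_functional
begin

lemma \<Lambda>_Q_add: "regular q \<Longrightarrow> regular q' \<Longrightarrow> \<Lambda> (Q (\<lambda>u. q u + q' u)) = \<Lambda> (Q q) + \<Lambda> (Q q')"
proof -
  assume "regular q" "regular q'"
  from \<Lambda>_add[OF this[THEN regular_admissible]] have "\<Lambda> (\<lambda>w. Q q w + Q q' w) = \<Lambda> (Q q) + \<Lambda> (Q q')" .
  moreover have "Q (\<lambda>u. q u + q' u) = (\<lambda>w. Q q w + Q q' w)" by (rule ext) (rule Q_add)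
  ultimately show ?thesis by simp
qed

lemma \<Lambda>_Q_cmult: "regular q \<Longrightarrow> \<Lambda> (Q (\<lambda>u. k * q u)) = k * \<Lambda> (Q q)"
proof -
  assume "regular q"
  from \<Lambda>_cmult[OF this[THEN regular_admissible]] have "\<Lambda> (\<lambda>w. k * Q q w) = k * \<Lambda> (Q q)" .
  moreover have "Q (\<lambda>u. k * q u) = (\<lambda>w. k * Q q w)" by (rule ext) (rule Q_cmult)
  ultimately show ?thesis by simp
qed

lemma \<Lambda>_Q_sum:
  "finite I \<Longrightarrow> (\<And>k. k \<in> I \<Longrightarrow> regular (q k)) \<Longrightarrow> \<Lambda> (Q (\<lambda>u. \<Sum>k\<in>I. q k u)) = (\<Sum>k\<in>I. \<Lambda> (Q (q k)))"
proof (induction I rule: finite_induct)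
  case empty
  have "regular (\<lambda>_. 0)" by (simp add: regular_def)
  from \<Lambda>_Q_cmult[OF this, of 0] show ?case by simp
next
  case (insert k I)
  have "\<Lambda> (Q (\<lambda>u. q k u + (\<Sum>k\<in>I. q k u))) = \<Lambda> (Q (q k)) + \<Lambda> (Q (\<lambda>u. \<Sum>k\<in>I. q k u))"
    by (rule \<Lambda>_Q_add) (use insert regular_sum in auto)
  thus ?case using insert by simp
qed

text \<open>Both \<open>\<Lambda>\<close> and \<open>Q\<close> are linear and bounded, so a
  quadratic Taylor estimate that is uniform on the annuli passes to the values of the
  functional.\<close>

lemma \<Lambda>_Q_derivative:
  assumes r: "0 < r" and reg: "\<And>w. norm (w - w0) < r \<Longrightarrow> regular (q w)" and q': "regular q'"
    and K: "\<And>w u. norm (w - w0) < r \<Longrightarrow> u \<in> annuli \<Longrightarrow>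
      norm (q w u - q w0 u - (w - w0) * q' u) \<le> K * (norm (w - w0))\<^sup>2"
  shows "((\<lambda>w. \<Lambda> (Q (q w))) has_field_derivative \<Lambda> (Q q')) (at w0)"
proof -
  obtain CQ where CQ: "0 < CQ"
    "\<And>q B w. 0 \<le> B \<Longrightarrow> (\<And>u. u \<in> annuli \<Longrightarrow> norm (q u) \<le> B) \<Longrightarrow> norm (Q q w) \<le> CQ * B"
    by (rule Q_bound_annuli) blast
  show ?thesis
  proof (rule quadratic_imp_has_field_derivative[OF r, of _ _ _ "C * (CQ * \<bar>K\<bar>)"])
    fix w assume w: "norm (w - w0) < r"
    define p where "p = (\<lambda>u. q w u + ((-1) * q w0 u + (- (w - w0)) * q' u))"
    have rw: "regular (q w)" "regular (q w0)" using reg[OF w] reg[of w0] r by simp_all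
    have "\<Lambda> (Q p) = \<Lambda> (Q (q w)) + ((-1) * \<Lambda> (Q (q w0)) + (- (w - w0)) * \<Lambda> (Q q'))"
      unfolding p_def
        \<Lambda>_Q_add[OF rw(1) regular_add[OF regular_cmult[OF rw(2)] regular_cmult[OF q']]]
        \<Lambda>_Q_add[OF regular_cmult[OF rw(2)] regular_cmult[OF q']]
        \<Lambda>_Q_cmult[OF rw(2)] \<Lambda>_Q_cmult[OF q'] ..
    hence "\<Lambda> (Q p) = \<Lambda> (Q (q w)) - \<Lambda> (Q (q w0)) - (w - w0) * \<Lambda> (Q q')"
      by (simp add: algebra_simps)
    moreover have "norm (\<Lambda> (Q p)) \<le> C * (CQ * (\<bar>K\<bar> * (norm (w - w0))\<^sup>2))"
    proof (rule \<Lambda>_bound)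
      show "admissible (Q p)" unfolding p_def
        by (intro regular_admissible regular_add regular_cmult rw q')
      show "norm (Q p v) \<le> CQ * (\<bar>K\<bar> * (norm (w - w0))\<^sup>2)" for v
      proof (rule CQ(2))
        fix u assume "u \<in> annuli"
        have "p u = q w u - q w0 u - (w - w0) * q' u" by (simp add: p_def algebra_simps)
        thus "norm (p u) \<le> \<bar>K\<bar> * (norm (w - w0))\<^sup>2"
          using K[OF w \<open>u \<in> annuli\<close>] by (auto intro: order.trans[OF _ mult_right_mono])
      qed simp
    qed
    ultimately show "norm (\<Lambda> (Q (q w)) - \<Lambda> (Q (q w0)) - (w - w0) * \<Lambda> (Q q')) \<le> C * (CQ * \<bar>K\<bar>) * (norm (w - w0))\<^sup>2"
      by (simp add: mult.assoc)
  qed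
qed

definition \<theta> :: "nat \<Rightarrow> complex \<Rightarrow> complex" where
  "\<theta> i w = \<Lambda> (Q (cauchy_part i w))"

lemma log_part_derivative:
  assumes i: "i < n" and a: "a \<in> ball (ctr i) 1" and t0: "t0 \<in> ball (ctr i) 1"
  shows "((\<lambda>t. \<Lambda> (Q (log_part i a t))) has_field_derivative - \<theta> i t0) (at t0)"
proof -
  obtain r where r: "0 < r" "ball t0 r \<subseteq> ball (ctr i) 1" using t0 open_ball by (meson openE)
  have inr: "t \<in> ball (ctr i) 1" if "norm (t - t0) < r" for t
    using r(2) that by (auto simp: dist_norm norm_minus_commute subset_iff)
  have "((\<lambda>t. \<Lambda> (Q (log_part i a t))) has_field_derivative \<Lambda> (Q (\<lambda>u. (-1) * cauchy_part i t0 u))) (at t0)"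
  proof (rule \<Lambda>_Q_derivative[OF r(1), where K = 4])
    show "regular (log_part i a w)" if "norm (w - t0) < r" for w
      by (rule regular_log_part[OF a inr[OF that]])
    show "regular (\<lambda>u. (-1) * cauchy_part i t0 u)"
      by (intro regular_cmult regular_cauchy_part t0)
    fix t u assume t: "norm (t - t0) < r" and u: "u \<in> annuli"
    show "norm (log_part i a t u - log_part i a t0 u - (t - t0) * ((-1) * cauchy_part i t0 u)) \<le> 4 * (norm (t - t0))\<^sup>2"
    proof (cases "norm (u - ctr i) < 3")
      case False
      thus ?thesis by (simp add: log_part_def cauchy_part_def on_disc_def)
    next
      case True
      obtain j where j: "j < n" "3/2 < norm (u - ctr j)" "norm (u - ctr j) < 2"
        using u by (auto simp: annuli_def)
      have "j = i" using ctr_far[of j i u 2] j True by force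
      hence u1: "3/2 < norm (u - ctr i)" using j by simp
      \<comment> \<open>The logarithm minus its linear part at \<open>t0\<close>. Along the segment
        its derivative is at most \<open>4 * norm (t - t0)\<close>, because all points keep distance
        1/2 from \<open>u\<close>; integrating once more gives the quadratic bound with constant
        4.\<close>
      define \<phi> where "\<phi> = (\<lambda>s. Ln ((u - s) / (u - a)) - (s - t0) * (- 1 / (u - t0)))"
      let ?S = "closed_segment t0 t"
      have S: "s \<in> ball (ctr i) 1" if "s \<in> ?S" for s
        using closed_segment_subset[OF t0 inr[OF t] convex_ball] that by blast
      have far: "1/2 < norm (u - s)" if "s \<in> ball (ctr i) 1" for s
        using that u1 norm_triangle_ineq[of "u - s" "s - ctr i"] by (simp add: dist_norm norm_minus_commute)
      have "norm (\<phi> t - \<phi> t0) \<le> (4 * norm (t - t0)) * norm (t - t0)"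
      proof (rule field_differentiable_bound[of ?S \<phi> "\<lambda>s. - 1 / (u - s) - (- 1 / (u - t0))"])
        show "convex ?S" by simp
        show "(\<phi> has_field_derivative - 1 / (u - s) - - 1 / (u - t0)) (at s within ?S)" if s: "s \<in> ?S" for s
        proof -
          have "((\<lambda>t. Ln ((u - t) / (u - a))) has_field_derivative - 1 / (u - s)) (at s)"
            by (rule Ln_quotient_derivatives(1)[OF segment_in_unit[OF a S[OF s]]]) (use u1 in simp)
          moreover have "((\<lambda>s. (s - t0) * (- 1 / (u - t0))) has_field_derivative - 1 / (u - t0)) (at s)"
            using DERIV_cmult_right[OF DERIV_diff[OF DERIV_ident DERIV_const[of t0]], of "- 1 / (u - t0)" s] by simp
          ultimately show ?thesis unfolding \<phi>_def
            by (rule has_field_derivative_at_within[OF DERIV_diff])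
        qed
        show "norm (- 1 / (u - s) - - 1 / (u - t0)) \<le> 4 * norm (t - t0)" if s: "s \<in> ?S" for s
        proof -
          note fs = far[OF S[OF s]] and f0 = far[OF t0]
          have "- 1 / (u - s) - - 1 / (u - t0) = (t0 - s) / ((u - s) * (u - t0))"
          proof -
            have "norm (u - s) \<noteq> 0" "norm (u - t0) \<noteq> 0" using fs f0 by linarith+
            hence ne: "u - s \<noteq> 0" "u - t0 \<noteq> 0" by auto
            show ?thesis unfolding diff_frac_eq[OF ne] by simp
          qed
          also have "norm \<dots> \<le> norm (t - t0) / ((1/2) * (1/2))"
            unfolding norm_divide norm_mult
            using segment_bound1[OF s] fs f0 by (intro frac_le mult_mono) (auto simp: norm_minus_commute)
          finally show ?thesis by simp
        qed
      qed auto
      thus ?thesis using True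
        by (simp add: \<phi>_def log_part_def cauchy_part_def on_disc_def power2_eq_square algebra_simps)
    qed
  qed
  also have "\<Lambda> (Q (\<lambda>u. (-1) * cauchy_part i t0 u)) = - \<theta> i t0"
    unfolding \<Lambda>_Q_cmult[OF regular_cauchy_part[OF t0]] \<theta>_def by simp
  finally show ?thesis .
qed

text \<open>\<open>\<theta> i\<close> is minus the derivative of a function that is complex
  differentiable throughout the disc, so no derivative of the Cauchy kernel has to be
  estimated.\<close>

lemma \<theta>_holomorphic:
  assumes i: "i < n" shows "\<theta> i holomorphic_on ball (ctr i) 1"
proof -
  define G where "G = (\<lambda>t. \<Lambda> (Q (log_part i (ctr i) t)))"
  have D: "(G has_field_derivative - \<theta> i t) (at t)" if "t \<in> ball (ctr i) 1" for t
    unfolding G_def by (rule log_part_derivative[OF i _ that]) simp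
  hence "G holomorphic_on ball (ctr i) 1" unfolding holomorphic_on_open[OF open_ball] by blast
  hence "(\<lambda>t. - deriv G t) holomorphic_on ball (ctr i) 1" by (intro holomorphic_intros holomorphic_deriv) auto
  thus ?thesis by (rule holomorphic_transform) (use DERIV_imp_deriv[OF D] in auto)
qed

end


text \<open>A simple pole expressed in two coordinates differs by a holomorphic function once the
  residue is scaled by the derivative of the coordinate change. \<open>T\<close> is the difference
  quotient of \<tau>, \<open>N\<close> that of \<open>T\<close>, and the required function is
  \<open>N / T\<close>.\<close>

lemma pole_transformation:
  fixes \<tau> :: "complex \<Rightarrow> complex"
  assumes S: "open S" "w \<in> S" "\<tau> holomorphic_on S" and inj: "inj_on \<tau> S" and d: "deriv \<tau> w \<noteq> 0"
  shows "\<exists>h. h holomorphic_on S \<and> (\<forall>z\<in>S - {w}. h z = 1 / (z - w) - deriv \<tau> w / (\<tau> z - \<tau> w))"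
proof -
  define T where "T = (\<lambda>z. if z = w then deriv \<tau> w else (\<tau> z - \<tau> w) / (z - w))"
  have int: "w \<in> interior S" using S by (simp add: interior_open)
  have T: "T holomorphic_on S" unfolding T_def by (rule pole_lemma[OF S(3) int])
  define N where "N = (\<lambda>z. if z = w then deriv T w else (T z - T w) / (z - w))"
  have N: "N holomorphic_on S" unfolding N_def by (rule pole_lemma[OF T int])
  have T0: "T z \<noteq> 0" if "z \<in> S" for z
    using that d inj_onD[OF inj, of z w] S(2) by (auto simp: T_def)
  show ?thesis
  proof (intro exI[of _ "\<lambda>z. N z / T z"] conjI ballI)
    show "(\<lambda>z. N z / T z) holomorphic_on S" using N T T0 by (intro holomorphic_intros) auto
    fix z assume z: "z \<in> S - {w}"
    have ne: "\<tau> z - \<tau> w \<noteq> 0" "z - w \<noteq> 0" using z inj_onD[OF inj, of z w] S(2) by auto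
    have "N z / T z = ((\<tau> z - \<tau> w) / (z - w) - deriv \<tau> w) / (z - w) / ((\<tau> z - \<tau> w) / (z - w))"
      using z by (simp add: N_def T_def)
    also have "\<dots> = 1 / (z - w) - deriv \<tau> w / (\<tau> z - \<tau> w)"
      using ne by (simp add: divide_simps)
    finally show "N z / T z = 1 / (z - w) - deriv \<tau> w / (\<tau> z - \<tau> w)" .
  qed
qed

context cutoff_cover
begin

lemma cut'_zero:
  assumes "i < n" "norm (w - ctr i) \<le> 3/2" shows "\<Psi>' w = 0"
proof (rule ccontr)
  assume "\<Psi>' w \<noteq> 0"
  then obtain k where k: "k < n" "3/2 < norm (w - ctr k)" "norm (w - ctr k) < 2"
    using cut'_support by blast
  thus False using ctr_far[of i k w "3/2"] assms by (cases "k = i") auto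
qed

lemma push_on_disc:
  assumes "i < n" and "\<And>u. 2 \<le> norm (u - ctr i) \<Longrightarrow> f u = 0"
  shows "push (on_disc i f) x = (if x \<in> fst (d i) then f (snd (d i) x) else 0)"
proof -
  have "push (on_disc i f) x = (\<Sum>j<n. if j = i then (if x \<in> fst (d i) then f (snd (d i) x) else 0) else 0)"
    unfolding push_def
  proof (rule sum.cong[OF refl])
    fix j assume "j \<in> {..<n}"
    hence j: "j < n" by simp
    show "(if x \<in> fst (d j) then on_disc i f (snd (d j) x) else 0) =
        (if j = i then (if x \<in> fst (d i) then f (snd (d i) x) else 0) else 0)"
    proof (cases "j = i")
      case True
      thus ?thesis using disc_range[OF assms(1), of x] by (auto simp: on_disc_def)
    next
      case False
      have "on_disc i f (snd (d j) x) = 0" if "x \<in> fst (d j)"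
        using ctr_far[OF False, of "snd (d j) x" 3] disc_range[OF j that] by (auto simp: on_disc_def)
      thus ?thesis using False by auto
    qed
  qed
  thus ?thesis using assms(1) by simp
qed

lemma disc_point_unique:
  assumes "i < n" "j < n" "x \<in> fst (d i)" "y \<in> fst (d j)" "snd (d i) x = snd (d j) y"
  shows "i = j \<and> x = y"
proof -
  have "i = j"
    using ctr_far[of i j "snd (d i) x" 3] disc_range[OF assms(1,3)] disc_range[OF assms(2,4)] assms(5)
    by (cases "i = j") auto
  thus ?thesis using inj_onD[OF chartD(3)[OF disc_chart[OF assms(1)]]] assms by simp
qed

text \<open>The two Cauchy kernels describe the same principal part at \<open>x\<close>, with the
  residue scaled by \<open>jac\<close>. Their cut-off difference is therefore a function on the
  whole surface with a removable singularity at \<open>x\<close>, and its dbar-derivative is the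
  form of \<open>\<Psi>' u * q u\<close>.\<close>

lemma exact_cauchy_parts:
  assumes i: "i < n" and j: "j < n" and x: "x \<in> fst (d i)" "x \<in> fst (d j)"
    and near: "norm (snd (d i) x - ctr i) < 1" "norm (snd (d j) x - ctr j) < 1"
  shows "exact (Q (\<lambda>u. cauchy_part i (snd (d i) x) u + (- jac (d i) (d j) x) * cauchy_part j (snd (d j) x) u))"
    (is "exact (Q ?q)")
proof -
  define w w' J where "w = snd (d i) x" and "w' = snd (d j) x" and "J = jac (d i) (d j) x"
  define \<tau> where "\<tau> = transition (d i) (d j)"
  define O' where "O' = snd (d i) ` (fst (d i) \<inter> fst (d j))"
  note dM = disc_chart[OF i] disc_chart[OF j]
  have q: "?q = (\<lambda>u. cauchy_part i w u + (- J) * cauchy_part j w' u)" by (simp add: w_def w'_def J_def)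
  have O': "open O'" "w \<in> O'" using open_chart_overlap[OF dM] x by (auto simp: O'_def w_def)
  have \<tau>w: "\<tau> w = w'" using x dM by (simp add: \<tau>_def w_def w'_def)
  have dJ: "deriv \<tau> w = J" by (simp add: \<tau>_def w_def J_def jac_def)
  have \<tau>hol: "\<tau> holomorphic_on O'" unfolding \<tau>_def O'_def by (rule holomorphic_transition[OF dM])
  have \<tau>inj: "inj_on \<tau> O'"
  proof (rule inj_onI)
    fix a b assume ab: "a \<in> O'" "b \<in> O'" "\<tau> a = \<tau> b"
    then obtain y y' where y: "y \<in> fst (d i)" "y \<in> fst (d j)" "a = snd (d i) y"
      "y' \<in> fst (d i)" "y' \<in> fst (d j)" "b = snd (d i) y'" by (auto simp: O'_def)
    hence "snd (d j) y = snd (d j) y'" using ab(3) dM by (simp add: \<tau>_def)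
    hence "y = y'" using y inj_onD[OF chartD(3)[OF dM(2)]] by blast
    thus "a = b" using y by simp
  qed
  have "J \<noteq> 0" unfolding J_def by (rule jac_nonzero[OF dM x])
  then obtain h where h: "h holomorphic_on O'" "\<And>z. z \<in> O' - {w} \<Longrightarrow> h z = 1 / (z - w) - J / (\<tau> z - w')"
    using pole_transformation[OF O' \<tau>hol \<tau>inj] unfolding dJ \<tau>w by blast
  define v where "v = (\<lambda>u. \<Psi> u * (cauchy_part i w u + (- J) * cauchy_part j w' u))"
  \<comment> \<open>Near \<open>x\<close> both cutoffs are 1 and \<open>push v\<close> is the
    function \<open>h\<close> of \<open>pole_transformation\<close>, whose value fills the removable
    singularity.\<close>
  define g where "g = (\<lambda>y. if y = x then h w else push v y)"
  have xX: "x \<in> topspace X" using disc_topspace[OF i x(1)] .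
  have supp: "v u = 0" if "\<And>k. k < n \<Longrightarrow> 2 < norm (u - ctr k)" for u
    using cut_zero[of u] that by (simp add: v_def less_imp_le)
  have pv: "push v y = (if y \<in> fst (d i) then \<Psi> (snd (d i) y) / (snd (d i) y - w) else 0) +
      (- J) * (if y \<in> fst (d j) then \<Psi> (snd (d j) y) / (snd (d j) y - w') else 0)" for y
  proof -
    have z: "\<Psi> u = 0" if k: "k < n" "norm (u - ctr k) < 3" "2 \<le> norm (u - ctr k)" for u k
    proof (rule cut_zero)
      fix l assume "l < n"
      show "2 \<le> norm (u - ctr l)" using ctr_far[of k l u 3] k by (cases "l = k") auto
    qed
    have eq: "v u = on_disc i (\<lambda>u. if norm (u - ctr i) < 2 then \<Psi> u / (u - w) else 0) u +
        (- J) * on_disc j (\<lambda>u. if norm (u - ctr j) < 2 then \<Psi> u / (u - w') else 0) u" for u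
      unfolding v_def cauchy_part_def using z[OF i, of u] z[OF j, of u]
      by (auto simp: on_disc_def algebra_simps)
    have "push v y = push (on_disc i (\<lambda>u. if norm (u - ctr i) < 2 then \<Psi> u / (u - w) else 0)) y +
        (- J) * push (on_disc j (\<lambda>u. if norm (u - ctr j) < 2 then \<Psi> u / (u - w') else 0)) y"
      unfolding push_def sum_distrib_left sum.distrib[symmetric] by (rule sum.cong) (auto simp: eq)
    thus ?thesis
      using z[OF i disc_range[OF i]] z[OF j disc_range[OF j]]
      by (subst (asm) push_on_disc[OF i], simp, subst (asm) push_on_disc[OF j], simp) (auto simp: not_less)
  qed
  have "exact (\<lambda>u. \<Psi>' u * ?q u)"
  proof (rule exactI[of g])
    fix y assume y: "y \<in> topspace X"
    show "\<exists>c\<in>maximal_atlas. y \<in> fst c \<and> has_dbar (g \<circ> chart_inv c) (form (\<lambda>u. \<Psi>' u * ?q u) c y) (snd c y)"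
    proof (cases "y = x")
      case False
      obtain c where c: "c \<in> maximal_atlas" "y \<in> fst c" using atlas_covers[OF y] atlas_subset by blast
      have "has_dbar (push v \<circ> chart_inv c) (form (\<lambda>u. \<Psi>' u * ?q u) c y) (snd c y)"
      proof (rule push_has_dbar[OF c supp])
        fix k assume k: "k < n" "y \<in> fst (d k)"
        let ?u = "snd (d k) y"
        have part: "has_dbar (cauchy_part l (snd (d l) x)) 0 ?u" if l: "l < n" "x \<in> fst (d l)" for l
        proof (cases "k = l")
          case True
          have "?u \<noteq> snd (d l) x" using disc_point_unique[OF k(1) l(1) k(2) l(2)] False by blast
          hence "(\<lambda>u. 1 / (u - snd (d l) x)) field_differentiable (at ?u)"
            by (intro derivative_intros) auto
          thus ?thesis unfolding cauchy_part_def
            using disc_range[OF k] True by (intro on_disc_has_dbar) (auto simp: has_dbar_0_iff)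
        next
          case kl: False
          show ?thesis unfolding cauchy_part_def by (rule on_disc_has_dbar_0[OF disc_range[OF k] kl])
        qed
        have "has_dbar ?q (0 + (- J) * 0) ?u" unfolding J_def
          by (intro has_dbar_add has_dbar_cmult part i j x)
        from has_dbar_mult[OF cut_dbar this] show "has_dbar v (\<Psi>' ?u * ?q ?u) ?u"
          by (simp add: v_def w_def w'_def J_def)
      qed
      moreover have "eventually (\<lambda>z. chart_inv c z \<in> topspace X - {x}) (nhds (snd c y))"
      proof -
        have "openin X (topspace X - {x})"
          using closedin_Hausdorff_singleton[OF Hausdorff xX] by blast
        from eventually_chart[OF c(1) this _ c(2)] show ?thesis
          using False y by (auto elim: eventually_mono)
      qed
      hence "eventually (\<lambda>z. (push v \<circ> chart_inv c) z = (g \<circ> chart_inv c) z) (nhds (snd c y))"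
        by (rule eventually_mono) (simp add: g_def)
      ultimately have "has_dbar (g \<circ> chart_inv c) (form (\<lambda>u. \<Psi>' u * ?q u) c y) (snd c y)"
        by (rule has_dbar_eventually)
      thus ?thesis using c by blast
    next
      case True
      have "has_dbar (g \<circ> chart_inv (d i)) 0 w"
      proof (rule has_dbar_eventually[OF holomorphic_imp_has_dbar_0[OF h(1) O']])
        have e1: "eventually (\<lambda>z. z \<in> O') (nhds w)" using O' by (rule eventually_nhds_in_open)
        have e2: "eventually (\<lambda>z. norm (z - ctr i) < 1) (nhds w)"
          using eventually_nhds_in_open[of "ball (ctr i) 1" w] near(1)
          by (simp add: w_def dist_norm norm_minus_commute)
        have ct: "(\<tau> \<longlongrightarrow> \<tau> w) (nhds w)"
          using holomorphic_on_imp_continuous_on[OF \<tau>hol] O'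
          by (simp add: continuous_on_eq_continuous_at isCont_def tendsto_nhds_iff)
        have e3: "eventually (\<lambda>z. norm (\<tau> z - ctr j) < 1) (nhds w)"
          using topological_tendstoD[OF ct, of "ball (ctr j) 1"] near(2)
          by (simp add: \<tau>w w'_def dist_norm norm_minus_commute)
        show "\<forall>\<^sub>F z in nhds w. h z = (g \<circ> chart_inv (d i)) z"
          using e1 e2 e3
        proof eventually_elim
          case (elim z)
          then obtain y where y: "y \<in> fst (d i)" "y \<in> fst (d j)" "z = snd (d i) y" by (auto simp: O'_def)
          have cz: "chart_inv (d i) z = y" using y dM by simp
          have tz: "\<tau> z = snd (d j) y" by (simp add: \<tau>_def cz)
          show ?case
          proof (cases "y = x")
            case True
            thus ?thesis unfolding comp_apply cz using y(3) by (simp add: g_def w_def)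
          next
            case False
            have "z \<noteq> w" using False disc_point_unique[OF i i y(1) x(1)] y(3) by (auto simp: w_def)
            moreover have "\<Psi> z = 1" using elim by (intro cut_one[OF i]) simp
            moreover have "\<Psi> (\<tau> z) = 1" using elim by (intro cut_one[OF j]) simp
            moreover have "push v y = \<Psi> z / (z - w) + (- J) * (\<Psi> (\<tau> z) / (\<tau> z - w'))"
              using y(1,2) tz unfolding pv y(3) by simp
            ultimately show ?thesis unfolding comp_apply cz using False h(2)[of z] elim
              by (simp add: g_def)
          qed
        qed
      qed
      moreover have "form (\<lambda>u. \<Psi>' u * ?q u) (d i) x = 0"
        unfolding form_def
      proof (rule sum.neutral, intro ballI)
        fix k assume "k \<in> {..<n}"
        hence k: "k < n" by simp
        have "\<Psi>' (snd (d k) x) * ?q (snd (d k) x) = 0" if xk: "x \<in> fst (d k)"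
        proof (cases "k = i \<or> k = j")
          case True
          hence "\<Psi>' (snd (d k) x) = 0" using near by (auto intro!: cut'_zero[OF k])
          thus ?thesis by simp
        next
          case False
          hence "on_disc i f (snd (d k) x) = 0" "on_disc j f (snd (d k) x) = 0" for f
            using ctr_far[of k i "snd (d k) x" 3] ctr_far[of k j "snd (d k) x" 3] disc_range[OF k xk]
            by (auto simp: on_disc_def)
          thus ?thesis by (simp add: cauchy_part_def)
        qed
        thus "(if x \<in> fst (d k) then \<Psi>' (snd (d k) x) * ?q (snd (d k) x) * cnj (jac (d i) (d k) x) else 0) = 0" by simp
      qed
      ultimately show ?thesis using True x dM unfolding w_def by auto
    qed
  qed
  thus ?thesis by (simp add: exact_Q_iff)
qed

end

context form_functional
begin

lemma \<theta>_transition: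
  assumes i: "i < n" and j: "j < n" and x: "x \<in> fst (d i)" "x \<in> fst (d j)"
    and near: "norm (snd (d i) x - ctr i) < 1" "norm (snd (d j) x - ctr j) < 1"
  shows "\<theta> i (snd (d i) x) = \<theta> j (snd (d j) x) * jac (d i) (d j) x"
proof -
  have r: "regular (cauchy_part i (snd (d i) x))" "regular (cauchy_part j (snd (d j) x))"
    using near by (auto intro!: regular_cauchy_part simp: dist_norm norm_minus_commute)
  have "regular (\<lambda>u. cauchy_part i (snd (d i) x) u + (- jac (d i) (d j) x) * cauchy_part j (snd (d j) x) u)"
    by (intro regular_add regular_cmult r)
  from \<Lambda>_exact[OF regular_admissible[OF this] regular_differentiable[OF this] exact_cauchy_parts[OF assms]]
  have "0 = \<theta> i (snd (d i) x) + (- jac (d i) (d j) x) * \<theta> j (snd (d j) x)"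
    unfolding \<Lambda>_Q_add[OF r(1) regular_cmult[OF r(2)]] \<Lambda>_Q_cmult[OF r(2)] \<theta>_def by simp
  thus ?thesis by (simp add: mult.commute)
qed

definition small_disc :: "nat \<Rightarrow> 'a set" where
  "small_disc i = {x \<in> fst (d i). snd (d i) x \<in> ball (ctr i) 1}"

definition home :: "'a \<Rightarrow> nat" where
  "home x = (SOME i. i < n \<and> x \<in> small_disc i)"

lemma home: "x \<in> topspace X \<Longrightarrow> home x < n \<and> x \<in> small_disc (home x)"
proof -
  assume "x \<in> topspace X"
  hence "\<exists>i. i < n \<and> x \<in> small_disc i" using disc_covers unfolding small_disc_def by blast
  thus ?thesis unfolding home_def by (rule someI_ex)
qed

text \<open>The disc \<open>home x\<close> is an arbitrary choice;
  \<open>\<theta>_transition\<close> shows that every small disc around the point gives the same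
  coefficient.\<close>

definition \<omega> :: "'a chart \<Rightarrow> complex \<Rightarrow> complex" where
  "\<omega> c z = (let x = chart_inv c z; i = home x in \<theta> i (snd (d i) x) * jac c (d i) x)"

lemma \<omega>_eq:
  assumes c: "c \<in> maximal_atlas" "x \<in> fst c" and i: "i < n" "x \<in> small_disc i"
  shows "\<omega> c (snd c x) = \<theta> i (snd (d i) x) * jac c (d i) x"
proof -
  define k where "k = home x"
  have k: "k < n" "x \<in> small_disc k" using home[of x] chartD(2)[OF c(1)] c(2) by (auto simp: k_def)
  have x: "x \<in> fst (d i)" "x \<in> fst (d k)" using i k by (auto simp: small_disc_def)
  have "\<theta> i (snd (d i) x) = \<theta> k (snd (d k) x) * jac (d i) (d k) x"
    by (rule \<theta>_transition[OF i(1) k(1) x])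
       (use i k in \<open>auto simp: small_disc_def dist_norm norm_minus_commute\<close>)
  moreover have "jac c (d k) x = jac (d i) (d k) x * jac c (d i) x"
    by (rule jac_chain[OF c(1) disc_chart[OF i(1)] disc_chart[OF k(1)] c(2) x])
  ultimately show ?thesis using c by (simp add: \<omega>_def k_def[symmetric] Let_def)
qed

lemma openin_small_disc: "i < n \<Longrightarrow> openin X (small_disc i)"
  unfolding small_disc_def by (rule chartD(5)[OF disc_chart open_ball])

lemma \<omega>_holomorphic_differential: "holomorphic_differential A \<omega>"
  unfolding holomorphic_differential_def
proof (intro conjI ballI)
  fix c assume "c \<in> A"
  hence cM: "c \<in> maximal_atlas" using atlas_subset by blast
  show "\<omega> c holomorphic_on snd c ` fst c"
    unfolding holomorphic_on_def
  proof
    fix z assume "z \<in> snd c ` fst c"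
    then obtain x where x: "x \<in> fst c" "z = snd c x" by auto
    then obtain i where i: "i < n" "x \<in> small_disc i" using home chartD(2)[OF cM] by blast
    note dM = disc_chart[OF i(1)]
    have xd: "x \<in> fst (d i)" "snd (d i) x \<in> ball (ctr i) 1" using i by (auto simp: small_disc_def)
    have O': "open (snd c ` (fst c \<inter> fst (d i)))" by (rule open_chart_overlap[OF cM dM])
    have "deriv (transition c (d i)) holomorphic_on snd c ` (fst c \<inter> fst (d i))"
      by (rule holomorphic_deriv[OF holomorphic_transition[OF cM dM] O'])
    hence 1: "deriv (transition c (d i)) field_differentiable at z"
      by (rule holomorphic_on_imp_differentiable_at[OF _ O']) (use x xd in auto)
    have "\<theta> i field_differentiable at (transition c (d i) z)"
      by (rule holomorphic_on_imp_differentiable_at[OF \<theta>_holomorphic[OF i(1)] open_ball])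
         (use x xd cM in simp)
    moreover have "transition c (d i) field_differentiable at z"
      unfolding x(2) by (rule transition_differentiable[OF cM dM x(1) xd(1)])
    ultimately have 2: "(\<theta> i \<circ> transition c (d i)) field_differentiable at z"
      by (intro field_differentiable_compose)
    have "(\<lambda>z. (\<theta> i \<circ> transition c (d i)) z * deriv (transition c (d i)) z) field_differentiable at z"
      by (intro field_differentiable_mult 1 2)
    then obtain D where D: "((\<lambda>z. (\<theta> i \<circ> transition c (d i)) z * deriv (transition c (d i)) z) has_field_derivative D) (at z)"
      unfolding field_differentiable_def by blast
    have "(\<omega> c has_field_derivative D) (at z)"
    proof (rule has_field_derivative_transform_within_open[OF D])
      show "open (snd c ` (small_disc i \<inter> fst c))"
        by (rule open_chart_image[OF maximal_chart[OF cM] openin_small_disc[OF i(1)]])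
      show "z \<in> snd c ` (small_disc i \<inter> fst c)" using x i by auto
      fix z' assume "z' \<in> snd c ` (small_disc i \<inter> fst c)"
      then obtain y where y: "y \<in> small_disc i" "y \<in> fst c" "z' = snd c y" by auto
      show "(\<theta> i \<circ> transition c (d i)) z' * deriv (transition c (d i)) z' = \<omega> c z'"
        using \<omega>_eq[OF cM y(2) i(1) y(1)] y cM by (simp add: jac_def)
    qed
    thus "\<omega> c field_differentiable at z within snd c ` fst c"
      unfolding field_differentiable_def using has_field_derivative_at_within by blast
  qed
  fix e z assume "e \<in> A" and z: "z \<in> snd c ` (fst c \<inter> fst e)"
  hence eM: "e \<in> maximal_atlas" using atlas_subset by blast
  obtain x where x: "x \<in> fst c" "x \<in> fst e" "z = snd c x" using z by auto
  then obtain i where i: "i < n" "x \<in> small_disc i" using home chartD(2)[OF cM] by blast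
  have xd: "x \<in> fst (d i)" using i by (auto simp: small_disc_def)
  show "\<omega> c z = \<omega> e (transition c e z) * deriv (transition c e) z"
    using \<omega>_eq[OF cM x(1) i] \<omega>_eq[OF eM x(2) i] jac_chain[OF cM eM disc_chart[OF i(1)] x(1,2) xd] x cM
    by (simp add: jac_def)
qed

lemma \<omega>_primitive:
  assumes i: "i < n" and a: "a \<in> ball (ctr i) 1"
  shows "primitive_on A \<omega> (small_disc i) (\<lambda>x. - \<Lambda> (Q (log_part i a (snd (d i) x))))"
  unfolding primitive_on_def
proof (intro ballI)
  fix c x assume "c \<in> A" and x: "x \<in> small_disc i \<inter> fst c"
  hence cM: "c \<in> maximal_atlas" using atlas_subset by blast
  have xd: "x \<in> fst (d i)" "snd (d i) x \<in> ball (ctr i) 1" "x \<in> fst c" using x by (auto simp: small_disc_def)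
  have "((\<lambda>t. - \<Lambda> (Q (log_part i a t))) has_field_derivative \<theta> i (snd (d i) x)) (at (transition c (d i) (snd c x)))"
    using DERIV_minus[OF log_part_derivative[OF i a xd(2)]] xd(3) cM by simp
  from DERIV_chain[OF this has_derivative_transition[OF cM disc_chart[OF i] xd(3,1)]]
  have "((\<lambda>t. - \<Lambda> (Q (log_part i a t))) \<circ> transition c (d i) has_field_derivative
      \<theta> i (snd (d i) x) * jac c (d i) x) (at (snd c x))" .
  thus "((\<lambda>x. - \<Lambda> (Q (log_part i a (snd (d i) x)))) \<circ> chart_inv c has_field_derivative \<omega> c (snd c x)) (at (snd c x))"
    using \<omega>_eq[OF cM xd(3) i] x by (simp add: comp_def)
qed

end


section \<open>Integration along paths\<close>

lemma pathin_near:
  assumes "pathin X g" "t \<in> {0..1}" "openin X W" "g t \<in> W"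
  obtains e where "0 < e" "\<And>s. s \<in> {0..1} \<Longrightarrow> \<bar>s - t\<bar> < e \<Longrightarrow> g s \<in> W"
proof -
  have "openin (top_of_set {0..1::real}) {s \<in> topspace (top_of_set {0..1}). g s \<in> W}"
    using assms(1,3) unfolding pathin_def by (rule openin_continuous_map_preimage)
  then obtain T where T: "open T" "{s \<in> {0..1}. g s \<in> W} = {0..1} \<inter> T"
    unfolding openin_open by auto
  have "t \<in> T" using T(2) assms(2,4) by blast
  then obtain e where e: "0 < e" "ball t e \<subseteq> T" using T(1) by (meson openE)
  show ?thesis
  proof (rule that[OF e(1)])
    fix s assume "s \<in> {0..1}" "\<bar>s - t\<bar> < e"
    hence "s \<in> {0..1} \<inter> T" using e(2) by (auto simp: dist_real_def)
    thus "g s \<in> W" using T(2) by blast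
  qed
qed

lemma pathin_topspace: "pathin X g \<Longrightarrow> t \<in> {0..1} \<Longrightarrow> g t \<in> topspace X"
  unfolding pathin_def continuous_map_def by auto

lemma primitive_along_eval:
  assumes "primitive_along X A \<omega> g \<Phi>" "continuous_on {0..1} \<alpha>" "\<alpha> ` {0..1} \<subseteq> {0..1}"
  shows "primitive_along X A \<omega> (g \<circ> \<alpha>) (\<Phi> \<circ> \<alpha>)"
  unfolding primitive_along_def
proof
  fix t :: real assume t: "t \<in> {0..1}"
  hence "\<alpha> t \<in> {0..1}" using assms(3) by blast
  then obtain T W F where 1: "open T" "\<alpha> t \<in> T" "openin X W" "primitive_on A \<omega> W F"
      "\<forall>s\<in>T \<inter> {0..1}. g s \<in> W \<and> \<Phi> s = F (g s)"
    using assms(1) unfolding primitive_along_def by meson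
  have "openin (top_of_set {0..1}) ({0..1} \<inter> \<alpha> -` T)"
    using assms(2) 1(1) by (rule continuous_openin_preimage_gen)
  then obtain T' where T': "open T'" "{0..1} \<inter> \<alpha> -` T = {0..1} \<inter> T'" unfolding openin_open by blast
  have "t \<in> T'" using T'(2) t 1(2) by blast
  moreover have "\<forall>s\<in>T' \<inter> {0..1}. (g \<circ> \<alpha>) s \<in> W \<and> (\<Phi> \<circ> \<alpha>) s = F ((g \<circ> \<alpha>) s)"
  proof
    fix s assume "s \<in> T' \<inter> {0..1}"
    hence "s \<in> {0..1}" "\<alpha> s \<in> T" using T'(2) by blast+
    hence "\<alpha> s \<in> T \<inter> {0..1}" using assms(3) by blast
    thus "(g \<circ> \<alpha>) s \<in> W \<and> (\<Phi> \<circ> \<alpha>) s = F ((g \<circ> \<alpha>) s)" using 1(5) by simp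
  qed
  ultimately show "\<exists>T W F. open T \<and> t \<in> T \<and> openin X W \<and> primitive_on A \<omega> W F \<and>
      (\<forall>s\<in>T \<inter> {0..1}. (g \<circ> \<alpha>) s \<in> W \<and> (\<Phi> \<circ> \<alpha>) s = F ((g \<circ> \<alpha>) s))"
    using T'(1) 1(3,4) by blast
qed

lemma pathin_reparam:
  assumes "pathin X g" "continuous_on {0..1} \<alpha>" "\<alpha> ` {0..1} \<subseteq> {0..1}"
  shows "pathin X (g \<circ> \<alpha>)"
  unfolding pathin_def
proof (rule continuous_map_compose)
  show "continuous_map (top_of_set {0..1}) (top_of_set {0..1}) \<alpha>"
    using assms(2,3) by (simp add: continuous_map_in_subtopology image_subset_iff_funcset)
  show "continuous_map (top_of_set {0..1}) X g" using assms(1) by (simp add: pathin_def)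
qed

definition path_join :: "(real \<Rightarrow> 'a) \<Rightarrow> (real \<Rightarrow> 'a) \<Rightarrow> real \<Rightarrow> 'a" where
  "path_join g h t = (if t \<le> 1/2 then g (2 * t) else h (2 * t - 1))"

lemma path_join_ends [simp]: "path_join g h 0 = g 0" "path_join g h 1 = h 1"
  by (simp_all add: path_join_def)

lemma path_join_halves:
  assumes "g 1 = h 0" "t \<in> {0..1}"
  shows "(path_join g h \<circ> (\<lambda>t. t / 2)) t = g t" "(path_join g h \<circ> (\<lambda>t. t / 2 + 1/2)) t = h t"
  using assms by (auto simp: path_join_def)

lemma pathin_join:
  assumes "pathin X g" "pathin X h" "g 1 = h 0"
  shows "pathin X (path_join g h)"
  unfolding pathin_def path_join_def
proof (rule continuous_map_cases_le)
  have half: "continuous_map (subtopology (top_of_set {0..1}) {t \<in> topspace (top_of_set {0..1::real}). t \<le> 1/2}) (top_of_set {0..1}) (\<lambda>t. 2 * t)"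
    by (auto simp: subtopology_subtopology continuous_map_in_subtopology intro!: continuous_intros)
  show "continuous_map (subtopology (top_of_set {0..1}) {t \<in> topspace (top_of_set {0..1}). t \<le> 1/2}) X (\<lambda>t. g (2 * t))"
    using continuous_map_compose[OF half, of X g] assms(1) by (simp add: pathin_def comp_def)
  have half': "continuous_map (subtopology (top_of_set {0..1}) {t \<in> topspace (top_of_set {0..1::real}). 1/2 \<le> t}) (top_of_set {0..1}) (\<lambda>t. 2 * t - 1)"
    by (auto simp: subtopology_subtopology continuous_map_in_subtopology intro!: continuous_intros)
  show "continuous_map (subtopology (top_of_set {0..1}) {t \<in> topspace (top_of_set {0..1}). 1/2 \<le> t}) X (\<lambda>t. h (2 * t - 1))"
    using continuous_map_compose[OF half', of X h] assms(2) by (simp add: pathin_def comp_def)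
  show "g (2 * t) = h (2 * t - 1)" if "t \<in> topspace (top_of_set {0..1})" "t = 1/2" for t
    unfolding that(2) using assms(3) by simp
qed (auto intro: continuous_intros)

definition path_reverse :: "(real \<Rightarrow> 'a) \<Rightarrow> real \<Rightarrow> 'a" where
  "path_reverse g = g \<circ> (\<lambda>t. 1 - t)"

lemma path_reverse_ends [simp]: "path_reverse g 0 = g 1" "path_reverse g 1 = g 0"
  by (simp_all add: path_reverse_def)

lemma pathin_reverse: "pathin X g \<Longrightarrow> pathin X (path_reverse g)"
  unfolding path_reverse_def by (rule pathin_reparam) (auto intro!: continuous_intros)

context rsurface
begin

lemma local_primitive:
  assumes \<omega>: "holomorphic_differential A \<omega>" and c: "c \<in> A" and r: "ball a r \<subseteq> snd c ` fst c"
  shows "\<exists>F. primitive_on A \<omega> {y \<in> fst c. snd c y \<in> ball a r} F"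
proof -
  have "\<omega> c holomorphic_on ball a r"
    using \<omega> c r unfolding holomorphic_differential_def by (blast intro: holomorphic_on_subset)
  then obtain P where "\<And>z. z \<in> ball a r \<Longrightarrow> (P has_field_derivative \<omega> c z) (at z within ball a r)"
    using holomorphic_convex_primitive'[of "ball a r" "\<omega> c"] by auto
  hence P: "(P has_field_derivative \<omega> c z) (at z)" if "z \<in> ball a r" for z
    using that at_within_open[OF that open_ball] by metis
  have "primitive_on A \<omega> {y \<in> fst c. snd c y \<in> ball a r} (P \<circ> snd c)"
    unfolding primitive_on_def
  proof (intro ballI)
    fix e x assume e: "e \<in> A" and x: "x \<in> {y \<in> fst c. snd c y \<in> ball a r} \<inter> fst e"
    have M: "c \<in> maximal_atlas" "e \<in> maximal_atlas" using c e atlas_subset by auto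
    have "(P has_field_derivative \<omega> c (snd c x)) (at (transition e c (snd e x)))"
      using P x M by simp
    from DERIV_chain[OF this has_derivative_transition[OF M(2,1)]]
    have "(P \<circ> transition e c has_field_derivative \<omega> c (snd c x) * jac e c x) (at (snd e x))" using x by simp
    moreover have "\<omega> e (snd e x) = \<omega> c (snd c x) * jac e c x"
    proof -
      have "snd e x \<in> snd e ` (fst e \<inter> fst c)" using x by auto
      hence "\<omega> e (snd e x) = \<omega> c (transition e c (snd e x)) * deriv (transition e c) (snd e x)"
        using \<omega> c e unfolding holomorphic_differential_def by blast
      thus ?thesis using x M by (simp add: jac_def)
    qed
    ultimately show "((P \<circ> snd c) \<circ> chart_inv e has_field_derivative \<omega> e (snd e x)) (at (snd e x))"
      by (simp add: comp_def)
  qed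
  thus ?thesis by blast
qed

lemma chart_ball_nbhd:
  assumes c: "c \<in> maximal_atlas" and W: "openin X W" "x \<in> W" "x \<in> fst c"
  obtains r where "0 < r" "ball (snd c x) r \<subseteq> snd c ` fst c" "{y \<in> fst c. snd c y \<in> ball (snd c x) r} \<subseteq> W"
proof -
  have "open (snd c ` (W \<inter> fst c))" "snd c x \<in> snd c ` (W \<inter> fst c)"
    using open_chart_image[OF maximal_chart[OF c] W(1)] W by auto
  then obtain r where r: "0 < r" "ball (snd c x) r \<subseteq> snd c ` (W \<inter> fst c)" by (meson openE)
  have "{y \<in> fst c. snd c y \<in> ball (snd c x) r} \<subseteq> W"
  proof
    fix y assume y: "y \<in> {y \<in> fst c. snd c y \<in> ball (snd c x) r}"
    then obtain y' where "y' \<in> W" "y' \<in> fst c" "snd c y = snd c y'" using r(2) by blast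
    thus "y \<in> W" using inj_onD[OF chartD(3)[OF c], of y y'] y by auto
  qed
  with r show ?thesis using that by blast
qed

lemma primitive_exists:
  assumes "holomorphic_differential A \<omega>" "x \<in> topspace X"
  obtains W F where "openin X W" "x \<in> W" "primitive_on A \<omega> W F"
proof -
  obtain c where c: "c \<in> A" "x \<in> fst c" using atlas_covers[OF assms(2)] by blast
  hence M: "c \<in> maximal_atlas" using atlas_subset by blast
  obtain r where r: "0 < r" "ball (snd c x) r \<subseteq> snd c ` fst c"
    by (rule chart_ball_nbhd[OF M chartD(1)[OF M] c(2,2)])
  from local_primitive[OF assms(1) c(1) r(2)] obtain F
    where "primitive_on A \<omega> {y \<in> fst c. snd c y \<in> ball (snd c x) r} F" by blast
  thus ?thesis using that[of "{y \<in> fst c. snd c y \<in> ball (snd c x) r}"] chartD(5)[OF M open_ball] c r by auto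
qed

lemma primitives_differ_locally:
  assumes W: "openin X W" "x \<in> W" "primitive_on A \<omega> W F" and W': "openin X W'" "x \<in> W'" "primitive_on A \<omega> W' F'"
  obtains N where "openin X N" "x \<in> N" "N \<subseteq> W \<inter> W'" "\<And>y. y \<in> N \<Longrightarrow> F y = F' y + (F x - F' x)"
proof -
  obtain c where c: "c \<in> A" "x \<in> fst c" using atlas_covers openin_subset[OF W(1)] W(2) by blast
  hence M: "c \<in> maximal_atlas" using atlas_subset by blast
  obtain r where r: "0 < r" "ball (snd c x) r \<subseteq> snd c ` fst c"
      "{y \<in> fst c. snd c y \<in> ball (snd c x) r} \<subseteq> W \<inter> W'"
    by (rule chart_ball_nbhd[OF M openin_Int[OF W(1) W'(1)] IntI[OF W(2) W'(2)] c(2)])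
  define H where "H = (\<lambda>z. (F \<circ> chart_inv c) z - (F' \<circ> chart_inv c) z)"
  have "(H has_field_derivative 0) (at z within ball (snd c x) r)" if z: "z \<in> ball (snd c x) r" for z
  proof -
    obtain y where y: "y \<in> fst c" "z = snd c y" using r(2) z by blast
    hence "y \<in> {y \<in> fst c. snd c y \<in> ball (snd c x) r}" using z by simp
    hence "y \<in> W \<inter> W'" using r(3) by (rule subsetD[rotated])
    hence yW: "y \<in> W \<inter> fst c" "y \<in> W' \<inter> fst c" using y(1) by simp_all
    have "((F \<circ> chart_inv c) has_field_derivative \<omega> c z) (at z)"
      "((F' \<circ> chart_inv c) has_field_derivative \<omega> c z) (at z)"
      using W(3) W'(3) c(1) yW y(2) unfolding primitive_on_def by blast+
    from DERIV_diff[OF this] show ?thesis unfolding H_def by (simp add: has_field_derivative_at_within)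
  qed
  from has_field_derivative_zero_constant[OF convex_ball this]
  obtain k where k: "\<And>z. z \<in> ball (snd c x) r \<Longrightarrow> H z = k" by metis
  show ?thesis
  proof (rule that[of "{y \<in> fst c. snd c y \<in> ball (snd c x) r}"])
    show "openin X {y \<in> fst c. snd c y \<in> ball (snd c x) r}" by (rule chartD(5)[OF M open_ball])
    fix y assume y: "y \<in> {y \<in> fst c. snd c y \<in> ball (snd c x) r}"
    have "F y - F' y = k" using k[of "snd c y"] y M by (simp add: H_def)
    moreover have "F x - F' x = k" using k[of "snd c x"] c(2) r(1) M by (simp add: H_def)
    ultimately show "F y = F' y + (F x - F' x)" by (simp add: algebra_simps)
  qed (use c r in auto)
qed

lemma primitive_on_add_const:
  "primitive_on A \<omega> W F \<Longrightarrow> primitive_on A \<omega> W (\<lambda>x. F x + k)"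
  unfolding primitive_on_def comp_def by (auto intro!: derivative_eq_intros)

lemma primitive_on_subset: "primitive_on A \<omega> W F \<Longrightarrow> V \<subseteq> W \<Longrightarrow> primitive_on A \<omega> V F"
  unfolding primitive_on_def by blast

text \<open>Bisection of the parameter interval: short pieces of the path lie in the domain of one
  local primitive, and primitives along adjacent intervals can be glued.\<close>

lemma primitive_along_exists:
  assumes \<omega>: "holomorphic_differential A \<omega>" and g: "pathin X g"
  shows "\<exists>\<Phi>. primitive_along X A \<omega> g \<Phi>"
proof -
  define along where "along = (\<lambda>S \<Phi>. \<forall>t\<in>S. \<exists>T W F. open T \<and> t \<in> T \<and> openin X W \<and> primitive_on A \<omega> W F \<and>
        (\<forall>s\<in>T \<inter> S. g s \<in> W \<and> \<Phi> s = F (g s)))"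
  have "\<exists>\<Phi>. along ({0..1} \<inter> {0..1}) \<Phi>"
  proof (rule Bolzano[where P = "\<lambda>a b. \<exists>\<Phi>. along ({a..b} \<inter> {0..1}) \<Phi>"])
    fix a b c :: real assume P: "\<exists>\<Phi>. along ({a..b} \<inter> {0..1}) \<Phi>" "\<exists>\<Phi>. along ({b..c} \<inter> {0..1}) \<Phi>"
      and abc: "a \<le> b" "b \<le> c"
    obtain \<Phi>1 \<Phi>2 where \<Phi>: "along ({a..b} \<inter> {0..1}) \<Phi>1" "along ({b..c} \<inter> {0..1}) \<Phi>2" using P by blast
    \<comment> \<open>The constant that makes the second primitive continue the first at
      \<open>b\<close>. At \<open>b\<close> itself the two local primitives differ by exactly this
      constant on a neighbourhood of \<open>g b\<close>, so one of them serves both sides.\<close>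
    define k where "k = \<Phi>1 b - \<Phi>2 b"
    define \<Phi> where "\<Phi> = (\<lambda>t. if t \<le> b then \<Phi>1 t else \<Phi>2 t + k)"
    have "along ({a..c} \<inter> {0..1}) \<Phi>" unfolding along_def
    proof
      fix t assume t: "t \<in> {a..c} \<inter> {0..1}"
      show "\<exists>T W F. open T \<and> t \<in> T \<and> openin X W \<and> primitive_on A \<omega> W F \<and>
          (\<forall>s\<in>T \<inter> ({a..c} \<inter> {0..1}). g s \<in> W \<and> \<Phi> s = F (g s))"
      proof (cases rule: linorder_cases[of t b])
        case less
        hence "t \<in> {a..b} \<inter> {0..1}" using t by auto
        from bspec[OF \<Phi>(1)[unfolded along_def] this] obtain T W F where
          T: "open T" "t \<in> T" "openin X W" "primitive_on A \<omega> W F"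
          "\<forall>s\<in>T \<inter> ({a..b} \<inter> {0..1}). g s \<in> W \<and> \<Phi>1 s = F (g s)"
          by (elim exE conjE) (rule that)
        have val: "\<forall>s\<in>(T \<inter> {..<b}) \<inter> ({a..c} \<inter> {0..1}). g s \<in> W \<and> \<Phi> s = F (g s)"
        proof
          fix s assume s: "s \<in> (T \<inter> {..<b}) \<inter> ({a..c} \<inter> {0..1})"
          have "s \<in> T \<inter> ({a..b} \<inter> {0..1})" using s by simp
          from bspec[OF T(5) this] show "g s \<in> W \<and> \<Phi> s = F (g s)" using s by (simp add: \<Phi>_def)
        qed
        have "open (T \<inter> {..<b})" "t \<in> T \<inter> {..<b}" using T less by auto
        with T(3,4) val show ?thesis
          by (intro exI[of _ "T \<inter> {..<b}"] exI[of _ W] exI[of _ F] conjI)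
      next
        case greater
        hence "t \<in> {b..c} \<inter> {0..1}" using t by auto
        from bspec[OF \<Phi>(2)[unfolded along_def] this] obtain T W F where
          T: "open T" "t \<in> T" "openin X W" "primitive_on A \<omega> W F"
          "\<forall>s\<in>T \<inter> ({b..c} \<inter> {0..1}). g s \<in> W \<and> \<Phi>2 s = F (g s)"
          by (elim exE conjE) (rule that)
        have val: "\<forall>s\<in>(T \<inter> {b<..}) \<inter> ({a..c} \<inter> {0..1}). g s \<in> W \<and> \<Phi> s = (\<lambda>x. F x + k) (g s)"
        proof
          fix s assume s: "s \<in> (T \<inter> {b<..}) \<inter> ({a..c} \<inter> {0..1})"
          have "s \<in> T \<inter> ({b..c} \<inter> {0..1})" using s by simp
          from bspec[OF T(5) this] show "g s \<in> W \<and> \<Phi> s = (\<lambda>x. F x + k) (g s)" using s by (simp add: \<Phi>_def)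
        qed
        have "open (T \<inter> {b<..})" "t \<in> T \<inter> {b<..}" using T greater by auto
        with T(3) primitive_on_add_const[OF T(4)] val show ?thesis
          by (intro exI[of _ "T \<inter> {b<..}"] exI[of _ W] exI[of _ "\<lambda>x. F x + k"] conjI)
      next
        case equal
        have b1: "b \<in> {a..b} \<inter> {0..1}" "b \<in> {b..c} \<inter> {0..1}" using t equal abc by auto
        from bspec[OF \<Phi>(1)[unfolded along_def] b1(1)] obtain T W F where
          T: "open T" "b \<in> T" "openin X W" "primitive_on A \<omega> W F"
          "\<forall>s\<in>T \<inter> ({a..b} \<inter> {0..1}). g s \<in> W \<and> \<Phi>1 s = F (g s)"
          by (elim exE conjE) (rule that)
        from bspec[OF \<Phi>(2)[unfolded along_def] b1(2)] obtain T' W' F' where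
          T': "open T'" "b \<in> T'" "openin X W'" "primitive_on A \<omega> W' F'"
          "\<forall>s\<in>T' \<inter> ({b..c} \<inter> {0..1}). g s \<in> W' \<and> \<Phi>2 s = F' (g s)"
          by (elim exE conjE) (rule that)
        have gb: "g b \<in> W" "g b \<in> W'" "\<Phi>1 b = F (g b)" "\<Phi>2 b = F' (g b)" using T T' b1 by blast+
        obtain N where N: "openin X N" "g b \<in> N" "N \<subseteq> W \<inter> W'" "\<And>y. y \<in> N \<Longrightarrow> F y = F' y + (F (g b) - F' (g b))"
          by (rule primitives_differ_locally[OF T(3) gb(1) T(4) T'(3) gb(2) T'(4)]) blast
        obtain e where e: "0 < e" "\<And>s. s \<in> {0..1} \<Longrightarrow> \<bar>s - b\<bar> < e \<Longrightarrow> g s \<in> N"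
          by (rule pathin_near[OF g IntD2[OF b1(1)] N(1,2)]) blast
        have "\<forall>s\<in>(T \<inter> T' \<inter> ball b e) \<inter> ({a..c} \<inter> {0..1}). g s \<in> N \<and> \<Phi> s = F (g s)"
        proof
          fix s assume s: "s \<in> (T \<inter> T' \<inter> ball b e) \<inter> ({a..c} \<inter> {0..1})"
          hence gs: "g s \<in> N" using e(2) by (auto simp: dist_real_def abs_minus_commute)
          show "g s \<in> N \<and> \<Phi> s = F (g s)"
          proof (cases "s \<le> b")
            case True
            hence "s \<in> T \<inter> ({a..b} \<inter> {0..1})" using s by simp
            from bspec[OF T(5) this] show ?thesis using gs True by (simp add: \<Phi>_def)
          next
            case False
            hence "s \<in> T' \<inter> ({b..c} \<inter> {0..1})" using s by simp
            from bspec[OF T'(5) this] show ?thesis using gs False N(4)[OF gs] gb by (simp add: \<Phi>_def k_def)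
          qed
        qed
        moreover have "primitive_on A \<omega> N F" using N(3) by (intro primitive_on_subset[OF T(4)]) blast
        moreover have "open (T \<inter> T' \<inter> ball b e)" "t \<in> T \<inter> T' \<inter> ball b e"
          using T(1,2) T'(1,2) e(1) equal by auto
        ultimately show ?thesis using N(1)
          by (intro exI[of _ "T \<inter> T' \<inter> ball b e"] exI[of _ N] exI[of _ F] conjI)
      qed
    qed
    thus "\<exists>\<Phi>. along ({a..c} \<inter> {0..1}) \<Phi>" by blast
  next
    fix x :: real assume x: "0 \<le> x" "x \<le> 1"
    hence "g x \<in> topspace X" using pathin_topspace[OF g] by simp
    then obtain W F where W: "openin X W" "g x \<in> W" "primitive_on A \<omega> W F"
      by (rule primitive_exists[OF \<omega>])
    have "x \<in> {0..1}" using x by simp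
    then obtain e where e: "0 < e" "\<And>s. s \<in> {0..1} \<Longrightarrow> \<bar>s - x\<bar> < e \<Longrightarrow> g s \<in> W"
      by (rule pathin_near[OF g _ W(1,2)]) blast
    have "along ({a..b} \<inter> {0..1}) (F \<circ> g)" if "a \<le> x \<and> x \<le> b \<and> b - a < e" for a b
      unfolding along_def
      by (intro ballI exI[of _ UNIV] exI[of _ W] exI[of _ F]) (use that e W in auto)
    thus "\<exists>d>0. \<forall>a b. a \<le> x \<and> x \<le> b \<and> b - a < d \<longrightarrow> (\<exists>\<Phi>. along ({a..b} \<inter> {0..1}) \<Phi>)"
      using e(1) by blast
  qed simp
  thus ?thesis unfolding along_def primitive_along_def by simp
qed

lemma path_integral_primitive:
  assumes "pathin X g" "openin X W" "primitive_on A \<omega> W F" "g ` {0..1} \<subseteq> W"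
  shows "path_integral X A g \<omega> = F (g 1) - F (g 0)"
proof -
  have "primitive_along X A \<omega> g (F \<circ> g)"
    unfolding primitive_along_def
    by (intro ballI exI[of _ UNIV] exI[of _ W] exI[of _ F]) (use assms in auto)
  from path_integral_eqI[OF riemann assms(1) this] show ?thesis by simp
qed

lemma path_integral_cong:
  assumes "pathin X g" "\<And>t. t \<in> {0..1} \<Longrightarrow> g t = h t"
  shows "path_integral X A h \<omega> = path_integral X A g \<omega>"
proof -
  have "primitive_along X A \<omega> h \<Phi> \<longleftrightarrow> primitive_along X A \<omega> g \<Phi>" for \<Phi>
    using assms(2) by (auto simp: primitive_along_def)
  thus ?thesis by (simp add: path_integral_def)
qed

lemma path_integral_reparam:
  assumes "pathin X g" "primitive_along X A \<omega> g \<Phi>" "continuous_on {0..1} \<alpha>" "\<alpha> ` {0..1} \<subseteq> {0..1}"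
  shows "path_integral X A (g \<circ> \<alpha>) \<omega> = \<Phi> (\<alpha> 1) - \<Phi> (\<alpha> 0)"
  using path_integral_eqI[OF riemann pathin_reparam[OF assms(1,3,4)] primitive_along_eval[OF assms(2-4)]] by simp

text \<open>One primitive along the joined path, evaluated at 0, 1/2 and 1, gives all three
  integrals.\<close>

lemma path_integral_join:
  assumes \<omega>: "holomorphic_differential A \<omega>" and g: "pathin X g" "pathin X h" "g 1 = h 0"
  shows "path_integral X A (path_join g h) \<omega> = path_integral X A g \<omega> + path_integral X A h \<omega>"
proof -
  let ?j = "path_join g h"
  have j: "pathin X ?j" by (rule pathin_join[OF g])
  obtain \<Phi> where \<Phi>: "primitive_along X A \<omega> ?j \<Phi>" using primitive_along_exists[OF \<omega> j] by blast
  have "path_integral X A (?j \<circ> (\<lambda>t. t / 2)) \<omega> = \<Phi> (1/2) - \<Phi> 0"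
    by (subst path_integral_reparam[OF j \<Phi>]) (auto intro!: continuous_intros)
  moreover have "path_integral X A (?j \<circ> (\<lambda>t. t / 2 + 1/2)) \<omega> = \<Phi> 1 - \<Phi> (1/2)"
    by (subst path_integral_reparam[OF j \<Phi>]) (auto intro!: continuous_intros)
  moreover have "path_integral X A (?j \<circ> (\<lambda>t. t / 2)) \<omega> = path_integral X A g \<omega>"
    by (rule path_integral_cong[OF g(1)]) (rule sym, rule path_join_halves(1)[of g h, OF g(3)])
  moreover have "path_integral X A (?j \<circ> (\<lambda>t. t / 2 + 1/2)) \<omega> = path_integral X A h \<omega>"
    by (rule path_integral_cong[OF g(2)]) (rule sym, rule path_join_halves(2)[of g h, OF g(3)])
  moreover have "path_integral X A ?j \<omega> = \<Phi> 1 - \<Phi> 0" by (rule path_integral_eqI[OF riemann j \<Phi>])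
  ultimately show ?thesis by simp
qed

lemma path_integral_reverse:
  assumes \<omega>: "holomorphic_differential A \<omega>" and g: "pathin X g"
  shows "path_integral X A (path_reverse g) \<omega> = - path_integral X A g \<omega>"
proof -
  obtain \<Phi> where \<Phi>: "primitive_along X A \<omega> g \<Phi>" using primitive_along_exists[OF \<omega> g] by blast
  have "path_integral X A (path_reverse g) \<omega> = \<Phi> 0 - \<Phi> 1"
    unfolding path_reverse_def by (subst path_integral_reparam[OF g \<Phi>]) (auto intro!: continuous_intros)
  thus ?thesis using path_integral_eqI[OF riemann g \<Phi>] by simp
qed

lemma path_integral_const:
  assumes "holomorphic_differential A \<omega>" "x \<in> topspace X"
  shows "path_integral X A (\<lambda>_. x) \<omega> = 0"
proof -
  obtain W F where W: "openin X W" "x \<in> W" "primitive_on A \<omega> W F"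
    by (rule primitive_exists[OF assms])
  have "pathin X (\<lambda>_. x)" using assms(2) by (simp add: pathin_def)
  from path_integral_primitive[OF this W(1,3)] W(2) show ?thesis by auto
qed

end


section \<open>Cutting a path into segments inside the unit discs\<close>

context disc_cover
begin

lemma openin_unit_disc: "i < n \<Longrightarrow> openin X {x \<in> fst (d i). snd (d i) x \<in> ball (ctr i) 1}"
  by (rule chartD(5)[OF disc_chart open_ball])

text \<open>The subdivision depends on the path alone, so the list is fixed before the differential
  and its primitives. Both the divisor of the end points and the increments of a primitive telescope
  along it.\<close>

lemma path_segments:
  assumes g: "pathin X g"
  shows "\<exists>L :: (nat \<times> 'a \<times> 'a) list.
    (\<forall>(i, x, y)\<in>set L. i < n \<and> x \<in> fst (d i) \<and> y \<in> fst (d i) \<and>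
       snd (d i) x \<in> ball (ctr i) 1 \<and> snd (d i) y \<in> ball (ctr i) 1) \<and>
    frag_of (g 1) - frag_of (g 0) = (\<Sum>(i, x, y)\<leftarrow>L. frag_of y - frag_of x) \<and>
    (\<forall>\<omega> F. holomorphic_differential A \<omega> \<longrightarrow>
      (\<forall>i<n. primitive_on A \<omega> {x \<in> fst (d i). snd (d i) x \<in> ball (ctr i) 1} (F i)) \<longrightarrow>
      path_integral X A g \<omega> = (\<Sum>(i, x, y)\<leftarrow>L. F i y - F i x))"
proof -
  define D where "D = (\<lambda>i. {x \<in> fst (d i). snd (d i) x \<in> ball (ctr i) 1})"
  define ok where "ok = (\<lambda>L. \<forall>(i, x, y)\<in>set L. i < n \<and> x \<in> D i \<and> y \<in> D i)"
  define prim where "prim = (\<lambda>\<omega> F. holomorphic_differential A \<omega> \<and> (\<forall>i<n. primitive_on A \<omega> (D i) (F i)))"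
  define P where "P = (\<lambda>a b. 0 \<le> a \<longrightarrow> b \<le> 1 \<longrightarrow> (\<exists>L. ok L \<and>
      frag_of (g b) - frag_of (g a) = (\<Sum>(i, x, y)\<leftarrow>L. frag_of y - frag_of x) \<and>
      (\<forall>\<omega> F \<Phi>. prim \<omega> F \<longrightarrow> primitive_along X A \<omega> g \<Phi> \<longrightarrow>
         \<Phi> b - \<Phi> a = (\<Sum>(i, x, y)\<leftarrow>L. F i y - F i x))))"
  have "P 0 1"
  proof (rule Bolzano[where P = P])
    fix a b c :: real assume PP: "P a b" "P b c" and abc: "a \<le> b" "b \<le> c"
    show "P a c" unfolding P_def
    proof (intro impI)
      assume ac: "0 \<le> a" "c \<le> 1"
      obtain L where L: "ok L" "frag_of (g b) - frag_of (g a) = (\<Sum>(i, x, y)\<leftarrow>L. frag_of y - frag_of x)"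
        "\<And>\<omega> F \<Phi>. prim \<omega> F \<Longrightarrow> primitive_along X A \<omega> g \<Phi> \<Longrightarrow>
          \<Phi> b - \<Phi> a = (\<Sum>(i, x, y)\<leftarrow>L. F i y - F i x)"
        using PP(1) ac abc unfolding P_def by (meson order.trans)
      obtain L' where L': "ok L'" "frag_of (g c) - frag_of (g b) = (\<Sum>(i, x, y)\<leftarrow>L'. frag_of y - frag_of x)"
        "\<And>\<omega> F \<Phi>. prim \<omega> F \<Longrightarrow> primitive_along X A \<omega> g \<Phi> \<Longrightarrow>
          \<Phi> c - \<Phi> b = (\<Sum>(i, x, y)\<leftarrow>L'. F i y - F i x)"
        using PP(2) ac abc unfolding P_def by (meson order.trans)
      show "\<exists>L. ok L \<and> frag_of (g c) - frag_of (g a) = (\<Sum>(i, x, y)\<leftarrow>L. frag_of y - frag_of x) \<and>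
        (\<forall>\<omega> F \<Phi>. prim \<omega> F \<longrightarrow> primitive_along X A \<omega> g \<Phi> \<longrightarrow>
           \<Phi> c - \<Phi> a = (\<Sum>(i, x, y)\<leftarrow>L. F i y - F i x))"
      proof (rule exI[of _ "L @ L'"], intro conjI allI impI)
        show "ok (L @ L')" using L(1) L'(1) by (auto simp: ok_def)
        show "frag_of (g c) - frag_of (g a) = (\<Sum>(i, x, y)\<leftarrow>L @ L'. frag_of y - frag_of x)"
          using L(2) L'(2) by (simp flip: L(2) L'(2))
        fix \<omega> F \<Phi> assume "prim \<omega> F" "primitive_along X A \<omega> g \<Phi>"
        from L(3)[OF this] L'(3)[OF this]
        show "\<Phi> c - \<Phi> a = (\<Sum>(i, x, y)\<leftarrow>L @ L'. F i y - F i x)"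
          unfolding map_append sum_list_append by (metis add.commute diff_add_cancel diff_add_eq)
      qed
    qed
  next
    fix t :: real assume t: "0 \<le> t" "t \<le> 1"
    hence gt: "g t \<in> topspace X" using pathin_topspace[OF g] by simp
    then obtain i where i: "i < n" "g t \<in> D i" using disc_covers unfolding D_def by blast
    have Do: "openin X (D i)" unfolding D_def by (rule openin_unit_disc[OF i(1)])
    have "t \<in> {0..1}" using t by simp
    then obtain e where e: "0 < e" "\<And>s. s \<in> {0..1} \<Longrightarrow> \<bar>s - t\<bar> < e \<Longrightarrow> g s \<in> D i"
      by (rule pathin_near[OF g _ Do i(2)]) blast
    have "P a b" if ab: "a \<le> t" "t \<le> b" "b - a < e" for a b
      unfolding P_def
    proof (intro impI)
      assume ab1: "0 \<le> a" "b \<le> 1"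
      have inD: "g s \<in> D i" if "a \<le> s" "s \<le> b" for s
        using that ab ab1 by (intro e(2)) auto
      define \<alpha> where "\<alpha> = (\<lambda>s. a + s * (b - a))"
      have \<alpha>b: "a \<le> \<alpha> s" "\<alpha> s \<le> b" if "s \<in> {0..1}" for s
        using that ab mult_left_le_one_le[of "b - a" s] by (auto simp: \<alpha>_def)
      have \<alpha>c: "continuous_on {0..1} \<alpha>" by (auto simp: \<alpha>_def intro!: continuous_intros)
      have \<alpha>r: "\<alpha> ` {0..1} \<subseteq> {0..1}"
      proof (rule image_subsetI)
        fix s :: real assume "s \<in> {0..1}"
        from \<alpha>b[OF this] ab1 show "\<alpha> s \<in> {0..1}" by simp
      qed
      show "\<exists>L. ok L \<and> frag_of (g b) - frag_of (g a) = (\<Sum>(i, x, y)\<leftarrow>L. frag_of y - frag_of x) \<and>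
        (\<forall>\<omega> F \<Phi>. prim \<omega> F \<longrightarrow> primitive_along X A \<omega> g \<Phi> \<longrightarrow>
           \<Phi> b - \<Phi> a = (\<Sum>(i, x, y)\<leftarrow>L. F i y - F i x))"
      proof (rule exI[of _ "[(i, g a, g b)]"], intro conjI allI impI)
        show "ok [(i, g a, g b)]" using i(1) inD[of a] inD[of b] ab by (simp add: ok_def)
        fix \<omega> F \<Phi> assume pr: "prim \<omega> F" and \<Phi>: "primitive_along X A \<omega> g \<Phi>"
        have "path_integral X A (g \<circ> \<alpha>) \<omega> = \<Phi> (\<alpha> 1) - \<Phi> (\<alpha> 0)"
          by (rule path_integral_reparam[OF g \<Phi> \<alpha>c \<alpha>r])
        moreover have "path_integral X A (g \<circ> \<alpha>) \<omega> = F i ((g \<circ> \<alpha>) 1) - F i ((g \<circ> \<alpha>) 0)"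
        proof (rule path_integral_primitive[OF pathin_reparam[OF g \<alpha>c \<alpha>r] Do])
          show "primitive_on A \<omega> (D i) (F i)" using pr i(1) by (simp add: prim_def)
          show "(g \<circ> \<alpha>) ` {0..1} \<subseteq> D i"
          proof (rule image_subsetI)
            fix s :: real assume "s \<in> {0..1}"
            from inD[OF \<alpha>b[OF this]] show "(g \<circ> \<alpha>) s \<in> D i" by simp
          qed
        qed
        ultimately show "\<Phi> b - \<Phi> a = (\<Sum>(i, x, y)\<leftarrow>[(i, g a, g b)]. F i y - F i x)"
          by (simp add: \<alpha>_def)
      qed simp
    qed
    thus "\<exists>d>0. \<forall>a b. a \<le> t \<and> t \<le> b \<and> b - a < d \<longrightarrow> P a b" using e(1) by blast
  qed simp
  then obtain L where L: "ok L" "frag_of (g 1) - frag_of (g 0) = (\<Sum>(i, x, y)\<leftarrow>L. frag_of y - frag_of x)"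
    "\<And>\<omega> F \<Phi>. prim \<omega> F \<Longrightarrow> primitive_along X A \<omega> g \<Phi> \<Longrightarrow> \<Phi> 1 - \<Phi> 0 = (\<Sum>(i, x, y)\<leftarrow>L. F i y - F i x)"
    unfolding P_def by (meson order.refl)
  show ?thesis
  proof (rule exI[of _ L], intro conjI allI impI)
    show "\<forall>(i, x, y)\<in>set L. i < n \<and> x \<in> fst (d i) \<and> y \<in> fst (d i) \<and>
       snd (d i) x \<in> ball (ctr i) 1 \<and> snd (d i) y \<in> ball (ctr i) 1"
      using L(1) by (auto simp: ok_def D_def)
    show "frag_of (g 1) - frag_of (g 0) = (\<Sum>(i, x, y)\<leftarrow>L. frag_of y - frag_of x)" by (rule L(2))
    fix \<omega> F assume \<omega>: "holomorphic_differential A \<omega>"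
      and F: "\<forall>i<n. primitive_on A \<omega> {x \<in> fst (d i). snd (d i) x \<in> ball (ctr i) 1} (F i)"
    obtain \<Phi> where \<Phi>: "primitive_along X A \<omega> g \<Phi>" using primitive_along_exists[OF \<omega> g] by blast
    have "prim \<omega> F" using \<omega> F by (simp add: prim_def D_def)
    from L(3)[OF this \<Phi>] path_integral_eqI[OF riemann g \<Phi>]
    show "path_integral X A g \<omega> = (\<Sum>(i, x, y)\<leftarrow>L. F i y - F i x)" by simp
  qed
qed

end

section \<open>Meromorphic functions\<close>

lemma eventually_at_open:
  "open S \<Longrightarrow> a \<in> S \<Longrightarrow> (\<And>z. z \<in> S - {a} \<Longrightarrow> P z) \<Longrightarrow> eventually P (at a)"
  unfolding eventually_at_topological by blast

context rsurface
begin

lemma eventually_transition: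
  assumes c: "c \<in> maximal_atlas" and e: "e \<in> maximal_atlas" and x: "x \<in> fst c" "x \<in> fst e"
  shows "eventually (\<lambda>z. chart_inv e (transition c e z) = chart_inv c z) (at (snd c x))"
  using eventually_chart[OF c chartD(1)[OF e] x(2,1)]
  unfolding eventually_at_filter by (rule eventually_mono) (use e in simp)

lemma transition_filterlim:
  assumes c: "c \<in> maximal_atlas" and e: "e \<in> maximal_atlas" and x: "x \<in> fst c" "x \<in> fst e"
  shows "filterlim (transition c e) (at (snd e x)) (at (snd c x))"
proof -
  have "(transition c e \<longlongrightarrow> snd e x) (at (snd c x))"
    using field_differentiable_imp_continuous_at[OF transition_differentiable[OF c e x]] x c
    by (simp add: isCont_def)
  moreover have ev: "eventually (\<lambda>z. chart_inv c z \<in> fst e \<and> z \<in> snd c ` fst c \<and> z \<noteq> snd c x) (at (snd c x))"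
    using eventually_chart[OF c chartD(1)[OF e] x(2,1)]
    unfolding eventually_at_filter by (auto elim: eventually_mono)
  have "eventually (\<lambda>z. transition c e z \<noteq> snd e x) (at (snd c x))"
    using ev
  proof eventually_elim
    case (elim z)
    then obtain y where y: "y \<in> fst c" "z = snd c y" by auto
    hence "y \<in> fst e" "y \<noteq> x" using elim c by auto
    thus ?case using y c inj_onD[OF chartD(3)[OF e], of y x] x by auto
  qed
  ultimately show ?thesis by (simp add: filterlim_at)
qed

lemma transition_filterlim_compose:
  assumes "c \<in> maximal_atlas" "e \<in> maximal_atlas" "x \<in> fst c" "x \<in> fst e"
    and "filterlim (F \<circ> chart_inv e) L (at (snd e x))"
  shows "filterlim (F \<circ> chart_inv c) L (at (snd c x))"
  using filterlim_compose[OF assms(5) transition_filterlim[OF assms(1-4)]]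
  by (rule filterlim_mono_eventually[OF _ order.refl order.refl])
     (use eventually_transition[OF assms(1-4)] in \<open>auto elim: eventually_mono\<close>)

text \<open>\<open>F\<close> itself may have arbitrary values at the centres. The representative
  required by \<open>meromorphic_function\<close> is obtained by taking limits where the order is 0
  and the value 0 elsewhere; what has to be shown is that these corrections agree with
  \<open>F\<close> near every centre, apart from the centre.\<close>

lemma meromorphic_functionI:
  fixes N :: "'a \<Rightarrow> int"
  assumes F: "\<And>c x. c \<in> A \<Longrightarrow> x \<in> fst c \<Longrightarrow> \<exists>S G. open S \<and> snd c x \<in> S \<and> G holomorphic_on S \<and>
      G (snd c x) \<noteq> 0 \<and> (\<forall>z\<in>S - {snd c x}. (F \<circ> chart_inv c) z = G z * (z - snd c x) powi N x)"
  shows "\<exists>f. meromorphic_function X A f \<and> (\<forall>x\<in>topspace X. ord_at A f x = N x) \<and>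
    (\<forall>x\<in>topspace X. N x = 0 \<longrightarrow> f x \<noteq> 0)"
proof -
  \<comment> \<open>A limit computed in some chart; limits transfer between charts, so the chart
    does not matter.\<close>
  define l where "l = (\<lambda>x. SOME l. \<exists>c\<in>A. x \<in> fst c \<and> ((F \<circ> chart_inv c) \<longlongrightarrow> l) (at (snd c x)))"
  define f where "f = (\<lambda>x. if N x = 0 then l x else 0)"
  have lim: "((F \<circ> chart_inv c) \<longlongrightarrow> l x) (at (snd c x))" "l x \<noteq> 0"
    if c: "c \<in> A" "x \<in> fst c" and N0: "N x = 0" for c x
  proof -
    obtain S G where S: "open S" "snd c x \<in> S" "G holomorphic_on S" "G (snd c x) \<noteq> 0"
      "\<forall>z\<in>S - {snd c x}. (F \<circ> chart_inv c) z = G z * (z - snd c x) powi N x" using F[OF c] by metis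
    have "isCont G (snd c x)"
      using holomorphic_on_imp_continuous_on[OF S(3)] S(1,2) continuous_on_eq_continuous_at by blast
    hence "(G \<longlongrightarrow> G (snd c x)) (at (snd c x))" by (simp add: isCont_def)
    moreover have "eventually (\<lambda>z. G z = (F \<circ> chart_inv c) z) (at (snd c x))"
    proof (rule eventually_at_open[OF S(1,2)])
      fix z assume "z \<in> S - {snd c x}"
      from bspec[OF S(5) this] show "G z = (F \<circ> chart_inv c) z" using N0 by simp
    qed
    ultimately have G: "((F \<circ> chart_inv c) \<longlongrightarrow> G (snd c x)) (at (snd c x))"
      by (rule Lim_transform_eventually)
    hence "\<exists>l. \<exists>c\<in>A. x \<in> fst c \<and> ((F \<circ> chart_inv c) \<longlongrightarrow> l) (at (snd c x))" using c by blast
    hence "\<exists>e\<in>A. x \<in> fst e \<and> ((F \<circ> chart_inv e) \<longlongrightarrow> l x) (at (snd e x))"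
      unfolding l_def by (rule someI_ex)
    then obtain e where e: "e \<in> A" "x \<in> fst e" "((F \<circ> chart_inv e) \<longlongrightarrow> l x) (at (snd e x))"
      by (elim bexE conjE) (rule that)
    have "((F \<circ> chart_inv c) \<longlongrightarrow> l x) (at (snd c x))"
      by (rule transition_filterlim_compose[OF subsetD[OF atlas_subset c(1)] subsetD[OF atlas_subset e(1)] c(2) e(2,3)])
    thus "((F \<circ> chart_inv c) \<longlongrightarrow> l x) (at (snd c x))" .
    from LIM_unique[OF this G] show "l x \<noteq> 0" using S(4) by simp
  qed
  have loc: "\<exists>S G. open S \<and> snd c x \<in> S \<and> G holomorphic_on S \<and> G (snd c x) \<noteq> 0 \<and>
      (\<forall>z\<in>S - {snd c x}. (f \<circ> chart_inv c) z = G z * (z - snd c x) powi N x)"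
    and nic: "(N x \<noteq> 0 \<and> (f \<circ> chart_inv c) (snd c x) = 0) \<or> (f \<circ> chart_inv c) \<midarrow>snd c x\<rightarrow> (f \<circ> chart_inv c) (snd c x)"
    if c: "c \<in> A" "x \<in> fst c" for c x
  proof -
    have M: "c \<in> maximal_atlas" using c atlas_subset by blast
    obtain S G where S: "open S" "snd c x \<in> S" "G holomorphic_on S" "G (snd c x) \<noteq> 0"
      "\<forall>z\<in>S - {snd c x}. (F \<circ> chart_inv c) z = G z * (z - snd c x) powi N x" using F[OF c] by metis
    have "isCont G (snd c x)"
      using holomorphic_on_imp_continuous_on[OF S(3)] S(1,2) continuous_on_eq_continuous_at by blast
    from continuous_at_avoid[OF this S(4)] obtain r0 where
      "0 < r0" "\<And>z. dist (snd c x) z < r0 \<Longrightarrow> G z \<noteq> 0" by blast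
    moreover obtain r1 where "0 < r1" "ball (snd c x) r1 \<subseteq> S" using S(1,2) by (meson openE)
    moreover obtain r2 where "0 < r2" "ball (snd c x) r2 \<subseteq> snd c ` fst c"
      using chartD(4)[OF M] c(2) by (meson openE imageI)
    ultimately obtain r where r: "0 < r" "ball (snd c x) r \<subseteq> S" "ball (snd c x) r \<subseteq> snd c ` fst c"
      "\<And>z. z \<in> ball (snd c x) r \<Longrightarrow> G z \<noteq> 0"
      by (intro that[of "min r0 (min r1 r2)"]) (auto simp: subset_iff)
    have ff: "(f \<circ> chart_inv c) z = G z * (z - snd c x) powi N x" if z: "z \<in> ball (snd c x) r - {snd c x}" for z
    proof -
      obtain y where y: "y \<in> fst c" "z = snd c y" using z r(3) by auto
      let ?H = "\<lambda>w. G w * (w - snd c x) powi N x"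
      have Hh: "?H holomorphic_on ball (snd c x) r - {snd c x}"
        by (intro holomorphic_intros holomorphic_on_subset[OF S(3)]) (use r(2) in auto)
      have op: "open (ball (snd c x) r - {snd c x})" by auto
      have Hz: "?H z \<noteq> 0" using r(4) z by auto
      have "isCont ?H z"
        using holomorphic_on_imp_continuous_on[OF Hh] op z continuous_on_eq_continuous_at by blast
      moreover have "eventually (\<lambda>w. ?H w = (F \<circ> chart_inv c) w) (at z)"
      proof (rule eventually_at_open[OF op z])
        fix w assume "w \<in> ball (snd c x) r - {snd c x} - {z}"
        hence "w \<in> S - {snd c x}" using r(2) by blast
        from bspec[OF S(5) this] show "?H w = (F \<circ> chart_inv c) w" ..
      qed
      ultimately have FH: "((F \<circ> chart_inv c) \<longlongrightarrow> ?H z) (at z)"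
        unfolding isCont_def by (rule Lim_transform_eventually)
      obtain S' G' where S': "open S'" "z \<in> S'" "G' holomorphic_on S'" "G' z \<noteq> 0"
        "\<forall>w\<in>S' - {z}. (F \<circ> chart_inv c) w = G' w * (w - z) powi N y" using F[OF c(1) y(1)] y(2) by metis
      \<comment> \<open>Close to \<open>x\<close> there are no further zeros or poles: the local
        representation at \<open>x\<close> has order 0 at \<open>z\<close>, and it coincides near
        \<open>z\<close> with the one of order \<open>N y\<close>.\<close>
      have "N y = 0"
      proof -
        have "zorder ?H z = 0"
        proof (rule zorder_eq_0I)
          show "?H analytic_on {z}" unfolding analytic_at using Hh op z by blast
        qed (rule Hz)
        moreover have "zorder ?H z = N y"
        proof (rule zorder_eqI[of "S' \<inter> (ball (snd c x) r - {snd c x})" _ G'])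
          show "?H w = G' w * (w - z) powi N y" if "w \<in> S' \<inter> (ball (snd c x) r - {snd c x})" "w \<noteq> z" for w
          proof -
            have "w \<in> S - {snd c x}" "w \<in> S' - {z}" using that r(2) by auto
            from bspec[OF S(5) this(1)] bspec[OF S'(5) this(2)] show ?thesis by simp
          qed
          show "open (S' \<inter> (ball (snd c x) r - {snd c x}))" using S'(1) op by (rule open_Int)
          show "z \<in> S' \<inter> (ball (snd c x) r - {snd c x})" using S'(2) z by blast
          show "G' holomorphic_on S' \<inter> (ball (snd c x) r - {snd c x})"
            using S'(3) by (rule holomorphic_on_subset) blast
        qed (rule S'(4))
        ultimately show ?thesis by simp
      qed
      have "l y = ?H z" using lim(1)[OF c(1) y(1) \<open>N y = 0\<close>] FH unfolding y(2) by (rule LIM_unique)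
      thus ?thesis using \<open>N y = 0\<close> y M by (simp add: f_def)
    qed
    show "\<exists>S G. open S \<and> snd c x \<in> S \<and> G holomorphic_on S \<and> G (snd c x) \<noteq> 0 \<and>
      (\<forall>z\<in>S - {snd c x}. (f \<circ> chart_inv c) z = G z * (z - snd c x) powi N x)"
    proof (rule exI[of _ "ball (snd c x) r"], rule exI[of _ G], intro conjI ballI)
      show "G holomorphic_on ball (snd c x) r" using S(3) r(2) by (rule holomorphic_on_subset)
      show "snd c x \<in> ball (snd c x) r" using r(1) by simp
      show "G (snd c x) \<noteq> 0" by (rule S(4))
    qed (rule open_ball, rule ff)
    show "(N x \<noteq> 0 \<and> (f \<circ> chart_inv c) (snd c x) = 0) \<or> (f \<circ> chart_inv c) \<midarrow>snd c x\<rightarrow> (f \<circ> chart_inv c) (snd c x)"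
    proof (cases "N x = 0")
      case True
      have "((F \<circ> chart_inv c) \<longlongrightarrow> l x) (at (snd c x))" by (rule lim(1)[OF c True])
      moreover have "eventually (\<lambda>z. (F \<circ> chart_inv c) z = (f \<circ> chart_inv c) z) (at (snd c x))"
      proof (rule eventually_at_open[OF open_ball])
        show "snd c x \<in> ball (snd c x) r" using r(1) by simp
        fix z assume z: "z \<in> ball (snd c x) r - {snd c x}"
        hence "z \<in> S - {snd c x}" using r(2) by blast
        from bspec[OF S(5) this] ff[OF z] show "(F \<circ> chart_inv c) z = (f \<circ> chart_inv c) z" by simp
      qed
      ultimately have "((f \<circ> chart_inv c) \<longlongrightarrow> l x) (at (snd c x))" by (rule Lim_transform_eventually)
      thus ?thesis using True c M by (simp add: f_def)
    next
      case False
      thus ?thesis using c M by (simp add: f_def)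
    qed
  qed
  have zo: "zorder (f \<circ> chart_inv c) (snd c x) = N x" if cx: "c \<in> A" "x \<in> fst c" for c x
  proof -
    from loc[OF cx] obtain S G where S: "open S" "snd c x \<in> S" "G holomorphic_on S" "G (snd c x) \<noteq> 0"
      "\<forall>z\<in>S - {snd c x}. (f \<circ> chart_inv c) z = G z * (z - snd c x) powi N x" by (elim exE conjE) (rule that)
    show ?thesis by (rule zorder_eqI[OF S(1-4)]) (use S(5) in blast)
  qed
  have mer: "(f \<circ> chart_inv c) meromorphic_on {snd c x}" if cx: "c \<in> A" "x \<in> fst c" for c x
  proof -
    from loc[OF cx] obtain S G where S: "open S" "snd c x \<in> S" "G holomorphic_on S"
      "\<forall>z\<in>S - {snd c x}. (f \<circ> chart_inv c) z = G z * (z - snd c x) powi N x" by (elim exE conjE) (rule that)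
    have "G analytic_on {snd c x}" using S(1-3) by (auto simp: analytic_at)
    hence "(\<lambda>z. G z * (z - snd c x) powi N x) meromorphic_on {snd c x}"
      by (intro meromorphic_intros analytic_on_imp_meromorphic_on) (auto intro!: analytic_intros)
    moreover have "eventually (\<lambda>z. (f \<circ> chart_inv c) z = G z * (z - snd c x) powi N x) (at (snd c x))"
      by (rule eventually_at_open[OF S(1,2)]) (rule bspec[OF S(4)])
    ultimately show ?thesis
      using meromorphic_on_cong[of "{snd c x}" "f \<circ> chart_inv c" "\<lambda>z. G z * (z - snd c x) powi N x"] by blast
  qed
  have nice: "(is_pole (f \<circ> chart_inv c) (snd c x) \<and> (f \<circ> chart_inv c) (snd c x) = 0) \<or>
      (f \<circ> chart_inv c) \<midarrow>snd c x\<rightarrow> (f \<circ> chart_inv c) (snd c x)" if cx: "c \<in> A" "x \<in> fst c" for c x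
  proof -
    consider "N x = 0" | "N x > 0" | "N x < 0" by linarith
    thus ?thesis
    proof cases
      case 1
      thus ?thesis using nic[OF cx] by blast
    next
      case 2
      from loc[OF cx] obtain S G where S: "open S" "snd c x \<in> S" "G holomorphic_on S"
        "\<forall>z\<in>S - {snd c x}. (f \<circ> chart_inv c) z = G z * (z - snd c x) powi N x" by (elim exE conjE) (rule that)
      have "isCont G (snd c x)"
        using holomorphic_on_imp_continuous_on[OF S(3)] S(1,2) continuous_on_eq_continuous_at by blast
      hence "((\<lambda>z. G z * (z - snd c x) ^ nat (N x)) \<longlongrightarrow> G (snd c x) * (snd c x - snd c x) ^ nat (N x)) (at (snd c x))"
        unfolding isCont_def by (intro tendsto_mult tendsto_power tendsto_diff tendsto_ident_at tendsto_const)
      hence l0: "((\<lambda>z. G z * (z - snd c x) powi N x) \<longlongrightarrow> 0) (at (snd c x))"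
        using 2 by (simp add: power_int_def zero_power)
      have "((f \<circ> chart_inv c) \<longlongrightarrow> 0) (at (snd c x))"
        by (rule Lim_transform_eventually[OF l0], rule eventually_at_open[OF S(1,2)])
           (rule bspec[OF S(4), symmetric])
      moreover have "(f \<circ> chart_inv c) (snd c x) = 0"
        using 2 cx(2) subsetD[OF atlas_subset cx(1)] by (simp add: f_def)
      ultimately show ?thesis by simp
    next
      case 3
      from loc[OF cx] obtain S G where S: "open S" "snd c x \<in> S" "G holomorphic_on S" "G (snd c x) \<noteq> 0"
        "\<forall>z\<in>S - {snd c x}. (f \<circ> chart_inv c) z = G z * (z - snd c x) powi N x" by (elim exE conjE) (rule that)
      have "isCont G (snd c x)"
        using holomorphic_on_imp_continuous_on[OF S(3)] S(1,2) continuous_on_eq_continuous_at by blast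
      hence "eventually (\<lambda>z. G z \<noteq> 0) (at (snd c x))"
        using S(4) unfolding isCont_def by (rule tendsto_imp_eventually_ne)
      moreover have "eventually (\<lambda>z. z \<noteq> snd c x \<and> (f \<circ> chart_inv c) z = G z * (z - snd c x) powi N x) (at (snd c x))"
      proof (rule eventually_at_open[OF S(1,2)])
        fix z assume z: "z \<in> S - {snd c x}"
        from bspec[OF S(5) z] z show "z \<noteq> snd c x \<and> (f \<circ> chart_inv c) z = G z * (z - snd c x) powi N x" by simp
      qed
      ultimately have "eventually (\<lambda>z. (f \<circ> chart_inv c) z \<noteq> 0) (at (snd c x))"
        by eventually_elim simp
      moreover have "zorder (f \<circ> chart_inv c) (snd c x) < 0" using zo[OF cx] 3 by simp
      ultimately have "is_pole (f \<circ> chart_inv c) (snd c x)"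
        by (rule zorder_neg_imp_is_pole[OF mer[OF cx]])
      moreover have "(f \<circ> chart_inv c) (snd c x) = 0"
        using 3 cx(2) subsetD[OF atlas_subset cx(1)] by (simp add: f_def)
      ultimately show ?thesis by simp
    qed
  qed
  have "meromorphic_function X A f"
    unfolding meromorphic_function_def nicely_meromorphic_on_def
  proof (intro ballI conjI)
    fix c assume c: "c \<in> A"
    show "(f \<circ> chart_inv c) meromorphic_on snd c ` fst c"
      by (subst meromorphic_on_meromorphic_at) (use mer[OF c] in blast)
    fix z assume "z \<in> snd c ` fst c"
    thus "(is_pole (f \<circ> chart_inv c) z \<and> (f \<circ> chart_inv c) z = 0) \<or> (f \<circ> chart_inv c) \<midarrow>z\<rightarrow> (f \<circ> chart_inv c) z"
      using nice[OF c] by blast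
  qed
  moreover have "ord_at A f x = N x" if xX: "x \<in> topspace X" for x
  proof -
    define c where "c = (SOME c. c \<in> A \<and> x \<in> fst c)"
    have "c \<in> A \<and> x \<in> fst c" unfolding c_def by (rule someI_ex) (use atlas_covers[OF xX] in blast)
    from zo[OF conjunct1[OF this] conjunct2[OF this]] show ?thesis
      unfolding ord_at_def c_def[symmetric] by simp
  qed
  moreover have "f x \<noteq> 0" if xX: "x \<in> topspace X" and N0: "N x = 0" for x
  proof -
    obtain c where "c \<in> A" "x \<in> fst c" using atlas_covers[OF xX] by blast
    from lim(2)[OF this N0] show ?thesis using N0 by (simp add: f_def)
  qed
  ultimately show ?thesis by blast
qed

end


section \<open>The existence part of Abel's theorem\<close>

text \<open>An asymptotic order that asks for no differentiability. The factors of the function to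
  be constructed are merely smooth, and their orders must be added before the product is known to be
  holomorphic.\<close>

definition leading :: "(complex \<Rightarrow> complex) \<Rightarrow> int \<Rightarrow> complex \<Rightarrow> bool" where
  "leading \<phi> e z0 \<longleftrightarrow> (\<exists>L. L \<noteq> 0 \<and> ((\<lambda>z. \<phi> z / (z - z0) powi e) \<longlongrightarrow> L) (at z0))"

lemma leading_cong:
  assumes "leading \<phi> e z0" "eventually (\<lambda>z. \<phi> z = \<psi> z) (at z0)"
  shows "leading \<psi> e z0"
proof -
  obtain L where L: "L \<noteq> 0" "((\<lambda>z. \<phi> z / (z - z0) powi e) \<longlongrightarrow> L) (at z0)"
    using assms(1) unfolding leading_def by blast
  have "((\<lambda>z. \<psi> z / (z - z0) powi e) \<longlongrightarrow> L) (at z0)"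
    by (rule Lim_transform_eventually[OF L(2)]) (use assms(2) in \<open>auto elim: eventually_mono\<close>)
  thus ?thesis using L(1) unfolding leading_def by blast
qed

lemma leading_tendsto: "(\<phi> \<longlongrightarrow> L) (at z0) \<Longrightarrow> L \<noteq> 0 \<Longrightarrow> leading \<phi> 0 z0"
  unfolding leading_def by auto

lemma leading_mult:
  assumes "leading \<phi> e z0" "leading \<psi> e' z0"
  shows "leading (\<lambda>z. \<phi> z * \<psi> z) (e + e') z0"
proof -
  obtain L L' where L: "L \<noteq> 0" "((\<lambda>z. \<phi> z / (z - z0) powi e) \<longlongrightarrow> L) (at z0)"
    "L' \<noteq> 0" "((\<lambda>z. \<psi> z / (z - z0) powi e') \<longlongrightarrow> L') (at z0)"
    using assms unfolding leading_def by blast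
  have "((\<lambda>z. \<phi> z / (z - z0) powi e * (\<psi> z / (z - z0) powi e')) \<longlongrightarrow> L * L') (at z0)"
    by (intro tendsto_mult L)
  hence "((\<lambda>z. \<phi> z * \<psi> z / (z - z0) powi (e + e')) \<longlongrightarrow> L * L') (at z0)"
    by (rule Lim_transform_eventually) (auto simp: eventually_at_filter power_int_add)
  thus ?thesis using L(1,3) unfolding leading_def by (intro exI[of _ "L * L'"]) simp
qed

lemma leading_divide:
  assumes "leading \<phi> e z0" "leading \<psi> e' z0"
  shows "leading (\<lambda>z. \<phi> z / \<psi> z) (e - e') z0"
proof -
  obtain L L' where L: "L \<noteq> 0" "((\<lambda>z. \<phi> z / (z - z0) powi e) \<longlongrightarrow> L) (at z0)"
    "L' \<noteq> 0" "((\<lambda>z. \<psi> z / (z - z0) powi e') \<longlongrightarrow> L') (at z0)"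
    using assms unfolding leading_def by blast
  have "((\<lambda>z. \<phi> z / (z - z0) powi e / (\<psi> z / (z - z0) powi e')) \<longlongrightarrow> L / L') (at z0)"
    by (intro tendsto_divide L)
  hence "((\<lambda>z. \<phi> z / \<psi> z / (z - z0) powi (e - e')) \<longlongrightarrow> L / L') (at z0)"
    by (rule Lim_transform_eventually) (auto simp: eventually_at_filter power_int_diff)
  thus ?thesis using L(1,3) unfolding leading_def by (intro exI[of _ "L / L'"]) simp
qed

lemma leading_prod:
  assumes "finite I" "\<And>i. i \<in> I \<Longrightarrow> leading (\<phi> i) (e i) z0"
  shows "leading (\<lambda>z. \<Prod>i\<in>I. \<phi> i z) (\<Sum>i\<in>I. e i) z0"
  using assms
proof (induction I rule: finite_induct)
  case empty
  have "leading (\<lambda>z. 1) 0 z0" by (rule leading_tendsto[OF tendsto_const]) simp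
  thus ?case by (simp only: prod.empty sum.empty)
next
  case (insert i I)
  have "leading (\<lambda>z. \<phi> i z * (\<Prod>i\<in>I. \<phi> i z)) (e i + (\<Sum>i\<in>I. e i)) z0"
    by (rule leading_mult) (use insert in blast)+
  thus ?case by (simp only: prod.insert[OF insert.hyps] sum.insert[OF insert.hyps])
qed

lemma leading_derivative:
  assumes "(\<tau> has_field_derivative D) (at z0)" "D \<noteq> 0"
  shows "leading (\<lambda>z. \<tau> z - \<tau> z0) 1 z0"
  using assms unfolding leading_def has_field_derivative_iff by auto

text \<open>After division by the power the function has a nonzero limit at \<open>z0\<close>, so
  the singularity is removable.\<close>

lemma leading_holomorphic:
  assumes r: "0 < r" and hol: "\<And>z. z \<in> ball z0 r - {z0} \<Longrightarrow> has_dbar \<phi> 0 z" and lead: "leading \<phi> e z0"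
  shows "\<exists>G. G holomorphic_on ball z0 r \<and> G z0 \<noteq> 0 \<and> (\<forall>z\<in>ball z0 r - {z0}. \<phi> z = G z * (z - z0) powi e)"
proof -
  obtain L where L: "L \<noteq> 0" "((\<lambda>z. \<phi> z / (z - z0) powi e) \<longlongrightarrow> L) (at z0)"
    using lead unfolding leading_def by blast
  define G where "G = (\<lambda>z. if z = z0 then L else \<phi> z / (z - z0) powi e)"
  have "\<phi> holomorphic_on ball z0 r - {z0}"
    by (rule has_dbar_0_imp_holomorphic) (use hol in auto)
  hence "(\<lambda>z. \<phi> z / (z - z0) powi e) holomorphic_on ball z0 r - {z0}"
    by (intro holomorphic_intros) auto
  hence Gh: "G holomorphic_on ball z0 r - {z0}"
    by (rule holomorphic_transform) (auto simp: G_def)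
  have "(G \<longlongrightarrow> L) (at z0)"
    by (rule Lim_transform_eventually[OF L(2)]) (auto simp: G_def eventually_at_filter)
  hence c0: "isCont G z0" by (simp add: isCont_def G_def)
  have op: "open (ball z0 r - {z0})" by auto
  have "isCont G z" if "z \<in> ball z0 r" for z
  proof (cases "z = z0")
    case False
    hence "z \<in> ball z0 r - {z0}" using that by blast
    thus ?thesis using holomorphic_on_imp_continuous_on[OF Gh] op continuous_on_eq_continuous_at by blast
  qed (use c0 in simp)
  hence "continuous_on (ball z0 r) G" by (intro continuous_at_imp_continuous_on) blast
  hence "G holomorphic_on ball z0 r"
    by (rule no_isolated_singularity[OF _ Gh]) auto
  moreover have "\<phi> z = G z * (z - z0) powi e" if "z \<in> ball z0 r - {z0}" for z
    using that by (simp add: G_def)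
  ultimately show ?thesis using L(1) by (intro exI[of _ G]) (simp add: G_def)
qed

context form_functional
begin

text \<open>As functions of \<open>b\<close> both sides have the derivative
  \<open>- \<theta> i b\<close>, and they agree at \<open>b = a\<close>, where the logarithm
  vanishes on the annuli.\<close>

lemma \<Lambda>_log_part:
  assumes i: "i < n" and ab: "a \<in> ball (ctr i) 1" "b \<in> ball (ctr i) 1"
  shows "\<Lambda> (Q (log_part i a b)) = \<Lambda> (Q (log_part i (ctr i) b)) - \<Lambda> (Q (log_part i (ctr i) a))"
proof -
  define H where "H = (\<lambda>t. \<Lambda> (Q (log_part i a t)) - \<Lambda> (Q (log_part i (ctr i) t)))"
  have c: "ctr i \<in> ball (ctr i) 1" by simp
  have "(H has_field_derivative 0) (at t within ball (ctr i) 1)" if "t \<in> ball (ctr i) 1" for t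
    using DERIV_diff[OF log_part_derivative[OF i ab(1) that] log_part_derivative[OF i c that]]
    unfolding H_def by (simp add: has_field_derivative_at_within)
  from has_field_derivative_zero_constant[OF convex_ball this]
  obtain k where k: "\<And>t. t \<in> ball (ctr i) 1 \<Longrightarrow> H t = k" by metis
  have "log_part i a a u = 0 * log_part i a a u" if "u \<in> annuli" for u
  proof (cases "norm (u - ctr i) < 3")
    case True
    obtain j where j: "3/2 < norm (u - ctr j)" "norm (u - ctr j) < 2"
      using \<open>u \<in> annuli\<close> by (auto simp: annuli_def)
    have "j = i" using ctr_far[of j i u 2] j True by force
    hence "u \<noteq> a" using j(1) ab(1) by (auto simp: dist_norm norm_minus_commute)
    thus ?thesis by (simp add: log_part_def on_disc_def)
  qed (simp add: log_part_def on_disc_def)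
  hence "Q (log_part i a a) = Q (\<lambda>u. 0 * log_part i a a u)" by (intro ext Q_cong_annuli)
  hence "\<Lambda> (Q (log_part i a a)) = \<Lambda> (Q (\<lambda>u. 0 * log_part i a a u))" by (rule arg_cong)
  also have "\<dots> = 0 * \<Lambda> (Q (log_part i a a))"
    by (rule \<Lambda>_Q_cmult[OF regular_log_part[OF ab(1) ab(1)]])
  finally have "\<Lambda> (Q (log_part i a a)) = 0" by simp
  hence "H a = - \<Lambda> (Q (log_part i (ctr i) a))" by (simp add: H_def)
  with k[OF ab(1)] k[OF ab(2)] show ?thesis by (simp add: H_def algebra_simps)
qed

end

context cutoff_cover
begin

lemma log_part_has_dbar:
  assumes ab: "a \<in> ball (ctr i) 1" "b \<in> ball (ctr i) 1" and u: "1 < norm (u - ctr j)" "norm (u - ctr j) < 3"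
  shows "has_dbar (log_part i a b) 0 u"
proof (cases "j = i")
  case True
  have "has_dbar (\<lambda>u. Ln ((u - b) / (u - a))) 0 u"
    unfolding has_dbar_0_iff
    by (rule Ln_quotient_derivatives(2)[OF segment_in_unit[OF ab]]) (use u True in simp)
  thus ?thesis unfolding log_part_def by (intro on_disc_has_dbar) (use u True in simp_all)
next
  case False
  show ?thesis unfolding log_part_def by (rule on_disc_has_dbar_0[OF u(2) False])
qed

context
  fixes m :: nat and I :: "nat \<Rightarrow> nat" and p q :: "nat \<Rightarrow> 'a"
  assumes seg: "\<And>k. k < m \<Longrightarrow> I k < n" "\<And>k. k < m \<Longrightarrow> p k \<in> fst (d (I k))" "\<And>k. k < m \<Longrightarrow> q k \<in> fst (d (I k))"
    "\<And>k. k < m \<Longrightarrow> snd (d (I k)) (p k) \<in> ball (ctr (I k)) 1" "\<And>k. k < m \<Longrightarrow> snd (d (I k)) (q k) \<in> ball (ctr (I k)) 1"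
begin

definition seg_start where "seg_start k = snd (d (I k)) (p k)"
definition seg_end where "seg_end k = snd (d (I k)) (q k)"

definition log_sum :: "complex \<Rightarrow> complex" where
  "log_sum u = (\<Sum>k<m. log_part (I k) (seg_start k) (seg_end k) u)"

lemma seg_in_ball: "k < m \<Longrightarrow> seg_start k \<in> ball (ctr (I k)) 1" "k < m \<Longrightarrow> seg_end k \<in> ball (ctr (I k)) 1"
  using seg(4,5) by (auto simp: seg_start_def seg_end_def)

text \<open>Were the form not exact, a functional would separate it from the exact forms. The
  differential attached to this functional has the primitives \<open>F i\<close>, and its increments
  along the segments sum to minus the value of the functional on the form; by hypothesis this is
  0.\<close>

lemma exact_log_sum:
  assumes per: "\<And>\<omega> F. holomorphic_differential A \<omega> \<Longrightarrow>
    (\<And>i. i < n \<Longrightarrow> primitive_on A \<omega> {x \<in> fst (d i). snd (d i) x \<in> ball (ctr i) 1} (F i)) \<Longrightarrow>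
    (\<Sum>k<m. F (I k) (q k) - F (I k) (p k)) = 0"
  shows "exact (Q log_sum)"
proof (rule ccontr)
  assume nex: "\<not> exact (Q log_sum)"
  have reg: "regular (log_part (I k) (seg_start k) (seg_end k))" if "k \<in> {..<m}" for k
    using that by (intro regular_log_part seg_in_ball) auto
  have ls: "log_sum = (\<lambda>u. \<Sum>k<m. log_part (I k) (seg_start k) (seg_end k) u)"
    by (rule ext) (rule log_sum_def)
  have rs: "regular log_sum" unfolding ls by (rule regular_sum) (use reg in auto)
  obtain \<Lambda> C where \<Lambda>:
    "\<And>b b'. admissible b \<Longrightarrow> admissible b' \<Longrightarrow> \<Lambda> (\<lambda>w. b w + b' w) = \<Lambda> b + \<Lambda> b'"
    "\<And>k b. admissible b \<Longrightarrow> \<Lambda> (\<lambda>w. k * b w) = k * \<Lambda> b"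
    "\<And>b B. admissible b \<Longrightarrow> (\<And>w. norm (b w) \<le> B) \<Longrightarrow> norm (\<Lambda> b) \<le> C * B"
    "\<And>b. admissible b \<Longrightarrow> (\<And>w. b differentiable (at w)) \<Longrightarrow> exact b \<Longrightarrow> \<Lambda> b = 0"
    "\<Lambda> (Q log_sum) \<noteq> 0"
    by (rule separating_form_functional[OF regular_admissible[OF rs] regular_differentiable[OF rs] nex]) blast
  interpret L: form_functional X A n d \<rho> \<Psi> \<Psi>' \<Lambda> C
    by unfold_locales (fact \<Lambda>)+
  define F where "F = (\<lambda>i x. - \<Lambda> (Q (log_part i (ctr i) (snd (d i) x))))"
  have "(\<Sum>k<m. F (I k) (q k) - F (I k) (p k)) = 0"
  proof (rule per[OF L.\<omega>_holomorphic_differential])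
    fix i assume "i < n"
    from L.\<omega>_primitive[OF this, of "ctr i"]
    show "primitive_on A L.\<omega> {x \<in> fst (d i). snd (d i) x \<in> ball (ctr i) 1} (F i)"
      by (simp add: F_def L.small_disc_def)
  qed
  moreover have "\<Lambda> (Q log_sum) = - (\<Sum>k<m. F (I k) (q k) - F (I k) (p k))"
  proof -
    have "\<Lambda> (Q log_sum) = (\<Sum>k<m. \<Lambda> (Q (log_part (I k) (seg_start k) (seg_end k))))"
      unfolding ls by (rule L.\<Lambda>_Q_sum) (use reg in simp_all)
    also have "\<dots> = (\<Sum>k<m. - (F (I k) (q k) - F (I k) (p k)))"
    proof (rule sum.cong[OF refl])
      fix k assume "k \<in> {..<m}"
      hence k: "k < m" by simp
      show "\<Lambda> (Q (log_part (I k) (seg_start k) (seg_end k))) = - (F (I k) (q k) - F (I k) (p k))"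
        using L.\<Lambda>_log_part[OF seg(1)[OF k] seg_in_ball(1)[OF k] seg_in_ball(2)[OF k]]
        by (simp add: F_def seg_start_def seg_end_def)
    qed
    finally show ?thesis by (simp only: sum_negf)
  qed
  ultimately show False using \<Lambda>(5) by simp
qed

definition ratio :: "nat \<Rightarrow> complex \<Rightarrow> complex" where
  "ratio k u = (if norm (u - ctr (I k)) < 3 then (u - seg_end k) / (u - seg_start k) else 1)"

(* Away from the unit disc containing p and q the logarithm of (u - q) / (u - p) is single-valued,
   so the cutoff interpolates between the ratio and the constant 1. *)
definition disc_factor :: "complex \<Rightarrow> complex" where
  "disc_factor u = (if \<exists>j<n. norm (u - ctr j) \<le> 5/4 then \<Prod>k<m. ratio k u else exp (\<Psi> u * log_sum u))"

text \<open>Between radius 1 and 5/4 both formulas hold, since the cutoff is 1 there and the ratio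
  is the exponential of its logarithm. The threshold 5/4 lies strictly between 1 and 3/2, which
  makes them overlap on an open annulus.\<close>

lemma disc_factor_outer:
  assumes "l < n" "1 < norm (u - ctr l)" "norm (u - ctr l) < 3"
  shows "disc_factor u = exp (\<Psi> u * log_sum u)"
proof (cases "\<exists>j<n. norm (u - ctr j) \<le> 5/4")
  case True
  then obtain j where j: "j < n" "norm (u - ctr j) \<le> 5/4" by blast
  hence "\<Psi> u = 1" by (intro cut_one[of j]) auto
  moreover have "ratio k u = exp (log_part (I k) (seg_start k) (seg_end k) u)" if k: "k < m" for k
  proof (cases "norm (u - ctr (I k)) < 3")
    case True
    have "I k = l" using ctr_far[of l "I k" u 3] assms True by force
    hence "u \<noteq> seg_start k" "u \<noteq> seg_end k"
      using seg_in_ball[OF k] assms(2) by (auto simp: dist_norm norm_minus_commute)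
    thus ?thesis using True by (simp add: ratio_def log_part_def on_disc_def)
  qed (simp add: ratio_def log_part_def on_disc_def)
  hence "(\<Prod>k<m. ratio k u) = exp (log_sum u)"
    unfolding log_sum_def by (subst exp_sum) (auto intro: prod.cong)
  ultimately show ?thesis using True by (simp add: disc_factor_def)
next
  case False
  thus ?thesis unfolding disc_factor_def by (simp only: if_False)
qed

lemma disc_factor_inner: "l < n \<Longrightarrow> norm (u - ctr l) \<le> 5/4 \<Longrightarrow> disc_factor u = (\<Prod>k<m. ratio k u)"
  unfolding disc_factor_def by (rule if_P) blast

lemma disc_factor_off: "(\<And>j. j < n \<Longrightarrow> 2 < norm (u - ctr j)) \<Longrightarrow> disc_factor u = 1"
proof -
  assume a: "\<And>j. j < n \<Longrightarrow> 2 < norm (u - ctr j)"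
  hence "\<not> (\<exists>j<n. norm (u - ctr j) \<le> 5/4)" by force
  moreover have "\<Psi> u = 0" by (rule cut_zero) (use a in force)
  ultimately show ?thesis unfolding disc_factor_def by (simp only: if_False mult_zero_left exp_zero)
qed

text \<open>Outside the closed unit disc the factor is an exponential, with logarithmic
  dbar-derivative \<open>\<Psi>' u * log_sum u\<close>. Inside it is a product of holomorphic
  ratios, in accordance with \<open>\<Psi>' u = 0\<close>.\<close>

lemma disc_factor_has_dbar:
  assumes l: "l < n" and u: "norm (u - ctr l) < 3"
    and ns: "\<And>k. k < m \<Longrightarrow> I k = l \<Longrightarrow> u \<noteq> seg_start k"
  shows "has_dbar disc_factor (disc_factor u * (\<Psi>' u * log_sum u)) u"
proof (cases "1 < norm (u - ctr l)")
  case True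
  have "has_dbar (\<lambda>u. \<Sum>k<m. log_part (I k) (seg_start k) (seg_end k) u) (\<Sum>k<m. 0) u"
    by (rule has_dbar_sum) (use log_part_has_dbar[OF seg_in_ball True u] in auto)
  hence "has_dbar log_sum 0 u" by (simp add: log_sum_def[abs_def])
  from has_dbar_exp[OF has_dbar_mult[OF cut_dbar this]]
  have *: "has_dbar (\<lambda>w. exp (\<Psi> w * log_sum w)) (exp (\<Psi> u * log_sum u) * (\<Psi>' u * log_sum u)) u" by simp
  have "has_dbar disc_factor (exp (\<Psi> u * log_sum u) * (\<Psi>' u * log_sum u)) u"
  proof (rule has_dbar_transform_open[OF *])
    show "open (ball (ctr l) 3 - cball (ctr l) 1)" by (intro open_Diff) auto
    show "u \<in> ball (ctr l) 3 - cball (ctr l) 1" using True u by (auto simp: dist_norm norm_minus_commute)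
    show "exp (\<Psi> w * log_sum w) = disc_factor w" if "w \<in> ball (ctr l) 3 - cball (ctr l) 1" for w
      using that by (intro disc_factor_outer[OF l, symmetric]) (auto simp: dist_norm norm_minus_commute)
  qed
  thus ?thesis using disc_factor_outer[OF l True u] by simp
next
  case False
  have "has_dbar (ratio k) (ratio k u * 0) u" if k: "k < m" for k
  proof (cases "I k = l")
    case True
    have "(\<lambda>u. (u - seg_end k) / (u - seg_start k)) field_differentiable (at u)"
      using ns[OF k True] by (intro derivative_intros) auto
    hence "has_dbar (\<lambda>u. (u - seg_end k) / (u - seg_start k)) 0 u" by (simp add: has_dbar_0_iff)
    hence "has_dbar (ratio k) 0 u"
      by (rule has_dbar_transform_open[OF _ open_ball[of "ctr l" 3]])
         (use u True in \<open>auto simp: ratio_def dist_norm norm_minus_commute\<close>)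
    thus ?thesis by simp
  next
    case kl: False
    have "has_dbar (ratio k) 0 u"
    proof (rule has_dbar_transform_open[OF has_dbar_const open_ball[of "ctr l" 3]])
      fix v assume "v \<in> ball (ctr l) 3"
      thus "1 = ratio k v" using ctr_far[of l "I k" v 3] kl
        by (auto simp: ratio_def dist_norm norm_minus_commute)
    qed (use u in \<open>auto simp: dist_norm norm_minus_commute\<close>)
    thus ?thesis by simp
  qed
  hence *: "has_dbar (\<lambda>w. \<Prod>k<m. ratio k w) ((\<Prod>k<m. ratio k u) * (\<Sum>k<m. 0)) u"
    by (intro has_dbar_prod) auto
  have "has_dbar disc_factor ((\<Prod>k<m. ratio k u) * (\<Sum>k<m. 0)) u"
    by (rule has_dbar_transform_open[OF * open_ball[of "ctr l" "5/4"]])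
       (use False in \<open>auto simp: dist_norm norm_minus_commute intro!: disc_factor_inner[OF l, symmetric]\<close>)
  thus ?thesis using cut'_zero[OF l, of u] False by simp
qed

text \<open>The logarithmic dbar-derivative of the product is the form of
  \<open>\<Psi>' u * log_sum u\<close>. If \<open>g\<close> is a solution for this form, the
  exponential cancels it without adding zeros or poles.\<close>

definition total :: "('a \<Rightarrow> complex) \<Rightarrow> 'a \<Rightarrow> complex" where
  "total g x = exp (- g x) * (\<Prod>l<n. if x \<in> fst (d l) then disc_factor (snd (d l) x) else 1)"

definition seg_order :: "'a \<Rightarrow> int" where
  "seg_order x = (\<Sum>k<m. of_bool (x = q k) - of_bool (x = p k))"

lemma total_has_dbar:
  assumes g: "has_dbar (g \<circ> chart_inv c) (form (\<lambda>u. \<Psi>' u * log_sum u) c x) (snd c x)"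
    and c: "c \<in> maximal_atlas" "x \<in> fst c" and x: "\<And>k. k < m \<Longrightarrow> x \<noteq> p k"
  shows "has_dbar (total g \<circ> chart_inv c) 0 (snd c x)"
proof -
  let ?f = "\<lambda>l z. if chart_inv c z \<in> fst (d l) then disc_factor (snd (d l) (chart_inv c z)) else 1"
  let ?e = "\<lambda>l. if x \<in> fst (d l) then (\<Psi>' (snd (d l) x) * log_sum (snd (d l) x)) * cnj (jac c (d l) x) else 0"
  have "has_dbar (?f l) (?f l (snd c x) * ?e l) (snd c x)" if l: "l \<in> {..<n}" for l
  proof (cases "x \<in> fst (d l)")
    case True
    have ln: "l < n" using l by simp
    let ?u = "snd (d l) x"
    have "has_dbar disc_factor (disc_factor ?u * (\<Psi>' ?u * log_sum ?u)) ?u"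
    proof (rule disc_factor_has_dbar[OF ln disc_range[OF ln True]])
      fix k assume k: "k < m" "I k = l"
      show "?u \<noteq> seg_start k"
        using disc_point_unique[OF ln seg(1)[OF k(1)] True seg(2)[OF k(1)]] x[OF k(1)]
        by (auto simp: seg_start_def)
    qed
    hence "has_dbar (\<lambda>z. disc_factor (transition c (d l) z)) (disc_factor ?u * (\<Psi>' ?u * log_sum ?u) * cnj (jac c (d l) x)) (snd c x)"
      by (intro has_dbar_comp_holomorphic has_derivative_transition[OF c(1) disc_chart[OF ln] c(2) True])
         (use c in simp)
    hence "has_dbar (?f l) (disc_factor ?u * (\<Psi>' ?u * log_sum ?u) * cnj (jac c (d l) x)) (snd c x)"
      by (rule has_dbar_eventually)
         (use eventually_chart[OF c(1) chartD(1)[OF disc_chart[OF ln]] True c(2)] in \<open>auto elim: eventually_mono\<close>)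
    thus ?thesis using True c by (simp add: mult.assoc)
  next
    case False
    have "has_dbar (?f l) 0 (snd c x)"
      by (rule has_dbar_eventually[OF has_dbar_const],
          rule eventually_mono[OF eventually_outside_disc[OF c _ False]])
         (use l disc_factor_off in auto)
    thus ?thesis using False by simp
  qed
  from has_dbar_prod[OF finite_lessThan this]
  have P: "has_dbar (\<lambda>z. \<Prod>l<n. ?f l z) ((\<Prod>l<n. ?f l (snd c x)) * (\<Sum>l<n. ?e l)) (snd c x)" .
  have E: "has_dbar (\<lambda>z. exp ((-1) * (g \<circ> chart_inv c) z))
      (exp ((-1) * (g \<circ> chart_inv c) (snd c x)) * ((-1) * (\<Sum>l<n. ?e l))) (snd c x)"
    using has_dbar_exp[OF has_dbar_cmult[OF g, of "-1"]] by (simp add: form_def)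
  from has_dbar_mult[OF E P]
  have "has_dbar (\<lambda>z. exp ((-1) * (g \<circ> chart_inv c) z) * (\<Prod>l<n. ?f l z)) 0 (snd c x)"
    by (simp add: algebra_simps)
  thus ?thesis by (simp add: total_def[abs_def] comp_def)
qed

lemma seg_coordinate:
  assumes c: "c \<in> maximal_atlas" "x \<in> fst c" and l: "l < n" "x \<in> fst (d l)" and y: "y \<in> fst (d l)"
  shows "leading (\<lambda>z. transition c (d l) z - snd (d l) y) (of_bool (x = y)) (snd c x)"
proof (cases "x = y")
  case True
  have "leading (\<lambda>z. transition c (d l) z - transition c (d l) (snd c x)) 1 (snd c x)"
    by (rule leading_derivative[OF has_derivative_transition[OF c(1) disc_chart[OF l(1)] c(2) l(2)]
          jac_nonzero[OF c(1) disc_chart[OF l(1)] c(2) l(2)]])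
  thus ?thesis using True c by simp
next
  case False
  have "isCont (transition c (d l)) (snd c x)"
    by (rule DERIV_isCont[OF has_derivative_transition[OF c(1) disc_chart[OF l(1)] c(2) l(2)]])
  hence "(transition c (d l) \<longlongrightarrow> snd (d l) x) (at (snd c x))" using c by (simp add: isCont_def)
  hence "((\<lambda>z. transition c (d l) z - snd (d l) y) \<longlongrightarrow> snd (d l) x - snd (d l) y) (at (snd c x))"
    by (intro tendsto_diff tendsto_const)
  moreover have "snd (d l) x - snd (d l) y \<noteq> 0"
    using disc_point_unique[OF l(1) l(1) l(2) y] False by auto
  ultimately show ?thesis using False leading_tendsto by simp
qed

lemma total_leading:
  assumes g: "has_dbar (g \<circ> chart_inv c) b (snd c x)" and c: "c \<in> maximal_atlas" "x \<in> fst c"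
  shows "leading (total g \<circ> chart_inv c) (seg_order x) (snd c x)"
proof -
  let ?z = "snd c x"
  let ?f = "\<lambda>l z. if chart_inv c z \<in> fst (d l) then disc_factor (snd (d l) (chart_inv c z)) else 1"
  \<comment> \<open>Segment \<open>k\<close> contributes only to the factor of its own disc
    \<open>I k\<close>; summing over all discs recovers \<open>seg_order\<close>.\<close>
  let ?e = "\<lambda>l k. if I k = l then of_bool (x = q k) - of_bool (x = p k) else (0::int)"
  have "leading (?f l) (\<Sum>k<m. ?e l k) ?z" if "l \<in> {..<n}" for l
  proof -
    have l: "l < n" using that by simp
    have zero: "(\<Sum>k<m. ?e l k) = 0" if "\<not> (x \<in> fst (d l) \<and> norm (snd (d l) x - ctr l) \<le> 1)"
    proof (rule sum.neutral, intro ballI)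
      fix k assume "k \<in> {..<m}"
      hence k: "k < m" by simp
      show "?e l k = 0"
        using that seg(2-5)[OF k] by (auto simp: dist_norm norm_minus_commute)
    qed
    show ?thesis
    proof (cases "x \<in> fst (d l)")
      case False
      have "leading (?f l) 0 ?z"
      proof (rule leading_cong[OF leading_tendsto[OF tendsto_const]])
        show "\<forall>\<^sub>F z in at ?z. 1 = ?f l z"
          using eventually_outside_disc[OF c l False] unfolding eventually_at_filter
          by (rule eventually_mono) (use disc_factor_off in auto)
      qed simp
      thus ?thesis using zero False by simp
    next
      case True
      let ?u = "snd (d l) x" and ?t = "transition c (d l)"
      note ev = eventually_chart[OF c(1) chartD(1)[OF disc_chart[OF l]] True c(2)]
      have "isCont ?t ?z"
        by (rule DERIV_isCont[OF has_derivative_transition[OF c(1) disc_chart[OF l] c(2) True]])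
      hence tl: "(?t \<longlongrightarrow> ?u) (at ?z)" using c by (simp add: isCont_def)
      have evf: "\<forall>\<^sub>F z in at ?z. ?f l z = disc_factor (?t z)"
        using ev unfolding eventually_at_filter by (rule eventually_mono) auto
      show ?thesis
      proof (cases "norm (?u - ctr l) \<le> 1")
        case False
        have "isCont disc_factor ?u"
        proof (rule has_dbar_imp_continuous[OF disc_factor_has_dbar[OF l disc_range[OF l True]]])
          show "?u \<noteq> seg_start k" if "k < m" "I k = l" for k
            using seg_in_ball(1)[OF that(1)] that(2) False by (auto simp: dist_norm norm_minus_commute)
        qed
        hence "((\<lambda>z. disc_factor (?t z)) \<longlongrightarrow> disc_factor ?u) (at ?z)"
          using tl by (rule isCont_tendsto_compose)
        moreover have "disc_factor ?u \<noteq> 0"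
          using disc_factor_outer[OF l _ disc_range[OF l True]] False by simp
        ultimately have "leading (\<lambda>z. disc_factor (?t z)) 0 ?z" by (rule leading_tendsto)
        hence "leading (?f l) 0 ?z" by (rule leading_cong) (use evf in \<open>auto elim: eventually_mono\<close>)
        thus ?thesis using zero False by simp
      next
        case inner: True
        have near: "\<forall>\<^sub>F z in at ?z. norm (?t z - ctr l) < 5/4"
        proof -
          have "?u \<in> ball (ctr l) (5/4)" using inner by (simp add: dist_norm norm_minus_commute)
          from topological_tendstoD[OF tl open_ball this] show ?thesis
            by (simp add: dist_norm norm_minus_commute)
        qed
        have "leading (\<lambda>z. ratio k (?t z)) (?e l k) ?z" if "k \<in> {..<m}" for k
        proof -
          have k: "k < m" using that by simp
          show ?thesis
          proof (cases "I k = l")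
            case Ik: True
            have "leading (\<lambda>z. (?t z - seg_end k) / (?t z - seg_start k)) (of_bool (x = q k) - of_bool (x = p k)) ?z"
              unfolding seg_start_def seg_end_def Ik
              by (intro leading_divide seg_coordinate[OF c l True]) (use seg(2,3)[OF k] Ik in auto)
            hence "leading (\<lambda>z. ratio k (?t z)) (of_bool (x = q k) - of_bool (x = p k)) ?z"
              by (rule leading_cong) (use near Ik in \<open>auto elim!: eventually_mono simp: ratio_def\<close>)
            thus ?thesis using Ik by simp
          next
            case Ik: False
            have "leading (\<lambda>z. ratio k (?t z)) 0 ?z"
            proof (rule leading_cong[OF leading_tendsto[OF tendsto_const]])
              show "\<forall>\<^sub>F z in at ?z. 1 = ratio k (?t z)"
                using near
              proof eventually_elim
                case (elim z)
                show ?case using ctr_far[of l "I k" "?t z" "5/4"] Ik elim by (simp add: ratio_def)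
              qed
            qed simp
            thus ?thesis using Ik by simp
          qed
        qed
        from leading_prod[OF finite_lessThan this]
        have "leading (\<lambda>z. \<Prod>k<m. ratio k (?t z)) (\<Sum>k<m. ?e l k) ?z" .
        thus ?thesis
        proof (rule leading_cong)
          show "\<forall>\<^sub>F z in at ?z. (\<Prod>k<m. ratio k (?t z)) = ?f l z"
            using near evf by eventually_elim (simp add: disc_factor_inner[OF l])
        qed
      qed
    qed
  qed
  from leading_prod[OF finite_lessThan this]
  have 1: "leading (\<lambda>z. \<Prod>l<n. ?f l z) (\<Sum>l<n. \<Sum>k<m. ?e l k) ?z" .
  have "(\<Sum>l<n. \<Sum>k<m. ?e l k) = seg_order x"
    unfolding seg_order_def
    by (subst sum.swap, rule sum.cong) (use seg(1) in \<open>auto simp: sum.delta\<close>)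
  moreover have "isCont (g \<circ> chart_inv c) ?z" by (rule has_dbar_imp_continuous[OF g])
  hence "((\<lambda>z. exp (- (g \<circ> chart_inv c) z)) \<longlongrightarrow> exp (- (g \<circ> chart_inv c) ?z)) (at ?z)"
    unfolding isCont_def by (intro tendsto_intros)
  hence 2: "leading (\<lambda>z. exp (- (g \<circ> chart_inv c) z)) 0 ?z" by (rule leading_tendsto) simp
  ultimately show ?thesis using leading_mult[OF 2 1] by (simp add: total_def[abs_def] comp_def)
qed

lemma function_with_seg_order:
  assumes "exact (Q log_sum)"
  shows "\<exists>f. meromorphic_function X A f \<and> (\<forall>x\<in>topspace X. ord_at A f x = seg_order x) \<and>
    (\<forall>x\<in>topspace X. seg_order x = 0 \<longrightarrow> f x \<noteq> 0)"
proof -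
  have "exact (\<lambda>u. \<Psi>' u * log_sum u)" using assms by (simp add: exact_Q_iff)
  then obtain g where g: "\<And>c x. c \<in> maximal_atlas \<Longrightarrow> x \<in> fst c \<Longrightarrow>
      has_dbar (g \<circ> chart_inv c) (form (\<lambda>u. \<Psi>' u * log_sum u) c x) (snd c x)"
    unfolding exact_def by blast
  show ?thesis
  proof (rule meromorphic_functionI[of "total g" seg_order])
    fix c x assume "c \<in> A" and x: "x \<in> fst c"
    hence c: "c \<in> maximal_atlas" using atlas_subset by blast
    \<comment> \<open>Only starting points are excluded: at an end point that is not a starting
      point the function merely vanishes and \<open>total_has_dbar\<close> still applies. Removing
      \<open>x\<close> from the set leaves a punctured disc around \<open>x\<close> free of
      singularities.\<close>
    define P where "P = p ` {..<m} - {x}"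
    have "P \<subseteq> topspace X" unfolding P_def using seg(1,2) disc_topspace by blast
    hence "closedin X P"
      using Hausdorff_imp_t1_space[OF Hausdorff] by (simp add: t1_space_closedin_finite P_def)
    hence oP: "openin X (topspace X - P)" by blast
    have xP: "x \<in> topspace X - P" using chartD(2)[OF c] x by (auto simp: P_def)
    obtain r where r: "0 < r" "ball (snd c x) r \<subseteq> snd c ` fst c"
        "{y \<in> fst c. snd c y \<in> ball (snd c x) r} \<subseteq> topspace X - P"
      by (rule chart_ball_nbhd[OF c oP xP x])
    have "has_dbar (total g \<circ> chart_inv c) 0 z" if z: "z \<in> ball (snd c x) r - {snd c x}" for z
    proof -
      obtain y where y: "y \<in> fst c" "z = snd c y" using r(2) z by blast
      have "y \<notin> P" using r(3) y z by blast
      moreover have "y \<noteq> x" using z y by blast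
      ultimately have "y \<noteq> p k" if "k < m" for k using that by (auto simp: P_def)
      from total_has_dbar[OF g[OF c y(1)] c y(1) this] show ?thesis using y by simp
    qed
    from leading_holomorphic[OF r(1) this total_leading[OF g[OF c x] c x]]
    obtain G where G: "G holomorphic_on ball (snd c x) r" "G (snd c x) \<noteq> 0"
      "\<forall>z\<in>ball (snd c x) r - {snd c x}. (total g \<circ> chart_inv c) z = G z * (z - snd c x) powi seg_order x"
      by blast
    show "\<exists>S G. open S \<and> snd c x \<in> S \<and> G holomorphic_on S \<and> G (snd c x) \<noteq> 0 \<and>
        (\<forall>z\<in>S - {snd c x}. (total g \<circ> chart_inv c) z = G z * (z - snd c x) powi seg_order x)"
      by (rule exI[of _ "ball (snd c x) r"], rule exI[of _ G]) (use G r(1) in simp)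
  qed
qed

end

end


lemma divisor_eqI:
  assumes "\<And>x. x \<in> topspace X \<Longrightarrow> ord_at A f x = Poly_Mapping.lookup D x" "Poly_Mapping.keys D \<subseteq> topspace X"
  shows "divisor X A f = D"
proof -
  have "{p \<in> topspace X. ord_at A f p \<noteq> 0} = Poly_Mapping.keys D"
    using assms by (auto simp: in_keys_iff)
  hence "divisor X A f = (\<Sum>p\<in>Poly_Mapping.keys D. frag_cmul (Poly_Mapping.lookup D p) (frag_of p))"
    unfolding divisor_def using assms by (auto intro!: sum.cong)
  also have "\<dots> = D" using frag_expansion[of D] by (simp add: frag_extend_def)
  finally show ?thesis .
qed

lemma (in cutoff_cover) function_of_segments:
  fixes L :: "(nat \<times> 'a \<times> 'a) list"
  assumes L: "\<forall>(i, x, y)\<in>set L. i < n \<and> x \<in> fst (d i) \<and> y \<in> fst (d i) \<and>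
       snd (d i) x \<in> ball (ctr i) 1 \<and> snd (d i) y \<in> ball (ctr i) 1"
    and per: "\<And>\<omega> F. holomorphic_differential A \<omega> \<Longrightarrow>
      \<forall>i<n. primitive_on A \<omega> {x \<in> fst (d i). snd (d i) x \<in> ball (ctr i) 1} (F i) \<Longrightarrow>
      (\<Sum>(i, x, y)\<leftarrow>L. F i y - F i x) = 0"
  shows "\<exists>f. meromorphic_function X A f \<and> divisor X A f = (\<Sum>(i, x, y)\<leftarrow>L. frag_of y - frag_of x) \<and>
    (\<forall>x\<in>topspace X. x \<notin> Poly_Mapping.keys (\<Sum>(i, x, y)\<leftarrow>L. frag_of y - frag_of x) \<longrightarrow> f x \<noteq> 0)"
proof -
  define I where "I = (\<lambda>k. fst (L ! k))"
  define p where "p = (\<lambda>k. fst (snd (L ! k)))"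
  define q where "q = (\<lambda>k. snd (snd (L ! k)))"
  let ?m = "length L"
  let ?D = "\<Sum>(i, x, y)\<leftarrow>L. frag_of y - frag_of x"
  have "I k < n \<and> p k \<in> fst (d (I k)) \<and> q k \<in> fst (d (I k)) \<and>
      snd (d (I k)) (p k) \<in> ball (ctr (I k)) 1 \<and> snd (d (I k)) (q k) \<in> ball (ctr (I k)) 1" if "k < ?m" for k
    using bspec[OF L nth_mem[OF that]] by (simp add: I_def p_def q_def case_prod_beta)
  hence seg: "\<And>k. k < ?m \<Longrightarrow> I k < n" "\<And>k. k < ?m \<Longrightarrow> p k \<in> fst (d (I k))" "\<And>k. k < ?m \<Longrightarrow> q k \<in> fst (d (I k))"
    "\<And>k. k < ?m \<Longrightarrow> snd (d (I k)) (p k) \<in> ball (ctr (I k)) 1" "\<And>k. k < ?m \<Longrightarrow> snd (d (I k)) (q k) \<in> ball (ctr (I k)) 1"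
    by simp_all
  have F: "(\<Sum>(i, x, y)\<leftarrow>L. F i y - F i x) = (\<Sum>k<?m. F (I k) (q k) - F (I k) (p k))" for F :: "nat \<Rightarrow> 'a \<Rightarrow> complex"
    unfolding sum_list_sum_nth by (simp add: I_def p_def q_def case_prod_beta lessThan_atLeast0)
  have D: "?D = (\<Sum>k<?m. frag_of (q k) - frag_of (p k))"
    unfolding sum_list_sum_nth by (simp add: p_def q_def case_prod_beta lessThan_atLeast0)
  have so: "seg_order ?m p q x = (\<Sum>k<?m. of_bool (x = q k) - of_bool (x = p k))" for x
    by (rule seg_order_def; erule seg)
  have lk: "Poly_Mapping.lookup ?D x = seg_order ?m p q x" for x
    unfolding D so by (simp add: lookup_sum lookup_minus of_bool_def)
  have "exact (Q (log_sum ?m I p q))"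
  proof (rule exact_log_sum; (erule seg)?)
    fix \<omega> F assume \<omega>: "holomorphic_differential A \<omega>"
      and pr: "\<And>i. i < n \<Longrightarrow> primitive_on A \<omega> {x \<in> fst (d i). snd (d i) x \<in> ball (ctr i) 1} (F i)"
    have "\<forall>i<n. primitive_on A \<omega> {x \<in> fst (d i). snd (d i) x \<in> ball (ctr i) 1} (F i)" using pr by blast
    from per[OF \<omega> this] show "(\<Sum>k<?m. F (I k) (q k) - F (I k) (p k)) = 0" unfolding F .
  qed
  have "\<exists>f. meromorphic_function X A f \<and> (\<forall>x\<in>topspace X. ord_at A f x = seg_order ?m p q x) \<and>
    (\<forall>x\<in>topspace X. seg_order ?m p q x = 0 \<longrightarrow> f x \<noteq> 0)"
    by (rule function_with_seg_order[OF _ _ _ _ _ \<open>exact (Q (log_sum ?m I p q))\<close>]; erule seg)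
  then obtain f where f: "meromorphic_function X A f" "\<forall>x\<in>topspace X. ord_at A f x = seg_order ?m p q x"
    "\<forall>x\<in>topspace X. seg_order ?m p q x = 0 \<longrightarrow> f x \<noteq> 0" by (elim exE conjE) (rule that)
  have "Poly_Mapping.keys ?D \<subseteq> topspace X"
  proof
    fix x assume "x \<in> Poly_Mapping.keys ?D"
    hence "seg_order ?m p q x \<noteq> 0" by (simp add: in_keys_iff lk)
    hence "\<exists>k<?m. x = p k \<or> x = q k"
      unfolding so by (auto dest: sum.not_neutral_contains_not_neutral)
    thus "x \<in> topspace X" using seg chartD(2)[OF disc_chart] by blast
  qed
  hence "divisor X A f = ?D" by (intro divisor_eqI) (use f(2) lk in simp_all)
  moreover have "\<forall>x\<in>topspace X. x \<notin> Poly_Mapping.keys ?D \<longrightarrow> f x \<noteq> 0"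
    using f(3) by (simp add: in_keys_iff lk)
  ultimately show ?thesis using f(1) by blast
qed

context rsurface
begin

text \<open>Supplies a point off the finite support of the divisor, at which the constructed
  function is visibly nonzero.\<close>

lemma infinite_topspace:
  assumes "topspace X \<noteq> {}"
  shows "infinite (topspace X)"
proof
  assume fin: "finite (topspace X)"
  obtain c where c: "c \<in> A" "fst c \<noteq> {}" using assms atlas_covers by blast
  hence M: "c \<in> maximal_atlas" using atlas_subset by blast
  have "finite (snd c ` fst c)" using fin chartD(2)[OF M] by (blast intro: finite_subset)
  thus False using finite_imp_not_open chartD(4)[OF M] c(2) by blast
qed

lemma function_of_paths:
  assumes comp: "compact_space X" and ne: "topspace X \<noteq> {}"
    and gs: "\<And>g. g \<in> set gs \<Longrightarrow> pathin X g"
    and per: "\<And>\<omega>. holomorphic_differential A \<omega> \<Longrightarrow> (\<Sum>g\<leftarrow>gs. path_integral X A g \<omega>) = 0"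
  shows "\<exists>f. meromorphic_function X A f \<and> (\<exists>x\<in>topspace X. f x \<noteq> 0) \<and>
    divisor X A f = (\<Sum>g\<leftarrow>gs. frag_of (g 1) - frag_of (g 0))"
proof -
  obtain n d where d: "\<And>i. i < n \<Longrightarrow> d i \<in> maximal_atlas" "\<And>i. i < n \<Longrightarrow> snd (d i) ` fst (d i) = ball (ctr i) 3"
    "\<And>x. x \<in> topspace X \<Longrightarrow> \<exists>i<n. x \<in> fst (d i) \<and> snd (d i) x \<in> ball (ctr i) 1"
    using disc_cover_exists[OF comp] by metis
  obtain \<rho> where \<rho>: "\<And>w. 0 \<le> \<rho> w" "\<And>i w. i < n \<Longrightarrow> norm (w - ctr i) < 1 \<Longrightarrow> 0 < \<rho> w"
    "\<And>w. (\<And>i. i < n \<Longrightarrow> 1 \<le> norm (w - ctr i)) \<Longrightarrow> \<rho> w = 0"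
    "\<And>w. (\<lambda>w. complex_of_real (\<rho> w)) differentiable (at w)"
    by (rule plane_bump_exists[of n]) blast
  obtain \<Psi> \<Psi>' where \<Psi>: "\<And>i w. i < n \<Longrightarrow> norm (w - ctr i) \<le> 3/2 \<Longrightarrow> \<Psi> w = 1"
    "\<And>w. (\<And>i. i < n \<Longrightarrow> 2 \<le> norm (w - ctr i)) \<Longrightarrow> \<Psi> w = 0"
    "\<And>w. \<Psi>' w \<noteq> 0 \<Longrightarrow> \<exists>i<n. 3/2 < norm (w - ctr i) \<and> norm (w - ctr i) < 2"
    "\<And>w. has_dbar \<Psi> (\<Psi>' w) w" "\<And>w. \<Psi>' differentiable (at w)"
    by (rule plane_cutoff_exists[of n]) blast
  interpret cutoff_cover X A n d \<rho> \<Psi> \<Psi>'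
    by unfold_locales (fact d \<rho> \<Psi>)+
  define ok where "ok L \<longleftrightarrow> (\<forall>(i, x, y)\<in>set L. i < n \<and> x \<in> fst (d i) \<and> y \<in> fst (d i) \<and>
       snd (d i) x \<in> ball (ctr i) 1 \<and> snd (d i) y \<in> ball (ctr i) 1)" for L :: "(nat \<times> 'a \<times> 'a) list"
  define prim where "prim \<omega> F \<longleftrightarrow> (\<forall>i<n. primitive_on A \<omega> {x \<in> fst (d i). snd (d i) x \<in> ball (ctr i) 1} (F i))" for \<omega> F
  have gs': "\<forall>g\<in>set gs. pathin X g" using gs by blast
  have "\<exists>L. ok L \<and> (\<Sum>g\<leftarrow>gs. frag_of (g 1) - frag_of (g 0)) = (\<Sum>(i, x, y)\<leftarrow>L. frag_of y - frag_of x) \<and>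
    (\<forall>\<omega> F. holomorphic_differential A \<omega> \<longrightarrow> prim \<omega> F \<longrightarrow>
      (\<Sum>g\<leftarrow>gs. path_integral X A g \<omega>) = (\<Sum>(i, x, y)\<leftarrow>L. F i y - F i x))"
    using gs'
  proof (induction gs)
    case Nil
    show ?case by (rule exI[of _ "[]"]) (simp add: ok_def)
  next
    case (Cons g gs)
    have "\<forall>h\<in>set gs. pathin X h" using Cons.prems by simp
    from Cons.IH[OF this]
    obtain L where L: "ok L" "(\<Sum>g\<leftarrow>gs. frag_of (g 1) - frag_of (g 0)) = (\<Sum>(i, x, y)\<leftarrow>L. frag_of y - frag_of x)"
      "\<forall>\<omega> F. holomorphic_differential A \<omega> \<longrightarrow> prim \<omega> F \<longrightarrow>
        (\<Sum>g\<leftarrow>gs. path_integral X A g \<omega>) = (\<Sum>(i, x, y)\<leftarrow>L. F i y - F i x)"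
      by (elim exE conjE) (rule that)
    have "pathin X g" using Cons.prems by simp
    from path_segments[OF this, folded ok_def prim_def]
    obtain L' where L': "ok L'" "frag_of (g 1) - frag_of (g 0) = (\<Sum>(i, x, y)\<leftarrow>L'. frag_of y - frag_of x)"
      "\<forall>\<omega> F. holomorphic_differential A \<omega> \<longrightarrow> prim \<omega> F \<longrightarrow>
        path_integral X A g \<omega> = (\<Sum>(i, x, y)\<leftarrow>L'. F i y - F i x)" by (elim exE conjE) (rule that)
    show ?case
    proof (rule exI[of _ "L' @ L"], intro conjI allI impI)
      show "ok (L' @ L)" using L(1) L'(1) by (auto simp: ok_def)
      show "(\<Sum>g\<leftarrow>g # gs. frag_of (g 1) - frag_of (g 0)) = (\<Sum>(i, x, y)\<leftarrow>L' @ L. frag_of y - frag_of x)"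
        by (simp only: list.map sum_list.Cons map_append sum_list_append L(2) L'(2))
      fix \<omega> F assume "holomorphic_differential A \<omega>" "prim \<omega> F"
      thus "(\<Sum>g\<leftarrow>g # gs. path_integral X A g \<omega>) = (\<Sum>(i, x, y)\<leftarrow>L' @ L. F i y - F i x)"
        using L(3) L'(3) by (simp only: list.map sum_list.Cons map_append sum_list_append)
    qed
  qed
  then obtain L where L: "ok L" "(\<Sum>g\<leftarrow>gs. frag_of (g 1) - frag_of (g 0)) = (\<Sum>(i, x, y)\<leftarrow>L. frag_of y - frag_of x)"
    "\<forall>\<omega> F. holomorphic_differential A \<omega> \<longrightarrow> prim \<omega> F \<longrightarrow>
      (\<Sum>g\<leftarrow>gs. path_integral X A g \<omega>) = (\<Sum>(i, x, y)\<leftarrow>L. F i y - F i x)" by (elim exE conjE) (rule that)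
  have z: "(\<Sum>(i, x, y)\<leftarrow>L. F i y - F i x) = 0" if "holomorphic_differential A \<omega>" "prim \<omega> F" for \<omega> F
    using L(3)[THEN spec, THEN spec, THEN mp, THEN mp, OF that] per[OF that(1)] by simp
  have "\<exists>f. meromorphic_function X A f \<and> divisor X A f = (\<Sum>(i, x, y)\<leftarrow>L. frag_of y - frag_of x) \<and>
    (\<forall>x\<in>topspace X. x \<notin> Poly_Mapping.keys (\<Sum>(i, x, y)\<leftarrow>L. frag_of y - frag_of x) \<longrightarrow> f x \<noteq> 0)"
    by (rule function_of_segments[OF L(1)[unfolded ok_def]], erule z) (simp only: prim_def)
  then obtain f where f: "meromorphic_function X A f" "divisor X A f = (\<Sum>(i, x, y)\<leftarrow>L. frag_of y - frag_of x)"
    "\<forall>x\<in>topspace X. x \<notin> Poly_Mapping.keys (\<Sum>(i, x, y)\<leftarrow>L. frag_of y - frag_of x) \<longrightarrow> f x \<noteq> 0"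
    by (elim exE conjE) (rule that)
  have "topspace X - Poly_Mapping.keys (\<Sum>(i, x, y)\<leftarrow>L. frag_of y - frag_of x) \<noteq> {}"
    by (rule infinite_imp_nonempty[OF Diff_infinite_finite[OF finite_keys infinite_topspace[OF ne]]])
  then obtain x where x: "x \<in> topspace X - Poly_Mapping.keys (\<Sum>(i, x, y)\<leftarrow>L. frag_of y - frag_of x)"
    unfolding ex_in_conv[symmetric] ..
  have "f x \<noteq> 0" using bspec[OF f(3), of x] x by simp
  moreover have "x \<in> topspace X" using x by simp
  ultimately show ?thesis using f(1,2) unfolding L(2) by blast
qed

end


section \<open>Fibres of meromorphic functions\<close>

lemma contour_integral_parameter_derivative:
  fixes \<phi> H :: "complex \<Rightarrow> complex"
  assumes r: "0 < r" and cont: "continuous_on (sphere a r) \<phi>" "continuous_on (sphere a r) H"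
    and s: "\<And>s w. s \<in> ball s1 \<epsilon> \<Longrightarrow> w \<in> sphere a r \<Longrightarrow> \<phi> w \<noteq> s" and t: "t \<in> ball s1 \<epsilon>"
  shows "((\<lambda>s. contour_integral (circlepath a r) (\<lambda>w. H w / (\<phi> w - s))) has_field_derivative
    contour_integral (circlepath a r) (\<lambda>w. H w / (\<phi> w - t)\<^sup>2)) (at t)"
proof -
  let ?c = "circlepath a r"
  let ?d = "\<lambda>x::real. 2 * pi * \<i> * r * exp (2 * of_real pi * \<i> * of_real x)"
  have sph: "?c x \<in> sphere a r" for x
    using r by (simp add: circlepath_def part_circlepath_def linepath_def dist_norm norm_mult)
  have cc: "continuous_on UNIV ?c" unfolding circlepath by (intro continuous_intros)
  have c\<phi>: "continuous_on UNIV (\<lambda>x. \<phi> (?c x))" "continuous_on UNIV (\<lambda>x. H (?c x))"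
    by (rule continuous_on_compose2[OF cont(1) cc], use sph in blast,
        rule continuous_on_compose2[OF cont(2) cc], use sph in blast)
  have conv: "contour_integral ?c F = integral {0..1} (\<lambda>x. F (?c x) * ?d x)" for F
    by (simp only: contour_integral_integral vector_derivative_circlepath)
  have d: "continuous_on UNIV ?d" by (intro continuous_intros)
  have "((\<lambda>s. integral (cbox 0 1) (\<lambda>x. H (?c x) / (\<phi> (?c x) - s) * ?d x)) has_field_derivative
      integral (cbox 0 1) (\<lambda>x. H (?c x) / (\<phi> (?c x) - t)\<^sup>2 * ?d x)) (at t within ball s1 \<epsilon>)"
  proof (rule leibniz_rule_field_derivative[OF _ _ _ t convex_ball])
    fix s x assume "s \<in> ball s1 \<epsilon>" "x \<in> cbox 0 (1::real)"
    hence "\<phi> (?c x) \<noteq> s" using s sph by blast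
    thus "((\<lambda>s. H (?c x) / (\<phi> (?c x) - s) * ?d x) has_field_derivative
        H (?c x) / (\<phi> (?c x) - s)\<^sup>2 * ?d x) (at s within ball s1 \<epsilon>)"
      by (auto intro!: derivative_eq_intros simp: power2_eq_square)
  next
    fix u assume u: "u \<in> ball s1 \<epsilon>"
    have "\<phi> (?c x) - u \<noteq> 0" for x using s[OF u sph] by simp
    hence "continuous_on UNIV (\<lambda>x. H (?c x) / (\<phi> (?c x) - u) * ?d x)"
      by (intro continuous_intros c\<phi> d) auto
    thus "(\<lambda>x. H (?c x) / (\<phi> (?c x) - u) * ?d x) integrable_on cbox 0 1"
      by (rule integrable_continuous[OF continuous_on_subset[OF _ subset_UNIV]])
  next
    have c\<phi>': "continuous_on (ball s1 \<epsilon> \<times> cbox 0 1) (\<lambda>z. \<phi> (?c (snd z)))"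
      "continuous_on (ball s1 \<epsilon> \<times> cbox 0 1) (\<lambda>z. H (?c (snd z)))"
      "continuous_on (ball s1 \<epsilon> \<times> cbox 0 1) (\<lambda>z. ?d (snd z))"
      by (rule continuous_on_compose2[OF c\<phi>(1) continuous_on_snd[OF continuous_on_id]], simp,
          rule continuous_on_compose2[OF c\<phi>(2) continuous_on_snd[OF continuous_on_id]], simp,
          intro continuous_intros)
    have nz: "(\<phi> (?c (snd z)) - fst z)\<^sup>2 \<noteq> 0" if "z \<in> ball s1 \<epsilon> \<times> cbox 0 (1::real)" for z
      using s[of "fst z", OF _ sph] that by auto
    have "continuous_on (ball s1 \<epsilon> \<times> cbox 0 1) (\<lambda>z. (\<phi> (?c (snd z)) - fst z)\<^sup>2)"
      by (intro continuous_on_power continuous_on_diff c\<phi>' continuous_on_fst continuous_on_id)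
    hence "continuous_on (ball s1 \<epsilon> \<times> cbox 0 1) (\<lambda>z. H (?c (snd z)) / (\<phi> (?c (snd z)) - fst z)\<^sup>2 * ?d (snd z))"
      by (intro continuous_on_mult[OF _ c\<phi>'(3)] continuous_on_divide[OF c\<phi>'(2)]) (use nz in blast)+
    thus "continuous_on (ball s1 \<epsilon> \<times> cbox 0 1) (\<lambda>(s, x). H (?c x) / (\<phi> (?c x) - s)\<^sup>2 * ?d x)"
      by (simp add: case_prod_beta)
  qed
  thus ?thesis unfolding conv using t by (simp add: at_within_open[OF t open_ball])
qed

text \<open>By the argument principle the weighted sum over the level set is the integral of
  \<open>deriv \<phi> w * G w / (\<phi> w - s)\<close> over the circle, divided by
  \<open>2 * pi * \<i>\<close>; it may be differentiated in \<open>s\<close> under the integral. The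
  last clause will show that the derivative depends only on the derivative of
  \<open>G\<close>.\<close>

lemma level_sum_derivative:
  assumes r: "0 < r" "r < R" and \<phi>: "\<phi> holomorphic_on ball a R" and G: "G holomorphic_on ball a R"
    and s1: "\<forall>w\<in>sphere a r. \<phi> w \<noteq> s1"
  shows "\<exists>\<epsilon>>0. \<exists>N'. \<forall>s\<in>ball s1 \<epsilon>. finite {w \<in> ball a r. \<phi> w = s} \<and>
    ((\<lambda>s. \<Sum>w\<in>{w \<in> ball a r. \<phi> w = s}. of_int (zorder (\<lambda>w. \<phi> w - s) w) * G w) has_field_derivative N' s) (at s) \<and>
    ((\<forall>w\<in>ball a R. deriv G w = 0) \<longrightarrow> N' s = 0)"
proof -
  have sR: "sphere a r \<subseteq> ball a R" using r by auto
  have "continuous_on (sphere a r) (\<lambda>w. norm (\<phi> w - s1))"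
    by (intro continuous_intros holomorphic_on_imp_continuous_on[OF holomorphic_on_subset[OF \<phi> sR]])
  from continuous_attains_inf[OF compact_sphere _ this]
  obtain w0 where w0: "w0 \<in> sphere a r" "\<And>w. w \<in> sphere a r \<Longrightarrow> norm (\<phi> w0 - s1) \<le> norm (\<phi> w - s1)"
    using r by auto
  \<comment> \<open>The distance of \<open>s1\<close> from the image of the circle: for closer
    \<open>s\<close> no solution of \<open>\<phi> w = s\<close> lies on the circle.\<close>
  define \<epsilon> where "\<epsilon> = norm (\<phi> w0 - s1)"
  have e0: "0 < \<epsilon>" using bspec[OF s1 w0(1)] by (simp add: \<epsilon>_def)
  have off: "\<phi> w \<noteq> s" if "s \<in> ball s1 \<epsilon>" "w \<in> sphere a r" for s w
    using w0(2)[OF that(2)] that(1) by (auto simp: \<epsilon>_def dist_norm norm_minus_commute)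
  have d\<phi>: "deriv \<phi> holomorphic_on ball a R" using \<phi> by (rule holomorphic_deriv) simp
  define N where "N = (\<lambda>s. contour_integral (circlepath a r) (\<lambda>w. (deriv \<phi> w * G w) / (\<phi> w - s)) / (2 * pi * \<i>))"
  define N' where "N' = (\<lambda>s. contour_integral (circlepath a r) (\<lambda>w. (deriv \<phi> w * G w) / (\<phi> w - s)\<^sup>2) / (2 * pi * \<i>))"
  have Nd: "(N has_field_derivative N' s) (at s)" if "s \<in> ball s1 \<epsilon>" for s
    unfolding N_def N'_def
    by (intro DERIV_cdivide contour_integral_parameter_derivative[OF r(1) _ _ off that]
        holomorphic_on_imp_continuous_on holomorphic_on_subset[OF \<phi> sR] holomorphic_on_subset[OF _ sR]
        holomorphic_intros d\<phi> G)
  \<comment> \<open>The argument principle asks for finitely many zeros in its domain. They might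
    accumulate at the rim of the disc of radius \<open>R\<close>, but not in the smaller closed disc
    of radius \<open>r'\<close>.\<close>
  define r' where "r' = (r + R) / 2"
  have r': "r < r'" "r' < R" using r by (auto simp: r'_def)
  have brR: "ball a r' \<subseteq> ball a R" using r' by auto
  have sum: "finite {w \<in> ball a r. \<phi> w = s} \<and>
      (\<Sum>w\<in>{w \<in> ball a r. \<phi> w = s}. of_int (zorder (\<lambda>w. \<phi> w - s) w) * G w) = N s" if s: "s \<in> ball s1 \<epsilon>" for s
  proof -
    let ?\<phi> = "\<lambda>w. \<phi> w - s"
    have h: "?\<phi> holomorphic_on ball a R" by (intro holomorphic_intros \<phi>)
    \<comment> \<open>The function may be constant; it then has no zeros at all, since it has none
      on the circle.\<close>
    have "finite {w \<in> cball a r'. ?\<phi> w = 0}"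
    proof (cases "?\<phi> constant_on ball a R")
      case True
      then obtain k where k: "\<And>w. w \<in> ball a R \<Longrightarrow> ?\<phi> w = k" unfolding constant_on_def by blast
      have "k \<noteq> 0" using k[of w0] off[OF s w0(1)] w0(1) sR by auto
      have "?\<phi> w \<noteq> 0" if "w \<in> cball a r'" for w using k[of w] \<open>k \<noteq> 0\<close> that r' by auto
      hence "{w \<in> cball a r'. ?\<phi> w = 0} = {}" by blast
      thus ?thesis by (simp only: finite.emptyI)
    next
      case False
      show ?thesis
        by (rule holomorphic_compact_finite_zeros[OF h open_ball connected_ball compact_cball _ False]) (use r' in auto)
    qed
    hence fin: "finite {w \<in> ball a r'. ?\<phi> w = 0}" by (rule finite_subset[rotated]) auto
    have "contour_integral (circlepath a r) (\<lambda>w. deriv ?\<phi> w * G w / ?\<phi> w) = 2 * pi * \<i> *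
        (\<Sum>w\<in>{w \<in> ball a r'. ?\<phi> w = 0 \<or> w \<in> {}}. winding_number (circlepath a r) w * G w * zorder ?\<phi> w)"
    proof (rule argument_principle)
      show "?\<phi> holomorphic_on ball a r' - {}" using holomorphic_on_subset[OF h brR] by simp
      show "G holomorphic_on ball a r'" by (rule holomorphic_on_subset[OF G brR])
      show "path_image (circlepath a r) \<subseteq> ball a r' - {w \<in> ball a r'. ?\<phi> w = 0 \<or> w \<in> {}}"
      proof
        fix w assume "w \<in> path_image (circlepath a r)"
        hence w: "w \<in> sphere a r" using r by simp
        thus "w \<in> ball a r' - {w \<in> ball a r'. ?\<phi> w = 0 \<or> w \<in> {}}" using off[OF s w] r' by auto
      qed
      show "\<forall>z. z \<notin> ball a r' \<longrightarrow> winding_number (circlepath a r) z = 0"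
        using r r' by (auto intro!: winding_number_zero_outside[of _ "cball a r"])
    qed (use fin in auto)
    also have "(\<Sum>w\<in>{w \<in> ball a r'. ?\<phi> w = 0 \<or> w \<in> {}}. winding_number (circlepath a r) w * G w * zorder ?\<phi> w) =
        (\<Sum>w\<in>{w \<in> ball a r. \<phi> w = s}. of_int (zorder ?\<phi> w) * G w)"
    proof (rule sum.mono_neutral_cong_right)
      show "finite {w \<in> ball a r'. ?\<phi> w = 0 \<or> w \<in> {}}" using fin by simp
      show "{w \<in> ball a r. \<phi> w = s} \<subseteq> {w \<in> ball a r'. ?\<phi> w = 0 \<or> w \<in> {}}" using r' by auto
      show "\<forall>w\<in>{w \<in> ball a r'. ?\<phi> w = 0 \<or> w \<in> {}} - {w \<in> ball a r. \<phi> w = s}.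
          winding_number (circlepath a r) w * G w * zorder ?\<phi> w = 0"
      proof
        fix w assume "w \<in> {w \<in> ball a r'. ?\<phi> w = 0 \<or> w \<in> {}} - {w \<in> ball a r. \<phi> w = s}"
        hence w: "\<phi> w = s" "w \<notin> ball a r" by auto
        hence "w \<notin> cball a r" using off[OF s, of w] by auto
        hence "winding_number (circlepath a r) w = 0"
          using r by (intro winding_number_zero_outside[of _ "cball a r"]) auto
        thus "winding_number (circlepath a r) w * G w * zorder ?\<phi> w = 0" by simp
      qed
      show "winding_number (circlepath a r) w * G w * zorder ?\<phi> w = of_int (zorder ?\<phi> w) * G w"
        if "w \<in> {w \<in> ball a r. \<phi> w = s}" for w
        using that winding_number_circlepath[of w a r] by (simp add: dist_norm norm_minus_commute)
    qed
    finally have "contour_integral (circlepath a r) (\<lambda>w. deriv ?\<phi> w * G w / ?\<phi> w) =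
      2 * pi * \<i> * (\<Sum>w\<in>{w \<in> ball a r. \<phi> w = s}. of_int (zorder ?\<phi> w) * G w)" .
    moreover have "contour_integral (circlepath a r) (\<lambda>w. deriv ?\<phi> w * G w / ?\<phi> w) =
        contour_integral (circlepath a r) (\<lambda>w. deriv \<phi> w * G w / (\<phi> w - s))"
    proof (rule contour_integral_cong[OF refl])
      fix w assume "w \<in> path_image (circlepath a r)"
      hence "w \<in> ball a R" using sR r by auto
      hence "\<phi> field_differentiable at w" using holomorphic_on_imp_differentiable_at[OF \<phi> open_ball] by blast
      thus "deriv ?\<phi> w * G w / ?\<phi> w = deriv \<phi> w * G w / (\<phi> w - s)" by simp
    qed
    moreover have "finite {w \<in> ball a r. \<phi> w = s}"
      by (rule finite_subset[OF _ fin]) (use r' in auto)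
    ultimately show ?thesis by (simp add: N_def)
  qed
  show ?thesis
  proof (rule exI[of _ \<epsilon>], rule conjI[OF e0], rule exI[of _ N'], intro ballI conjI impI)
    fix s assume s: "s \<in> ball s1 \<epsilon>"
    show "finite {w \<in> ball a r. \<phi> w = s}" using sum[OF s] by blast
    show "((\<lambda>s. \<Sum>w\<in>{w \<in> ball a r. \<phi> w = s}. of_int (zorder (\<lambda>w. \<phi> w - s) w) * G w) has_field_derivative N' s) (at s)"
      by (rule has_field_derivative_transform_within_open[OF Nd[OF s] open_ball s]) (use sum in simp)
    assume G0: "\<forall>w\<in>ball a R. deriv G w = 0"
    \<comment> \<open>For locally constant \<open>G\<close> the integrand is the derivative of
      \<open>- G w / (\<phi> w - s)\<close>, so the integral over the closed circle
      vanishes.\<close>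
    have "((\<lambda>w. (deriv \<phi> w * G w) / (\<phi> w - s)\<^sup>2) has_contour_integral 0) (circlepath a r)"
    proof (rule Cauchy_theorem_primitive)
      show "((\<lambda>w. - G w / (\<phi> w - s)) has_field_derivative deriv \<phi> w * G w / (\<phi> w - s)\<^sup>2) (at w within sphere a r)"
        if w: "w \<in> sphere a r" for w
      proof -
        have wR: "w \<in> ball a R" using w sR by blast
        have "(G has_field_derivative 0) (at w)" "(\<phi> has_field_derivative deriv \<phi> w) (at w)"
          using holomorphic_derivI[OF G open_ball wR] holomorphic_derivI[OF \<phi> open_ball wR] bspec[OF G0 wR] by auto
        hence "((\<lambda>w. - G w / (\<phi> w - s)) has_field_derivative deriv \<phi> w * G w / (\<phi> w - s)\<^sup>2) (at w)"
          using off[OF s w] by (auto intro!: derivative_eq_intros simp: power2_eq_square)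
        thus ?thesis by (rule has_field_derivative_at_within)
      qed
    qed (use r in auto)
    thus "N' s = 0" by (simp add: N'_def contour_integral_unique)
  qed
qed


lemma finite_locally_finite:
  assumes "compact_space X" "\<And>x. x \<in> topspace X \<Longrightarrow> \<exists>N. openin X N \<and> x \<in> N \<and> finite (N \<inter> S)"
    and "S \<subseteq> topspace X"
  shows "finite S"
proof -
  obtain N where N: "\<And>x. x \<in> topspace X \<Longrightarrow> openin X (N x) \<and> x \<in> N x \<and> finite (N x \<inter> S)"
    using assms(2) by metis
  have "\<And>U. U \<in> N ` topspace X \<Longrightarrow> openin X U" "topspace X \<subseteq> \<Union>(N ` topspace X)" using N by auto
  then obtain \<F> where \<F>: "finite \<F>" "\<F> \<subseteq> N ` topspace X" "topspace X \<subseteq> \<Union>\<F>"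
    using assms(1) unfolding compact_space_def compactin_def by meson
  have "finite (\<Union>U\<in>\<F>. U \<inter> S)" using \<F>(1,2) N by blast
  moreover have "S \<subseteq> (\<Union>U\<in>\<F>. U \<inter> S)" using \<F>(3) assms(3) by blast
  ultimately show ?thesis by (rule finite_subset[rotated])
qed

lemma Hausdorff_finite_separation:
  assumes H: "Hausdorff_space X" and S: "finite S" "S \<subseteq> topspace X"
  shows "\<exists>V. (\<forall>x\<in>S. openin X (V x) \<and> x \<in> V x) \<and> (\<forall>x\<in>S. \<forall>y\<in>S. x \<noteq> y \<longrightarrow> V x \<inter> V y = {})"
proof -
  have "\<forall>x y. \<exists>U W. x \<in> topspace X \<and> y \<in> topspace X \<and> x \<noteq> y \<longrightarrow>
      openin X U \<and> openin X W \<and> x \<in> U \<and> y \<in> W \<and> disjnt U W"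
    using H unfolding Hausdorff_space_def by blast
  then obtain U W where UW: "\<And>x y. x \<in> topspace X \<and> y \<in> topspace X \<and> x \<noteq> y \<longrightarrow>
      openin X (U x y) \<and> openin X (W x y) \<and> x \<in> U x y \<and> y \<in> W x y \<and> disjnt (U x y) (W x y)"
    by metis
  have UW': "openin X (U x y \<inter> W y x)" "x \<in> U x y \<inter> W y x" if "x \<in> S" "y \<in> S - {x}" for x y
    using UW[of x y] UW[of y x] S(2) that by blast+
  define V where "V = (\<lambda>x. topspace X \<inter> \<Inter>((\<lambda>y. U x y \<inter> W y x) ` (S - {x})))"
  have "openin X (V x) \<and> x \<in> V x" if "x \<in> S" for x
    unfolding V_def using UW' S that by (intro conjI openin_Int_Inter) auto
  moreover have "V x \<inter> V y = {}" if "x \<in> S" "y \<in> S" "x \<noteq> y" for x y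
  proof -
    have "V x \<subseteq> U x y" "V y \<subseteq> W x y" unfolding V_def using that by auto
    moreover have "disjnt (U x y) (W x y)" using UW that S(2) by blast
    ultimately show ?thesis unfolding disjnt_def by blast
  qed
  ultimately show ?thesis by blast
qed

section \<open>Poles, orders and fibres on the surface\<close>

context rsurface
begin

text \<open>The chosen representative is 0 at its poles, so its values alone do not tell zeros from
  poles.\<close>

definition pole_at :: "('a \<Rightarrow> complex) \<Rightarrow> 'a \<Rightarrow> bool" where
  "pole_at f x \<longleftrightarrow> (\<exists>c\<in>A. x \<in> fst c \<and> is_pole (f \<circ> chart_inv c) (snd c x))"

lemma pole_at_chart:
  assumes "c \<in> A" "x \<in> fst c"
  shows "pole_at f x \<longleftrightarrow> is_pole (f \<circ> chart_inv c) (snd c x)"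
proof
  assume "pole_at f x"
  then obtain e where e: "e \<in> A" "x \<in> fst e" "is_pole (f \<circ> chart_inv e) (snd e x)"
    unfolding pole_at_def by blast
  show "is_pole (f \<circ> chart_inv c) (snd c x)"
    using transition_filterlim_compose[OF subsetD[OF atlas_subset assms(1)] subsetD[OF atlas_subset e(1)] assms(2) e(2)] e(3)
    unfolding is_pole_def by blast
qed (use assms in \<open>auto simp: pole_at_def\<close>)

text \<open>Orders multiply under composition, and a transition minus its value at the point has a
  simple zero there.\<close>

lemma zorder_transition:
  assumes c: "c \<in> maximal_atlas" and e: "e \<in> maximal_atlas" and x: "x \<in> fst c" "x \<in> fst e"
    and g: "(g \<circ> chart_inv e) meromorphic_on {snd e x}"
      "eventually (\<lambda>z. (g \<circ> chart_inv e) z \<noteq> 0) (at (snd e x))"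
  shows "zorder (g \<circ> chart_inv c) (snd c x) = zorder (g \<circ> chart_inv e) (snd e x)"
proof -
  let ?t = "transition c e" and ?z = "snd c x"
  have tz: "?t ?z = snd e x" using c x by simp
  have an: "?t analytic_on {?z}"
    unfolding analytic_at using holomorphic_transition[OF c e] open_chart_overlap[OF c e] x by blast
  have "zorder (\<lambda>w. ?t w - ?t ?z) ?z = 1"
  proof (rule zorder_zero_eqI')
    show "(\<lambda>w. ?t w - ?t ?z) analytic_on {?z}" by (intro analytic_intros an)
    have "deriv (\<lambda>w. ?t w - ?t ?z) ?z = deriv ?t ?z"
      using transition_differentiable[OF c e x] by (subst deriv_diff) auto
    thus "(deriv ^^ nat 1) (\<lambda>w. ?t w - ?t ?z) ?z \<noteq> 0"
      using jac_nonzero[OF c e x] by (simp add: jac_def)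
  qed auto
  moreover have "zorder ((g \<circ> chart_inv e) \<circ> ?t) ?z = zorder (g \<circ> chart_inv e) (?t ?z) * zorder (\<lambda>w. ?t w - ?t ?z) ?z"
  proof (rule zorder_compose'[OF _ _ an])
    show "isolated_singularity_at (g \<circ> chart_inv e) (?t ?z)" "not_essential (g \<circ> chart_inv e) (?t ?z)"
      using g(1) unfolding tz meromorphic_at_iff by auto
    show "\<forall>\<^sub>F w in at (?t ?z). (g \<circ> chart_inv e) w \<noteq> 0" unfolding tz by (rule g(2))
    show "\<forall>\<^sub>F w in at ?z. ?t w \<noteq> ?t ?z"
      using transition_filterlim[OF c e x] unfolding tz filterlim_at by (auto elim: eventually_mono)
  qed
  moreover have "zorder ((g \<circ> chart_inv e) \<circ> ?t) ?z = zorder (g \<circ> chart_inv c) ?z"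
    by (rule zorder_cong[OF _ refl], rule eventually_mono[OF eventually_transition[OF c e x]]) simp
  ultimately show ?thesis unfolding tz by simp
qed

lemma ord_at_chart:
  assumes c: "c \<in> A" "x \<in> fst c"
    and g: "(g \<circ> chart_inv c) meromorphic_on {snd c x}"
      "eventually (\<lambda>z. (g \<circ> chart_inv c) z \<noteq> 0) (at (snd c x))"
  shows "ord_at A g x = zorder (g \<circ> chart_inv c) (snd c x)"
proof -
  define e where "e = (SOME e. e \<in> A \<and> x \<in> fst e)"
  have "e \<in> A \<and> x \<in> fst e" unfolding e_def by (rule someI_ex) (use c in blast)
  hence "zorder (g \<circ> chart_inv e) (snd e x) = zorder (g \<circ> chart_inv c) (snd c x)"
    using zorder_transition[OF _ _ _ c(2) g] c(1) atlas_subset by blast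
  thus ?thesis unfolding ord_at_def e_def[symmetric] by simp
qed

end

locale surface_meromorphic = rsurface +
  fixes f
  assumes mero: "meromorphic_function X A f"
begin

lemma meromorphic_at: "c \<in> A \<Longrightarrow> x \<in> fst c \<Longrightarrow> (f \<circ> chart_inv c) meromorphic_on {snd c x}"
  using mero unfolding meromorphic_function_def nicely_meromorphic_on_def
  by (meson imageI meromorphic_on_subset empty_subsetI insert_subset)

lemma pole_value: "pole_at f x \<Longrightarrow> f x = 0"
proof -
  assume "pole_at f x"
  then obtain c where c: "c \<in> A" "x \<in> fst c" "is_pole (f \<circ> chart_inv c) (snd c x)"
    unfolding pole_at_def by blast
  have "(f \<circ> chart_inv c) (snd c x) = 0"
    using mero c is_pole_def not_tendsto_and_filterlim_at_infinity[OF at_neq_bot]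
    unfolding meromorphic_function_def nicely_meromorphic_on_def by (metis imageI)
  thus "f x = 0" using c subsetD[OF atlas_subset c(1)] by simp
qed

lemma analytic_off_poles:
  assumes "c \<in> A" "x \<in> fst c" "\<not> pole_at f x"
  shows "(f \<circ> chart_inv c) analytic_on {snd c x}"
  using nicely_meromorphic_on_imp_analytic_at[of "f \<circ> chart_inv c" "snd c ` fst c" "snd c x"] mero assms
    pole_at_chart[OF assms(1,2)] by (auto simp: meromorphic_function_def)

end

locale nonconstant_meromorphic = surface_meromorphic +
  assumes compact: "compact_space X" and connected: "connected_space X"
    and nonconstant: "\<And>s. \<exists>x\<in>topspace X. f x \<noteq> s"
begin

text \<open>The identity theorem: the set of points near which the function is constantly
  \<open>s\<close> is open and closed, and by nonconstancy it is not the whole surface.\<close>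

lemma eventually_value_ne:
  assumes c: "c \<in> A" "x \<in> fst c"
  shows "eventually (\<lambda>z. (f \<circ> chart_inv c) z \<noteq> s) (at (snd c x))"
proof -
  define E where "E = {x \<in> topspace X. \<exists>W. openin X W \<and> x \<in> W \<and> (\<forall>y\<in>W. f y = s)}"
  \<comment> \<open>A meromorphic germ taking the value \<open>s\<close> arbitrarily close to its
    centre takes it on a punctured neighbourhood. Then the centre is no pole, and the value there is
    \<open>s\<close> as well.\<close>
  have dich: "x \<in> E \<or> eventually (\<lambda>z. (f \<circ> chart_inv c) z \<noteq> s) (at (snd c x))"
    if c: "c \<in> A" "x \<in> fst c" for c x
  proof (rule disjCI)
    assume ne: "\<not> eventually (\<lambda>z. (f \<circ> chart_inv c) z \<noteq> s) (at (snd c x))"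
    have M: "c \<in> maximal_atlas" using c(1) atlas_subset by blast
    have "(\<lambda>z. (f \<circ> chart_inv c) z - s) meromorphic_on {snd c x}"
      by (intro meromorphic_intros meromorphic_at[OF c])
    hence ev: "eventually (\<lambda>z. (f \<circ> chart_inv c) z - s = 0) (at (snd c x))"
      by (intro not_essential_frequently_0_imp_eventually_0)
         (use ne in \<open>auto simp: meromorphic_at_iff frequently_def\<close>)
    hence lim: "((f \<circ> chart_inv c) \<longlongrightarrow> s) (at (snd c x))"
      by (intro tendsto_eventually) (auto elim: eventually_mono)
    have "\<not> pole_at f x"
      unfolding pole_at_chart[OF c] is_pole_def
      using not_tendsto_and_filterlim_at_infinity[OF at_neq_bot lim] by blast
    from analytic_at_imp_isCont[OF analytic_off_poles[OF c this]]
    have "((f \<circ> chart_inv c) \<longlongrightarrow> (f \<circ> chart_inv c) (snd c x)) (at (snd c x))" by (simp add: isCont_def)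
    from LIM_unique[OF this lim] have fx: "f x = s" using c(2) M by simp
    obtain T where T: "open T" "snd c x \<in> T" "\<And>z. z \<in> T \<Longrightarrow> z \<noteq> snd c x \<Longrightarrow> (f \<circ> chart_inv c) z - s = 0"
      using ev unfolding eventually_at_topological by blast
    have "f y = s" if "y \<in> {y \<in> fst c. snd c y \<in> T}" for y
    proof (cases "snd c y = snd c x")
      case True
      hence "y = x" using inj_onD[OF chartD(3)[OF M] True] that c(2) by blast
      thus ?thesis using fx by simp
    next
      case False
      thus ?thesis using T(3)[of "snd c y"] that M by simp
    qed
    thus "x \<in> E" unfolding E_def using chartD(5)[OF M T(1)] T(2) c(2) chartD(2)[OF M] by blast
  qed
  have Eo: "openin X E"
    unfolding openin_subopen[of X E]
  proof
    fix x assume "x \<in> E"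
    then obtain W where W: "openin X W" "x \<in> W" "\<forall>y\<in>W. f y = s" unfolding E_def by blast
    hence "W \<subseteq> E" unfolding E_def using openin_subset[OF W(1)] by blast
    thus "\<exists>T. openin X T \<and> x \<in> T \<and> T \<subseteq> E" using W(1,2) by blast
  qed
  have "openin X (topspace X - E)"
    unfolding openin_subopen[of X "topspace X - E"]
  proof
    fix x assume x: "x \<in> topspace X - E"
    then obtain c where c: "c \<in> A" "x \<in> fst c" using atlas_covers by blast
    hence M: "c \<in> maximal_atlas" using atlas_subset by blast
    from dich[OF c] x have "eventually (\<lambda>z. (f \<circ> chart_inv c) z \<noteq> s) (at (snd c x))" by blast
    then obtain T where T: "open T" "snd c x \<in> T" "\<And>z. z \<in> T \<Longrightarrow> z \<noteq> snd c x \<Longrightarrow> (f \<circ> chart_inv c) z \<noteq> s"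
      unfolding eventually_at_topological by blast
    have "{y \<in> fst c. snd c y \<in> T} \<subseteq> topspace X - E"
    proof
      fix y assume y: "y \<in> {y \<in> fst c. snd c y \<in> T}"
      have "y \<notin> E"
      proof (cases "snd c y = snd c x")
        case True
        hence "y = x" using inj_onD[OF chartD(3)[OF M] True] y c(2) by blast
        thus ?thesis using x by simp
      next
        case False
        hence "f y \<noteq> s" using T(3)[of "snd c y"] y M by simp
        thus ?thesis by (auto simp: E_def)
      qed
      thus "y \<in> topspace X - E" using chartD(2)[OF M] y by blast
    qed
    thus "\<exists>T. openin X T \<and> x \<in> T \<and> T \<subseteq> topspace X - E"
      using chartD(5)[OF M T(1)] T(2) c(2) by blast
  qed
  hence "closedin X E" using Eo openin_subset by (auto simp: closedin_def)
  hence "E = {} \<or> E = topspace X" using connected Eo by (auto simp: connected_space_clopen_in)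
  moreover have "E \<noteq> topspace X" using nonconstant[of s] by (auto simp: E_def)
  ultimately show ?thesis using dich[OF c] by blast
qed

definition fibre :: "complex \<Rightarrow> 'a set" where
  "fibre s = {x \<in> topspace X. f x = s \<and> \<not> pole_at f x}"

lemma punctured_nbhd:
  assumes c: "c \<in> A" "x \<in> fst c" and ev: "eventually (\<lambda>z. P (chart_inv c z)) (at (snd c x))"
  obtains N where "openin X N" "x \<in> N" "\<And>y. y \<in> N \<Longrightarrow> y \<noteq> x \<Longrightarrow> P y"
proof -
  have M: "c \<in> maximal_atlas" using c(1) atlas_subset by blast
  obtain T where T: "open T" "snd c x \<in> T" "\<And>z. z \<in> T \<Longrightarrow> z \<noteq> snd c x \<Longrightarrow> P (chart_inv c z)"
    using ev unfolding eventually_at_topological by blast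
  show ?thesis
  proof (rule that[of "{y \<in> fst c. snd c y \<in> T}"])
    fix y assume y: "y \<in> {y \<in> fst c. snd c y \<in> T}" "y \<noteq> x"
    hence "snd c y \<noteq> snd c x" using inj_onD[OF chartD(3)[OF M], of y x] c(2) by blast
    thus "P y" using T(3)[of "snd c y"] y M by simp
  qed (use chartD(5)[OF M T(1)] T(2) c(2) in auto)
qed

lemma finite_fibre: "finite (fibre s)"
proof (rule finite_locally_finite[OF compact])
  fix x assume "x \<in> topspace X"
  then obtain c where c: "c \<in> A" "x \<in> fst c" using atlas_covers by blast
  from eventually_value_ne[OF c, of s] have "eventually (\<lambda>z. f (chart_inv c z) \<noteq> s) (at (snd c x))" by simp
  then obtain N where N: "openin X N" "x \<in> N" "\<And>y. y \<in> N \<Longrightarrow> y \<noteq> x \<Longrightarrow> f y \<noteq> s"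
    by (rule punctured_nbhd[OF c]) blast
  have "N \<inter> fibre s \<subseteq> {x}" using N(3) by (auto simp: fibre_def)
  thus "\<exists>N. openin X N \<and> x \<in> N \<and> finite (N \<inter> fibre s)"
    using N(1,2) by (meson finite.emptyI finite_insert finite_subset)
qed (auto simp: fibre_def)

text \<open>Properness. Every point outside \<open>W\<close> has a neighbourhood on which values off
  \<open>W\<close> stay away from \<open>s1\<close>: near a pole they are large, elsewhere
  continuity applies. Compactness makes the distance uniform.\<close>

lemma fibre_near:
  assumes W: "openin X W" "fibre s1 \<subseteq> W"
  shows "\<exists>\<epsilon>>0. \<forall>s\<in>ball s1 \<epsilon>. fibre s \<subseteq> W"
proof -
  have "\<exists>N \<epsilon>. openin X N \<and> x \<in> N \<and> 0 < \<epsilon> \<and> (\<forall>y\<in>N - W. \<not> pole_at f y \<longrightarrow> \<epsilon> \<le> norm (f y - s1))"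
    if x: "x \<in> topspace X" for x
  proof (cases "x \<in> W")
    case True
    thus ?thesis using W(1) by (intro exI[of _ W] exI[of _ 1]) auto
  next
    case xW: False
    obtain c where c: "c \<in> A" "x \<in> fst c" using atlas_covers[OF x] by blast
    hence M: "c \<in> maximal_atlas" using atlas_subset by blast
    show ?thesis
    proof (cases "pole_at f x")
      case True
      hence "filterlim (f \<circ> chart_inv c) at_infinity (at (snd c x))"
        using pole_at_chart[OF c, of f] by (simp only: is_pole_def)
      hence "eventually (\<lambda>z. norm s1 + 1 \<le> norm ((f \<circ> chart_inv c) z)) (at (snd c x))"
        unfolding filterlim_at_infinity[OF order.refl] by (metis add_nonneg_pos less_numeral_extra(1) norm_ge_zero)
      hence "eventually (\<lambda>z. norm s1 + 1 \<le> norm (f (chart_inv c z))) (at (snd c x))" by simp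
      then obtain N where N: "openin X N" "x \<in> N" "\<And>y. y \<in> N \<Longrightarrow> y \<noteq> x \<Longrightarrow> norm s1 + 1 \<le> norm (f y)"
        by (rule punctured_nbhd[OF c]) blast
      have "1 \<le> norm (f y - s1)" if "y \<in> N - W" "\<not> pole_at f y" for y
        using N(3)[of y] that True norm_triangle_ineq2[of "f y" s1] by fastforce
      thus ?thesis using N(1,2) by (intro exI[of _ N] exI[of _ 1]) auto
    next
      case False
      have ne: "f x \<noteq> s1" using W(2) xW x False by (auto simp: fibre_def)
      define \<epsilon> where "\<epsilon> = norm (f x - s1) / 2"
      have e: "0 < \<epsilon>" using ne by (simp add: \<epsilon>_def)
      have "isCont (f \<circ> chart_inv c) (snd c x)"
        by (rule analytic_at_imp_isCont[OF analytic_off_poles[OF c False]])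
      hence "((f \<circ> chart_inv c) \<longlongrightarrow> f x) (at (snd c x))" using c(2) M by (simp add: isCont_def)
      from tendstoD[OF this e] have "eventually (\<lambda>z. dist (f (chart_inv c z)) (f x) < \<epsilon>) (at (snd c x))" by simp
      then obtain N where N: "openin X N" "x \<in> N" "\<And>y. y \<in> N \<Longrightarrow> y \<noteq> x \<Longrightarrow> dist (f y) (f x) < \<epsilon>"
        by (rule punctured_nbhd[OF c]) blast
      have "\<epsilon> \<le> norm (f y - s1)" if "y \<in> N" for y
      proof -
        have "dist (f y) (f x) < \<epsilon>" using N(3)[OF that] e by (cases "y = x") auto
        thus ?thesis using norm_triangle_ineq[of "f x - f y" "f y - s1"]
          by (simp add: \<epsilon>_def dist_norm norm_minus_commute)
      qed
      thus ?thesis using N(1,2) e by blast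
    qed
  qed
  then obtain N \<epsilon> where N: "\<And>x. x \<in> topspace X \<Longrightarrow> openin X (N x) \<and> x \<in> N x \<and> 0 < \<epsilon> x \<and>
      (\<forall>y\<in>N x - W. \<not> pole_at f y \<longrightarrow> \<epsilon> x \<le> norm (f y - s1))" by metis
  have "\<And>U. U \<in> N ` topspace X \<Longrightarrow> openin X U" "topspace X \<subseteq> \<Union>(N ` topspace X)" using N by auto
  then obtain \<F> where \<F>: "finite \<F>" "\<F> \<subseteq> N ` topspace X" "topspace X \<subseteq> \<Union>\<F>"
    using compact unfolding compact_space_def compactin_def by meson
  obtain C where C: "C \<subseteq> topspace X" "finite C" "\<F> = N ` C" using finite_subset_image[OF \<F>(1,2)] by blast
  define e where "e = Min (insert 1 (\<epsilon> ` C))"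
  have e: "0 < e" "\<And>x. x \<in> C \<Longrightarrow> e \<le> \<epsilon> x" using C N by (auto simp: e_def)
  have "fibre s \<subseteq> W" if s: "s \<in> ball s1 e" for s
  proof
    fix y assume y: "y \<in> fibre s"
    show "y \<in> W"
    proof (rule ccontr)
      assume "y \<notin> W"
      obtain x where x: "x \<in> C" "y \<in> N x" using \<F>(3) C(3) y by (auto simp: fibre_def)
      hence "\<epsilon> x \<le> norm (f y - s1)" using N[of x] C(1) y \<open>y \<notin> W\<close> by (auto simp: fibre_def)
      thus False using e(2)[OF x(1)] s y by (auto simp: fibre_def dist_norm norm_minus_commute)
    qed
  qed
  thus ?thesis using e(1) by blast
qed

end


context nonconstant_meromorphic
begin

definition fibre_sum :: "('a \<Rightarrow> complex) \<Rightarrow> complex \<Rightarrow> complex" where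
  "fibre_sum G s = (\<Sum>x\<in>fibre s. of_int (ord_at A (\<lambda>y. f y - s) x) * G x)"

text \<open>\<open>level_sum_derivative\<close> in a chart disc around \<open>x\<close>, where
  solutions of \<open>\<phi> w = s\<close> correspond to the points of the fibre in
  \<open>E\<close>.\<close>

lemma local_fibre_sum_derivative:
  assumes U: "openin X U" "x \<in> U" and x: "x \<in> fibre s1" and G: "primitive_on A \<omega> U G"
  shows "\<exists>E \<epsilon> N'. openin X E \<and> x \<in> E \<and> E \<subseteq> U \<and> 0 < \<epsilon> \<and> (\<forall>s\<in>ball s1 \<epsilon>.
    ((\<lambda>s. \<Sum>y\<in>E \<inter> fibre s. of_int (ord_at A (\<lambda>y. f y - s) y) * G y) has_field_derivative N' s) (at s) \<and>
    ((\<forall>c\<in>A. \<forall>y\<in>U \<inter> fst c. \<omega> c (snd c y) = 0) \<longrightarrow> N' s = 0))"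
proof -
  have xX: "x \<in> topspace X" "f x = s1" "\<not> pole_at f x" using x by (auto simp: fibre_def)
  obtain c where c: "c \<in> A" "x \<in> fst c" using atlas_covers[OF xX(1)] by blast
  hence M: "c \<in> maximal_atlas" using atlas_subset by blast
  let ?a = "snd c x" and ?\<phi> = "f \<circ> chart_inv c" and ?G = "G \<circ> chart_inv c"
  obtain r1 where r1: "0 < r1" "ball ?a r1 \<subseteq> snd c ` fst c" "{y \<in> fst c. snd c y \<in> ball ?a r1} \<subseteq> U"
    by (rule chart_ball_nbhd[OF M U c(2)])
  obtain T where T: "open T" "?a \<in> T" "?\<phi> holomorphic_on T"
    using analytic_off_poles[OF c xX(3)] unfolding analytic_at by blast
  obtain r2 where r2: "0 < r2" "ball ?a r2 \<subseteq> T" using T(1,2) by (meson openE)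
  obtain T' where T': "open T'" "?a \<in> T'" "\<And>z. z \<in> T' \<Longrightarrow> z \<noteq> ?a \<Longrightarrow> ?\<phi> z \<noteq> s1"
    using eventually_value_ne[OF c, of s1] unfolding eventually_at_topological by blast
  obtain r3 where r3: "0 < r3" "ball ?a r3 \<subseteq> T'" using T'(1,2) by (meson openE)
  \<comment> \<open>Within \<open>R\<close> the chart stays in \<open>U\<close>, the function is
    holomorphic, and \<open>s1\<close> is taken only at the centre; the circle of radius
    \<open>R / 2\<close> therefore avoids the value \<open>s1\<close>.\<close>
  define R where "R = min r1 (min r2 r3)"
  have R: "0 < R" "ball ?a R \<subseteq> ball ?a r1" "ball ?a R \<subseteq> T" "ball ?a R \<subseteq> T'"
    using r1(1) r2 r3 by (auto simp: R_def)
  have \<phi>: "?\<phi> holomorphic_on ball ?a R" using T(3) R(3) by (rule holomorphic_on_subset)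
  have inU: "y \<in> U" if "y \<in> fst c" "snd c y \<in> ball ?a R" for y using that r1(3) R(2) by blast
  have Gd: "(?G has_field_derivative \<omega> c z) (at z)" if z: "z \<in> ball ?a R" for z
  proof -
    obtain y where y: "y \<in> fst c" "z = snd c y" using z r1(2) R(2) by blast
    hence "y \<in> U \<inter> fst c" using inU z by blast
    thus ?thesis using G c(1) y(2) unfolding primitive_on_def by blast
  qed
  have Gh: "?G holomorphic_on ball ?a R"
    unfolding holomorphic_on_def field_differentiable_def using Gd has_field_derivative_at_within by blast
  have off: "\<forall>w\<in>sphere ?a (R / 2). ?\<phi> w \<noteq> s1"
  proof
    fix w assume w: "w \<in> sphere ?a (R / 2)"
    have "w \<in> T'" "w \<noteq> ?a" using w R(1) subsetD[OF R(4), of w] by auto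
    thus "?\<phi> w \<noteq> s1" by (rule T'(3))
  qed
  have "0 < R / 2" "R / 2 < R" using R(1) by auto
  from level_sum_derivative[OF this \<phi> Gh off]
  obtain \<epsilon> N' where N': "0 < \<epsilon>" "\<forall>s\<in>ball s1 \<epsilon>. finite {w \<in> ball ?a (R / 2). ?\<phi> w = s} \<and>
    ((\<lambda>s. \<Sum>w\<in>{w \<in> ball ?a (R / 2). ?\<phi> w = s}. of_int (zorder (\<lambda>w. ?\<phi> w - s) w) * ?G w) has_field_derivative N' s) (at s) \<and>
    ((\<forall>w\<in>ball ?a R. deriv ?G w = 0) \<longrightarrow> N' s = 0)" by (elim exE conjE) (rule that)
  define E where "E = {y \<in> fst c. snd c y \<in> ball ?a (R / 2)}"
  have half: "ball ?a (R / 2) \<subseteq> ball ?a R" using R(1) by auto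
  have np: "\<not> pole_at f y" if y: "y \<in> fst c" "snd c y \<in> ball ?a R" for y
    unfolding pole_at_chart[OF c(1) y(1)] by (rule not_is_pole_holomorphic[OF open_ball y(2) \<phi>])
  have eq: "(\<Sum>w\<in>{w \<in> ball ?a (R / 2). ?\<phi> w = s}. of_int (zorder (\<lambda>w. ?\<phi> w - s) w) * ?G w) =
      (\<Sum>y\<in>E \<inter> fibre s. of_int (ord_at A (\<lambda>y. f y - s) y) * G y)" for s
  proof (rule sum.reindex_bij_witness[of _ "snd c" "chart_inv c"])
    fix w assume w: "w \<in> {w \<in> ball ?a (R / 2). ?\<phi> w = s}"
    hence "w \<in> ball ?a R" using half by blast
    then obtain y where y: "y \<in> fst c" "w = snd c y" using r1(2) R(2) by blast
    have iw: "chart_inv c w = y" using y M by simp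
    have yR: "snd c y \<in> ball ?a R" using \<open>w \<in> ball ?a R\<close> y(2) by simp
    show "snd c (chart_inv c w) = w" using iw y by simp
    show "chart_inv c w \<in> E \<inter> fibre s"
      using w y iw chartD(2)[OF M] np[OF y(1) yR] by (auto simp: E_def fibre_def)
    have "(\<lambda>y. f y - s) \<circ> chart_inv c = (\<lambda>w. ?\<phi> w - s)" by (auto simp: fun_eq_iff)
    moreover have "ord_at A (\<lambda>y. f y - s) y = zorder ((\<lambda>y. f y - s) \<circ> chart_inv c) (snd c y)"
    proof (rule ord_at_chart[OF c(1) y(1)])
      show "((\<lambda>y. f y - s) \<circ> chart_inv c) meromorphic_on {snd c y}"
        unfolding \<open>(\<lambda>y. f y - s) \<circ> chart_inv c = _\<close> by (intro meromorphic_intros meromorphic_at[OF c(1) y(1)])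
      show "\<forall>\<^sub>F z in at (snd c y). ((\<lambda>y. f y - s) \<circ> chart_inv c) z \<noteq> 0"
        using eventually_value_ne[OF c(1) y(1), of s] by simp
    qed
    ultimately show "of_int (ord_at A (\<lambda>y. f y - s) (chart_inv c w)) * G (chart_inv c w) =
        of_int (zorder (\<lambda>w. ?\<phi> w - s) w) * ?G w" using iw y by simp
  next
    fix y assume y: "y \<in> E \<inter> fibre s"
    thus "chart_inv c (snd c y) = y" "snd c y \<in> {w \<in> ball ?a (R / 2). ?\<phi> w = s}"
      using M by (auto simp: E_def fibre_def)
  qed
  show ?thesis
  proof (rule exI[of _ E], rule exI[of _ \<epsilon>], rule exI[of _ N'], intro conjI ballI impI)
    show "openin X E" unfolding E_def by (rule chartD(5)[OF M open_ball])
    show "x \<in> E" using c(2) R(1) by (simp add: E_def)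
    show "E \<subseteq> U" unfolding E_def using inU half by blast
    show "0 < \<epsilon>" by (rule N'(1))
    fix s assume s: "s \<in> ball s1 \<epsilon>"
    show "((\<lambda>s. \<Sum>y\<in>E \<inter> fibre s. of_int (ord_at A (\<lambda>y. f y - s) y) * G y) has_field_derivative N' s) (at s)"
      using bspec[OF N'(2) s] unfolding eq by blast
    assume \<omega>0: "\<forall>c\<in>A. \<forall>y\<in>U \<inter> fst c. \<omega> c (snd c y) = 0"
    have "deriv ?G w = 0" if w: "w \<in> ball ?a R" for w
    proof -
      obtain y where y: "y \<in> fst c" "w = snd c y" using w r1(2) R(2) by blast
      hence "\<omega> c w = 0" using \<omega>0 c(1) inU w by blast
      thus ?thesis using DERIV_imp_deriv[OF Gd[OF w]] by simp
    qed
    thus "N' s = 0" using bspec[OF N'(2) s] by blast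
  qed
qed

text \<open>The points of the fibre over \<open>s1\<close> are given disjoint neighbourhoods. By
  \<open>fibre_near\<close> these contain all nearby fibres, so the sum over a nearby fibre splits
  into the local sums.\<close>

lemma fibre_sum_derivative:
  assumes U: "openin X U" "fibre s1 \<subseteq> U" and G: "primitive_on A \<omega> U G"
  shows "\<exists>\<epsilon>>0. \<exists>N'. \<forall>s\<in>ball s1 \<epsilon>. fibre s \<subseteq> U \<and> (fibre_sum G has_field_derivative N' s) (at s) \<and>
    ((\<forall>c\<in>A. \<forall>y\<in>U \<inter> fst c. \<omega> c (snd c y) = 0) \<longrightarrow> N' s = 0)"
proof -
  let ?m = "\<lambda>s y. of_int (ord_at A (\<lambda>y. f y - s) y) * G y"
  have "fibre s1 \<subseteq> topspace X" by (auto simp: fibre_def)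
  from Hausdorff_finite_separation[OF Hausdorff finite_fibre this]
  obtain V where V: "\<And>x. x \<in> fibre s1 \<Longrightarrow> openin X (V x) \<and> x \<in> V x"
    "\<And>x y. x \<in> fibre s1 \<Longrightarrow> y \<in> fibre s1 \<Longrightarrow> x \<noteq> y \<Longrightarrow> V x \<inter> V y = {}" by metis
  define P where "P x E \<epsilon> N' \<longleftrightarrow> openin X E \<and> x \<in> E \<and> E \<subseteq> U \<inter> V x \<and> 0 < \<epsilon> \<and> (\<forall>s\<in>ball s1 \<epsilon>.
    ((\<lambda>s. \<Sum>y\<in>E \<inter> fibre s. ?m s y) has_field_derivative N' s) (at s) \<and>
    ((\<forall>c\<in>A. \<forall>y\<in>(U \<inter> V x) \<inter> fst c. \<omega> c (snd c y) = 0) \<longrightarrow> N' s = 0))" for x E \<epsilon> N'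
  have "\<exists>E \<epsilon> N'. P x E \<epsilon> N'" if x: "x \<in> fibre s1" for x
    unfolding P_def by (rule local_fibre_sum_derivative[OF _ _ x primitive_on_subset[OF G]]) (use U V[OF x] x in auto)
  then obtain E \<epsilon> N' where "\<And>x. x \<in> fibre s1 \<Longrightarrow> P x (E x) (\<epsilon> x) (N' x)" by metis
  note E = this[unfolded P_def]
  have "openin X (\<Union>(E ` fibre s1))" "fibre s1 \<subseteq> \<Union>(E ` fibre s1)" using E by auto
  from fibre_near[OF this] obtain \<epsilon>0 where e0: "0 < \<epsilon>0" "\<And>s. s \<in> ball s1 \<epsilon>0 \<Longrightarrow> fibre s \<subseteq> \<Union>(E ` fibre s1)"
    by blast
  define e where "e = Min (insert \<epsilon>0 (\<epsilon> ` fibre s1))"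
  have e: "0 < e" "e \<le> \<epsilon>0" "\<And>x. x \<in> fibre s1 \<Longrightarrow> e \<le> \<epsilon> x"
    using finite_fibre[of s1] e0(1) E by (auto simp: e_def)
  have eq: "(\<Sum>x\<in>fibre s1. \<Sum>y\<in>E x \<inter> fibre s. ?m s y) = fibre_sum G s" if s: "s \<in> ball s1 e" for s
  proof -
    have "fibre s \<subseteq> \<Union>(E ` fibre s1)" using s e(2) by (intro e0(2)) auto
    hence "fibre s = (\<Union>x\<in>fibre s1. E x \<inter> fibre s)" by blast
    moreover have "(\<Sum>y\<in>(\<Union>x\<in>fibre s1. E x \<inter> fibre s). ?m s y) = (\<Sum>x\<in>fibre s1. \<Sum>y\<in>E x \<inter> fibre s. ?m s y)"
    proof (rule sum.UNION_disjoint[OF finite_fibre])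
      show "\<forall>x\<in>fibre s1. finite (E x \<inter> fibre s)" using finite_fibre by blast
      show "\<forall>x\<in>fibre s1. \<forall>y\<in>fibre s1. x \<noteq> y \<longrightarrow> E x \<inter> fibre s \<inter> (E y \<inter> fibre s) = {}"
      proof (intro ballI impI)
        fix x y assume xy: "x \<in> fibre s1" "y \<in> fibre s1" "x \<noteq> y"
        have "E x \<subseteq> V x" "E y \<subseteq> V y" using E xy by blast+
        thus "E x \<inter> fibre s \<inter> (E y \<inter> fibre s) = {}" using V(2)[OF xy] by blast
      qed
    qed
    ultimately show ?thesis unfolding fibre_sum_def by simp
  qed
  show ?thesis
  proof (rule exI[of _ e], rule conjI[OF e(1)], rule exI[of _ "\<lambda>s. \<Sum>x\<in>fibre s1. N' x s"], intro ballI conjI impI)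
    fix s assume s: "s \<in> ball s1 e"
    have sx: "s \<in> ball s1 (\<epsilon> x)" if "x \<in> fibre s1" for x using s e(3)[OF that] by auto
    show "fibre s \<subseteq> U"
    proof -
      have "fibre s \<subseteq> \<Union>(E ` fibre s1)" using s e(2) by (intro e0(2)) auto
      thus ?thesis using E by blast
    qed
    have "((\<lambda>s. \<Sum>x\<in>fibre s1. \<Sum>y\<in>E x \<inter> fibre s. ?m s y) has_field_derivative (\<Sum>x\<in>fibre s1. N' x s)) (at s)"
      by (rule DERIV_sum) (use E sx in blast)
    thus "(fibre_sum G has_field_derivative (\<Sum>x\<in>fibre s1. N' x s)) (at s)"
      by (rule has_field_derivative_transform_within_open[OF _ open_ball s]) (rule eq)
    assume \<omega>0: "\<forall>c\<in>A. \<forall>y\<in>U \<inter> fst c. \<omega> c (snd c y) = 0"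
    show "(\<Sum>x\<in>fibre s1. N' x s) = 0"
    proof (rule sum.neutral, intro ballI)
      fix x assume x: "x \<in> fibre s1"
      have "\<forall>c\<in>A. \<forall>y\<in>(U \<inter> V x) \<inter> fst c. \<omega> c (snd c y) = 0" using \<omega>0 by blast
      thus "N' x s = 0" using E[OF x] sx[OF x] by blast
    qed
  qed
qed

end


section \<open>Paths from a base point, and periods\<close>

lemma primitive_on_cong:
  assumes X: "riemann_surface X A" and W: "openin X W" "primitive_on A \<omega> W F" "\<And>x. x \<in> W \<Longrightarrow> F x = G x"
  shows "primitive_on A \<omega> W G"
  unfolding primitive_on_def
proof (intro ballI)
  fix c x assume c: "c \<in> A" and x: "x \<in> W \<inter> fst c"
  have cc: "complex_chart X c" using X c by (auto simp: riemann_surface_def)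
  have "((F \<circ> chart_inv c) has_field_derivative \<omega> c (snd c x)) (at (snd c x))"
    using W(2) c x unfolding primitive_on_def by blast
  thus "((G \<circ> chart_inv c) has_field_derivative \<omega> c (snd c x)) (at (snd c x))"
  proof (rule has_field_derivative_transform_within_open[OF _ open_chart_image[OF cc W(1)]])
    fix z assume "z \<in> snd c ` (W \<inter> fst c)"
    then obtain y where "y \<in> W" "y \<in> fst c" "z = snd c y" by blast
    thus "(F \<circ> chart_inv c) z = (G \<circ> chart_inv c) z" using chart_inv_snd[OF cc] W(3) by simp
  qed (use x in blast)
qed

context rsurface
begin

lemma chart_segment:
  assumes c: "c \<in> maximal_atlas" and r: "ball (snd c x) r \<subseteq> snd c ` fst c" and x: "x \<in> fst c"
    and y: "y \<in> fst c" "snd c y \<in> ball (snd c x) r"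
  shows "\<exists>h. pathin X h \<and> h 0 = x \<and> h 1 = y \<and> h ` {0..1} \<subseteq> {y \<in> fst c. snd c y \<in> ball (snd c x) r}"
proof -
  define l where "l = linepath (snd c x) (snd c y)"
  have lin: "l t \<in> ball (snd c x) r" if "t \<in> {0..1}" for t
  proof -
    have "l t \<in> closed_segment (snd c x) (snd c y)"
      unfolding l_def using that by (metis linepath_in_path)
    moreover have "snd c x \<in> ball (snd c x) r" using y(2) by (auto intro: le_less_trans[OF zero_le_dist])
    ultimately show ?thesis using closed_segment_subset[OF _ y(2) convex_ball] by blast
  qed
  have cc: "complex_chart X c" by (rule maximal_chart[OF c])
  have h: "homeomorphic_map (subtopology X (fst c)) (top_of_set (snd c ` fst c)) (snd c)"
    using cc by (simp add: complex_chart_def)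
  then obtain k where k: "homeomorphic_maps (subtopology X (fst c)) (top_of_set (snd c ` fst c)) (snd c) k"
    unfolding homeomorphic_map_maps by blast
  have top: "topspace (subtopology X (fst c)) = fst c" using chartD(2)[OF c] by auto
  have kc: "continuous_map (top_of_set (snd c ` fst c)) (subtopology X (fst c)) k"
    and ks: "\<And>y. y \<in> fst c \<Longrightarrow> k (snd c y) = y" and sk: "\<And>z. z \<in> snd c ` fst c \<Longrightarrow> snd c (k z) = z"
    using k top unfolding homeomorphic_maps_def by auto
  have kin: "k z \<in> fst c" if "z \<in> snd c ` fst c" for z using ks that by auto
  have "continuous_map (top_of_set {0..1}) (top_of_set (snd c ` fst c)) l"
    using lin r by (auto simp: continuous_map_in_subtopology l_def intro!: continuous_intros)
  hence "continuous_map (top_of_set {0..1}) (subtopology X (fst c)) (k \<circ> l)"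
    by (rule continuous_map_compose[OF _ kc])
  hence "pathin X (k \<circ> l)" unfolding pathin_def continuous_map_in_subtopology by blast
  moreover have "(k \<circ> l) 0 = x" "(k \<circ> l) 1 = y" using ks x y(1) by (simp_all add: l_def linepath_def)
  moreover have "(k \<circ> l) ` {0..1} \<subseteq> {y \<in> fst c. snd c y \<in> ball (snd c x) r}"
  proof (rule image_subsetI)
    fix t :: real assume "t \<in> {0..1}"
    from lin[OF this] show "(k \<circ> l) t \<in> {y \<in> fst c. snd c y \<in> ball (snd c x) r}"
      using r kin sk by auto
  qed
  ultimately show ?thesis by blast
qed

definition path_between :: "(real \<Rightarrow> 'a) \<Rightarrow> 'a \<Rightarrow> 'a \<Rightarrow> bool" where
  "path_between g x y \<longleftrightarrow> pathin X g \<and> g 0 = x \<and> g 1 = y"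

lemma path_between_join: "path_between g x y \<Longrightarrow> path_between h y z \<Longrightarrow> path_between (path_join g h) x z"
  unfolding path_between_def by (simp add: pathin_join)

lemma path_between_reverse: "path_between g x y \<Longrightarrow> path_between (path_reverse g) y x"
  unfolding path_between_def by (simp add: pathin_reverse)

lemma path_between_topspace: "path_between g x y \<Longrightarrow> x \<in> topspace X \<and> y \<in> topspace X"
  unfolding path_between_def using pathin_topspace[of X g 0] pathin_topspace[of X g 1] by auto

lemma path_between_exists:
  assumes "connected_space X" "x \<in> topspace X" "y \<in> topspace X"
  shows "\<exists>g. path_between g x y"
proof -
  define P where "P = {y. \<exists>g. path_between g x y}"
  have nb: "\<exists>D. openin X D \<and> z \<in> D \<and> (\<forall>w\<in>D. \<exists>h. path_between h z w)" if z: "z \<in> topspace X" for z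
  proof -
    obtain c where c: "c \<in> A" "z \<in> fst c" using atlas_covers[OF z] by blast
    hence M: "c \<in> maximal_atlas" using atlas_subset by blast
    obtain r where r: "0 < r" "ball (snd c z) r \<subseteq> snd c ` fst c"
      by (rule chart_ball_nbhd[OF M chartD(1)[OF M] c(2,2)])
    have "\<exists>h. path_between h z w" if "w \<in> {w \<in> fst c. snd c w \<in> ball (snd c z) r}" for w
      using chart_segment[OF M r(2) c(2), of w] that unfolding path_between_def by blast
    thus ?thesis using chartD(5)[OF M open_ball] c(2) r(1)
      by (intro exI[of _ "{w \<in> fst c. snd c w \<in> ball (snd c z) r}"]) auto
  qed
  have Pt: "P \<subseteq> topspace X" unfolding P_def using path_between_topspace by blast
  have "openin X P"
    unfolding openin_subopen[of X P]
  proof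
    fix z assume z: "z \<in> P"
    with nb Pt obtain D where D: "openin X D" "z \<in> D" "\<forall>w\<in>D. \<exists>h. path_between h z w" by blast
    have "D \<subseteq> P" using z D(3) path_between_join unfolding P_def by blast
    thus "\<exists>T. openin X T \<and> z \<in> T \<and> T \<subseteq> P" using D by blast
  qed
  moreover have "openin X (topspace X - P)"
    unfolding openin_subopen[of X "topspace X - P"]
  proof
    fix z assume z: "z \<in> topspace X - P"
    with nb obtain D where D: "openin X D" "z \<in> D" "\<forall>w\<in>D. \<exists>h. path_between h z w" by blast
    have "w \<notin> P" if "w \<in> D" for w
      using D(3) that z path_between_join path_between_reverse unfolding P_def by blast
    hence "D \<subseteq> topspace X - P" using openin_subset[OF D(1)] by blast
    thus "\<exists>T. openin X T \<and> z \<in> T \<and> T \<subseteq> topspace X - P" using D by blast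
  qed
  moreover have "x \<in> P"
  proof -
    have "path_between (\<lambda>_. x) x x" using assms(2) by (simp add: path_between_def pathin_def)
    thus ?thesis unfolding P_def by blast
  qed
  ultimately have "P = topspace X"
    using assms(1) Pt by (auto simp: connected_space_clopen_in closedin_def)
  thus ?thesis using assms(3) unfolding P_def by blast
qed

text \<open>One path to each point of \<open>S\<close>, continued by straight segments in a chart
  disc. The choice is made before any differential, and for every differential the integral along it
  is a primitive near \<open>S\<close>; this uniformity is what finally gives a single closed
  path.\<close>

lemma path_family:
  assumes conn: "connected_space X" and x0: "x0 \<in> topspace X" and S: "finite S" "S \<subseteq> topspace X"
  shows "\<exists>U r. openin X U \<and> S \<subseteq> U \<and> (\<forall>y\<in>U. path_between (r y) x0 y) \<and>
    (\<forall>\<omega>. holomorphic_differential A \<omega> \<longrightarrow> primitive_on A \<omega> U (\<lambda>y. path_integral X A (r y) \<omega>))"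
proof -
  obtain V where V: "\<And>x. x \<in> S \<Longrightarrow> openin X (V x) \<and> x \<in> V x"
    "\<And>x y. x \<in> S \<Longrightarrow> y \<in> S \<Longrightarrow> x \<noteq> y \<Longrightarrow> V x \<inter> V y = {}"
    using Hausdorff_finite_separation[OF Hausdorff S] by metis
  define P where "P x D r \<longleftrightarrow> openin X D \<and> x \<in> D \<and> D \<subseteq> V x \<and> (\<forall>y\<in>D. path_between (r y) x0 y) \<and>
    (\<forall>\<omega>. holomorphic_differential A \<omega> \<longrightarrow> primitive_on A \<omega> D (\<lambda>y. path_integral X A (r y) \<omega>))" for x D r
  have "\<exists>D r. P x D r" if x: "x \<in> S" for x
  proof -
    have xX: "x \<in> topspace X" using x S by blast
    obtain c where c: "c \<in> A" "x \<in> fst c" using atlas_covers[OF xX] by blast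
    hence M: "c \<in> maximal_atlas" using atlas_subset by blast
    have VV: "openin X (V x)" "x \<in> V x" using V(1)[OF x] by auto
    obtain \<rho> where \<rho>: "0 < \<rho>" "ball (snd c x) \<rho> \<subseteq> snd c ` fst c" "{y \<in> fst c. snd c y \<in> ball (snd c x) \<rho>} \<subseteq> V x"
      by (rule chart_ball_nbhd[OF M VV c(2)])
    define D where "D = {y \<in> fst c. snd c y \<in> ball (snd c x) \<rho>}"
    have Do: "openin X D" unfolding D_def by (rule chartD(5)[OF M open_ball])
    obtain g where g: "path_between g x0 x" using path_between_exists[OF conn x0 xX] by blast
    have "\<exists>h. pathin X h \<and> h 0 = x \<and> h 1 = y \<and> h ` {0..1} \<subseteq> D" if "y \<in> D" for y
      using chart_segment[OF M \<rho>(2) c(2), of y] that unfolding D_def by blast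
    then obtain h where h: "\<And>y. y \<in> D \<Longrightarrow> pathin X (h y) \<and> h y 0 = x \<and> h y 1 = y \<and> h y ` {0..1} \<subseteq> D"
      by metis
    have "P x D (\<lambda>y. path_join g (h y))" unfolding P_def
    proof (intro conjI ballI allI impI)
      show "openin X D" by (rule Do)
      show "x \<in> D" using c(2) \<rho>(1) by (simp add: D_def)
      show "D \<subseteq> V x" using \<rho>(3) by (simp add: D_def)
      show "path_between (path_join g (h y)) x0 y" if "y \<in> D" for y
        using h[OF that] by (intro path_between_join[OF g]) (simp add: path_between_def)
      fix \<omega> assume \<omega>: "holomorphic_differential A \<omega>"
      obtain F where F: "primitive_on A \<omega> D F" using local_primitive[OF \<omega> c(1) \<rho>(2)] unfolding D_def by blast
      show "primitive_on A \<omega> D (\<lambda>y. path_integral X A (path_join g (h y)) \<omega>)"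
      proof (rule primitive_on_cong[OF riemann Do primitive_on_add_const[OF F, of "path_integral X A g \<omega> - F x"]])
        fix y assume y: "y \<in> D"
        have hy: "pathin X (h y)" "h y 0 = x" "h y 1 = y" "h y ` {0..1} \<subseteq> D" using h[OF y] by auto
        have "pathin X g" "g 1 = h y 0" using g hy(2) by (simp_all add: path_between_def)
        from path_integral_join[OF \<omega> this(1) hy(1) this(2)] path_integral_primitive[OF hy(1) Do F hy(4)]
        show "F y + (path_integral X A g \<omega> - F x) = path_integral X A (path_join g (h y)) \<omega>"
          using hy(2,3) by simp
      qed
    qed
    thus ?thesis by blast
  qed
  then obtain D r where "\<And>x. x \<in> S \<Longrightarrow> P x (D x) (r x)" by metis
  note DP = this[unfolded P_def]
  \<comment> \<open>The neighbourhoods of different points of \<open>S\<close> are disjoint, so the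
    selected point is unique.\<close>
  define r' where "r' y = r (SOME x. x \<in> S \<and> y \<in> D x) y" for y
  have r': "r' y = r x y" if xy: "x \<in> S" "y \<in> D x" for x y
  proof -
    have "(SOME x. x \<in> S \<and> y \<in> D x) = x"
    proof (rule some_equality)
      fix z assume z: "z \<in> S \<and> y \<in> D z"
      have "y \<in> V x \<inter> V z" using DP z xy by blast
      thus "z = x" using V(2)[of x z] xy(1) z by blast
    qed (use xy in blast)
    thus ?thesis by (simp add: r'_def)
  qed
  show ?thesis
  proof (rule exI[of _ "\<Union>(D ` S)"], rule exI[of _ r'], intro conjI ballI allI impI)
    show "openin X (\<Union>(D ` S))" "S \<subseteq> \<Union>(D ` S)" using DP by auto
    show "path_between (r' y) x0 y" if y: "y \<in> \<Union>(D ` S)" for y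
    proof -
      obtain x where x: "x \<in> S" "y \<in> D x" using y by blast
      thus ?thesis using DP r'[OF x] by simp
    qed
    fix \<omega> assume \<omega>: "holomorphic_differential A \<omega>"
    have "primitive_on A \<omega> (D x) (\<lambda>y. path_integral X A (r' y) \<omega>)" if x: "x \<in> S" for x
      by (rule primitive_on_cong[OF riemann, of "D x" _ "\<lambda>y. path_integral X A (r x y) \<omega>"])
         (use DP[OF x] \<omega> r'[OF x] in auto)
    thus "primitive_on A \<omega> (\<Union>(D ` S)) (\<lambda>y. path_integral X A (r' y) \<omega>)"
      unfolding primitive_on_def by blast
  qed
qed

text \<open>A functional on differentials that is integration over one loop at \<open>x0\<close>.
  Such functionals are closed under sums and integer multiples, which takes the place of homology
  classes.\<close>

definition period :: "'a \<Rightarrow> (('a chart \<Rightarrow> complex \<Rightarrow> complex) \<Rightarrow> complex) \<Rightarrow> bool" where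
  "period x0 I \<longleftrightarrow> (\<exists>\<gamma>. path_between \<gamma> x0 x0 \<and>
    (\<forall>\<omega>. holomorphic_differential A \<omega> \<longrightarrow> I \<omega> = path_integral X A \<gamma> \<omega>))"

lemma period_zero: "x0 \<in> topspace X \<Longrightarrow> period x0 (\<lambda>_. 0)"
  unfolding period_def path_between_def
  by (rule exI[of _ "\<lambda>_. x0"]) (simp add: path_integral_const pathin_def)

lemma period_add: "period x0 I \<Longrightarrow> period x0 J \<Longrightarrow> period x0 (\<lambda>\<omega>. I \<omega> + J \<omega>)"
proof -
  assume "period x0 I" "period x0 J"
  then obtain \<gamma> \<delta> where g: "path_between \<gamma> x0 x0" "\<And>\<omega>. holomorphic_differential A \<omega> \<Longrightarrow> I \<omega> = path_integral X A \<gamma> \<omega>"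
    "path_between \<delta> x0 x0" "\<And>\<omega>. holomorphic_differential A \<omega> \<Longrightarrow> J \<omega> = path_integral X A \<delta> \<omega>"
    unfolding period_def by blast
  have "I \<omega> + J \<omega> = path_integral X A (path_join \<gamma> \<delta>) \<omega>" if "holomorphic_differential A \<omega>" for \<omega>
    using g path_integral_join[OF that, of \<gamma> \<delta>] that by (simp add: path_between_def)
  thus ?thesis using path_between_join[OF g(1,3)] unfolding period_def by blast
qed

lemma period_uminus: "period x0 I \<Longrightarrow> period x0 (\<lambda>\<omega>. - I \<omega>)"
proof -
  assume "period x0 I"
  then obtain \<gamma> where g: "path_between \<gamma> x0 x0" "\<And>\<omega>. holomorphic_differential A \<omega> \<Longrightarrow> I \<omega> = path_integral X A \<gamma> \<omega>"
    unfolding period_def by blast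
  have "- I \<omega> = path_integral X A (path_reverse \<gamma>) \<omega>" if "holomorphic_differential A \<omega>" for \<omega>
    using g path_integral_reverse[OF that, of \<gamma>] that by (simp add: path_between_def)
  thus ?thesis using path_between_reverse[OF g(1)] unfolding period_def by blast
qed

lemma period_cong:
  "period x0 I \<Longrightarrow> (\<And>\<omega>. holomorphic_differential A \<omega> \<Longrightarrow> I \<omega> = J \<omega>) \<Longrightarrow> period x0 J"
  unfolding period_def by metis

lemma period_diff: "period x0 I \<Longrightarrow> period x0 J \<Longrightarrow> period x0 (\<lambda>\<omega>. I \<omega> - J \<omega>)"
  using period_add[OF _ period_uminus] by fastforce

lemma period_of_nat:
  assumes "x0 \<in> topspace X" "period x0 I"
  shows "period x0 (\<lambda>\<omega>. of_nat k * I \<omega>)"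
proof (induction k)
  case 0
  show ?case using period_zero[OF assms(1)] by simp
next
  case (Suc k)
  from period_add[OF assms(2) Suc] show ?case by (simp add: algebra_simps)
qed

lemma period_of_int:
  assumes "x0 \<in> topspace X" "period x0 I"
  shows "period x0 (\<lambda>\<omega>. of_int k * I \<omega>)"
proof (cases "0 \<le> k")
  case True
  thus ?thesis using period_of_nat[OF assms, of "nat k"] by simp
next
  case False
  thus ?thesis using period_uminus[OF period_of_nat[OF assms, of "nat (- k)"]] by simp
qed

lemma period_sum:
  assumes "x0 \<in> topspace X" "finite S" "\<And>i. i \<in> S \<Longrightarrow> period x0 (I i)"
  shows "period x0 (\<lambda>\<omega>. \<Sum>i\<in>S. I i \<omega>)"
  using assms(2,3)
proof (induction S rule: finite_induct)
  case empty
  show ?case using period_zero[OF assms(1)] by simp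
next
  case (insert i S)
  have "period x0 (\<lambda>\<omega>. I i \<omega> + (\<Sum>i\<in>S. I i \<omega>))" by (rule period_add) (use insert in blast)+
  thus ?case using insert.hyps by simp
qed

lemma period_path_diff:
  assumes "path_between g x0 y" "path_between h x0 y"
  shows "period x0 (\<lambda>\<omega>. path_integral X A g \<omega> - path_integral X A h \<omega>)"
  unfolding period_def
proof (intro exI[of _ "path_join g (path_reverse h)"] conjI allI impI)
  show "path_between (path_join g (path_reverse h)) x0 x0"
    by (rule path_between_join[OF assms(1) path_between_reverse[OF assms(2)]])
  fix \<omega> assume "holomorphic_differential A \<omega>"
  thus "path_integral X A g \<omega> - path_integral X A h \<omega> = path_integral X A (path_join g (path_reverse h)) \<omega>"
    using assms path_integral_join[of \<omega> g "path_reverse h"] path_integral_reverse[of \<omega> h] pathin_reverse[of X h]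
    by (simp add: path_between_def)
qed

end


section \<open>The reciprocal function and the trace of a differential\<close>

context nonconstant_meromorphic
begin

lemma value_tendsto:
  assumes c: "c \<in> A" "x \<in> fst c" and np: "\<not> pole_at f x"
  shows "((f \<circ> chart_inv c) \<longlongrightarrow> f x) (at (snd c x))"
  using analytic_at_imp_isCont[OF analytic_off_poles[OF c np]] c subsetD[OF atlas_subset c(1)]
  by (simp add: isCont_def)

lemma inverse_tendsto_pole:
  assumes c: "c \<in> A" "x \<in> fst c" and p: "pole_at f x"
  shows "((\<lambda>z. inverse ((f \<circ> chart_inv c) z)) \<longlongrightarrow> 0) (at (snd c x))"
  using p pole_at_chart[OF c, of f] filterlim_compose[OF tendsto_inverse_0] unfolding is_pole_def by blast

lemma inverse_pole_zero:
  assumes c: "c \<in> A" "x \<in> fst c" and np: "\<not> pole_at f x" and z: "f x = 0"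
  shows "is_pole (\<lambda>z. inverse ((f \<circ> chart_inv c) z)) (snd c x)"
proof -
  have "filterlim (f \<circ> chart_inv c) (at 0) (at (snd c x))"
    using value_tendsto[OF c np] eventually_value_ne[OF c, of 0] z by (simp add: filterlim_at)
  from filterlim_compose[OF filterlim_inverse_at_infinity this] show ?thesis by (simp add: is_pole_def)
qed

text \<open>The convention \<open>inverse 0 = 0\<close> matches the value 0 at poles: the pointwise
  inverse is already the required representative of the reciprocal, at zeros and at poles
  alike.\<close>

lemma inverse_meromorphic: "meromorphic_function X A (\<lambda>x. inverse (f x))"
  unfolding meromorphic_function_def nicely_meromorphic_on_def
proof (intro ballI conjI)
  fix c assume c: "c \<in> A"
  hence M: "c \<in> maximal_atlas" using atlas_subset by blast
  have eq: "(\<lambda>x. inverse (f x)) \<circ> chart_inv c = (\<lambda>z. inverse ((f \<circ> chart_inv c) z))" by (simp add: comp_def)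
  have "(\<lambda>z. inverse ((f \<circ> chart_inv c) z)) meromorphic_on {snd c x}" if "x \<in> fst c" for x
    by (intro meromorphic_intros meromorphic_at[OF c that])
  thus "((\<lambda>x. inverse (f x)) \<circ> chart_inv c) meromorphic_on snd c ` fst c"
    unfolding eq by (subst meromorphic_on_meromorphic_at) blast
  fix z assume "z \<in> snd c ` fst c"
  then obtain x where x: "x \<in> fst c" "z = snd c x" by blast
  show "is_pole ((\<lambda>x. inverse (f x)) \<circ> chart_inv c) z \<and> ((\<lambda>x. inverse (f x)) \<circ> chart_inv c) z = 0 \<or>
    ((\<lambda>x. inverse (f x)) \<circ> chart_inv c) \<midarrow>z\<rightarrow> ((\<lambda>x. inverse (f x)) \<circ> chart_inv c) z"
  proof (cases "pole_at f x")
    case True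
    thus ?thesis using inverse_tendsto_pole[OF c x(1) True] pole_value[OF True] x M unfolding eq by simp
  next
    case False
    show ?thesis
    proof (cases "f x = 0")
      case True
      thus ?thesis using inverse_pole_zero[OF c x(1) False True] x M unfolding eq by simp
    next
      case nz: False
      from tendsto_inverse[OF value_tendsto[OF c x(1) False] nz] show ?thesis using x M unfolding eq by simp
    qed
  qed
qed

lemma nonconstant_inverse: "nonconstant_meromorphic X A (\<lambda>x. inverse (f x))"
proof unfold_locales
  show "meromorphic_function X A (\<lambda>x. inverse (f x))" by (rule inverse_meromorphic)
  fix s
  obtain x where "x \<in> topspace X" "f x \<noteq> inverse s" using nonconstant by blast
  thus "\<exists>x\<in>topspace X. inverse (f x) \<noteq> s" by (intro bexI[of _ x]) auto
qed (rule compact connected)+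

lemma fibre_primitive:
  assumes "holomorphic_differential A \<omega>"
  obtains U G where "openin X U" "fibre s \<subseteq> U" "primitive_on A \<omega> U G"
proof (cases "topspace X = {}")
  case True
  have "fibre s = {}" unfolding fibre_def True by blast
  thus ?thesis using that[of "{}" "\<lambda>_. 0"] by (simp add: primitive_on_def)
next
  case False
  then obtain x0 where x0: "x0 \<in> topspace X" by blast
  have "fibre s \<subseteq> topspace X" by (auto simp: fibre_def)
  from path_family[OF connected x0 finite_fibre this] assms that show ?thesis by blast
qed

end

locale meromorphic_pair = nonconstant_meromorphic X A f +
  inv: nonconstant_meromorphic X A "\<lambda>x. inverse (f x)" for X A f
begin

lemma inverse_fibre:
  assumes "t \<noteq> 0"
  shows "inv.fibre t = fibre (inverse t)"
  using assms pole_value inv.pole_value unfolding inv.fibre_def fibre_def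
  by (auto simp: inverse_eq_iff_eq)

text \<open>\<open>1 / f - t = (f - 1 / t) * (- t / f)\<close>, and the second factor is holomorphic
  without zero near a point where \<open>f = 1 / t\<close>.\<close>

lemma inverse_ord:
  assumes "t \<noteq> 0" "x \<in> fibre (inverse t)"
  shows "ord_at A (\<lambda>y. inverse (f y) - t) x = ord_at A (\<lambda>y. f y - inverse t) x"
proof -
  have x: "x \<in> topspace X" "f x = inverse t" "\<not> pole_at f x" using assms(2) by (auto simp: fibre_def)
  obtain c where c: "c \<in> A" "x \<in> fst c" using atlas_covers[OF x(1)] by blast
  hence M: "c \<in> maximal_atlas" using atlas_subset by blast
  let ?F = "f \<circ> chart_inv c" and ?z = "snd c x"
  have Fz: "?F ?z \<noteq> 0" using x(2) assms(1) c M by simp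
  have an: "?F analytic_on {?z}" by (rule analytic_off_poles[OF c x(3)])
  have u: "(\<lambda>w. - t / ?F w) analytic_on {?z}" by (intro analytic_intros an) (use Fz in auto)
  have nz: "eventually (\<lambda>w. ?F w \<noteq> 0) (at ?z)" by (rule eventually_value_ne[OF c])
  have ne: "eventually (\<lambda>w. ?F w - inverse t \<noteq> 0) (at ?z)" using eventually_value_ne[OF c, of "inverse t"] by simp
  have ev: "eventually (\<lambda>w. (?F w - inverse t) * (- t / ?F w) = inverse (?F w) - t) (at ?z)"
    using nz
  proof eventually_elim
    case (elim w)
    thus ?case using assms(1) by (simp add: field_simps)
  qed
  have fr: "\<exists>\<^sub>F w in at ?z. (?F w - inverse t) * (- t / ?F w) \<noteq> 0"
  proof (rule eventually_frequently[OF at_neq_bot])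
    show "\<forall>\<^sub>F w in at ?z. (?F w - inverse t) * (- t / ?F w) \<noteq> 0"
      using nz ne by eventually_elim (use assms(1) in simp)
  qed
  have a1: "(\<lambda>w. ?F w - inverse t) analytic_on {?z}" by (intro analytic_intros an)
  have iso: "isolated_singularity_at (\<lambda>w. ?F w - inverse t) ?z" "not_essential (\<lambda>w. ?F w - inverse t) ?z"
    "isolated_singularity_at (\<lambda>w. - t / ?F w) ?z" "not_essential (\<lambda>w. - t / ?F w) ?z"
    using analytic_on_imp_meromorphic_on[OF a1] analytic_on_imp_meromorphic_on[OF u] unfolding meromorphic_at_iff by blast+
  have "zorder (\<lambda>w. (?F w - inverse t) * (- t / ?F w)) ?z = zorder (\<lambda>w. ?F w - inverse t) ?z + zorder (\<lambda>w. - t / ?F w) ?z"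
    by (rule zorder_times[OF iso(1,3,2,4) fr])
  moreover have "zorder (\<lambda>w. - t / ?F w) ?z = 0"
    by (rule zorder_eq_0I[OF u]) (use Fz assms(1) in simp)
  moreover have "zorder (\<lambda>w. (?F w - inverse t) * (- t / ?F w)) ?z = zorder (\<lambda>w. inverse (?F w) - t) ?z"
    by (rule zorder_cong[OF ev refl])
  moreover have "ord_at A (\<lambda>y. f y - inverse t) x = zorder ((\<lambda>y. f y - inverse t) \<circ> chart_inv c) ?z"
    by (rule ord_at_chart[OF c]) (use a1 ne in \<open>auto simp: comp_def intro: analytic_on_imp_meromorphic_on\<close>)
  moreover have "ord_at A (\<lambda>y. inverse (f y) - t) x = zorder ((\<lambda>y. inverse (f y) - t) \<circ> chart_inv c) ?z"
  proof (rule ord_at_chart[OF c])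
    have "(\<lambda>w. inverse (?F w) - t) analytic_on {?z}" by (intro analytic_intros an) (use Fz in auto)
    thus "((\<lambda>y. inverse (f y) - t) \<circ> chart_inv c) meromorphic_on {?z}"
      by (auto simp: comp_def intro: analytic_on_imp_meromorphic_on)
    show "\<forall>\<^sub>F z in at ?z. ((\<lambda>y. inverse (f y) - t) \<circ> chart_inv c) z \<noteq> 0"
      using inv.eventually_value_ne[OF c, of t] by (simp add: comp_def)
  qed
  ultimately show ?thesis by (simp add: comp_def)
qed

lemma inverse_fibre_sum: "t \<noteq> 0 \<Longrightarrow> inv.fibre_sum G t = fibre_sum G (inverse t)"
  unfolding inv.fibre_sum_def fibre_sum_def
  by (rule sum.cong[OF inverse_fibre]) (simp_all add: inverse_ord)

(* The derivative of s |-> fibre_sum G s for local primitives G of omega is the trace of omega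
   along f; it is entire and vanishes at infinity. *)
lemma fibre_sum_derivative_zero:
  assumes \<omega>: "holomorphic_differential A \<omega>" and U: "openin X U" "fibre s \<subseteq> U" "primitive_on A \<omega> U G"
  shows "(fibre_sum G has_field_derivative 0) (at s)"
proof -
  \<comment> \<open>\<open>d\<close> is the derivative obtained from some local primitive. Two
    primitives differ by a primitive of the zero differential, whose fibre sum has derivative 0, so
    \<open>d\<close> is unique.\<close>
  define D where "D s d \<longleftrightarrow> (\<exists>U G. openin X U \<and> fibre s \<subseteq> U \<and> primitive_on A \<omega> U G \<and>
    (fibre_sum G has_field_derivative d) (at s))" for s d
  have uniq: "d = d'" if d: "D s d" and d': "D s d'" for s d d'
  proof -
    obtain U G where U: "openin X U" "fibre s \<subseteq> U" "primitive_on A \<omega> U G" "(fibre_sum G has_field_derivative d) (at s)"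
      using d unfolding D_def by blast
    obtain U' G' where U': "openin X U'" "fibre s \<subseteq> U'" "primitive_on A \<omega> U' G'" "(fibre_sum G' has_field_derivative d') (at s)"
      using d' unfolding D_def by blast
    have "primitive_on A (\<lambda>_ _. 0) (U \<inter> U') (\<lambda>y. G y - G' y)"
      unfolding primitive_on_def
    proof (intro ballI)
      fix c x assume c: "c \<in> A" and x: "x \<in> U \<inter> U' \<inter> fst c"
      have "((G \<circ> chart_inv c) has_field_derivative \<omega> c (snd c x)) (at (snd c x))"
        "((G' \<circ> chart_inv c) has_field_derivative \<omega> c (snd c x)) (at (snd c x))"
        using U(3) U'(3) c x unfolding primitive_on_def by blast+
      from DERIV_diff[OF this] show "((\<lambda>y. G y - G' y) \<circ> chart_inv c has_field_derivative 0) (at (snd c x))"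
        by (simp add: comp_def)
    qed
    from fibre_sum_derivative[OF openin_Int[OF U(1) U'(1)] Int_greatest[OF U(2) U'(2)] this]
    obtain \<epsilon> N' where N: "0 < \<epsilon>" "\<forall>t\<in>ball s \<epsilon>. fibre t \<subseteq> U \<inter> U' \<and>
      (fibre_sum (\<lambda>y. G y - G' y) has_field_derivative N' t) (at t) \<and>
      ((\<forall>c\<in>A. \<forall>y\<in>U \<inter> U' \<inter> fst c. (0::complex) = 0) \<longrightarrow> N' t = 0)" by (elim exE conjE) (rule that)
    have "s \<in> ball s \<epsilon>" using N(1) by simp
    from bspec[OF N(2) this] have "(fibre_sum (\<lambda>y. G y - G' y) has_field_derivative 0) (at s)" by auto
    moreover have "fibre_sum (\<lambda>y. G y - G' y) = (\<lambda>s. fibre_sum G s - fibre_sum G' s)"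
      by (rule ext) (simp add: fibre_sum_def right_diff_distrib sum_subtractf)
    ultimately have "((\<lambda>s. fibre_sum G s - fibre_sum G' s) has_field_derivative 0) (at s)" by simp
    from DERIV_unique[OF this DERIV_diff[OF U(4) U'(4)]] show ?thesis by simp
  qed
  \<comment> \<open>This is the coefficient of the trace. Near \<open>s\<close> it is the derivative
    of one fixed fibre sum, which is holomorphic; hence it is entire.\<close>
  define a where "a s = (THE d. D s d)" for s
  have aD: "a s = d" if "D s d" for s d
    unfolding a_def using that uniq by (blast intro: the_equality)
  have near: "\<exists>\<epsilon>>0. \<forall>t\<in>ball s \<epsilon>. (fibre_sum G has_field_derivative a t) (at t)"
    if U: "openin X U" "fibre s \<subseteq> U" "primitive_on A \<omega> U G" for s U G
  proof -
    from fibre_sum_derivative[OF U] obtain \<epsilon> N' where N: "0 < \<epsilon>" "\<forall>t\<in>ball s \<epsilon>. fibre t \<subseteq> U \<and>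
      (fibre_sum G has_field_derivative N' t) (at t) \<and>
      ((\<forall>c\<in>A. \<forall>y\<in>U \<inter> fst c. \<omega> c (snd c y) = 0) \<longrightarrow> N' t = 0)" by (elim exE conjE) (rule that)
    have "(fibre_sum G has_field_derivative a t) (at t)" if t: "t \<in> ball s \<epsilon>" for t
    proof -
      have Nt: "fibre t \<subseteq> U" "(fibre_sum G has_field_derivative N' t) (at t)" using bspec[OF N(2) t] by blast+
      hence "D t (N' t)" unfolding D_def using U by blast
      thus ?thesis using aD Nt(2) by simp
    qed
    thus ?thesis using N(1) by blast
  qed
  have "a field_differentiable (at s)" for s
  proof -
    obtain U G where U: "openin X U" "fibre s \<subseteq> U" "primitive_on A \<omega> U G" by (rule fibre_primitive[OF \<omega>])
    from near[OF U] obtain \<epsilon> where e: "0 < \<epsilon>" "\<forall>t\<in>ball s \<epsilon>. (fibre_sum G has_field_derivative a t) (at t)" by blast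
    have "fibre_sum G holomorphic_on ball s \<epsilon>"
      unfolding holomorphic_on_def field_differentiable_def using e(2) has_field_derivative_at_within by blast
    hence "deriv (fibre_sum G) holomorphic_on ball s \<epsilon>" by (rule holomorphic_deriv) simp
    hence "a holomorphic_on ball s \<epsilon>"
      by (rule holomorphic_transform) (use e(2) DERIV_imp_deriv in blast)
    thus ?thesis using holomorphic_on_imp_differentiable_at[OF _ open_ball] e(1) by auto
  qed
  hence hol: "a holomorphic_on UNIV" by (simp add: holomorphic_on_def field_differentiable_at_within)
  have "(a \<longlongrightarrow> 0) at_infinity"
  proof -
    obtain U G where U: "openin X U" "inv.fibre 0 \<subseteq> U" "primitive_on A \<omega> U G" by (rule inv.fibre_primitive[OF \<omega>])
    from inv.fibre_sum_derivative[OF U] obtain \<epsilon> N' where N: "0 < \<epsilon>" "\<forall>t\<in>ball 0 \<epsilon>. inv.fibre t \<subseteq> U \<and>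
      (inv.fibre_sum G has_field_derivative N' t) (at t) \<and>
      ((\<forall>c\<in>A. \<forall>y\<in>U \<inter> fst c. \<omega> c (snd c y) = 0) \<longrightarrow> N' t = 0)" by (elim exE conjE) (rule that)
    have "inv.fibre_sum G holomorphic_on ball 0 \<epsilon>"
      unfolding holomorphic_on_def field_differentiable_def using N(2) has_field_derivative_at_within by blast
    hence "deriv (inv.fibre_sum G) holomorphic_on ball 0 \<epsilon>" by (rule holomorphic_deriv) simp
    hence "N' holomorphic_on ball 0 \<epsilon>"
      by (rule holomorphic_transform) (use N(2) DERIV_imp_deriv in blast)
    hence "isCont N' 0"
      using holomorphic_on_imp_continuous_on continuous_on_eq_continuous_at[OF open_ball, of 0 \<epsilon> N'] N(1) by auto
    hence lim: "((\<lambda>s. - (N' (inverse s) * (inverse s)\<^sup>2)) \<longlongrightarrow> - (N' 0 * 0\<^sup>2)) at_infinity"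
      by (intro tendsto_minus tendsto_mult tendsto_power tendsto_inverse_0 isCont_tendsto_compose[OF _ tendsto_inverse_0])
    \<comment> \<open>For large \<open>s\<close> the fibre over \<open>s\<close> is the fibre of
      \<open>1 / f\<close> over \<open>1 / s\<close>, so a primitive near the poles can be used. The
      chain rule then expresses \<open>a s\<close> through \<open>N' (1 / s)\<close> with the
      decaying factor \<open>- 1 / s^2\<close>.\<close>
    have "eventually (\<lambda>s. - (N' (inverse s) * (inverse s)\<^sup>2) = a s) at_infinity"
    proof -
      have "((\<lambda>s::complex. inverse s) \<longlongrightarrow> 0) at_infinity" by (rule tendsto_inverse_0)
      from tendstoD[OF this N(1)] have "eventually (\<lambda>s::complex. dist (inverse s) 0 < \<epsilon>) at_infinity" .
      moreover have "eventually (\<lambda>s::complex. 1 \<le> norm s) at_infinity"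
        unfolding eventually_at_infinity by blast
      ultimately show ?thesis
      proof eventually_elim
        case (elim s)
        have s0: "s \<noteq> 0" using elim(2) by auto
        have ball: "inverse s \<in> ball 0 \<epsilon>" using elim(1) by (simp add: dist_commute)
        have fs: "fibre s \<subseteq> U" using bspec[OF N(2) ball] inverse_fibre[of "inverse s"] s0 by auto
        have "(inv.fibre_sum G has_field_derivative N' (inverse s)) (at (inverse s))" using bspec[OF N(2) ball] by blast
        moreover have "(inverse has_field_derivative - ((inverse s)\<^sup>2)) (at s)"
          using DERIV_inverse[OF s0] by (simp add: power2_eq_square)
        ultimately have "((\<lambda>s. inv.fibre_sum G (inverse s)) has_field_derivative N' (inverse s) * - ((inverse s)\<^sup>2)) (at s)"
          using DERIV_chain2[of "inv.fibre_sum G" _ inverse] by blast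
        hence "(fibre_sum G has_field_derivative N' (inverse s) * - ((inverse s)\<^sup>2)) (at s)"
          by (rule has_field_derivative_transform_within_open[of _ _ _ "- {0}"])
             (use s0 inverse_fibre_sum[of "inverse _"] in auto)
        hence "D s (N' (inverse s) * - ((inverse s)\<^sup>2))" unfolding D_def using U(1,3) fs by blast
        from aD[OF this] show ?case by simp
      qed
    qed
    from Lim_transform_eventually[OF lim this] show ?thesis by simp
  qed
  from Liouville_weak[OF hol this] have a0: "a s = 0" .
  from near[OF U] obtain \<epsilon> where e: "0 < \<epsilon>" "\<forall>t\<in>ball s \<epsilon>. (fibre_sum G has_field_derivative a t) (at t)" by blast
  have "s \<in> ball s \<epsilon>" using e(1) by simp
  from bspec[OF e(2) this] show ?thesis by (simp add: a0)
qed

end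


section \<open>Abel's theorem\<close>

context meromorphic_pair
begin

text \<open>For the coherent paths of \<open>path_family\<close> the fibre sum is locally constant,
  its derivative being zero. Replacing them by the arbitrary paths \<open>g y\<close> changes each
  fibre sum by an integer combination of loops at \<open>x0\<close>.\<close>

lemma fibre_period:
  assumes x0: "x0 \<in> topspace X" and g: "\<And>y. y \<in> topspace X \<Longrightarrow> path_between (g y) x0 y"
  shows "\<exists>\<epsilon>>0. \<forall>s\<in>ball s1 \<epsilon>. period x0 (\<lambda>\<omega>.
    fibre_sum (\<lambda>y. path_integral X A (g y) \<omega>) s - fibre_sum (\<lambda>y. path_integral X A (g y) \<omega>) s1)"
proof -
  have "fibre s1 \<subseteq> topspace X" by (auto simp: fibre_def)
  from path_family[OF connected x0 finite_fibre this]
  obtain U r where U: "openin X U" "fibre s1 \<subseteq> U" "\<And>y. y \<in> U \<Longrightarrow> path_between (r y) x0 y"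
    "\<And>\<omega>. holomorphic_differential A \<omega> \<Longrightarrow> primitive_on A \<omega> U (\<lambda>y. path_integral X A (r y) \<omega>)" by metis
  from fibre_near[OF U(1,2)] obtain \<epsilon> where e: "0 < \<epsilon>" "\<forall>s\<in>ball s1 \<epsilon>. fibre s \<subseteq> U" by blast
  let ?R = "\<lambda>\<omega> s. fibre_sum (\<lambda>y. path_integral X A (r y) \<omega>) s"
  let ?G = "\<lambda>\<omega> s. fibre_sum (\<lambda>y. path_integral X A (g y) \<omega>) s"
  have per: "period x0 (\<lambda>\<omega>. ?G \<omega> s - ?R \<omega> s)" if s: "s \<in> ball s1 \<epsilon>" for s
  proof -
    have "period x0 (\<lambda>\<omega>. \<Sum>y\<in>fibre s. of_int (ord_at A (\<lambda>y. f y - s) y) *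
        (path_integral X A (g y) \<omega> - path_integral X A (r y) \<omega>))"
    proof (rule period_sum[OF x0 finite_fibre])
      fix y assume y: "y \<in> fibre s"
      hence "y \<in> topspace X" "y \<in> U" using e(2) s by (auto simp: fibre_def)
      from period_path_diff[OF g[OF this(1)] U(3)[OF this(2)]]
      show "period x0 (\<lambda>\<omega>. of_int (ord_at A (\<lambda>y. f y - s) y) *
          (path_integral X A (g y) \<omega> - path_integral X A (r y) \<omega>))"
        by (rule period_of_int[OF x0])
    qed
    thus ?thesis by (rule period_cong) (simp add: fibre_sum_def right_diff_distrib sum_subtractf)
  qed
  have const: "?R \<omega> s = ?R \<omega> s1" if \<omega>: "holomorphic_differential A \<omega>" and s: "s \<in> ball s1 \<epsilon>" for \<omega> s
  proof -
    have "(?R \<omega> has_field_derivative 0) (at t within ball s1 \<epsilon>)" if t: "t \<in> ball s1 \<epsilon>" for t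
      using fibre_sum_derivative_zero[OF \<omega> U(1) bspec[OF e(2) t] U(4)[OF \<omega>]]
      by (rule has_field_derivative_at_within)
    from has_field_derivative_zero_constant[OF convex_ball this]
    obtain k where "\<And>t. t \<in> ball s1 \<epsilon> \<Longrightarrow> ?R \<omega> t = k" by metis
    thus ?thesis using s e(1) by simp
  qed
  have "period x0 (\<lambda>\<omega>. ?G \<omega> s - ?G \<omega> s1)" if s: "s \<in> ball s1 \<epsilon>" for s
  proof -
    have "s1 \<in> ball s1 \<epsilon>" using e(1) by simp
    from period_diff[OF per[OF s] per[OF this]] show ?thesis
      by (rule period_cong) (use const[OF _ s] in simp)
  qed
  thus ?thesis using e(1) by blast
qed

text \<open>Differing by a period is an equivalence relation on the values, and by
  \<open>fibre_period\<close> its classes are open; the plane is connected.\<close>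

lemma fibres_period:
  assumes x0: "x0 \<in> topspace X" and g: "\<And>y. y \<in> topspace X \<Longrightarrow> path_between (g y) x0 y"
  shows "period x0 (\<lambda>\<omega>. fibre_sum (\<lambda>y. path_integral X A (g y) \<omega>) s - fibre_sum (\<lambda>y. path_integral X A (g y) \<omega>) t)"
proof -
  define R where "R s t \<longleftrightarrow> period x0 (\<lambda>\<omega>. fibre_sum (\<lambda>y. path_integral X A (g y) \<omega>) s -
      fibre_sum (\<lambda>y. path_integral X A (g y) \<omega>) t)" for s t
  have sym: "R t s" if "R s t" for s t
    using period_uminus[OF that[unfolded R_def]] unfolding R_def by simp
  have trans: "R s u" if "R s t" "R t u" for s t u
    using period_add[OF that[unfolded R_def]] unfolding R_def by simp
  have "R t s"
  proof (rule connected_equivalence_relation[OF connected_UNIV, where R = R])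
    fix a :: complex assume "a \<in> UNIV"
    obtain \<epsilon> where e: "0 < \<epsilon>" "\<forall>s\<in>ball a \<epsilon>. R s a"
      using fibre_period[OF x0 g, of a] unfolding R_def by blast
    have "openin (top_of_set UNIV) (ball a \<epsilon>) \<and> a \<in> ball a \<epsilon> \<and> (\<forall>x\<in>ball a \<epsilon>. R a x)"
      using e sym by simp
    thus "\<exists>T. openin (top_of_set UNIV) T \<and> a \<in> T \<and> (\<forall>x\<in>T. R a x)" by blast
  qed (use sym trans in blast)+
  from sym[OF this] show ?thesis unfolding R_def .
qed

end

context nonconstant_meromorphic
begin

text \<open>The weighted sum over the divisor is the fibre sum over 0 minus that of
  \<open>1 / f\<close> over 0, since reciprocals have opposite orders. The poles cannot be reached
  within the plane of values of \<open>f\<close>, so the two are compared through the common fibre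
  over 1.\<close>

lemma divisor_period:
  assumes x0: "x0 \<in> topspace X" and g: "\<And>y. y \<in> topspace X \<Longrightarrow> path_between (g y) x0 y"
  shows "finite {x \<in> topspace X. ord_at A f x \<noteq> 0}"
    and "period x0 (\<lambda>\<omega>. \<Sum>x\<in>{x \<in> topspace X. ord_at A f x \<noteq> 0}. of_int (ord_at A f x) * path_integral X A (g x) \<omega>)"
proof -
  interpret P: meromorphic_pair X A f
    by (rule meromorphic_pair.intro[OF nonconstant_meromorphic_axioms nonconstant_inverse])
  \<comment> \<open>The pair in the opposite order; the reciprocal of the reciprocal is
    \<open>f\<close> again, also at zeros and poles.\<close>
  interpret Q: meromorphic_pair X A "\<lambda>x. inverse (f x)"
    by (rule meromorphic_pair.intro[OF nonconstant_inverse])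
       (simp add: nonconstant_meromorphic_axioms)
  let ?v = "\<lambda>\<omega> x. path_integral X A (g x) \<omega>" and ?S = "{x \<in> topspace X. ord_at A f x \<noteq> 0}"
  have ordc: "ord_at A f x = zorder (f \<circ> chart_inv c) (snd c x)" if "c \<in> A" "x \<in> fst c" for c x
    using ord_at_chart[OF that meromorphic_at[OF that] eventually_value_ne[OF that]] .
  have disj: "fibre 0 \<inter> P.inv.fibre 0 = {}"
  proof (rule equals0I)
    fix x assume "x \<in> fibre 0 \<inter> P.inv.fibre 0"
    hence x: "x \<in> topspace X" "f x = 0" "\<not> pole_at f x" "\<not> pole_at (\<lambda>x. inverse (f x)) x"
      by (auto simp: fibre_def P.inv.fibre_def)
    obtain c where c: "c \<in> A" "x \<in> fst c" using atlas_covers[OF x(1)] by blast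
    from inverse_pole_zero[OF c x(3,2)] show False
      using x(4) pole_at_chart[OF c, of "\<lambda>x. inverse (f x)"] by (simp add: comp_def)
  qed
  have sub: "?S \<subseteq> fibre 0 \<union> P.inv.fibre 0"
  proof
    fix x assume x: "x \<in> ?S"
    then obtain c where c: "c \<in> A" "x \<in> fst c" using atlas_covers by blast
    hence M: "c \<in> maximal_atlas" using atlas_subset by blast
    show "x \<in> fibre 0 \<union> P.inv.fibre 0"
    proof (cases "pole_at f x")
      case True
      have "(((\<lambda>x. inverse (f x)) \<circ> chart_inv c) \<longlongrightarrow> 0) (at (snd c x))"
        using inverse_tendsto_pole[OF c True] by (simp add: comp_def)
      hence "\<not> pole_at (\<lambda>x. inverse (f x)) x"
        unfolding pole_at_chart[OF c] is_pole_def using not_tendsto_and_filterlim_at_infinity[OF at_neq_bot] by blast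
      thus ?thesis using x pole_value[OF True] by (simp add: P.inv.fibre_def)
    next
      case False
      have "f x = 0"
      proof (rule ccontr)
        assume "f x \<noteq> 0"
        hence "zorder (f \<circ> chart_inv c) (snd c x) = 0"
          by (intro zorder_eq_0I analytic_off_poles[OF c False]) (use c M in simp)
        thus False using x ordc[OF c] by simp
      qed
      thus ?thesis using x False by (simp add: fibre_def)
    qed
  qed
  have fin: "finite (fibre 0 \<union> P.inv.fibre 0)" using finite_fibre P.inv.finite_fibre by blast
  show "finite ?S" by (rule finite_subset[OF sub fin])
  have ordinv: "ord_at A (\<lambda>y. inverse (f y) - 0) x = - ord_at A f x" if xX: "x \<in> topspace X" for x
  proof -
    obtain c where c: "c \<in> A" "x \<in> fst c" using atlas_covers[OF xX] by blast
    have m: "isolated_singularity_at (f \<circ> chart_inv c) (snd c x) \<and> not_essential (f \<circ> chart_inv c) (snd c x)"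
      using meromorphic_at[OF c] by (simp only: meromorphic_at_iff)
    have "ord_at A (\<lambda>y. inverse (f y) - 0) x = zorder ((\<lambda>y. inverse (f y)) \<circ> chart_inv c) (snd c x)"
      using ord_at_chart[OF c P.inv.meromorphic_at[OF c] P.inv.eventually_value_ne[OF c]] by simp
    also have "\<dots> = zorder (\<lambda>z. inverse ((f \<circ> chart_inv c) z)) (snd c x)" by (simp add: comp_def)
    also have "\<dots> = - zorder (f \<circ> chart_inv c) (snd c x)"
      by (rule zorder_inverse[OF conjunct1[OF m] conjunct2[OF m]
            eventually_frequently[OF at_neq_bot eventually_value_ne[OF c]]])
    finally show ?thesis using ordc[OF c] by simp
  qed
  have sum: "(\<Sum>x\<in>?S. of_int (ord_at A f x) * ?v \<omega> x) = fibre_sum (?v \<omega>) 0 - P.inv.fibre_sum (?v \<omega>) 0" for \<omega>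
  proof -
    have "(\<Sum>x\<in>?S. of_int (ord_at A f x) * ?v \<omega> x) = (\<Sum>x\<in>fibre 0 \<union> P.inv.fibre 0. of_int (ord_at A f x) * ?v \<omega> x)"
      by (rule sum.mono_neutral_left[OF fin sub]) (auto simp: fibre_def P.inv.fibre_def)
    also have "\<dots> = (\<Sum>x\<in>fibre 0. of_int (ord_at A f x) * ?v \<omega> x) + (\<Sum>x\<in>P.inv.fibre 0. of_int (ord_at A f x) * ?v \<omega> x)"
      by (rule sum.union_disjoint[OF finite_fibre P.inv.finite_fibre disj])
    also have "(\<Sum>x\<in>P.inv.fibre 0. of_int (ord_at A f x) * ?v \<omega> x) = - P.inv.fibre_sum (?v \<omega>) 0"
      unfolding P.inv.fibre_sum_def sum_negf[symmetric]
    proof (rule sum.cong[OF refl])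
      fix x assume "x \<in> P.inv.fibre 0"
      hence "x \<in> topspace X" by (simp add: P.inv.fibre_def)
      thus "of_int (ord_at A f x) * ?v \<omega> x = - (of_int (ord_at A (\<lambda>y. inverse (f y) - 0) x) * ?v \<omega> x)"
        by (simp only: ordinv of_int_minus mult_minus_left minus_minus)
    qed
    finally show ?thesis by (simp add: fibre_sum_def)
  qed
  \<comment> \<open>Stated at \<open>inverse 1\<close> so that \<open>inverse_fibre_sum\<close> at 1
    cancels it against the fibre sum of the reciprocal.\<close>
  have "period x0 (\<lambda>\<omega>. fibre_sum (?v \<omega>) 0 - fibre_sum (?v \<omega>) (inverse 1))"
    by (rule P.fibres_period[OF x0 g])
  moreover have "period x0 (\<lambda>\<omega>. P.inv.fibre_sum (?v \<omega>) 1 - P.inv.fibre_sum (?v \<omega>) 0)"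
    by (rule Q.fibres_period[OF x0 g])
  ultimately have "period x0 (\<lambda>\<omega>. fibre_sum (?v \<omega>) 0 - fibre_sum (?v \<omega>) (inverse 1) +
      (P.inv.fibre_sum (?v \<omega>) 1 - P.inv.fibre_sum (?v \<omega>) 0))" by (rule period_add)
  hence "period x0 (\<lambda>\<omega>. fibre_sum (?v \<omega>) 0 - P.inv.fibre_sum (?v \<omega>) 0)"
    by (rule period_cong) (simp add: P.inverse_fibre_sum)
  thus "period x0 (\<lambda>\<omega>. \<Sum>x\<in>?S. of_int (ord_at A f x) * ?v \<omega> x)" unfolding sum .
qed

end


context rsurface
begin

text \<open>A nonzero constant has all orders 0, so its divisor gives the trivial loop.\<close>

lemma meromorphic_divisor_period:
  assumes comp: "compact_space X" and conn: "connected_space X" and f: "meromorphic_function X A f"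
    and nz: "\<exists>x\<in>topspace X. f x \<noteq> 0"
    and x0: "x0 \<in> topspace X" and g: "\<And>y. y \<in> topspace X \<Longrightarrow> path_between (g y) x0 y"
  shows "finite {x \<in> topspace X. ord_at A f x \<noteq> 0} \<and>
    period x0 (\<lambda>\<omega>. \<Sum>x\<in>{x \<in> topspace X. ord_at A f x \<noteq> 0}. of_int (ord_at A f x) * path_integral X A (g x) \<omega>)"
proof (cases "\<forall>s. \<exists>x\<in>topspace X. f x \<noteq> s")
  case True
  interpret nonconstant_meromorphic X A f
    by unfold_locales (use f comp conn True in auto)
  show ?thesis using divisor_period[OF x0 g] by blast
next
  case False
  then obtain s where s: "\<And>x. x \<in> topspace X \<Longrightarrow> f x = s" by blast
  have s0: "s \<noteq> 0" using nz s by auto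
  interpret surface_meromorphic X A f by unfold_locales (rule f)
  have "ord_at A f x = 0" if x: "x \<in> topspace X" for x
  proof -
    define c where "c = (SOME c. c \<in> A \<and> x \<in> fst c)"
    have "c \<in> A \<and> x \<in> fst c" unfolding c_def by (rule someI_ex) (use atlas_covers[OF x] in blast)
    hence c: "c \<in> A" "x \<in> fst c" by auto
    have "\<not> pole_at f x" using pole_value s[OF x] s0 by metis
    from zorder_eq_0I[OF analytic_off_poles[OF c this]] s[OF x] s0 c subsetD[OF atlas_subset c(1)]
    show ?thesis unfolding ord_at_def c_def[symmetric] by simp
  qed
  hence empty: "{x \<in> topspace X. ord_at A f x \<noteq> 0} = {}" by blast
  show ?thesis unfolding empty using period_zero[OF x0] by simp
qed

lemma Abel_necessity:
  fixes p q :: "nat \<Rightarrow> 'a"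
  assumes comp: "compact_space X" and conn: "connected_space X"
    and \<beta>: "\<And>j. j \<in> {1..m} \<Longrightarrow> path_between (\<beta> j) (p j) (q j)"
    and f: "meromorphic_function X A f" "\<exists>x\<in>topspace X. f x \<noteq> 0"
    and div: "divisor X A f = (\<Sum>j=1..m. frag_of (q j)) - (\<Sum>j=1..m. frag_of (p j))"
  shows "\<exists>x0. period x0 (\<lambda>\<omega>. \<Sum>j=1..m. path_integral X A (\<beta> j) \<omega>)"
proof -
  obtain x0 where x0: "x0 \<in> topspace X" using f(2) by blast
  have "\<forall>y. \<exists>g. y \<in> topspace X \<longrightarrow> path_between g x0 y" using path_between_exists[OF conn x0] by blast
  then obtain g where g: "\<And>y. y \<in> topspace X \<Longrightarrow> path_between (g y) x0 y" by metis
  define S where "S = {x \<in> topspace X. ord_at A f x \<noteq> 0}"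
  let ?v = "\<lambda>\<omega> x. path_integral X A (g x) \<omega>"
  have S: "finite S" and per: "period x0 (\<lambda>\<omega>. \<Sum>x\<in>S. of_int (ord_at A f x) * ?v \<omega> x)"
    using meromorphic_divisor_period[OF comp conn f x0 g] unfolding S_def by blast+
  define T where "T = S \<union> p ` {1..m} \<union> q ` {1..m}"
  have T: "finite T" using S by (simp add: T_def)
  have lk: "Poly_Mapping.lookup (divisor X A f) x = (if x \<in> S then ord_at A f x else 0)" for x
  proof -
    have "Poly_Mapping.lookup (divisor X A f) x = (\<Sum>y\<in>S. if y = x then ord_at A f y else 0)"
      unfolding divisor_def S_def[symmetric] lookup_sum by (rule sum.cong) auto
    thus ?thesis using S by simp
  qed
  have lk': "Poly_Mapping.lookup (divisor X A f) x =
      (\<Sum>j=1..m. if q j = x then 1 else 0) - (\<Sum>j=1..m. if p j = x then 1 else 0)" for x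
    unfolding div lookup_minus lookup_sum by (simp only: lookup_frag_of eq_commute[of x])
  have ends: "(\<Sum>x\<in>T. of_int (\<Sum>j=1..m. if r j = x then 1 else 0) * ?v \<omega> x) = (\<Sum>j=1..m. ?v \<omega> (r j))"
    if r: "r ` {1..m} \<subseteq> T" for r and \<omega>
  proof -
    have "(\<Sum>x\<in>T. of_int (\<Sum>j=1..m. if r j = x then 1 else 0) * ?v \<omega> x) =
        (\<Sum>x\<in>T. \<Sum>j=1..m. if r j = x then ?v \<omega> x else 0)"
      unfolding of_int_sum sum_distrib_right by (intro sum.cong refl) simp
    also have "\<dots> = (\<Sum>j=1..m. \<Sum>x\<in>T. if r j = x then ?v \<omega> x else 0)" by (rule sum.swap)
    also have "\<dots> = (\<Sum>j=1..m. ?v \<omega> (r j))"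
    proof (rule sum.cong[OF refl])
      fix j assume "j \<in> {1..m}"
      hence "r j \<in> T" using r by blast
      thus "(\<Sum>x\<in>T. if r j = x then ?v \<omega> x else 0) = ?v \<omega> (r j)" using T by simp
    qed
    finally show ?thesis .
  qed
  have eval: "(\<Sum>x\<in>S. of_int (ord_at A f x) * ?v \<omega> x) = (\<Sum>j=1..m. ?v \<omega> (q j)) - (\<Sum>j=1..m. ?v \<omega> (p j))" for \<omega>
  proof -
    have "(\<Sum>x\<in>S. of_int (ord_at A f x) * ?v \<omega> x) = (\<Sum>x\<in>T. of_int (Poly_Mapping.lookup (divisor X A f) x) * ?v \<omega> x)"
      by (rule sum.mono_neutral_cong_left) (use T lk in \<open>auto simp: T_def\<close>)
    also have "\<dots> = (\<Sum>x\<in>T. of_int (\<Sum>j=1..m. if q j = x then 1 else 0) * ?v \<omega> x -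
        of_int (\<Sum>j=1..m. if p j = x then 1 else 0) * ?v \<omega> x)"
      unfolding lk' by (simp only: of_int_diff left_diff_distrib)
    also have "\<dots> = (\<Sum>j=1..m. ?v \<omega> (q j)) - (\<Sum>j=1..m. ?v \<omega> (p j))"
    proof -
      have "q ` {1..m} \<subseteq> T" "p ` {1..m} \<subseteq> T" by (auto simp: T_def)
      thus ?thesis unfolding sum_subtractf by (simp only: ends)
    qed
    finally show ?thesis .
  qed
  have pq: "p j \<in> topspace X" "q j \<in> topspace X" if "j \<in> {1..m}" for j
    using path_between_topspace[OF \<beta>[OF that]] by auto
  \<comment> \<open>Both \<open>g (p j)\<close> followed by \<open>\<beta> j\<close> and
    \<open>g (q j)\<close> lead from \<open>x0\<close> to \<open>q j\<close>. Adding the period of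
    the divisor removes the auxiliary paths.\<close>
  have "period x0 (\<lambda>\<omega>. \<Sum>j=1..m. path_integral X A (path_join (g (p j)) (\<beta> j)) \<omega> - ?v \<omega> (q j))"
    by (rule period_sum[OF x0 finite_atLeastAtMost], rule period_path_diff)
       (use path_between_join[OF g \<beta>] g pq in auto)
  from period_add[OF this per] have "period x0 (\<lambda>\<omega>. \<Sum>j=1..m. path_integral X A (\<beta> j) \<omega>)"
  proof (rule period_cong)
    fix \<omega> assume \<omega>: "holomorphic_differential A \<omega>"
    have "path_integral X A (path_join (g (p j)) (\<beta> j)) \<omega> = ?v \<omega> (p j) + path_integral X A (\<beta> j) \<omega>" if j: "j \<in> {1..m}" for j
      using path_integral_join[OF \<omega>, of "g (p j)" "\<beta> j"] g[OF pq(1)[OF j]] \<beta>[OF j] by (simp add: path_between_def)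
    hence "(\<Sum>j=1..m. path_integral X A (path_join (g (p j)) (\<beta> j)) \<omega> - ?v \<omega> (q j)) =
        (\<Sum>j=1..m. ?v \<omega> (p j) + path_integral X A (\<beta> j) \<omega> - ?v \<omega> (q j))" by simp
    thus "(\<Sum>j=1..m. path_integral X A (path_join (g (p j)) (\<beta> j)) \<omega> - ?v \<omega> (q j)) +
        (\<Sum>x\<in>S. of_int (ord_at A f x) * ?v \<omega> x) = (\<Sum>j=1..m. path_integral X A (\<beta> j) \<omega>)"
      unfolding eval by (simp add: sum.distrib sum_subtractf)
  qed
  thus ?thesis by blast
qed

lemma Abel_sufficiency:
  fixes p q :: "nat \<Rightarrow> 'a"
  assumes comp: "compact_space X"
    and \<beta>: "\<And>j. j \<in> {1..m} \<Longrightarrow> path_between (\<beta> j) (p j) (q j)"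
    and \<gamma>: "path_between \<gamma> x0 x0"
    and eq: "\<And>\<omega>. holomorphic_differential A \<omega> \<Longrightarrow> (\<Sum>j=1..m. path_integral X A (\<beta> j) \<omega>) = path_integral X A \<gamma> \<omega>"
  shows "\<exists>f. meromorphic_function X A f \<and> (\<exists>x\<in>topspace X. f x \<noteq> 0) \<and>
    divisor X A f = (\<Sum>j=1..m. frag_of (q j)) - (\<Sum>j=1..m. frag_of (p j))"
proof -
  \<comment> \<open>The reversed loop makes the total integral of every differential vanish, and
    being closed it contributes nothing to the divisor.\<close>
  define gs where "gs = map \<beta> [1..<Suc m] @ [path_reverse \<gamma>]"
  have sum: "(\<Sum>g\<leftarrow>gs. h g) = (\<Sum>j=1..m. h (\<beta> j)) + h (path_reverse \<gamma>)" for h :: "_ \<Rightarrow> 'c::comm_monoid_add"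
    by (simp only: gs_def map_append sum_list_append map_map comp_def list.map sum_list.Cons sum_list.Nil add_0_right
        sum_list_distinct_conv_sum_set[OF distinct_upt] set_upt atLeastLessThanSuc_atLeastAtMost)
  have ne: "topspace X \<noteq> {}" using path_between_topspace[OF \<gamma>] by blast
  have "\<exists>f. meromorphic_function X A f \<and> (\<exists>x\<in>topspace X. f x \<noteq> 0) \<and>
    divisor X A f = (\<Sum>g\<leftarrow>gs. frag_of (g 1) - frag_of (g 0))"
  proof (rule function_of_paths[OF comp ne])
    show "pathin X g" if "g \<in> set gs" for g
      using that \<beta> \<gamma> pathin_reverse[of X \<gamma>] by (auto simp: gs_def path_between_def)
    show "(\<Sum>g\<leftarrow>gs. path_integral X A g \<omega>) = 0" if "holomorphic_differential A \<omega>" for \<omega>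
      unfolding sum using eq[OF that] path_integral_reverse[OF that, of \<gamma>] \<gamma> by (simp add: path_between_def)
  qed
  moreover have "(\<Sum>g\<leftarrow>gs. frag_of (g 1) - frag_of (g 0)) = (\<Sum>j=1..m. frag_of (q j)) - (\<Sum>j=1..m. frag_of (p j))"
  proof -
    have "(\<Sum>j=1..m. frag_of (\<beta> j 1) - frag_of (\<beta> j 0)) = (\<Sum>j=1..m. frag_of (q j) - frag_of (p j))"
      by (rule sum.cong[OF refl]) (use \<beta> in \<open>simp add: path_between_def\<close>)
    moreover have "\<gamma> 1 = \<gamma> 0" using \<gamma> by (simp add: path_between_def)
    ultimately show ?thesis unfolding sum by (simp add: sum_subtractf)
  qed
  ultimately show ?thesis by simp
qed

end

theorem theorem8p1:
  fixes X :: "'a topology" and A :: "'a chart set"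
    and m :: nat and p q :: "nat \<Rightarrow> 'a" and \<beta> :: "nat \<Rightarrow> real \<Rightarrow> 'a"
  assumes "riemann_surface X A" and "compact_space X" and "connected_space X"
    and "\<And>j. j \<in> {1..m} \<Longrightarrow> p j \<in> topspace X \<and> q j \<in> topspace X"
    and "\<And>j. j \<in> {1..m} \<Longrightarrow> pathin X (\<beta> j) \<and> \<beta> j 0 = p j \<and> \<beta> j 1 = q j"
  shows "(\<exists>f. meromorphic_function X A f \<and> (\<exists>x\<in>topspace X. f x \<noteq> 0) \<and>
            divisor X A f = (\<Sum>j=1..m. frag_of (q j)) - (\<Sum>j=1..m. frag_of (p j)))
     \<longleftrightarrow> (\<exists>\<gamma>. pathin X \<gamma> \<and> \<gamma> 0 = \<gamma> 1 \<and>
            (\<forall>\<omega>. holomorphic_differential A \<omega> \<longrightarrow>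
               (\<Sum>j=1..m. path_integral X A (\<beta> j) \<omega>) = path_integral X A \<gamma> \<omega>))"
proof -
  interpret rsurface X A by unfold_locales (rule assms(1))
  have \<beta>: "path_between (\<beta> j) (p j) (q j)" if "j \<in> {1..m}" for j
    using assms(5)[OF that] by (simp add: path_between_def)
  show ?thesis
  proof
    assume "\<exists>f. meromorphic_function X A f \<and> (\<exists>x\<in>topspace X. f x \<noteq> 0) \<and>
      divisor X A f = (\<Sum>j=1..m. frag_of (q j)) - (\<Sum>j=1..m. frag_of (p j))"
    then obtain f where "meromorphic_function X A f" "\<exists>x\<in>topspace X. f x \<noteq> 0"
      "divisor X A f = (\<Sum>j=1..m. frag_of (q j)) - (\<Sum>j=1..m. frag_of (p j))" by (elim exE conjE) (rule that)
    from Abel_necessity[OF assms(2,3) \<beta> this]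
    obtain x0 where "period x0 (\<lambda>\<omega>. \<Sum>j=1..m. path_integral X A (\<beta> j) \<omega>)" by blast
    then obtain \<gamma> where "path_between \<gamma> x0 x0" "\<forall>\<omega>. holomorphic_differential A \<omega> \<longrightarrow>
        (\<Sum>j=1..m. path_integral X A (\<beta> j) \<omega>) = path_integral X A \<gamma> \<omega>"
      unfolding period_def by (elim exE conjE) (rule that)
    thus "\<exists>\<gamma>. pathin X \<gamma> \<and> \<gamma> 0 = \<gamma> 1 \<and> (\<forall>\<omega>. holomorphic_differential A \<omega> \<longrightarrow>
        (\<Sum>j=1..m. path_integral X A (\<beta> j) \<omega>) = path_integral X A \<gamma> \<omega>)"
      unfolding path_between_def by auto
  next
    assume "\<exists>\<gamma>. pathin X \<gamma> \<and> \<gamma> 0 = \<gamma> 1 \<and> (\<forall>\<omega>. holomorphic_differential A \<omega> \<longrightarrow>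
        (\<Sum>j=1..m. path_integral X A (\<beta> j) \<omega>) = path_integral X A \<gamma> \<omega>)"
    then obtain \<gamma> where \<gamma>: "pathin X \<gamma>" "\<gamma> 0 = \<gamma> 1" "\<forall>\<omega>. holomorphic_differential A \<omega> \<longrightarrow>
        (\<Sum>j=1..m. path_integral X A (\<beta> j) \<omega>) = path_integral X A \<gamma> \<omega>" by (elim exE conjE) (rule that)
    have closed: "path_between \<gamma> (\<gamma> 0) (\<gamma> 0)" using \<gamma>(1,2) by (simp add: path_between_def)
    show "\<exists>f. meromorphic_function X A f \<and> (\<exists>x\<in>topspace X. f x \<noteq> 0) \<and>
      divisor X A f = (\<Sum>j=1..m. frag_of (q j)) - (\<Sum>j=1..m. frag_of (p j))"
      by (rule Abel_sufficiency[where \<beta> = \<beta>, OF assms(2) _ closed]) (use \<beta> \<gamma>(3) in blast)+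
  qed
qed

end
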